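(* Let $\mathcal T$ be a line subbundle of $T\tilde M$ and let $(\tilde M,L,T\tilde M\setminus\mathcal T)$ be a stationary Finsler spacetime with timelike Killing vector field $K$. Then $(\tilde M,L,T\tilde M\setminus\mathcal T)$ is locally a standard stationary splitting if and only if the following conditions are satisfied: (a) $L\in C^1(T\tilde M)\cap C^2(T\tilde M\setminus\mathcal T)$, and $K_z\in\mathcal T_z$ at every point $z\in\tilde M$ where $L(z,\cdot)$ is not twice differentiable on $T_z\tilde M$ (so, at these points $z$, $L(z,\cdot)$ is not the quadratic form defined by a Lorentzian metric on $T_z\tilde M$); (b) $L(K)=L(-K)$; (c) $L(w\pm K_{\tilde\pi(w)})=L(w)+L(K_{\tilde\pi(w)})$ for all $w\in\mathcal D$, where $\mathcal D$ is the distribution of hyperplanes $\ker(\partial_{\dot z}L(K))$ in $T\tilde M$ (well defined when $L\in C^1(T\tilde M)$). Furthermore, $(\tilde M,L,T\tilde M\setminus\mathcal T)$ is locally standard static if and only if (a), (b) and (c) hold and $\mathcal D$ is integrable.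
   Context: Let $\tilde M$ be a smooth connected paracompact manifold of dimension $n+1$, $n\ge 1$, $\tilde\pi:T\tilde M\to\tilde M$ the projection, $0$ the zero section. Cone subset: an open $A\subset T\tilde M\setminus 0$ with $\tilde\pi(A)=\tilde M$ such that each $A_p=A\cap T_p\tilde M$ is an open linear cone without vertex ($v\in A_p,\lambda>0\Rightarrow\lambda v\in A_p$), varying smoothly with $p$: $A_p$ is the union over $k=1,\dots,l$ of the solution sets of finitely many systems $E_{1,k}(p,v)>0,\dots,E_{m_k,k}(p,v)>0$, with $E_{i,k}:T\tilde M\to\mathbb R$ smooth and positively homogeneous of degree 1 in $v$. Finsler spacetime $(\tilde M,L,A)$: a function $L:T\tilde M\to\mathbb R$, $L\in C^0(T\tilde M)\cap C^3(A)$, with $L(p,\lambda v)=\lambda^2L(p,v)$ for all $\lambda>0$, such that for each $(p,v)\in A$ the symmetric form $\tilde g_{(p,v)}(u_1,u_2)=\frac12\frac{\partial^2}{\partial s_1\partial s_2}L(p,v+s_1u_1+s_2u_2)|_{(0,0)}$ on $T_p\tilde M$ is non-degenerate of index $1$, $A$ being the maximal open domain in $T\tilde M\setminus0$ where $\tilde g$ is well defined with index $1$; moreover there exists a smooth vector field $Y$ with $Y_p\in\bar A_p$ (closure of $A_p$ in $T_p\tilde M\setminus\{0\}$) and $L(p,Y_p)<0$ for all $p$. Here $A=T\tilde M\setminus\mathcal T=\bigcup_p (T_p\tilde M\setminus\mathcal T_p)$. Killing field: a smooth vector field $K$ on $\tilde M$ with $\mathcal L_K\tilde g=0$ on $A$,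 i.e. in natural coordinates $(x^i,y^i)$ of $T\tilde M$, $K^c(\tilde g_{lj})+\frac{\partial K^h}{\partial x^l}\tilde g_{hj}+\frac{\partial K^h}{\partial x^j}\tilde g_{lh}=0$ on $A$ for all $l,j$, where $K^c=K^h\frac{\partial}{\partial x^h}+\frac{\partial K^h}{\partial x^i}y^i\frac{\partial}{\partial y^h}$ is the complete lift. $K$ is timelike if $L(K_p)<0$ for all $p$; a Finsler spacetime is stationary if it admits a timelike Killing field. $\partial_{\dot z}L(K)$ is the one-form $\frac{\partial L}{\partial\dot z^i}(K)\,dz^i$ on $\tilde M$, where $(z,\dot z)$ are natural coordinates on $T\tilde M$. Finsler metric on a manifold $S$: $F:TS\to[0,+\infty)$, $F\in C^0(TS)\cap C^3(TS\setminus0)$, fiberwise positively homogeneous of degree 1, with fiberwise Hessian of $\frac12F^2$ positive definite at every $v\in TS\setminus0$. Locally a standard stationary splitting: a stationary Finsler spacetime $(\tilde M,L,T\tilde M\setminus\mathcal T)$ with timelike Killing field $K$ such that $K_z\in\mathcal T_z$ for all $z$, and such that for every $z\in\tilde M$ there are a neighborhood $U_z$ of $z$, an interval $I_z=(-\varepsilon_z,\varepsilon_z)$, a manifold $S_z$ and a diffeomorphism $\phi:I_z\times S_z\to U_z$ with $\phi_*(\partial_t)=K|_{U_z}$ ($t$ the coordinate of $I_z$) and $L\circ\phi_*((\tau,v))=-\Lambda\tau^2+\omega(v)\tau+F^2(v)$ for all $(\tau,v)\in T(I_z\times S_z)$, where $\Lambda,\omega,F$ are respectively a positive function, a one-form and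 a Finsler metric on $S_z$. It is locally standard static if for every $z$ there is such a $\phi$ with $\omega=0$. *)

theory Defs
  imports "HOL-Analysis.Analysis" "HOL-Library.Function_Algebras"
begin

section \<open>Vector space structure on functions\<close>

instantiation "fun" :: (type, real_vector) real_vector
begin

definition scaleR_fun :: "real \<Rightarrow> ('a \<Rightarrow> 'b) \<Rightarrow> 'a \<Rightarrow> 'b" where
  "scaleR_fun r f = (\<lambda>x. r *\<^sub>R f x)"

instance
  by standard (auto simp: scaleR_fun_def fun_eq_iff scaleR_add_right scaleR_add_left)

end

section \<open>Differentiability classes in Euclidean space\<close>

text \<open>\<open>Ck_on\<close> is meant for open domains: derivatives are taken in the ambient space.\<close>

primrec Ck_on ::
  "nat \<Rightarrow> 'e::euclidean_space set \<Rightarrow> ('e \<Rightarrow> 'f::real_normed_vector) \<Rightarrow> bool" where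
  "Ck_on 0 S f \<longleftrightarrow> continuous_on S f"
| "Ck_on (Suc k) S f \<longleftrightarrow>
     (\<forall>x\<in>S. f differentiable (at x)) \<and>
     (\<forall>u. Ck_on k S (\<lambda>x. frechet_derivative f (at x) u))"

definition twice_differentiable_at :: "('e::euclidean_space \<Rightarrow> real) \<Rightarrow> 'e \<Rightarrow> bool" where
  "twice_differentiable_at f y \<longleftrightarrow>
     (\<forall>\<^sub>F x in nhds y. f differentiable (at x)) \<and>
     (\<forall>u. (\<lambda>x. frechet_derivative f (at x) u) differentiable (at y))"

section \<open>Smooth manifolds\<close>

text \<open>A chart is a pair of a domain and a coordinate map; values of the map outside the domain
  are irrelevant. A manifold is represented by a smooth atlas, from which the underlying set and
  the topology are recovered. The dimension is that of the model space \<open>'e\<close>.\<close>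

type_synonym ('a, 'e) chart = "'a set \<times> ('a \<Rightarrow> 'e)"

definition chart_inv :: "('a, 'e) chart \<Rightarrow> 'e \<Rightarrow> 'a" where
  "chart_inv c = inv_into (fst c) (snd c)"

definition smooth_atlas :: "('a, 'e::euclidean_space) chart set \<Rightarrow> bool" where
  "smooth_atlas M \<longleftrightarrow>
     (\<forall>c\<in>M. inj_on (snd c) (fst c)) \<and>
     (\<forall>c\<in>M. \<forall>d\<in>M. open (snd c ` (fst c \<inter> fst d)) \<and>
        (\<forall>k. Ck_on k (snd c ` (fst c \<inter> fst d)) (snd d \<circ> chart_inv c)))"

definition mfd_space :: "('a, 'e) chart set \<Rightarrow> 'a set" where
  "mfd_space M = (\<Union>c\<in>M. fst c)"

definition mfd_top :: "('a, 'e::euclidean_space) chart set \<Rightarrow> 'a topology" where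
  "mfd_top M = topology (\<lambda>W. W \<subseteq> mfd_space M \<and> (\<forall>c\<in>M. open (snd c ` (W \<inter> fst c))))"

lemma openin_mfd_top:
  assumes "smooth_atlas M"
  shows "openin (mfd_top M) W \<longleftrightarrow>
    W \<subseteq> mfd_space M \<and> (\<forall>c\<in>M. open (snd c ` (W \<inter> fst c)))"
proof -
  let ?P = "\<lambda>W. W \<subseteq> mfd_space M \<and> (\<forall>c\<in>M. open (snd c ` (W \<inter> fst c)))"
  have int: "?P (V \<inter> W)" if V: "?P V" and W: "?P W" for V W
  proof -
    have "open (snd c ` (V \<inter> W \<inter> fst c))" if c: "c \<in> M" for c
    proof -
      have "inj_on (snd c) (fst c)"
        using assms c by (auto simp: smooth_atlas_def)
      then have "snd c ` ((V \<inter> fst c) \<inter> (W \<inter> fst c)) =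
          snd c ` (V \<inter> fst c) \<inter> snd c ` (W \<inter> fst c)"
        by (rule inj_on_image_Int) auto
      moreover have "V \<inter> W \<inter> fst c = (V \<inter> fst c) \<inter> (W \<inter> fst c)"
        by auto
      ultimately show ?thesis
        using V W c by (simp add: open_Int)
    qed
    then show ?thesis
      using V by auto
  qed
  have un: "?P (\<Union>\<K>)" if "\<forall>K\<in>\<K>. ?P K" for \<K>
  proof -
    have "open (snd c ` (\<Union>\<K> \<inter> fst c))" if c: "c \<in> M" for c
    proof -
      have "snd c ` (\<Union>\<K> \<inter> fst c) = (\<Union>K\<in>\<K>. snd c ` (K \<inter> fst c))"
        by auto
      moreover have "open (\<Union>K\<in>\<K>. snd c ` (K \<inter> fst c))"
        using \<open>\<forall>K\<in>\<K>. ?P K\<close> c by (intro open_UN) blast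
      ultimately show ?thesis
        by (rule ssubst)
    qed
    then show ?thesis
      using that by blast
  qed
  have "istopology ?P"
    unfolding istopology_def using int un by blast
  then show ?thesis
    unfolding mfd_top_def by (simp add: topology_inverse')
qed

lemma topspace_mfd_top:
  assumes "smooth_atlas M"
  shows "topspace (mfd_top M) = mfd_space M"
proof -
  have "open (snd c ` (mfd_space M \<inter> fst c))" if "c \<in> M" for c
  proof -
    have "mfd_space M \<inter> fst c = fst c \<inter> fst c"
      using that by (auto simp: mfd_space_def)
    then show ?thesis
      using assms that unfolding smooth_atlas_def by metis
  qed
  then have "openin (mfd_top M) (mfd_space M)"
    using assms by (simp add: openin_mfd_top)
  then show ?thesis
    using assms by (meson openin_mfd_top openin_subset openin_topspace subset_antisym)
qed

definition paracompact_space :: "'a topology \<Rightarrow> bool" where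
  "paracompact_space X \<longleftrightarrow>
     (\<forall>\<U>. (\<forall>U\<in>\<U>. openin X U) \<and> \<Union>\<U> = topspace X \<longrightarrow>
       (\<exists>\<V>. (\<forall>V\<in>\<V>. openin X V) \<and> \<Union>\<V> = topspace X \<and>
            (\<forall>V\<in>\<V>. \<exists>U\<in>\<U>. V \<subseteq> U) \<and> locally_finite_in X \<V>))"

definition smooth_manifold :: "('a, 'e::euclidean_space) chart set \<Rightarrow> bool" where
  "smooth_manifold M \<longleftrightarrow>
     smooth_atlas M \<and> Hausdorff_space (mfd_top M) \<and> paracompact_space (mfd_top M)"

definition Ck_fun ::
  "('a, 'e::euclidean_space) chart set \<Rightarrow> nat \<Rightarrow> 'a set \<Rightarrow> ('a \<Rightarrow> real) \<Rightarrow> bool" where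
  "Ck_fun M k W f \<longleftrightarrow> (\<forall>c\<in>M. Ck_on k (snd c ` (W \<inter> fst c)) (f \<circ> chart_inv c))"

definition smooth_map_on ::
  "('a, 'e::euclidean_space) chart set \<Rightarrow> ('b, 'f::euclidean_space) chart set \<Rightarrow>
    'a set \<Rightarrow> ('a \<Rightarrow> 'b) \<Rightarrow> bool" where
  "smooth_map_on M N W f \<longleftrightarrow>
     continuous_map (subtopology (mfd_top M) W) (mfd_top N) f \<and>
     (\<forall>c\<in>M. \<forall>d\<in>N. \<forall>k.
        Ck_on k (snd c ` (W \<inter> fst c \<inter> f -` fst d)) (snd d \<circ> f \<circ> chart_inv c))"

section \<open>Tangent bundle\<close>

text \<open>A tangent vector at \<open>p\<close> is the family of its components in all charts around \<open>p\<close>, subject to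
  the usual transformation rule; entries for charts not containing \<open>p\<close> are set to zero, so that
  the vector space operations are those of the function space.\<close>

type_synonym ('a, 'e) tvec = "('a, 'e) chart \<Rightarrow> 'e"

definition tangent_space ::
  "('a, 'e::euclidean_space) chart set \<Rightarrow> 'a \<Rightarrow> ('a, 'e) tvec set" where
  "tangent_space M p =
     {v. (\<forall>c. \<not> (c \<in> M \<and> p \<in> fst c) \<longrightarrow> v c = 0) \<and>
         (\<forall>c\<in>M. \<forall>d\<in>M. p \<in> fst c \<longrightarrow> p \<in> fst d \<longrightarrow>
            v d = frechet_derivative (snd d \<circ> chart_inv c) (at (snd c p)) (v c))}"

definition tangent_bundle ::
  "('a, 'e::euclidean_space) chart set \<Rightarrow> ('a \<times> ('a, 'e) tvec) set" where
  "tangent_bundle M = Sigma (mfd_space M) (tangent_space M)"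

definition zero_section ::
  "('a, 'e::euclidean_space) chart set \<Rightarrow> ('a \<times> ('a, 'e) tvec) set" where
  "zero_section M = mfd_space M \<times> {0}"

text \<open>The natural coordinates \<open>(x\<^sup>i, y\<^sup>i)\<close> of the tangent bundle induced by a chart.\<close>

definition tb_chart ::
  "('a, 'e::euclidean_space) chart set \<Rightarrow> ('a, 'e) chart \<Rightarrow>
    ('a \<times> ('a, 'e) tvec, 'e \<times> 'e) chart" where
  "tb_chart M c = (Sigma (fst c) (tangent_space M), \<lambda>(p, v). (snd c p, v c))"

definition tb_atlas ::
  "('a, 'e::euclidean_space) chart set \<Rightarrow> ('a \<times> ('a, 'e) tvec, 'e \<times> 'e) chart set" where
  "tb_atlas M = tb_chart M ` M"

definition smooth_vector_field_on ::
  "('a, 'e::euclidean_space) chart set \<Rightarrow> 'a set \<Rightarrow> ('a \<Rightarrow> ('a, 'e) tvec) \<Rightarrow> bool" where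
  "smooth_vector_field_on M W X \<longleftrightarrow> smooth_map_on M (tb_atlas M) W (\<lambda>p. (p, X p))"

definition chart_at :: "('a, 'e) chart set \<Rightarrow> 'a \<Rightarrow> ('a, 'e) chart" where
  "chart_at M p = (SOME c. c \<in> M \<and> p \<in> fst c)"

text \<open>Differential at \<open>p\<close> of a map between manifolds and of a real function; by the chain rule
  neither depends on the chart chosen around \<open>p\<close>.\<close>

definition tangent_map ::
  "('a, 'e::euclidean_space) chart set \<Rightarrow> ('b, 'f::euclidean_space) chart set \<Rightarrow>
    ('a \<Rightarrow> 'b) \<Rightarrow> 'a \<Rightarrow> ('a, 'e) tvec \<Rightarrow> ('b, 'f) tvec" where
  "tangent_map M N f p v =
     (let c = chart_at M p in
      (\<lambda>d. if d \<in> N \<and> f p \<in> fst d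
          then frechet_derivative (snd d \<circ> f \<circ> chart_inv c) (at (snd c p)) (v c) else 0))"

definition dfun ::
  "('a, 'e::euclidean_space) chart set \<Rightarrow> ('a \<Rightarrow> real) \<Rightarrow> 'a \<Rightarrow> ('a, 'e) tvec \<Rightarrow> real" where
  "dfun M f p v =
     (let c = chart_at M p in frechet_derivative (f \<circ> chart_inv c) (at (snd c p)) (v c))"

definition line_subbundle ::
  "('a, 'e::euclidean_space) chart set \<Rightarrow> ('a \<times> ('a, 'e) tvec) set \<Rightarrow> bool" where
  "line_subbundle M T \<longleftrightarrow> T \<subseteq> tangent_bundle M \<and>
     (\<forall>p\<in>mfd_space M. \<exists>W X. openin (mfd_top M) W \<and> p \<in> W \<and> smooth_vector_field_on M W X \<and>
        (\<forall>q\<in>W. X q \<noteq> 0 \<and> {v. (q, v) \<in> T} = span {X q}))"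

definition prod_atlas ::
  "real set \<Rightarrow> ('a, 'e::euclidean_space) chart set \<Rightarrow> (real \<times> 'a, real \<times> 'e) chart set" where
  "prod_atlas I S = (\<lambda>c. (I \<times> fst c, \<lambda>(t, x). (t, snd c x))) ` S"

text \<open>The coordinate field \<open>\<partial>\<^sub>t\<close>, which has components \<open>(1, 0)\<close> in every product chart.\<close>

definition time_field ::
  "real set \<Rightarrow> ('a, 'e::euclidean_space) chart set \<Rightarrow> real \<times> 'a \<Rightarrow>
    (real \<times> 'a, real \<times> 'e) tvec" where
  "time_field I S p = (\<lambda>c. if c \<in> prod_atlas I S \<and> p \<in> fst c then (1, 0) else 0)"

section \<open>Finsler spacetimes\<close>

definition fib_hess :: "('a \<times> 'v::real_vector \<Rightarrow> real) \<Rightarrow> 'a \<Rightarrow> 'v \<Rightarrow> 'v \<Rightarrow> 'v \<Rightarrow> real" where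
  "fib_hess L p v u\<^sub>1 u\<^sub>2 =
     1/2 * deriv (\<lambda>s\<^sub>1. deriv (\<lambda>s\<^sub>2. L (p, v + s\<^sub>1 *\<^sub>R u\<^sub>1 + s\<^sub>2 *\<^sub>R u\<^sub>2)) 0) 0"

definition fib_twice_differentiable_at ::
  "('a, 'e::euclidean_space) chart set \<Rightarrow> ('a \<times> ('a, 'e) tvec \<Rightarrow> real) \<Rightarrow> 'a \<Rightarrow>
    ('a, 'e) tvec \<Rightarrow> bool" where
  "fib_twice_differentiable_at M L p v \<longleftrightarrow>
     (\<forall>c\<in>M. p \<in> fst c \<longrightarrow>
        twice_differentiable_at (\<lambda>y. L (chart_inv (tb_chart M c) (snd c p, y))) (v c))"

definition nondegenerate_on :: "'v::real_vector set \<Rightarrow> ('v \<Rightarrow> 'v \<Rightarrow> real) \<Rightarrow> bool" where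
  "nondegenerate_on V b \<longleftrightarrow> (\<forall>u\<in>V. (\<forall>w\<in>V. b u w = 0) \<longrightarrow> u = 0)"

definition form_index :: "'v::real_vector set \<Rightarrow> ('v \<Rightarrow> 'v \<Rightarrow> real) \<Rightarrow> nat" where
  "form_index V b = Max {dim W | W. subspace W \<and> W \<subseteq> V \<and> (\<forall>w\<in>W. w \<noteq> 0 \<longrightarrow> b w w < 0)}"

definition nondeg_index_1 ::
  "('a, 'e::euclidean_space) chart set \<Rightarrow> ('a \<times> ('a, 'e) tvec \<Rightarrow> real) \<Rightarrow> 'a \<Rightarrow>
    ('a, 'e) tvec \<Rightarrow> bool" where
  "nondeg_index_1 M L p v \<longleftrightarrow>
     nondegenerate_on (tangent_space M p) (fib_hess L p v) \<and>
     form_index (tangent_space M p) (fib_hess L p v) = 1"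

definition cone_subset ::
  "('a, 'e::euclidean_space) chart set \<Rightarrow> ('a \<times> ('a, 'e) tvec) set \<Rightarrow> bool" where
  "cone_subset M A \<longleftrightarrow>
     openin (mfd_top (tb_atlas M)) A \<and>
     A \<subseteq> tangent_bundle M - zero_section M \<and>
     fst ` A = mfd_space M \<and>
     (\<forall>p v r. (p, v) \<in> A \<longrightarrow> 0 < r \<longrightarrow> (p, r *\<^sub>R v) \<in> A) \<and>
     (\<exists>(l::nat) (m :: nat \<Rightarrow> nat) (E :: nat \<Rightarrow> nat \<Rightarrow> 'a \<times> ('a, 'e) tvec \<Rightarrow> real).
        (\<forall>k\<in>{1..l}. \<forall>i\<in>{1..m k}.
           (\<forall>j. Ck_fun (tb_atlas M) j (tangent_bundle M) (E i k)) \<and>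
           (\<forall>(p, v)\<in>tangent_bundle M. \<forall>r>0. E i k (p, r *\<^sub>R v) = r * E i k (p, v))) \<and>
        (\<forall>p\<in>mfd_space M. {v. (p, v) \<in> A} =
           (\<Union>k\<in>{1..l}. {v\<in>tangent_space M p. \<forall>i\<in>{1..m k}. E i k (p, v) > 0})))"

text \<open>The last but one conjunct is the maximality of \<open>A\<close>: the form \<open>fib_hess L p v\<close> is well defined where
  \<open>L (p, \<cdot>)\<close> is twice differentiable.\<close>

definition finsler_spacetime ::
  "('a, 'e::euclidean_space) chart set \<Rightarrow> ('a \<times> ('a, 'e) tvec \<Rightarrow> real) \<Rightarrow>
    ('a \<times> ('a, 'e) tvec) set \<Rightarrow> bool" where
  "finsler_spacetime M L A \<longleftrightarrow>
     cone_subset M A \<and>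
     Ck_fun (tb_atlas M) 0 (tangent_bundle M) L \<and>
     Ck_fun (tb_atlas M) 3 A L \<and>
     (\<forall>(p, v)\<in>tangent_bundle M. \<forall>r>0. L (p, r *\<^sub>R v) = r\<^sup>2 * L (p, v)) \<and>
     (\<forall>(p, v)\<in>A. nondeg_index_1 M L p v) \<and>
     (\<forall>B. openin (mfd_top (tb_atlas M)) B \<longrightarrow> B \<subseteq> tangent_bundle M - zero_section M \<longrightarrow>
        (\<forall>(p, v)\<in>B. fib_twice_differentiable_at M L p v \<and> nondeg_index_1 M L p v) \<longrightarrow>
        B \<subseteq> A) \<and>
     (\<exists>Y. smooth_vector_field_on M (mfd_space M) Y \<and>
        (\<forall>p\<in>mfd_space M.
           (p, Y p) \<in> subtopology (mfd_top (tb_atlas M)) ({p} \<times> (tangent_space M p - {0}))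
                        closure_of {(q, v)\<in>A. q = p} \<and>
           L (p, Y p) < 0))"

definition partial :: "('e::euclidean_space \<Rightarrow> real) \<Rightarrow> 'e \<Rightarrow> 'e \<Rightarrow> real" where
  "partial f b x = frechet_derivative f (at x) b"

text \<open>Local components in natural coordinates with respect to a chart \<open>c\<close>: \<open>vf_coord\<close> is
  \<open>K\<^sup>h\<close> and \<open>g_coord\<close> is \<open>g\<^sub>l\<^sub>j\<close>; coordinate indices are
  the elements of \<open>Basis\<close>.\<close>

definition vf_coord ::
  "('a, 'e::euclidean_space) chart \<Rightarrow> ('a \<Rightarrow> ('a, 'e) tvec) \<Rightarrow> 'e \<Rightarrow> 'e \<Rightarrow> real" where
  "vf_coord c K h x = K (chart_inv c x) c \<bullet> h"

definition g_coord ::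
  "('a, 'e::euclidean_space) chart set \<Rightarrow> ('a \<times> ('a, 'e) tvec \<Rightarrow> real) \<Rightarrow> ('a, 'e) chart \<Rightarrow>
    'e \<Rightarrow> 'e \<Rightarrow> 'e \<times> 'e \<Rightarrow> real" where
  "g_coord M L c l j = (\<lambda>(x, y).
     (let frame = (\<lambda>b. snd (chart_inv (tb_chart M c) (x, b)))
      in fib_hess L (chart_inv c x) (frame y) (frame l) (frame j)))"

definition killing_field ::
  "('a, 'e::euclidean_space) chart set \<Rightarrow> ('a \<times> ('a, 'e) tvec \<Rightarrow> real) \<Rightarrow>
    ('a \<times> ('a, 'e) tvec) set \<Rightarrow> ('a \<Rightarrow> ('a, 'e) tvec) \<Rightarrow> bool" where
  "killing_field M L A K \<longleftrightarrow>
     smooth_vector_field_on M (mfd_space M) K \<and>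
     (\<forall>c\<in>M. \<forall>(x, y)\<in>snd (tb_chart M c) ` (A \<inter> fst (tb_chart M c)). \<forall>l\<in>Basis. \<forall>j\<in>Basis.
        (\<Sum>h\<in>Basis. vf_coord c K h x * partial (g_coord M L c l j) (h, 0) (x, y)
            + (\<Sum>i\<in>Basis. partial (vf_coord c K h) i x * (y \<bullet> i)) *
                partial (g_coord M L c l j) (0, h) (x, y))
        + (\<Sum>h\<in>Basis. partial (vf_coord c K h) l x * g_coord M L c h j (x, y))
        + (\<Sum>h\<in>Basis. partial (vf_coord c K h) j x * g_coord M L c l h (x, y)) = 0)"

definition stationary_spacetime ::
  "('a, 'e::euclidean_space) chart set \<Rightarrow> ('a \<times> ('a, 'e) tvec \<Rightarrow> real) \<Rightarrow>
    ('a \<times> ('a, 'e) tvec) set \<Rightarrow> ('a \<Rightarrow> ('a, 'e) tvec) \<Rightarrow> bool" where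
  "stationary_spacetime M L A K \<longleftrightarrow>
     finsler_spacetime M L A \<and> killing_field M L A K \<and> (\<forall>p\<in>mfd_space M. L (p, K p) < 0)"

section \<open>Standard stationary splittings\<close>

definition finsler_metric ::
  "('a, 'e::euclidean_space) chart set \<Rightarrow> ('a \<times> ('a, 'e) tvec \<Rightarrow> real) \<Rightarrow> bool" where
  "finsler_metric S F \<longleftrightarrow>
     (\<forall>x\<in>tangent_bundle S. 0 \<le> F x) \<and>
     Ck_fun (tb_atlas S) 0 (tangent_bundle S) F \<and>
     Ck_fun (tb_atlas S) 3 (tangent_bundle S - zero_section S) F \<and>
     (\<forall>(p, v)\<in>tangent_bundle S. \<forall>r>0. F (p, r *\<^sub>R v) = r * F (p, v)) \<and>
     (\<forall>(p, v)\<in>tangent_bundle S - zero_section S.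
        \<forall>u\<in>tangent_space S p. u \<noteq> 0 \<longrightarrow> fib_hess (\<lambda>x. (F x)\<^sup>2) p v u u > 0)"

text \<open>One-forms are functions on the tangent bundle, linear on the fibres. As \<open>L\<close> and \<open>F\<close> are only
  of class \<open>C\<^sup>3\<close> (off suitable subsets), this is also the regularity required of \<open>\<Lambda>\<close> and \<open>\<omega>\<close>.\<close>

definition one_form ::
  "('a, 'e::euclidean_space) chart set \<Rightarrow> ('a \<times> ('a, 'e) tvec \<Rightarrow> real) \<Rightarrow> bool" where
  "one_form S \<omega> \<longleftrightarrow>
     Ck_fun (tb_atlas S) 3 (tangent_bundle S) \<omega> \<and>
     (\<forall>p\<in>mfd_space S. \<forall>u\<in>tangent_space S p. \<forall>v\<in>tangent_space S p. \<forall>a b.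
        \<omega> (p, a *\<^sub>R u + b *\<^sub>R v) = a * \<omega> (p, u) + b * \<omega> (p, v))"

text \<open>For \<open>u\<close> tangent to \<open>I \<times> S\<close>, its components \<open>(\<tau>, v)\<close> are the images of \<open>u\<close> under the
  differentials of the two projections.\<close>

definition standard_splitting ::
  "('a, real \<times> 'e::euclidean_space) chart set \<Rightarrow> ('a \<times> ('a, real \<times> 'e) tvec \<Rightarrow> real) \<Rightarrow>
    ('a \<Rightarrow> ('a, real \<times> 'e) tvec) \<Rightarrow> 'a set \<Rightarrow> real \<Rightarrow> ('s, 'e) chart set \<Rightarrow>
    (real \<times> 's \<Rightarrow> 'a) \<Rightarrow> ('s \<Rightarrow> real) \<Rightarrow> ('s \<times> ('s, 'e) tvec \<Rightarrow> real) \<Rightarrow>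
    ('s \<times> ('s, 'e) tvec \<Rightarrow> real) \<Rightarrow> bool" where
  "standard_splitting M L K U \<epsilon> S \<phi> \<Lambda> \<omega> F \<longleftrightarrow>
     (let I = {-\<epsilon><..<\<epsilon>}; P = prod_atlas I S; D = I \<times> mfd_space S in
       openin (mfd_top M) U \<and> 0 < \<epsilon> \<and> smooth_manifold S \<and>
       bij_betw \<phi> D U \<and> smooth_map_on P M D \<phi> \<and> smooth_map_on M P U (inv_into D \<phi>) \<and>
       (\<forall>q\<in>D. tangent_map P M \<phi> q (time_field I S q) = K (\<phi> q)) \<and>
       Ck_fun S 3 (mfd_space S) \<Lambda> \<and> (\<forall>s\<in>mfd_space S. 0 < \<Lambda> s) \<and>
       one_form S \<omega> \<and> finsler_metric S F \<and>
       (\<forall>(q, u)\<in>tangent_bundle P.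
          let s = snd q; \<tau> = dfun P fst q u; v = tangent_map P S snd q u in
          L (\<phi> q, tangent_map P M \<phi> q u) =
            - \<Lambda> s * \<tau>\<^sup>2 + \<omega> (s, v) * \<tau> + (F (s, v))\<^sup>2))"

text \<open>Since \<open>S\<close> is diffeomorphic to the subset \<open>\<phi> ({0} \<times> S)\<close> of \<open>M\<close>, it is no restriction to take the
  points of \<open>S\<close> from the type of points of \<open>M\<close>.\<close>

definition locally_standard_stationary ::
  "('a, real \<times> 'e::euclidean_space) chart set \<Rightarrow> ('a \<times> ('a, real \<times> 'e) tvec \<Rightarrow> real) \<Rightarrow>
    ('a \<times> ('a, real \<times> 'e) tvec) set \<Rightarrow> ('a \<Rightarrow> ('a, real \<times> 'e) tvec) \<Rightarrow> bool" where
  "locally_standard_stationary M L T K \<longleftrightarrow>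
     stationary_spacetime M L (tangent_bundle M - T) K \<and>
     (\<forall>z\<in>mfd_space M. (z, K z) \<in> T) \<and>
     (\<forall>z\<in>mfd_space M. \<exists>U \<epsilon> (S :: ('a, 'e) chart set) \<phi> \<Lambda> \<omega> F.
        z \<in> U \<and> standard_splitting M L K U \<epsilon> S \<phi> \<Lambda> \<omega> F)"

definition locally_standard_static ::
  "('a, real \<times> 'e::euclidean_space) chart set \<Rightarrow> ('a \<times> ('a, real \<times> 'e) tvec \<Rightarrow> real) \<Rightarrow>
    ('a \<times> ('a, real \<times> 'e) tvec) set \<Rightarrow> ('a \<Rightarrow> ('a, real \<times> 'e) tvec) \<Rightarrow> bool" where
  "locally_standard_static M L T K \<longleftrightarrow>
     stationary_spacetime M L (tangent_bundle M - T) K \<and>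
     (\<forall>z\<in>mfd_space M. (z, K z) \<in> T) \<and>
     (\<forall>z\<in>mfd_space M. \<exists>U \<epsilon> (S :: ('a, 'e) chart set) \<phi> \<Lambda> \<omega> F.
        z \<in> U \<and> standard_splitting M L K U \<epsilon> S \<phi> \<Lambda> \<omega> F \<and>
        (\<forall>x\<in>tangent_bundle S. \<omega> x = 0))"

section \<open>The distribution orthogonal to the Killing field\<close>

text \<open>The one-form with components \<open>\<partial>L/\<partial>y\<^sup>i (K)\<close>; it does not depend on the chart when \<open>L\<close> is of
  class \<open>C\<^sup>1\<close>.\<close>

definition vertical_dL ::
  "('a, 'e::euclidean_space) chart set \<Rightarrow> ('a \<times> ('a, 'e) tvec \<Rightarrow> real) \<Rightarrow>
    ('a \<Rightarrow> ('a, 'e) tvec) \<Rightarrow> 'a \<Rightarrow> ('a, 'e) tvec \<Rightarrow> real" where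
  "vertical_dL M L K p w =
     (let c = chart_at M p in
      \<Sum>i\<in>Basis. partial (L \<circ> chart_inv (tb_chart M c)) (0, i) (snd c p, K p c) * (w c \<bullet> i))"

definition kernel_distribution ::
  "('a, 'e::euclidean_space) chart set \<Rightarrow> ('a \<times> ('a, 'e) tvec \<Rightarrow> real) \<Rightarrow>
    ('a \<Rightarrow> ('a, 'e) tvec) \<Rightarrow> 'a \<Rightarrow> ('a, 'e) tvec set" where
  "kernel_distribution M L K p = {w\<in>tangent_space M p. vertical_dL M L K p w = 0}"

text \<open>Integrability is existence of smooth integral manifolds through every point. The distributions
  considered here need not be smooth, so that involutivity would be a weaker requirement.\<close>

definition integrable_distribution ::
  "('a, real \<times> 'e::euclidean_space) chart set \<Rightarrow> ('a \<Rightarrow> ('a, real \<times> 'e) tvec set) \<Rightarrow> bool" where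
  "integrable_distribution M \<D> \<longleftrightarrow>
     (\<forall>z\<in>mfd_space M. \<exists>(S :: ('a, 'e) chart set) \<iota>.
        smooth_manifold S \<and> smooth_map_on S M (mfd_space S) \<iota> \<and> inj_on \<iota> (mfd_space S) \<and>
        z \<in> \<iota> ` mfd_space S \<and>
        (\<forall>s\<in>mfd_space S. inj_on (tangent_map S M \<iota> s) (tangent_space S s) \<and>
           tangent_map S M \<iota> s ` tangent_space S s = \<D> (\<iota> s)))"

section \<open>Characterizing conditions\<close>

definition condition_a ::
  "('a, 'e::euclidean_space) chart set \<Rightarrow> ('a \<times> ('a, 'e) tvec \<Rightarrow> real) \<Rightarrow>
    ('a \<times> ('a, 'e) tvec) set \<Rightarrow> ('a \<Rightarrow> ('a, 'e) tvec) \<Rightarrow> bool" where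
  "condition_a M L T K \<longleftrightarrow>
     Ck_fun (tb_atlas M) 1 (tangent_bundle M) L \<and>
     Ck_fun (tb_atlas M) 2 (tangent_bundle M - T) L \<and>
     (\<forall>z\<in>mfd_space M. \<not> (\<forall>v\<in>tangent_space M z. fib_twice_differentiable_at M L z v) \<longrightarrow>
        (z, K z) \<in> T)"

definition condition_b ::
  "('a, 'e::euclidean_space) chart set \<Rightarrow> ('a \<times> ('a, 'e) tvec \<Rightarrow> real) \<Rightarrow>
    ('a \<Rightarrow> ('a, 'e) tvec) \<Rightarrow> bool" where
  "condition_b M L K \<longleftrightarrow> (\<forall>z\<in>mfd_space M. L (z, K z) = L (z, - K z))"

definition condition_c ::
  "('a, 'e::euclidean_space) chart set \<Rightarrow> ('a \<times> ('a, 'e) tvec \<Rightarrow> real) \<Rightarrow>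
    ('a \<Rightarrow> ('a, 'e) tvec) \<Rightarrow> bool" where
  "condition_c M L K \<longleftrightarrow>
     (\<forall>z\<in>mfd_space M. \<forall>w\<in>kernel_distribution M L K z.
        L (z, w + K z) = L (z, w) + L (z, K z) \<and>
        L (z, w - K z) = L (z, w) + L (z, K z))"

end

theory Submission
  imports Defs
begin

text \<open>Write \<open>\<theta>\<close> for the one-form \<open>\<partial>L/\<partial>y\<^sup>i (K) dx\<^sup>i\<close>. Since \<open>\<theta> K = 2 L K\<close> and \<open>L\<close> is homogeneous, (c) amounts to
  \<open>L (w + \<tau> K) = L w + \<tau> \<theta> w + \<tau>\<^sup>2 L K\<close> for all \<open>w\<close>; (b) is the special case \<open>w = 0\<close> of (c).
  Flowing a hypersurface transversal to \<open>K\<close> along \<open>K\<close> yields coordinates \<open>(t, x)\<close> with \<open>K = \<partial>\<^sub>t\<close>. The flow of a Killing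
  field preserves \<open>L\<close>, so \<open>L\<close> does not depend on \<open>t\<close>, and the identity above is a splitting with \<open>\<Lambda> = - L K\<close> and with
  \<open>\<omega>\<close> and \<open>F\<^sup>2\<close> the restrictions of \<open>\<theta>\<close> and \<open>L\<close> to the hypersurface. By (c), \<open>K\<close> is orthogonal to \<open>ker \<theta>\<close>, so index 1
  makes the fibre Hessian positive definite on \<open>ker \<theta>\<close>; hence \<open>F\<close> is a Finsler metric near the base point when the
  hypersurface is tangent to \<open>ker \<theta>\<close> there. In the static case it is an integral manifold of \<open>ker \<theta>\<close>.
  Moreover \<open>K\<close> spans \<open>T\<close>: on the open set where it does not, (a) makes \<open>L\<close> fibrewise a Lorentzian quadratic form, and
  the maximality of the domain leaves no room for the line \<open>T\<close>.
  Conversely, \<open>F\<^sup>2\<close> is of class \<open>C\<^sup>1\<close> up to the zero section by homogeneity, whence (a), and \<open>\<theta> = \<omega> - 2 \<Lambda> dt\<close> gives (b)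
  and (c); if \<open>\<omega> = 0\<close> then the slices \<open>t = const\<close> are integral manifolds of \<open>ker \<theta>\<close>.\<close>

section \<open>Functions of class \<open>C\<^sup>k\<close>\<close>

text \<open>The difficulty is regularity at \<open>T\<close>. The Killing equation and the C^3
  regularity of \<open>L\<close> are available only off \<open>T\<close>, and \<open>K\<close>
  itself lies in \<open>T\<close>; yet \<Lambda> and \<omega> have to be C^3, and both are made from
  \<open>L\<close> and its derivative at \<open>K\<close>. Polarization resolves this: for
  \<open>w\<close> off \<open>T\<close> the values L(w), L(w + K) and L(w - K) are all taken off
  \<open>T\<close>, and they determine \<theta>(w) = (L(w + K) - L(w - K)) / 2 as well as L(K). The
  same device carries invariance under the flow from vectors off \<open>T\<close> to multiples of
  \<open>K\<close>. Positivity of the Hessian is known only on ker \<theta>, while away from the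
  base point the hypersurface need not be tangent to ker \<theta>; since the fibre Hessian is
  homogeneous of degree 0, compactness of unit spheres carries positivity to a neighbourhood. All of
  this needs a flow and an inverse function that are smooth in the sense of \<open>Ck_on\<close> for
  every k. They are obtained by bootstrapping: the derivative is given by an equation whose
  coefficients are built from the solution, so each order of differentiability yields the
  next.\<close>

lemma Ck_on_subset: "Ck_on k S f \<Longrightarrow> S' \<subseteq> S \<Longrightarrow> Ck_on k S' f"
  by (induction k arbitrary: f) (auto intro: continuous_on_subset)

lemma Ck_on_imp_continuous_on: "Ck_on k S f \<Longrightarrow> continuous_on S f"
  by (cases k) (auto intro!: continuous_at_imp_continuous_on differentiable_imp_continuous_within)

lemma Ck_on_Suc_imp: "Ck_on (Suc k) S f \<Longrightarrow> Ck_on k S f"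
proof (induction k arbitrary: f)
  case 0
  then show ?case
    using Ck_on_imp_continuous_on[of "Suc 0" S f] by (simp del: Ck_on.simps(2))
next
  case (Suc k)
  then show ?case
    by (metis Ck_on.simps(2))
qed

lemma Ck_on_le: "Ck_on k S f \<Longrightarrow> j \<le> k \<Longrightarrow> Ck_on j S f"
  by (induction k) (auto simp: le_Suc_eq dest: Ck_on_Suc_imp simp del: Ck_on.simps)

lemma Ck_on_imp_differentiable: "Ck_on k S f \<Longrightarrow> 1 \<le> k \<Longrightarrow> x \<in> S \<Longrightarrow> f differentiable (at x)"
  by (cases k) auto

lemma Ck_on_imp_has_derivative:
  "Ck_on k S f \<Longrightarrow> 1 \<le> k \<Longrightarrow> x \<in> S \<Longrightarrow> (f has_derivative frechet_derivative f (at x)) (at x)"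
  using Ck_on_imp_differentiable frechet_derivative_works by blast

lemma frechet_derivative_eqI: "(f has_derivative f') (at x) \<Longrightarrow> frechet_derivative f (at x) = f'"
  using frechet_derivative_at by metis

lemma frechet_derivative_cong_open:
  assumes "open S" "x \<in> S" "\<And>y. y \<in> S \<Longrightarrow> f y = g y"
  shows "frechet_derivative f (at x) = frechet_derivative g (at x)"
proof -
  have "(f has_derivative h) (at x) \<longleftrightarrow> (g has_derivative h) (at x)" for h
    using has_derivative_transform_within_open[OF _ assms(1,2), of f h UNIV g]
      has_derivative_transform_within_open[OF _ assms(1,2), of g h UNIV f] assms(3)
    by auto
  then show ?thesis
    by (simp add: frechet_derivative_def)
qed

text \<open>Openness matters: \<open>frechet_derivative\<close> looks at a full neighbourhood of the
  point, so agreement on \<open>S\<close> passes to derivatives only when \<open>S\<close> is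
  open.\<close>

lemma Ck_on_cong:
  assumes "open S" "\<And>x. x \<in> S \<Longrightarrow> f x = g x"
  shows "Ck_on k S f \<longleftrightarrow> Ck_on k S g"
proof -
  have imp: "Ck_on k S g" if "Ck_on k S f" "\<And>x. x \<in> S \<Longrightarrow> f x = g x" for f g :: "'a \<Rightarrow> 'b"
    using that
  proof (induction k arbitrary: f g)
    case 0
    then show ?case
      by (metis Ck_on.simps(1) continuous_on_cong)
  next
    case (Suc k)
    have "g differentiable (at x)" if "x \<in> S" for x
      using has_derivative_transform_within_open[OF _ assms(1) that, of f _ UNIV g] Suc.prems that
      unfolding differentiable_def by (metis Ck_on.simps(2) differentiable_def)
    moreover have "Ck_on k S (\<lambda>x. frechet_derivative g (at x) u)" for u
    proof (rule Suc.IH[of "\<lambda>x. frechet_derivative f (at x) u"])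
      show "frechet_derivative f (at x) u = frechet_derivative g (at x) u" if "x \<in> S" for x
        using frechet_derivative_cong_open[OF assms(1) that, of f g] Suc.prems(2) by simp
    qed (use Suc.prems in simp)
    ultimately show ?case
      by simp
  qed
  show ?thesis
    using imp[of f g] imp[of g f] assms(2) by auto
qed

lemma Ck_on_SucI:
  assumes "open S" "\<And>x. x \<in> S \<Longrightarrow> (f has_derivative f' x) (at x)"
    "\<And>u. Ck_on k S (\<lambda>x. f' x u)"
  shows "Ck_on (Suc k) S f"
proof -
  have "frechet_derivative f (at x) = f' x" if "x \<in> S" for x
    using assms(2) that by (simp add: frechet_derivative_eqI)
  then have "Ck_on k S (\<lambda>x. frechet_derivative f (at x) u)" for u
    using assms(3)[of u] Ck_on_cong[OF assms(1), of "\<lambda>x. frechet_derivative f (at x) u" "\<lambda>x. f' x u"]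
    by auto
  then show ?thesis
    using assms(2) by (auto simp: differentiable_def)
qed

text \<open>Used to glue regularity that is found separately near each point, in coordinates that
  depend on the point.\<close>

lemma Ck_on_local:
  assumes "open S" "\<And>x. x \<in> S \<Longrightarrow> \<exists>N. open N \<and> x \<in> N \<and> Ck_on k (N \<inter> S) f"
  shows "Ck_on k S f"
  using assms(2)
proof (induction k arbitrary: f)
  case 0
  have "continuous (at x) f" if x: "x \<in> S" for x
  proof -
    obtain N where N: "open N" "x \<in> N" "continuous_on (N \<inter> S) f"
      using 0[OF x] by auto
    then show ?thesis
      using x assms(1) by (metis IntI continuous_on_eq_continuous_at open_Int)
  qed
  then show ?case
    by (simp add: continuous_at_imp_continuous_on)
next
  case (Suc k)
  have "f differentiable (at x)" if "x \<in> S" for x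
    using Suc.prems[OF that] that by auto
  moreover have "Ck_on k S (\<lambda>x. frechet_derivative f (at x) u)" for u
  proof (rule Suc.IH)
    fix x
    assume "x \<in> S"
    then obtain N where "open N" "x \<in> N" "Ck_on (Suc k) (N \<inter> S) f"
      using Suc.prems by blast
    then show "\<exists>N. open N \<and> x \<in> N \<and> Ck_on k (N \<inter> S) (\<lambda>x. frechet_derivative f (at x) u)"
      by auto
  qed
  ultimately show ?case
    by simp
qed

lemma Ck_on_const: "Ck_on k S (\<lambda>x. c)"
  by (induction k arbitrary: c) auto

lemma Ck_on_bounded_linear:
  assumes "bounded_linear f"
  shows "Ck_on k S f"
proof (cases k)
  case 0
  then show ?thesis
    using assms by (simp add: linear_continuous_on)
next
  case (Suc j)
  have d: "(f has_derivative f) (at x)" for x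
    by (rule bounded_linear_imp_has_derivative[OF assms])
  then have "f differentiable (at x)" for x
    by (rule differentiableI)
  then show ?thesis
    using Suc frechet_derivative_eqI[OF d] by (auto simp: Ck_on_const)
qed

lemma Ck_on_ident: "Ck_on k S (\<lambda>x. x)"
  by (rule Ck_on_bounded_linear) (rule bounded_linear_ident)

lemma Ck_on_fst: "Ck_on k S fst" and Ck_on_snd: "Ck_on k S snd"
  by (auto intro!: Ck_on_bounded_linear bounded_linear_fst bounded_linear_snd)

lemma Ck_on_linear_compose:
  assumes "bounded_linear h" "open S" "Ck_on k S f"
  shows "Ck_on k S (\<lambda>x. h (f x))"
  using assms(3)
proof (induction k arbitrary: f)
  case 0
  then show ?case
    using assms(1) by (auto intro: bounded_linear.continuous_on)
next
  case (Suc k)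
  show ?case
  proof (rule Ck_on_SucI[OF \<open>open S\<close>])
    show "((\<lambda>x. h (f x)) has_derivative (\<lambda>u. h (frechet_derivative f (at x) u))) (at x)" if "x \<in> S" for x
      using Suc.prems that
      by (intro bounded_linear.has_derivative[OF assms(1)] Ck_on_imp_has_derivative[of "Suc k" S]) auto
    show "Ck_on k S (\<lambda>x. h (frechet_derivative f (at x) u))" for u
      using Suc by simp
  qed
qed

lemma Ck_on_add:
  assumes "open S" "Ck_on k S f" "Ck_on k S g"
  shows "Ck_on k S (\<lambda>x. f x + g x)"
  using assms(2,3)
proof (induction k arbitrary: f g)
  case 0
  then show ?case
    by (auto intro: continuous_intros)
next
  case (Suc k)
  show ?case
  proof (rule Ck_on_SucI[OF \<open>open S\<close>])
    show "((\<lambda>x. f x + g x) has_derivative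
        (\<lambda>u. frechet_derivative f (at x) u + frechet_derivative g (at x) u)) (at x)" if "x \<in> S" for x
      using Suc.prems that by (intro has_derivative_add Ck_on_imp_has_derivative[of "Suc k" S]) auto
    show "Ck_on k S (\<lambda>x. frechet_derivative f (at x) u + frechet_derivative g (at x) u)" for u
      using Suc by simp
  qed
qed

lemma Ck_on_sum:
  assumes "open S" "\<And>i. i \<in> I \<Longrightarrow> Ck_on k S (f i)"
  shows "Ck_on k S (\<lambda>x. \<Sum>i\<in>I. f i x)"
  using assms(2)
  by (induction I rule: infinite_finite_induct) (auto intro: Ck_on_add[OF \<open>open S\<close>] Ck_on_const)

lemma Ck_on_bounded_bilinear:
  assumes "bounded_bilinear h" "open S" "Ck_on k S f" "Ck_on k S g"
  shows "Ck_on k S (\<lambda>x. h (f x) (g x))"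
  using assms(3,4)
proof (induction k arbitrary: f g)
  case 0
  then show ?case
    using assms(1) by (auto intro: bounded_bilinear.continuous_on)
next
  case (Suc k)
  show ?case
  proof (rule Ck_on_SucI[OF \<open>open S\<close>])
    show "((\<lambda>x. h (f x) (g x)) has_derivative
        (\<lambda>u. h (f x) (frechet_derivative g (at x) u) + h (frechet_derivative f (at x) u) (g x))) (at x)"
      if "x \<in> S" for x
      using Suc.prems that
      by (intro bounded_bilinear.FDERIV[OF assms(1)] Ck_on_imp_has_derivative[of "Suc k" S]) auto
    show "Ck_on k S (\<lambda>x. h (f x) (frechet_derivative g (at x) u) + h (frechet_derivative f (at x) u) (g x))"
      for u
      using Suc.prems by (intro Ck_on_add \<open>open S\<close> Suc.IH) (auto dest: Ck_on_Suc_imp simp del: Ck_on.simps(2), auto)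
  qed
qed

lemmas Ck_on_mult = Ck_on_bounded_bilinear[OF bounded_bilinear_mult]
lemmas Ck_on_scaleR = Ck_on_bounded_bilinear[OF bounded_bilinear_scaleR]
lemmas Ck_on_inner = Ck_on_bounded_bilinear[OF bounded_bilinear_inner]
lemmas Ck_on_minus = Ck_on_linear_compose[OF bounded_linear_minus[OF bounded_linear_ident]]
lemmas Ck_on_fst_compose = Ck_on_linear_compose[OF bounded_linear_fst]
lemmas Ck_on_snd_compose = Ck_on_linear_compose[OF bounded_linear_snd]

lemma Ck_on_diff:
  "open S \<Longrightarrow> Ck_on k S f \<Longrightarrow> Ck_on k S g \<Longrightarrow> Ck_on k S (\<lambda>x. f x - g x)"
  using Ck_on_add[of S k f "\<lambda>x. - g x"] Ck_on_minus[of S k g] by simp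

lemma Ck_on_power2: "open S \<Longrightarrow> Ck_on k S f \<Longrightarrow> Ck_on k S (\<lambda>x. (f x :: real)\<^sup>2)"
  by (simp add: power2_eq_square Ck_on_mult)

lemma Ck_on_Pair:
  fixes f :: "'a::euclidean_space \<Rightarrow> 'b::real_normed_vector" and g :: "'a \<Rightarrow> 'c::real_normed_vector"
  assumes "open S" "Ck_on k S f" "Ck_on k S g"
  shows "Ck_on k S (\<lambda>x. (f x, g x))"
proof -
  have "bounded_linear (\<lambda>x::'b. (x, 0::'c))" "bounded_linear (\<lambda>x::'c. (0::'b, x))"
    by (auto intro!: bounded_linear_Pair bounded_linear_ident bounded_linear_zero)
  from Ck_on_add[OF assms(1) Ck_on_linear_compose[OF this(1) assms(1,2)]
      Ck_on_linear_compose[OF this(2) assms(1,3)]]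
  show ?thesis
    by simp
qed

lemma frechet_derivative_basis_sum:
  fixes f :: "'a::euclidean_space \<Rightarrow> 'b::real_normed_vector"
  assumes "f differentiable (at x)"
  shows "frechet_derivative f (at x) u = (\<Sum>b\<in>Basis. (u \<bullet> b) *\<^sub>R frechet_derivative f (at x) b)"
proof -
  have "linear (frechet_derivative f (at x))"
    using assms linear_frechet_derivative by blast
  then have "frechet_derivative f (at x) (\<Sum>b\<in>Basis. (u \<bullet> b) *\<^sub>R b) =
      (\<Sum>b\<in>Basis. (u \<bullet> b) *\<^sub>R frechet_derivative f (at x) b)"
    by (simp add: linear_sum linear_cmul)
  then show ?thesis
    by (simp add: euclidean_representation)
qed

text \<open>The chain rule is expanded over \<open>Basis\<close>. Each summand differentiates
  \<open>f\<close> in a constant direction \<open>b\<close>, and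
  \<open>\<lambda>y. frechet_derivative f (at y) b\<close> is a C^k function to which the induction
  hypothesis applies; Df(g x) applied to the moving vector Dg(x) u would not have this
  shape.\<close>

lemma Ck_on_compose:
  fixes f :: "'b::euclidean_space \<Rightarrow> 'c::real_normed_vector" and g :: "'a::euclidean_space \<Rightarrow> 'b"
  assumes "open S" "Ck_on k T f" "Ck_on k S g" "\<And>x. x \<in> S \<Longrightarrow> g x \<in> T"
  shows "Ck_on k S (\<lambda>x. f (g x))"
  using assms(2,3)
proof (induction k arbitrary: f)
  case 0
  then show ?case
    using assms(4) by (auto intro: continuous_on_compose2)
next
  case (Suc k)
  show ?case
  proof (rule Ck_on_SucI[OF \<open>open S\<close>])
    show "((\<lambda>x. f (g x)) has_derivative
        (\<lambda>u. \<Sum>b\<in>Basis. (frechet_derivative g (at x) u \<bullet> b) *\<^sub>R frechet_derivative f (at (g x)) b)) (at x)"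
      if "x \<in> S" for x
    proof -
      have "((\<lambda>x. f (g x)) has_derivative
          (\<lambda>u. frechet_derivative f (at (g x)) (frechet_derivative g (at x) u))) (at x)"
        by (rule has_derivative_compose[OF Ck_on_imp_has_derivative[OF Suc.prems(2) _ that]
              Ck_on_imp_has_derivative[OF Suc.prems(1) _ assms(4)[OF that]]]) auto
      moreover have "f differentiable (at (g x))"
        using Suc.prems that assms(4) by auto
      ultimately show ?thesis
        by (rule has_derivative_eq_rhs[OF _ ext[OF frechet_derivative_basis_sum]])
    qed
    have "Ck_on k S g"
      using Suc.prems by (auto dest: Ck_on_Suc_imp simp del: Ck_on.simps)
    then show "Ck_on k S
        (\<lambda>x. \<Sum>b\<in>Basis. (frechet_derivative g (at x) u \<bullet> b) *\<^sub>R frechet_derivative f (at (g x)) b)" for u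
      using Suc.prems
      by (intro Ck_on_sum Ck_on_scaleR Ck_on_inner Ck_on_const Suc.IH[of "\<lambda>y. frechet_derivative f (at y) b" for b] \<open>open S\<close>)
        auto
  qed
qed

text \<open>Expansion over \<open>Basis\<close> again, now with base point and direction both
  varying; one order of differentiability of \<open>f\<close> is spent.\<close>

lemma Ck_on_frechet_derivative:
  fixes f :: "'b::euclidean_space \<Rightarrow> 'c::real_normed_vector" and g :: "'a::euclidean_space \<Rightarrow> 'b"
  assumes "open S" "Ck_on (Suc k) T f" "Ck_on k S g" "Ck_on k S h" "\<And>x. x \<in> S \<Longrightarrow> g x \<in> T"
  shows "Ck_on k S (\<lambda>x. frechet_derivative f (at (g x)) (h x))"
proof -
  have c: "Ck_on k S (\<lambda>x. frechet_derivative f (at (g x)) b)" for b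
    by (rule Ck_on_compose[OF assms(1) _ assms(3,5), of "\<lambda>y. frechet_derivative f (at y) b"])
      (use assms(2) in auto)
  have "Ck_on k S (\<lambda>x. \<Sum>b\<in>Basis. (h x \<bullet> b) *\<^sub>R frechet_derivative f (at (g x)) b)"
    by (intro Ck_on_sum Ck_on_scaleR Ck_on_inner Ck_on_const c assms)
  moreover have "(\<Sum>b\<in>Basis. (h x \<bullet> b) *\<^sub>R frechet_derivative f (at (g x)) b) =
      frechet_derivative f (at (g x)) (h x)" if "x \<in> S" for x
    using assms that by (intro frechet_derivative_basis_sum[symmetric]) simp
  ultimately show ?thesis
    using Ck_on_cong[OF assms(1)] by (metis (no_types, lifting))
qed

text \<open>The derivative of 1/f is -(1/f) Df (1/f), a product of functions that are C^k by
  induction.\<close>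

lemma Ck_on_inverse:
  fixes f :: "'a::euclidean_space \<Rightarrow> real"
  assumes "open S" "Ck_on k S f" "\<And>x. x \<in> S \<Longrightarrow> f x \<noteq> 0"
  shows "Ck_on k S (\<lambda>x. inverse (f x))"
  using assms(2)
proof (induction k)
  case 0
  then show ?case
    using assms(3) by (auto intro: continuous_intros)
next
  case (Suc k)
  have k: "Ck_on k S f" "Ck_on k S (\<lambda>x. inverse (f x))"
    using Suc by (auto dest: Ck_on_Suc_imp simp del: Ck_on.simps)
  show ?case
  proof (rule Ck_on_SucI[OF \<open>open S\<close>])
    show "((\<lambda>x. inverse (f x)) has_derivative
        (\<lambda>u. - (inverse (f x) * frechet_derivative f (at x) u * inverse (f x)))) (at x)" if "x \<in> S" for x
      by (rule Deriv.has_derivative_inverse[OF assms(3)[OF that] Ck_on_imp_has_derivative[OF Suc.prems _ that]]) simp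
    show "Ck_on k S (\<lambda>x. - (inverse (f x) * frechet_derivative f (at x) u * inverse (f x)))" for u
      using Suc.prems k by (intro Ck_on_minus Ck_on_mult \<open>open S\<close>) auto
  qed
qed

text \<open>The derivative Df / (2 sqrt f) contains the square root again, so the induction
  closes.\<close>

lemma Ck_on_sqrt:
  fixes f :: "'a::euclidean_space \<Rightarrow> real"
  assumes "open S" "Ck_on k S f" "\<And>x. x \<in> S \<Longrightarrow> f x > 0"
  shows "Ck_on k S (\<lambda>x. sqrt (f x))"
  using assms(2)
proof (induction k)
  case 0
  then show ?case
    by (auto intro: continuous_intros)
next
  case (Suc k)
  have k: "Ck_on k S (\<lambda>x. sqrt (f x))"
    using Suc by (auto dest: Ck_on_Suc_imp simp del: Ck_on.simps)
  show ?case
  proof (rule Ck_on_SucI[OF \<open>open S\<close>])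
    show "((\<lambda>x. sqrt (f x)) has_derivative
        (\<lambda>u. frechet_derivative f (at x) u * inverse (2 * sqrt (f x)))) (at x)" if "x \<in> S" for x
    proof (rule has_derivative_eq_rhs)
      show "((\<lambda>x. sqrt (f x)) has_derivative
          (\<lambda>u. inverse (sqrt (f x)) / 2 * frechet_derivative f (at x) u)) (at x)"
        using DERIV_real_sqrt[OF assms(3)[OF that]] unfolding has_field_derivative_def
        by (rule has_derivative_compose[OF Ck_on_imp_has_derivative[OF Suc.prems _ that], rotated]) simp
    qed (auto simp: field_simps)
    show "Ck_on k S (\<lambda>x. frechet_derivative f (at x) u * inverse (2 * sqrt (f x)))" for u
      using Suc.prems k assms(3)
      by (intro Ck_on_mult Ck_on_inverse \<open>open S\<close> Ck_on_const) force+
  qed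
qed

section \<open>Symmetry of second derivatives\<close>

lemma has_vector_derivative_line:
  assumes "(f has_derivative f') (at (p + r *\<^sub>R u))"
  shows "((\<lambda>r. f (p + r *\<^sub>R u)) has_vector_derivative f' u) (at r)"
proof -
  have "((\<lambda>r. p + r *\<^sub>R u) has_derivative (\<lambda>h. h *\<^sub>R u)) (at r)"
    by (auto intro!: derivative_eq_intros)
  from has_derivative_compose[OF this assms] show ?thesis
    using linear_cmul[OF has_derivative_linear[OF assms]] by (simp add: has_vector_derivative_def)
qed

text \<open>Two applications of the mean value theorem: along \<open>u\<close> to the increment in
  direction \<open>s *\<^sub>R v\<close>, then along \<open>v\<close> to the derivative in direction
  \<open>u\<close>. The intermediate point stays within s (|u| + |v|) of \<open>x\<close>, which
  makes the limit s -> 0 work.\<close>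

lemma second_difference_mean_value:
  fixes f :: "'a::euclidean_space \<Rightarrow> real"
  assumes f: "Ck_on 2 (ball x e) f" and s: "s > 0" "s * (norm u + norm v) < e"
  obtains p where "dist x p \<le> s * (norm u + norm v)"
    "f (x + s *\<^sub>R u + s *\<^sub>R v) - f (x + s *\<^sub>R u) - f (x + s *\<^sub>R v) + f x =
      s\<^sup>2 * frechet_derivative (\<lambda>y. frechet_derivative f (at y) u) (at p) v"
proof -
  let ?D = "\<lambda>y. frechet_derivative f (at y) u"
  have in_ball: "x + a *\<^sub>R u + b *\<^sub>R v \<in> ball x e \<and> dist x (x + a *\<^sub>R u + b *\<^sub>R v) \<le> s * (norm u + norm v)"
    if "0 \<le> a" "a \<le> s" "0 \<le> b" "b \<le> s" for a b
  proof -
    have "norm (a *\<^sub>R u + b *\<^sub>R v) \<le> a * norm u + b * norm v"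
      using that norm_triangle_ineq[of "a *\<^sub>R u" "b *\<^sub>R v"] by simp
    also have "\<dots> \<le> s * norm u + s * norm v"
      using that by (intro add_mono mult_right_mono) auto
    finally show ?thesis
      using s norm_minus_cancel[of "a *\<^sub>R u + b *\<^sub>R v"] by (simp add: dist_norm distrib_left add.assoc)
  qed
  have D1: "((\<lambda>r. f (x + r *\<^sub>R u + b *\<^sub>R v)) has_derivative (\<lambda>h. h * ?D (x + r *\<^sub>R u + b *\<^sub>R v))) (at r)"
    if "0 \<le> r" "r \<le> s" "0 \<le> b" "b \<le> s" for r b
  proof -
    have d: "(f has_derivative frechet_derivative f (at (x + r *\<^sub>R u + b *\<^sub>R v))) (at (x + r *\<^sub>R u + b *\<^sub>R v))"
      using f in_ball[OF that] by (intro Ck_on_imp_has_derivative) auto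
    then have "(f has_derivative frechet_derivative f (at (x + r *\<^sub>R u + b *\<^sub>R v))) (at (x + b *\<^sub>R v + r *\<^sub>R u))"
      by (simp add: add.assoc add.commute[of "r *\<^sub>R u"])
    from has_vector_derivative_line[OF this] show ?thesis
      by (simp add: has_vector_derivative_def add.assoc add.commute[of "_ *\<^sub>R u"])
  qed
  let ?g = "\<lambda>r. f (x + r *\<^sub>R u + s *\<^sub>R v) - f (x + r *\<^sub>R u)"
  have "\<exists>\<xi>>0. \<xi> < s \<and> ?g s - ?g 0 = (s - 0) * (?D (x + \<xi> *\<^sub>R u + s *\<^sub>R v) - ?D (x + \<xi> *\<^sub>R u))"
  proof (rule MVT2)
    show "(?g has_real_derivative ?D (x + r *\<^sub>R u + s *\<^sub>R v) - ?D (x + r *\<^sub>R u)) (at r)"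
      if "0 \<le> r" "r \<le> s" for r
      using D1[of r s] D1[of r 0] that s
      by (auto simp: has_field_derivative_def algebra_simps intro!: derivative_eq_intros)
  qed (use s in auto)
  then obtain \<xi> where \<xi>: "0 < \<xi>" "\<xi> < s"
    "?g s - ?g 0 = s * (?D (x + \<xi> *\<^sub>R u + s *\<^sub>R v) - ?D (x + \<xi> *\<^sub>R u))"
    by auto
  let ?E = "\<lambda>y. frechet_derivative ?D (at y) v"
  have "\<exists>\<eta>>0. \<eta> < s \<and> ?D (x + \<xi> *\<^sub>R u + s *\<^sub>R v) - ?D (x + \<xi> *\<^sub>R u + 0 *\<^sub>R v) =
      (s - 0) * ?E (x + \<xi> *\<^sub>R u + \<eta> *\<^sub>R v)"
  proof (rule MVT2)
    show "((\<lambda>r. ?D (x + \<xi> *\<^sub>R u + r *\<^sub>R v)) has_real_derivative ?E (x + \<xi> *\<^sub>R u + r *\<^sub>R v)) (at r)"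
      if "0 \<le> r" "r \<le> s" for r
    proof -
      have "Ck_on 1 (ball x e) ?D"
        using f by (simp add: numeral_2_eq_2)
      then have d: "(?D has_derivative frechet_derivative ?D (at (x + \<xi> *\<^sub>R u + r *\<^sub>R v))) (at (x + \<xi> *\<^sub>R u + r *\<^sub>R v))"
        using in_ball[of \<xi> r] that \<xi> by (intro Ck_on_imp_has_derivative) auto
      from has_vector_derivative_line[OF this] show ?thesis
        by (simp add: has_real_derivative_iff_has_vector_derivative)
    qed
  qed (use s in auto)
  then obtain \<eta> where \<eta>: "0 < \<eta>" "\<eta> < s"
    "?D (x + \<xi> *\<^sub>R u + s *\<^sub>R v) - ?D (x + \<xi> *\<^sub>R u) = s * ?E (x + \<xi> *\<^sub>R u + \<eta> *\<^sub>R v)"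
    by auto
  show thesis
    using that[of "x + \<xi> *\<^sub>R u + \<eta> *\<^sub>R v"] \<xi> \<eta> in_ball[of \<xi> \<eta>]
    by (auto simp: power2_eq_square algebra_simps)
qed

text \<open>Schwarz: the second difference is symmetric in \<open>u\<close> and \<open>v\<close>.
  Divided by s^2 it is a mixed derivative at a nearby point, in either order according to the
  variable to which the mean value theorem is applied first; continuity gives equality at
  \<open>x\<close>.\<close>

lemma second_derivative_symmetric_real:
  fixes f :: "'a::euclidean_space \<Rightarrow> real"
  assumes "open S" "Ck_on 2 S f" "x \<in> S"
  shows "frechet_derivative (\<lambda>y. frechet_derivative f (at y) u) (at x) v =
    frechet_derivative (\<lambda>y. frechet_derivative f (at y) v) (at x) u"
proof -
  let ?D = "\<lambda>u v p. frechet_derivative (\<lambda>y. frechet_derivative f (at y) u) (at p) v"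
  obtain e where e: "e > 0" "ball x e \<subseteq> S"
    using assms openE by blast
  have C2: "Ck_on 2 (ball x e) f"
    using assms(2) e(2) by (rule Ck_on_subset)
  \<comment> \<open>A null sequence of step sizes. The summand 1 covers u = v = 0, and already the
    first term keeps the corners of the parallelogram inside the ball.\<close>
  define s where "s = (\<lambda>n. e / (norm u + norm v + 1) / (real n + 2))"
  have s: "s n > 0" "s n * (norm u + norm v) < e" for n
  proof -
    have pos: "0 < (norm u + norm v + 1) * (real n + 2)"
      by (intro mult_pos_pos add_nonneg_pos add_nonneg_nonneg) auto
    have "norm u + norm v < (norm u + norm v + 1) * (real n + 2)"
      by (rule order_less_le_trans[of _ "(norm u + norm v + 1) * 1"]) (simp, intro mult_left_mono, auto)
    then have "(norm u + norm v) / ((norm u + norm v + 1) * (real n + 2)) < 1"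
      using pos by simp
    then have "e * ((norm u + norm v) / ((norm u + norm v + 1) * (real n + 2))) < e * 1"
      using e by (intro mult_strict_left_mono)
    then show "s n * (norm u + norm v) < e"
      by (simp add: s_def)
    show "s n > 0"
      using e pos by (simp add: s_def)
  qed
  have s0: "(\<lambda>n. s n * (norm u + norm v)) \<longlonglongrightarrow> 0"
    proof -
    have "(\<lambda>n. inverse (real n)) \<longlonglongrightarrow> 0"
      by (rule lim_inverse_n)
    then have "(\<lambda>n. inverse (real (n + 2))) \<longlonglongrightarrow> 0"
      by (rule LIMSEQ_ignore_initial_segment)
    then have "(\<lambda>n. e / (norm u + norm v + 1) * inverse (real (n + 2)) * (norm u + norm v)) \<longlonglongrightarrow>
        e / (norm u + norm v + 1) * 0 * (norm u + norm v)"
      by (intro tendsto_intros)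
    then show ?thesis
      by (simp add: s_def divide_inverse add.commute)
  qed
  have "\<exists>p. \<forall>n. dist x (p n) \<le> s n * (norm u + norm v) \<and>
     f (x + s n *\<^sub>R u + s n *\<^sub>R v) - f (x + s n *\<^sub>R u) - f (x + s n *\<^sub>R v) + f x = (s n)\<^sup>2 * ?D u v (p n)"
    by (rule choice) (metis second_difference_mean_value[OF C2 s(1) s(2)])
  then obtain p where p: "\<And>n. dist x (p n) \<le> s n * (norm u + norm v)"
     "\<And>n. f (x + s n *\<^sub>R u + s n *\<^sub>R v) - f (x + s n *\<^sub>R u) - f (x + s n *\<^sub>R v) + f x = (s n)\<^sup>2 * ?D u v (p n)"
    by blast
  have "\<exists>q. \<forall>n. dist x (q n) \<le> s n * (norm v + norm u) \<and>
     f (x + s n *\<^sub>R v + s n *\<^sub>R u) - f (x + s n *\<^sub>R v) - f (x + s n *\<^sub>R u) + f x = (s n)\<^sup>2 * ?D v u (q n)"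
    using s by (intro choice) (metis second_difference_mean_value[OF C2] add.commute)
  then obtain q where q: "\<And>n. dist x (q n) \<le> s n * (norm v + norm u)"
     "\<And>n. f (x + s n *\<^sub>R v + s n *\<^sub>R u) - f (x + s n *\<^sub>R v) - f (x + s n *\<^sub>R u) + f x = (s n)\<^sup>2 * ?D v u (q n)"
    by blast
  have eq: "?D u v (p n) = ?D v u (q n)" for n
  proof -
    have "(s n)\<^sup>2 * ?D u v (p n) = (s n)\<^sup>2 * ?D v u (q n)"
      unfolding p(2)[symmetric] q(2)[symmetric] by (simp add: algebra_simps)
    then show ?thesis
      using s(1)[of n] by simp
  qed
  have lim: "r \<longlonglongrightarrow> x" if "\<And>n. dist x (r n) \<le> s n * (norm u + norm v)" for r
    unfolding tendsto_dist_iff[of r]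
    by (rule tendsto_sandwich[OF _ _ tendsto_const s0]) (auto simp: that dist_commute)
  have cont: "isCont (?D u v) x" for u v
    using assms by (simp add: numeral_2_eq_2 continuous_on_eq_continuous_at)
  have "(\<lambda>n. ?D u v (p n)) \<longlonglongrightarrow> ?D u v x"
    using isCont_tendsto_compose[OF cont lim[OF p(1)]] .
  moreover have "(\<lambda>n. ?D v u (q n)) \<longlonglongrightarrow> ?D v u x"
    using isCont_tendsto_compose[OF cont lim] q(1) by (simp add: add.commute)
  ultimately show ?thesis
    unfolding eq using LIMSEQ_unique by blast
qed

lemma second_derivative_symmetric:
  fixes f :: "'a::euclidean_space \<Rightarrow> 'b::euclidean_space"
  assumes "open S" "Ck_on 2 S f" "x \<in> S"
  shows "frechet_derivative (\<lambda>y. frechet_derivative f (at y) u) (at x) v =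
    frechet_derivative (\<lambda>y. frechet_derivative f (at y) v) (at x) u"
proof (rule euclidean_eqI)
  fix b :: 'b
  assume "b \<in> Basis"
  let ?f = "\<lambda>y. f y \<bullet> b"
  have C2: "Ck_on 2 S ?f"
    by (rule Ck_on_linear_compose[OF bounded_linear_inner_left assms(1,2)])
  have "frechet_derivative ?f (at y) u = frechet_derivative f (at y) u \<bullet> b" if "y \<in> S" for u y
    using Ck_on_imp_has_derivative[OF assms(2) _ that]
    by (subst frechet_derivative_eqI[where f = ?f]) (auto intro: has_derivative_inner_left)
  then have "frechet_derivative (\<lambda>y. frechet_derivative ?f (at y) u) (at x) v =
      frechet_derivative (\<lambda>y. frechet_derivative f (at y) u \<bullet> b) (at x) v" for u v
    by (intro fun_cong[OF frechet_derivative_cong_open[OF assms(1,3)]])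
  also have "\<dots> u v = frechet_derivative (\<lambda>y. frechet_derivative f (at y) u) (at x) v \<bullet> b" for u v
  proof -
    have "Ck_on 1 S (\<lambda>y. frechet_derivative f (at y) u)"
      using assms(2) by (simp add: numeral_2_eq_2)
    from Ck_on_imp_has_derivative[OF this _ assms(3)] show ?thesis
      by (subst frechet_derivative_eqI) (auto intro: has_derivative_inner_left)
  qed
  finally show "frechet_derivative (\<lambda>y. frechet_derivative f (at y) u) (at x) v \<bullet> b =
    frechet_derivative (\<lambda>y. frechet_derivative f (at y) v) (at x) u \<bullet> b"
    using second_derivative_symmetric_real[OF assms(1) C2 assms(3)] by metis
qed

section \<open>Integral equations depending on parameters\<close>

text \<open>The integral of \<open>h\<close> from \<open>0\<close> to \<open>t\<close>, for \<open>t\<close> of either sign.\<close>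

definition oint :: "(real \<Rightarrow> 'b::banach) \<Rightarrow> real \<Rightarrow> 'b" where
  "oint h t = t *\<^sub>R integral {0..1} (\<lambda>\<sigma>. h (\<sigma> * t))"

lemma scaled_in_symmetric_interval:
  fixes \<sigma> t a :: real
  assumes "\<sigma> \<in> {0..1}" "\<bar>t\<bar> \<le> a"
  shows "\<bar>\<sigma> * t\<bar> \<le> a"
  using assms mult_mono[of \<sigma> 1 "\<bar>t\<bar>" a] by (auto simp: abs_mult)

lemma continuous_on_scaled:
  fixes h :: "real \<Rightarrow> 'b::topological_space"
  assumes "continuous_on {-a..a} h" "\<bar>t\<bar> \<le> a"
  shows "continuous_on {0..1} (\<lambda>\<sigma>. h (\<sigma> * t))"
proof -
  have "\<sigma> * t \<in> {-a..a}" if "\<sigma> \<in> {0..1}" for \<sigma>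
    using scaled_in_symmetric_interval[OF that assms(2)] by (auto simp: abs_le_iff)
  then show ?thesis
    by (intro continuous_on_compose2[OF assms(1)]) (auto intro: continuous_intros)
qed

lemma norm_oint_le:
  assumes "continuous_on {-a..a} h" "\<bar>t\<bar> \<le> a" "\<And>\<tau>. \<bar>\<tau>\<bar> \<le> a \<Longrightarrow> norm (h \<tau>) \<le> B" "0 \<le> B"
  shows "norm (oint h t) \<le> a * B"
proof -
  have "norm (integral {0..1} (\<lambda>\<sigma>. h (\<sigma> * t))) \<le> B * (1 - 0)"
    by (rule integral_bound[OF _ continuous_on_scaled[OF assms(1,2)]])
      (use assms scaled_in_symmetric_interval in auto)
  then show ?thesis
    using assms mult_mono[of "\<bar>t\<bar>" a "norm (integral {0..1} (\<lambda>\<sigma>. h (\<sigma> * t)))" B]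
    by (simp add: oint_def)
qed

lemma oint_diff:
  assumes "continuous_on {-a..a} h" "continuous_on {-a..a} g" "\<bar>t\<bar> \<le> a"
  shows "oint (\<lambda>\<tau>. h \<tau> - g \<tau>) t = oint h t - oint g t"
  using continuous_on_scaled[OF assms(1,3)] continuous_on_scaled[OF assms(2,3)]
  by (simp add: oint_def integral_diff integrable_continuous_real scaleR_diff_right)

lemma oint_bounded_linear:
  assumes "bounded_linear f" "continuous_on {-a..a} h" "\<bar>t\<bar> \<le> a"
  shows "oint (\<lambda>\<tau>. f (h \<tau>)) t = f (oint h t)"
proof -
  have "integral {0..1} (f \<circ> (\<lambda>\<sigma>. h (\<sigma> * t))) = f (integral {0..1} (\<lambda>\<sigma>. h (\<sigma> * t)))"
    by (intro integral_linear integrable_continuous_real continuous_on_scaled[OF assms(2,3)] assms(1))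
  then show ?thesis
    by (simp add: oint_def o_def linear_cmul[OF bounded_linear.linear[OF assms(1)]])
qed

lemma oint_cong:
  assumes "\<And>\<tau>. \<bar>\<tau>\<bar> \<le> \<bar>t\<bar> \<Longrightarrow> h \<tau> = g \<tau>"
  shows "oint h t = oint g t"
proof -
  have "integral {0..1} (\<lambda>\<sigma>. h (\<sigma> * t)) = integral {0..1} (\<lambda>\<sigma>. g (\<sigma> * t))"
    by (rule integral_cong) (use assms scaled_in_symmetric_interval[of _ t "\<bar>t\<bar>"] in auto)
  then show ?thesis
    by (simp add: oint_def)
qed

lemma oint_0 [simp]: "oint h 0 = 0"
  by (simp add: oint_def)

text \<open>The substitution \<sigma> -> \<sigma> u turns \<open>oint h u\<close> into
  \<open>H u - H 0\<close>, with \<open>H\<close> the integral from -a. This holds for either sign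
  of \<open>u\<close>, so the fundamental theorem for \<open>H\<close> applies.\<close>

lemma oint_has_vector_derivative:
  assumes "continuous_on {-a..a} h" "\<bar>t\<bar> < a"
  shows "(oint h has_vector_derivative h t) (at t)"
proof -
  define H where "H = (\<lambda>u. integral {-a..u} h)"
  have H: "(H has_vector_derivative h u) (at u within {-a..a})" if "\<bar>u\<bar> \<le> a" for u
    unfolding H_def by (rule integral_has_vector_derivative[OF assms(1)]) (use that in auto)
  have eq: "oint h u = H u - H 0" if u: "\<bar>u\<bar> < a" for u
  proof -
    have "((\<lambda>\<sigma>. u *\<^sub>R h (\<sigma> * u)) has_integral (H (1 * u) - H (0 * u))) {0..1}"
    proof (rule fundamental_theorem_of_calculus)
      fix \<sigma> :: real
      assume \<sigma>: "\<sigma> \<in> {0..1}"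
      have "((\<lambda>\<sigma>. \<sigma> * u) has_vector_derivative u) (at \<sigma> within {0..1})"
        by (auto simp: has_vector_derivative_def intro!: derivative_eq_intros)
      moreover have "(\<lambda>\<sigma>. \<sigma> * u) ` {0..1} \<subseteq> {-a..a}"
        using scaled_in_symmetric_interval[of _ u a] u by (force simp: abs_le_iff)
      then have "(H has_vector_derivative h (\<sigma> * u)) (at (\<sigma> * u) within (\<lambda>\<sigma>. \<sigma> * u) ` {0..1})"
        using H[of "\<sigma> * u"] scaled_in_symmetric_interval[OF \<sigma>, of u a] u
        by (meson has_vector_derivative_within_subset less_imp_le)
      ultimately show "((\<lambda>\<sigma>. H (\<sigma> * u)) has_vector_derivative u *\<^sub>R h (\<sigma> * u)) (at \<sigma> within {0..1})"
        using vector_diff_chain_within by (force simp: o_def)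
    qed simp
    then have "integral {0..1} (\<lambda>\<sigma>. u *\<^sub>R h (\<sigma> * u)) = H u - H 0"
      using integral_unique[of "\<lambda>\<sigma>. u *\<^sub>R h (\<sigma> * u)"] by (simp only: mult_1 mult_zero_left)
    then show ?thesis
      unfolding oint_def integral_cmul .
  qed
  have t: "t \<in> {-a<..<a}"
    using assms(2) by auto
  have "(H has_vector_derivative h t) (at t within {-a<..<a})"
    by (rule has_vector_derivative_within_subset[OF H]) (use assms(2) in auto)
  then have "(H has_vector_derivative h t) (at t)"
    unfolding at_within_open[OF t open_greaterThanLessThan] .
  then have "((\<lambda>u. H u - H 0) has_vector_derivative h t) (at t)"
    by (auto intro!: derivative_eq_intros)
  then show ?thesis
    by (rule has_vector_derivative_transform_within_open[OF _ open_greaterThanLessThan t])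
      (use eq in auto)
qed

text \<open>The supremum M of |r| is attained by compactness, and the step inequality at that point
  reads M \<le> e + M / 2. It plays the part of Gronwall's inequality for short times.\<close>

lemma contraction_bound:
  fixes r :: "real \<Rightarrow> 'b::real_normed_vector"
  assumes "0 \<le> a" "continuous_on {-a..a} r"
    and step: "\<And>M t. 0 \<le> M \<Longrightarrow> (\<And>\<tau>. \<bar>\<tau>\<bar> \<le> a \<Longrightarrow> norm (r \<tau>) \<le> M) \<Longrightarrow> \<bar>t\<bar> \<le> a \<Longrightarrow> norm (r t) \<le> e + M / 2"
    and "\<bar>t\<bar> \<le> a"
  shows "norm (r t) \<le> 2 * e"
proof -
  have "continuous_on {-a..a} (\<lambda>t. norm (r t))"
    using assms(2) by (intro continuous_intros)
  then obtain s where s: "s \<in> {-a..a}" "\<And>t. t \<in> {-a..a} \<Longrightarrow> norm (r t) \<le> norm (r s)"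
    using continuous_attains_sup[of "{-a..a}" "\<lambda>t. norm (r t)"] assms(1) by auto
  have "norm (r s) \<le> e + norm (r s) / 2"
    by (rule step) (use s in \<open>auto simp: abs_le_iff\<close>)
  moreover have "norm (r t) \<le> norm (r s)"
    using s(2)[of t] assms(4) by (auto simp: abs_le_iff)
  ultimately show ?thesis
    by simp
qed

text \<open>Banach's fixed point theorem in the space of bounded continuous functions of time and
  parameter together, so that joint continuity of the solution comes with existence. The global
  hypotheses on \<open>G\<close> and \<open>s\<close> are met later by composing local data with
  nearest-point projections. \<open>a * l\<close> bounds the Lipschitz constant of the integral
  operator.\<close>

lemma picard_exists:
  fixes G :: "real \<times> 'p::euclidean_space \<Rightarrow> 'b::banach \<Rightarrow> 'b"
  assumes a: "0 \<le> a" "0 \<le> l" "a * l \<le> 1 / 2"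
    and G: "continuous_on UNIV (\<lambda>(q, y). G q y)"
    and G_lipschitz: "\<And>q y y'. norm (G q y - G q y') \<le> l * norm (y - y')"
    and G_0: "\<And>q. norm (G q 0) \<le> B"
    and s: "continuous_on UNIV s" "\<And>x. norm (s x) \<le> B'"
  obtains Y where "continuous_on UNIV Y"
    "\<And>t x. \<bar>t\<bar> \<le> a \<Longrightarrow> Y (t, x) = s x + oint (\<lambda>\<tau>. G (\<tau>, x) (Y (\<tau>, x))) t"
proof -
  \<comment> \<open>Time is clamped to [-a, a]: the operator then acts on functions defined for all
    times, while its values for |t| \<le> a are unaffected.\<close>
  define c where "c = (\<lambda>t::real. max (- a) (min a t))"
  have c: "\<bar>c t\<bar> \<le> a" "\<bar>t\<bar> \<le> a \<Longrightarrow> c t = t" for t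
    using a(1) by (auto simp: c_def)
  have c_cont: "continuous_on S (\<lambda>x. c (f x))" if "continuous_on S f" for S :: "'c::topological_space set" and f
    unfolding c_def using that by (intro continuous_intros)
  define N where "N = (\<lambda>(Y :: (real \<times> 'p) \<Rightarrow>\<^sub>C 'b) (q :: real \<times> 'p).
     s (snd q) + oint (\<lambda>\<tau>. G (\<tau>, snd q) (Y (\<tau>, snd q))) (c (fst q)))"
  have G_cont: "continuous_on S (\<lambda>z. G (f z) (g z))"
    if "continuous_on S f" "continuous_on S g" for S :: "'c::topological_space set" and f g
    using continuous_on_compose2[OF G, of S "\<lambda>z. (f z, g z)"] that
    by (auto intro: continuous_intros)
  have Y_cont: "continuous_on S (\<lambda>z. apply_bcontfun Y (f z))"
    if "continuous_on S f" for S :: "'c::topological_space set" and f and Y :: "(real \<times> 'p) \<Rightarrow>\<^sub>C 'b"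
    using continuous_on_compose2[OF continuous_on_apply_bcontfun[of UNIV Y] that] by auto
  have Gt_cont: "continuous_on S (\<lambda>\<tau>. G (\<tau>, x) (apply_bcontfun Y (\<tau>, x)))" for S x Y
    by (intro G_cont Y_cont continuous_intros)
  have N_cont: "continuous_on UNIV (N Y)" for Y
  proof -
    have "continuous_on UNIV (\<lambda>q. integral (cbox 0 1) (\<lambda>\<sigma>. G (\<sigma> * c (fst q), snd q) (Y (\<sigma> * c (fst q), snd q))))"
      by (rule integral_continuous_on_param, unfold case_prod_unfold)
        (intro G_cont Y_cont continuous_intros c_cont)
    then show ?thesis
      unfolding N_def oint_def
      by (auto intro!: continuous_intros c_cont continuous_on_compose2[OF s(1)])
  qed
  \<comment> \<open>A Lipschitz right-hand side grows at most linearly, so the operator maps bounded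
    functions to bounded functions.\<close>
  have N_bound: "\<exists>C. \<forall>q. norm (N Y q) \<le> C" for Y
  proof -
    obtain R where R: "\<And>q. norm (apply_bcontfun Y q) \<le> R"
      using bounded_apply_bcontfun[of Y] by (auto simp: bounded_iff)
    have GR: "norm (G q (apply_bcontfun Y q')) \<le> l * R + B" for q q'
    proof -
      have "norm (G q (apply_bcontfun Y q')) \<le> norm (G q (apply_bcontfun Y q') - G q 0) + norm (G q 0)"
        using norm_triangle_ineq[of "G q (apply_bcontfun Y q') - G q 0" "G q 0"] by simp
      also have "\<dots> \<le> l * norm (apply_bcontfun Y q' - 0) + B"
        by (intro add_mono G_lipschitz G_0)
      also have "\<dots> \<le> l * R + B"
        using R a(2) by (simp add: mult_left_mono)
      finally show ?thesis .
    qed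
    have nonneg: "0 \<le> l * R + B"
      using GR[of undefined undefined] norm_ge_zero order_trans by blast
    have "norm (N Y q) \<le> B' + a * (l * R + B)" for q
      unfolding N_def
      by (intro norm_triangle_le add_mono s norm_oint_le[OF Gt_cont c(1)] GR nonneg)
    then show ?thesis
      by blast
  qed
  define NN where "NN = (\<lambda>Y. Bcontfun (N Y))"
  have NN: "apply_bcontfun (NN Y) = N Y" for Y
    unfolding NN_def using bcontfun_normI[OF N_cont] N_bound[of Y]
    by (intro Bcontfun_inverse) blast
  have contract: "dist (NN Y) (NN Y') \<le> 1 / 2 * dist Y Y'" for Y Y'
  proof (rule dist_bound)
    fix q :: "real \<times> 'p"
    let ?h = "\<lambda>Y \<tau>. G (\<tau>, snd q) (apply_bcontfun Y (\<tau>, snd q))"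
    have "dist (apply_bcontfun (NN Y) q) (apply_bcontfun (NN Y') q) =
        norm (oint (\<lambda>\<tau>. ?h Y \<tau> - ?h Y' \<tau>) (c (fst q)))"
      unfolding NN dist_norm N_def
      by (subst oint_diff[OF Gt_cont Gt_cont c(1)]) simp
    also have "\<dots> \<le> a * (l * dist Y Y')"
    proof (rule norm_oint_le[OF _ c(1)])
      show "continuous_on {-a..a} (\<lambda>\<tau>. ?h Y \<tau> - ?h Y' \<tau>)"
        by (intro continuous_intros Gt_cont)
      show "norm (?h Y \<tau> - ?h Y' \<tau>) \<le> l * dist Y Y'" for \<tau>
      proof (rule order_trans[OF G_lipschitz])
        show "l * norm (apply_bcontfun Y (\<tau>, snd q) - apply_bcontfun Y' (\<tau>, snd q)) \<le> l * dist Y Y'"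
          using dist_bounded[of Y "(\<tau>, snd q)" Y'] a(2) unfolding dist_norm by (rule mult_left_mono)
      qed
      show "0 \<le> l * dist Y Y'"
        using a(2) by simp
    qed
    also have "\<dots> \<le> 1 / 2 * dist Y Y'"
      using mult_right_mono[OF a(3), of "dist Y Y'"] by simp
    finally show "dist (apply_bcontfun (NN Y) q) (apply_bcontfun (NN Y') q) \<le> 1 / 2 * dist Y Y'" .
  qed
  have "\<exists>!Y. NN Y = Y"
    by (rule banach_fix_type[of "1 / 2"]) (use contract in auto)
  then obtain Y where "NN Y = Y"
    by blast
  then have Y: "apply_bcontfun Y q = N Y q" for q
    using NN by metis
  show thesis
  proof (rule that[of "apply_bcontfun Y"])
    show "apply_bcontfun Y (t, x) = s x + oint (\<lambda>\<tau>. G (\<tau>, x) (apply_bcontfun Y (\<tau>, x))) t" if "\<bar>t\<bar> \<le> a" for t x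
      using Y[of "(t, x)"] c(2)[OF that] by (simp add: N_def)
  qed auto
qed

text \<open>The derivative is uniformly continuous on a compact neighbourhood of \<open>C\<close>,
  so one radius \<open>d\<close> serves for the whole of \<open>C\<close>. In the application
  \<open>C\<close> is an entire trajectory.\<close>

lemma C1_uniform_linearization:
  fixes f :: "'a::euclidean_space \<Rightarrow> 'b::real_normed_vector"
  assumes "open U" "Ck_on 1 U f" "compact C" "C \<subseteq> U" "e > 0"
  obtains d where "d > 0"
    "\<And>p q. p \<in> C \<Longrightarrow> dist p q < d \<Longrightarrow>
       q \<in> U \<and> norm (f q - f p - frechet_derivative f (at p) (q - p)) \<le> e * norm (q - p)"
proof -
  define D where "D = (\<lambda>x. Blinfun (frechet_derivative f (at x)))"
  have d: "(f has_derivative frechet_derivative f (at x)) (at x)" if "x \<in> U" for x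
    using Ck_on_imp_has_derivative[OF assms(2) _ that] by simp
  have D: "blinfun_apply (D x) = frechet_derivative f (at x)" if "x \<in> U" for x
    unfolding D_def by (intro bounded_linear_Blinfun_apply has_derivative_bounded_linear[OF d[OF that]])
  have D_cont: "continuous_on U D"
  proof (rule continuous_on_blinfun_componentwise)
    fix i :: 'a
    have "continuous_on U (\<lambda>x. frechet_derivative f (at x) i)"
      using assms(2) by simp
    then show "continuous_on U (\<lambda>x. blinfun_apply (D x) i)"
      using D by (auto cong: continuous_on_cong)
  qed
  obtain r where r: "r > 0" "(\<Union>x\<in>C. cball x r) \<subseteq> U"
    using compact_subset_open_imp_cball_epsilon_subset[OF assms(3,1,4)] by blast
  \<comment> \<open>The closed r-neighbourhood of \<open>C\<close>, compact as a sum of compact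
    sets.\<close>
  define V where "V = {x + y |x y. x \<in> C \<and> y \<in> cball 0 r}"
  have V: "q \<in> V" if "p \<in> C" "dist p q \<le> r" for p q
    unfolding V_def using that by (intro CollectI exI[of _ p] exI[of _ "q - p"]) (auto simp: dist_norm norm_minus_commute)
  have "V \<subseteq> U"
    using r(2) by (fastforce simp: V_def dist_norm)
  have "compact V"
    unfolding V_def by (intro compact_sums assms(3) compact_cball)
  then have "uniformly_continuous_on V D"
    using D_cont \<open>V \<subseteq> U\<close> by (intro compact_uniformly_continuous) (auto intro: continuous_on_subset)
  then obtain \<delta> where \<delta>: "\<delta> > 0" "\<And>p q. p \<in> V \<Longrightarrow> q \<in> V \<Longrightarrow> dist q p < \<delta> \<Longrightarrow> dist (D q) (D p) < e"
    using assms(5) unfolding uniformly_continuous_on_def by metis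
  show thesis
  proof (rule that[of "min \<delta> r"])
    show "min \<delta> r > 0"
      using \<delta> r by simp
  next
    fix p q
    assume p: "p \<in> C" and q: "dist p q < min \<delta> r"
    have S: "ball p (min \<delta> r) \<subseteq> V"
      using V[OF p] by auto
    have pS: "p \<in> ball p (min \<delta> r)"
      using \<delta> r by auto
    have "norm (f q - f p - frechet_derivative f (at p) (q - p)) \<le> norm (q - p) * e"
    proof (rule differentiable_bound_linearization[where S = "ball p (min \<delta> r)" and f' = "\<lambda>x. frechet_derivative f (at x)"])
      show "p + t *\<^sub>R (q - p) \<in> ball p (min \<delta> r)" if "t \<in> {0..1}" for t
        using convexD_alt[OF convex_ball pS, of q t] q that by (auto simp: algebra_simps)
      show "(f has_derivative frechet_derivative f (at x)) (at x within ball p (min \<delta> r))"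
        if "x \<in> ball p (min \<delta> r)" for x
        by (rule has_derivative_at_withinI[OF d]) (use S \<open>V \<subseteq> U\<close> that in blast)
      show "onorm (frechet_derivative f (at x) - frechet_derivative f (at p)) \<le> e"
        if "x \<in> ball p (min \<delta> r)" for x
      proof -
        have xV: "x \<in> V" "p \<in> V"
          using that S pS by auto
        then have "frechet_derivative f (at x) - frechet_derivative f (at p) = blinfun_apply (D x - D p)"
          using D[of x] D[of p] \<open>V \<subseteq> U\<close> by (simp add: blinfun.diff_left fun_eq_iff subset_iff)
        then have "onorm (frechet_derivative f (at x) - frechet_derivative f (at p)) = dist (D x) (D p)"
          by (simp add: norm_blinfun.rep_eq dist_norm)
        then show ?thesis
          using \<delta>(2)[OF xV(2,1)] that by (simp add: dist_commute)
      qed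
    qed (rule pS)
    moreover have "q \<in> U"
      using V[OF p, of q] q \<open>V \<subseteq> U\<close> by auto
    ultimately show "q \<in> U \<and> norm (f q - f p - frechet_derivative f (at p) (q - p)) \<le> e * norm (q - p)"
      by (simp add: mult.commute)
  qed
qed

lemma continuous_on_frechet_derivative:
  "Ck_on 1 S f \<Longrightarrow> continuous_on S (\<lambda>x. frechet_derivative f (at x) u)"
  by simp

text \<open>The derivative in the parameter is guessed as the solution \<open>Z\<close> of the
  linearized integral equation. The error r = Y(y) - Y(x) - Z (y - x) satisfies a linear inequality
  along the trajectory, and \<open>contraction_bound\<close> makes it o(|y - x|). Requiring a l
  \<le> 1/4 leaves another 1/4 for the linearization error of \<open>g\<close>; together they give
  the factor 1/2 needed there.\<close>

lemma integral_equation_has_derivative: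
  fixes g :: "real \<times> 'p::euclidean_space \<times> 'e::euclidean_space \<Rightarrow> 'e"
  assumes a: "0 < a" "0 \<le> l" "a * l \<le> 1 / 4"
    and g: "open \<Theta>" "Ck_on 1 \<Theta> g"
    and s: "open P" "Ck_on 1 P s"
    and P: "0 < \<rho>" "cball z \<rho> \<subseteq> P"
    and Y: "continuous_on ({-a..a} \<times> cball z \<rho>) Y"
    and Y_mem: "\<And>t x. \<bar>t\<bar> \<le> a \<Longrightarrow> x \<in> cball z \<rho> \<Longrightarrow> (t, x, Y (t, x)) \<in> \<Theta>"
    and Y_bound: "\<And>t x v. \<bar>t\<bar> \<le> a \<Longrightarrow> x \<in> cball z \<rho> \<Longrightarrow>
      norm (frechet_derivative g (at (t, x, Y (t, x))) (0, 0, v)) \<le> l * norm v"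
    and Y_eq: "\<And>t x. \<bar>t\<bar> \<le> a \<Longrightarrow> x \<in> cball z \<rho> \<Longrightarrow>
      Y (t, x) = s x + oint (\<lambda>\<tau>. g (\<tau>, x, Y (\<tau>, x))) t"
  obtains Z :: "real \<times> 'p \<Rightarrow> 'p \<Rightarrow>\<^sub>L 'e" where "continuous_on UNIV Z"
    "\<And>t x u. \<bar>t\<bar> \<le> a \<Longrightarrow> x \<in> cball z \<rho> \<Longrightarrow> Z (t, x) u = frechet_derivative s (at x) u +
       oint (\<lambda>\<tau>. frechet_derivative g (at (\<tau>, x, Y (\<tau>, x))) (0, u, Z (\<tau>, x) u)) t"
    "\<And>t x. \<bar>t\<bar> < a \<Longrightarrow> x \<in> ball z \<rho> \<Longrightarrow>
       (Y has_derivative (\<lambda>q. fst q *\<^sub>R g (t, x, Y (t, x)) + Z (t, x) (snd q))) (at (t, x))"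
proof -
  define C where "C = {-a..a} \<times> cball z \<rho>"
  define p where "p = (\<lambda>q. (fst q, snd q, Y q))"
  define Dg where "Dg = (\<lambda>q. frechet_derivative g (at (p q)))"
  have C_ne: "C \<noteq> {}" "cball z \<rho> \<noteq> {}"
    using a(1) P(1) by (auto simp: C_def)
  have C: "compact C" "convex C" "closed C"
    unfolding C_def by (auto intro!: compact_Times convex_Times closed_Times)
  have C_iff: "(t, x) \<in> C \<longleftrightarrow> \<bar>t\<bar> \<le> a \<and> x \<in> cball z \<rho>" for t x
    by (auto simp: C_def abs_le_iff)
  have p_mem: "p q \<in> \<Theta>" if "q \<in> C" for q
    using that Y_mem[of "fst q" "snd q"] by (cases q) (simp add: C_iff p_def)
  have p_cont: "continuous_on C p"
    unfolding p_def using Y by (intro continuous_intros) (simp add: C_def)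
  have g_der: "(g has_derivative Dg q) (at (p q))" if "q \<in> C" for q
    unfolding Dg_def by (rule Ck_on_imp_has_derivative[OF g(2) _ p_mem[OF that]]) simp
  have Dg_linear: "linear (Dg q)" "bounded_linear (Dg q)" if "q \<in> C" for q
    using has_derivative_linear[OF g_der[OF that]] has_derivative_bounded_linear[OF g_der[OF that]] by auto
  have Dg_cont: "continuous_on C (\<lambda>q. Dg q w)" for w
    unfolding Dg_def
    by (rule continuous_on_compose2[of \<Theta>, OF _ p_cont])
      (use p_mem continuous_on_frechet_derivative[OF g(2)] in auto)
  have s_der: "(s has_derivative frechet_derivative s (at x)) (at x)" if "x \<in> cball z \<rho>" for x
    using s(2) P(2) that by (intro Ck_on_imp_has_derivative[of 1 P]) auto
  define A where "A = (\<lambda>q. Blinfun (\<lambda>v. Dg q (0, 0, v)))"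
  define B where "B = (\<lambda>q. Blinfun (\<lambda>u. Dg q (0, u, 0)))"
  define S where "S = (\<lambda>x. Blinfun (frechet_derivative s (at x)))"
  have A: "blinfun_apply (A q) = (\<lambda>v. Dg q (0, 0, v))" if "q \<in> C" for q
    unfolding A_def
    by (intro bounded_linear_Blinfun_apply bounded_linear_compose[OF Dg_linear(2)[OF that]]
        bounded_linear_Pair bounded_linear_zero bounded_linear_ident)
  have B: "blinfun_apply (B q) = (\<lambda>u. Dg q (0, u, 0))" if "q \<in> C" for q
    unfolding B_def
    by (intro bounded_linear_Blinfun_apply bounded_linear_compose[OF Dg_linear(2)[OF that]]
        bounded_linear_Pair bounded_linear_zero bounded_linear_ident)
  have S: "blinfun_apply (S x) = frechet_derivative s (at x)" if "x \<in> cball z \<rho>" for x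
    unfolding S_def by (intro bounded_linear_Blinfun_apply has_derivative_bounded_linear[OF s_der[OF that]])
  have A_cont: "continuous_on C A" and B_cont: "continuous_on C B"
    by (intro continuous_on_blinfun_componentwise; use Dg_cont A B in \<open>simp cong: continuous_on_cong\<close>)+
  have S_cont: "continuous_on (cball z \<rho>) S"
  proof (rule continuous_on_blinfun_componentwise)
    fix i :: 'p
    have "continuous_on (cball z \<rho>) (\<lambda>x. frechet_derivative s (at x) i)"
      using s(2) P(2) by (auto intro: continuous_on_subset)
    then show "continuous_on (cball z \<rho>) (\<lambda>x. blinfun_apply (S x) i)"
      by (subst continuous_on_cong[OF refl, where g = "\<lambda>x. frechet_derivative s (at x) i"]) (simp_all add: S)
  qed
  have A_norm: "norm (A q) \<le> l" if "q \<in> C" for q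
    using Y_bound[of "fst q" "snd q"] that a(2)
    by (intro norm_blinfun_bound) (cases q; auto simp: A Dg_def p_def C_iff)+
  \<comment> \<open>Nearest-point projections onto compact convex sets extend the coefficients,
    controlled only on those sets, continuously to the whole space, as \<open>picard_exists\<close>
    demands.\<close>
  define \<kappa> where "\<kappa> = closest_point C"
  define \<kappa>' where "\<kappa>' = closest_point (cball z \<rho>)"
  have \<kappa>: "continuous_on UNIV \<kappa>" "\<kappa> q \<in> C" "q \<in> C \<Longrightarrow> \<kappa> q = q" for q
    unfolding \<kappa>_def using C C_ne
    by (auto intro: continuous_on_closest_point closest_point_in_set closest_point_self)
  have \<kappa>': "continuous_on UNIV \<kappa>'" "\<kappa>' x \<in> cball z \<rho>" "x \<in> cball z \<rho> \<Longrightarrow> \<kappa>' x = x" for x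
    unfolding \<kappa>'_def using C_ne
    by (auto intro!: continuous_on_closest_point closest_point_in_set closest_point_self simp del: mem_cball)
  have cont_\<kappa>: "continuous_on UNIV (\<lambda>q. f (\<kappa> q))" if "continuous_on C f" for f :: "_ \<Rightarrow> 'x::topological_space"
    using \<kappa> by (intro continuous_on_compose2[OF that]) auto
  obtain B1 where B1: "\<And>q. q \<in> C \<Longrightarrow> norm (B q) \<le> B1"
    using compact_imp_bounded[OF compact_continuous_image[OF B_cont C(1)]] unfolding bounded_iff by blast
  obtain S1 where S1: "\<And>x. x \<in> cball z \<rho> \<Longrightarrow> norm (S x) \<le> S1"
    using compact_imp_bounded[OF compact_continuous_image[OF S_cont compact_cball]] unfolding bounded_iff by blast
  \<comment> \<open>Right-hand side of the linearized equation for the operator-valued unknown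
    \<open>W\<close>: the derivative of \<open>g\<close> in the last variable composed with
    \<open>W\<close>, plus its derivative in the parameter.\<close>
  define G where "G = (\<lambda>q (W :: 'p \<Rightarrow>\<^sub>L 'e). (A (\<kappa> q) o\<^sub>L W) + B (\<kappa> q))"
  obtain Z where Z: "continuous_on UNIV Z"
    "\<And>t x. \<bar>t\<bar> \<le> a \<Longrightarrow> Z (t, x) = S (\<kappa>' x) + oint (\<lambda>\<tau>. G (\<tau>, x) (Z (\<tau>, x))) t"
  proof (rule picard_exists[of a l G B1 "\<lambda>x. S (\<kappa>' x)" S1])
    show "continuous_on UNIV (\<lambda>(q, W). G q W)"
      unfolding G_def case_prod_unfold
      by (intro continuous_intros continuous_on_compose2[OF cont_\<kappa>[OF A_cont]]
          continuous_on_compose2[OF cont_\<kappa>[OF B_cont]]) auto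
    show "norm (G q W - G q W') \<le> l * norm (W - W')" for q W W'
    proof -
      have "G q W - G q W' = A (\<kappa> q) o\<^sub>L (W - W')"
        by (rule blinfun_eqI) (simp add: G_def blinfun.diff_right blinfun.diff_left blinfun.add_left)
      then show ?thesis
        using norm_blinfun_compose[of "A (\<kappa> q)" "W - W'"]
          mult_right_mono[OF A_norm[OF \<kappa>(2)], of "norm (W - W')" q] by simp
    qed
    show "norm (G q 0) \<le> B1" for q
      using B1[OF \<kappa>(2)] by (simp add: G_def)
    show "continuous_on UNIV (\<lambda>x. S (\<kappa>' x))"
      using \<kappa>' by (intro continuous_on_compose2[OF S_cont]) auto
    show "norm (S (\<kappa>' x)) \<le> S1" for x
      using S1[OF \<kappa>'(2)] .
  qed (use a in auto)
  have Z_path: "continuous_on T (\<lambda>\<tau>. Z (\<tau>, x))" for x T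
    by (rule continuous_on_compose2[OF Z(1)]) (auto intro: continuous_intros)
  have C_path: "continuous_on {-a..a} (\<lambda>\<tau>. f (\<tau>, x))" if "continuous_on C f" "x \<in> cball z \<rho>"
    for f :: "_ \<Rightarrow> 'x::topological_space" and x
    using that(2) by (intro continuous_on_compose2[OF that(1)]) (auto simp: C_def intro: continuous_intros)
  have GZ: "blinfun_apply (G q (Z q)) u = Dg q (0, u, Z q u)" if "q \<in> C" for q u
  proof -
    have "Dg q (0, u, Z q u) = Dg q ((0, 0, Z q u) + (0, u, 0))"
      by simp
    also have "\<dots> = Dg q (0, 0, Z q u) + Dg q (0, u, 0)"
      by (rule linear_add[OF Dg_linear(1)[OF that]])
    finally show ?thesis
      using that by (simp add: G_def \<kappa> A B blinfun.add_left)
  qed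
  have GZ_cont: "continuous_on {-a..a} (\<lambda>\<tau>. G (\<tau>, x) (Z (\<tau>, x)))" for x
    unfolding G_def
    by (intro continuous_intros Z_path continuous_on_compose2[OF cont_\<kappa>[OF A_cont]]
        continuous_on_compose2[OF cont_\<kappa>[OF B_cont]]) auto
  have Z_eq: "Z (t, x) u = frechet_derivative s (at x) u + oint (\<lambda>\<tau>. Dg (\<tau>, x) (0, u, Z (\<tau>, x) u)) t"
    if "\<bar>t\<bar> \<le> a" "x \<in> cball z \<rho>" for t x u
  proof -
    have "Z (t, x) u = S x u + blinfun_apply (oint (\<lambda>\<tau>. G (\<tau>, x) (Z (\<tau>, x))) t) u"
      using Z(2)[OF that(1), of x] \<kappa>'(3)[OF that(2)] by (simp add: blinfun.add_left)
    also have "blinfun_apply (oint (\<lambda>\<tau>. G (\<tau>, x) (Z (\<tau>, x))) t) u =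
        oint (\<lambda>\<tau>. blinfun_apply (G (\<tau>, x) (Z (\<tau>, x))) u) t"
      by (rule oint_bounded_linear[OF blinfun.bounded_linear_left GZ_cont that(1), symmetric])
    also have "\<dots> = oint (\<lambda>\<tau>. Dg (\<tau>, x) (0, u, Z (\<tau>, x) u)) t"
      by (rule oint_cong) (use that in \<open>auto simp: GZ C_iff\<close>)
    finally show ?thesis
      using S that(2) by simp
  qed
  have g_cont: "continuous_on C (\<lambda>q. g (p q))"
    using p_mem by (intro continuous_on_compose2[OF Ck_on_imp_continuous_on[OF g(2)] p_cont]) auto
  have Dx: "((\<lambda>y. Y (t, y)) has_derivative blinfun_apply (Z (t, x))) (at x)"
    if t: "\<bar>t\<bar> \<le> a" and x: "x \<in> ball z \<rho>" for t x
    unfolding has_derivative_at_alt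
  proof (intro conjI allI impI)
    show "bounded_linear (blinfun_apply (Z (t, x)))"
      by (rule blinfun.bounded_linear_right)
    fix e :: real
    assume e: "e > 0"
    have xc: "x \<in> cball z \<rho>"
      using x by auto
    obtain Cz where Cz: "\<And>\<tau>. \<bar>\<tau>\<bar> \<le> a \<Longrightarrow> norm (Z (\<tau>, x)) \<le> Cz"
    proof -
      have "bounded ((\<lambda>\<tau>. Z (\<tau>, x)) ` {-a..a})"
        by (intro compact_imp_bounded compact_continuous_image Z_path compact_Icc)
      then obtain R where "\<forall>\<tau>\<in>{-a..a}. norm (Z (\<tau>, x)) \<le> R"
        by (auto simp: bounded_iff)
      then show thesis
        by (intro that[of R]) (simp add: abs_le_iff)
    qed
    have Cz0: "0 \<le> Cz"
      using order_trans[OF norm_ge_zero Cz[of 0]] a(1) by simp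
    \<comment> \<open>The first bound gives a \<epsilon> \<le> 1/4 for the contraction; the second
      makes the final error at most e |h|.\<close>
    define \<epsilon> where "\<epsilon> = min (1 / (4 * a)) (e / (2 * (1 + a * (1 + Cz))))"
    have pos: "0 < 1 + a * (1 + Cz)"
      using a(1) Cz0 by (intro add_pos_nonneg mult_nonneg_nonneg) auto
    have \<epsilon>: "\<epsilon> > 0" "a * \<epsilon> \<le> 1 / 4" "2 * (\<epsilon> * (1 + a * (1 + Cz))) \<le> e"
    proof -
      show "\<epsilon> > 0"
        using a(1) e pos by (simp add: \<epsilon>_def)
      have "a * \<epsilon> \<le> a * (1 / (4 * a))"
        using a(1) by (intro mult_left_mono) (auto simp: \<epsilon>_def)
      then show "a * \<epsilon> \<le> 1 / 4"
        using a(1) by simp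
      have "\<epsilon> * (1 + a * (1 + Cz)) \<le> e / (2 * (1 + a * (1 + Cz))) * (1 + a * (1 + Cz))"
        using pos by (intro mult_right_mono) (auto simp: \<epsilon>_def)
      also have "\<dots> = e / 2"
        unfolding times_divide_eq_left by (rule mult_divide_mult_cancel_right) (use pos in simp)
      finally show "2 * (\<epsilon> * (1 + a * (1 + Cz))) \<le> e"
        by simp
    qed
    have K: "compact (p ` ({-a..a} \<times> {x}))" "p ` ({-a..a} \<times> {x}) \<subseteq> \<Theta>"
      using xc p_mem
      by (auto intro!: compact_continuous_image continuous_on_subset[OF p_cont] compact_Times simp: C_def)
    obtain \<delta> where \<delta>: "\<delta> > 0"
      "\<And>w q. w \<in> p ` ({-a..a} \<times> {x}) \<Longrightarrow> dist w q < \<delta> \<Longrightarrow>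
         q \<in> \<Theta> \<and> norm (g q - g w - frechet_derivative g (at w) (q - w)) \<le> \<epsilon> * norm (q - w)"
      by (rule C1_uniform_linearization[OF g K \<epsilon>(1)]) (rule that)
    have "uniformly_continuous_on C Y"
      by (rule compact_uniformly_continuous[OF _ C(1)]) (use Y in \<open>simp add: C_def\<close>)
    then obtain \<delta>1 where \<delta>1: "\<delta>1 > 0"
      "\<forall>q\<in>C. \<forall>q'\<in>C. dist q' q < \<delta>1 \<longrightarrow> dist (Y q') (Y q) < \<delta> / 2"
      unfolding uniformly_continuous_on_def using half_gt_zero[OF \<delta>(1)] by blast
    obtain \<delta>2 where \<delta>2: "\<delta>2 > 0"
      "\<And>y. norm (y - x) < \<delta>2 \<Longrightarrow> norm (s y - s x - frechet_derivative s (at x) (y - x)) \<le> \<epsilon> * norm (y - x)"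
      using s_der[OF xc] \<epsilon>(1) unfolding has_derivative_at_alt by blast
    obtain \<delta>3 where \<delta>3: "\<delta>3 > 0" "ball x \<delta>3 \<subseteq> ball z \<rho>"
      using x openE[OF open_ball] by blast
    show "\<exists>d>0. \<forall>y. norm (y - x) < d \<longrightarrow> norm (Y (t, y) - Y (t, x) - Z (t, x) (y - x)) \<le> e * norm (y - x)"
    proof (intro exI[of _ "min (min \<delta>1 \<delta>2) (min \<delta>3 (\<delta> / 2))"] conjI allI impI)
      show "0 < min (min \<delta>1 \<delta>2) (min \<delta>3 (\<delta> / 2))"
        using \<delta> \<delta>1 \<delta>2 \<delta>3 by simp
      fix y
      assume y: "norm (y - x) < min (min \<delta>1 \<delta>2) (min \<delta>3 (\<delta> / 2))"
      have yc: "y \<in> cball z \<rho>"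
        using y \<delta>3(2) by (auto simp: dist_norm norm_minus_commute subset_iff)
      define h where "h = y - x"
      define r where "r = (\<lambda>\<tau>. Y (\<tau>, y) - Y (\<tau>, x) - Z (\<tau>, x) h)"
      define \<Phi> where "\<Phi> = (\<lambda>\<tau>. g (\<tau>, y, Y (\<tau>, y)) - g (\<tau>, x, Y (\<tau>, x)) - Dg (\<tau>, x) (0, h, Z (\<tau>, x) h))"
      have gy_cont: "continuous_on {-a..a} (\<lambda>\<tau>. g (\<tau>, y, Y (\<tau>, y)))" "continuous_on {-a..a} (\<lambda>\<tau>. g (\<tau>, x, Y (\<tau>, x)))"
        using C_path[OF g_cont yc] C_path[OF g_cont xc] by (simp_all add: p_def)
      have "continuous_on {-a..a} (\<lambda>\<tau>. blinfun_apply (G (\<tau>, x) (Z (\<tau>, x))) h)"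
        by (intro continuous_intros GZ_cont)
      then have DZ_cont: "continuous_on {-a..a} (\<lambda>\<tau>. Dg (\<tau>, x) (0, h, Z (\<tau>, x) h))"
        using xc by (subst (asm) continuous_on_cong[OF refl GZ]) (auto simp: C_iff)
      have \<Phi>_cont: "continuous_on {-a..a} \<Phi>"
        unfolding \<Phi>_def by (intro continuous_intros gy_cont DZ_cont)
      have "norm (r t) \<le> 2 * (\<epsilon> * (1 + a * (1 + Cz)) * norm h)"
      proof (rule contraction_bound[OF _ _ _ t])
        show "0 \<le> a"
          using a(1) by simp
        show "continuous_on {-a..a} r"
          unfolding r_def
          using C_path[of Y] Y xc yc by (intro continuous_intros Z_path) (auto simp: C_def)
      next
        fix M t'
        assume M: "0 \<le> M" "\<And>\<tau>. \<bar>\<tau>\<bar> \<le> a \<Longrightarrow> norm (r \<tau>) \<le> M" and t': "\<bar>t'\<bar> \<le> a"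
        have "r t' = (s y - s x - frechet_derivative s (at x) h) + oint \<Phi> t'"
          unfolding r_def \<Phi>_def Y_eq[OF t' yc] Y_eq[OF t' xc] Z_eq[OF t' xc]
          by (subst oint_diff[OF _ DZ_cont t'], intro continuous_intros gy_cont, subst oint_diff[OF gy_cont t'])
            (simp add: algebra_simps)
        moreover have "norm (oint \<Phi> t') \<le> a * (\<epsilon> * ((1 + Cz) * norm h + M) + l * M)"
        proof (rule norm_oint_le[OF \<Phi>_cont t'])
          show "0 \<le> \<epsilon> * ((1 + Cz) * norm h + M) + l * M"
            using \<epsilon>(1) Cz0 M(1) a(2) by (intro add_nonneg_nonneg mult_nonneg_nonneg) auto
          fix \<tau>
          assume \<tau>: "\<bar>\<tau>\<bar> \<le> a"
          have C\<tau>: "(\<tau>, x) \<in> C" "(\<tau>, y) \<in> C"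
            using \<tau> xc yc by (auto simp: C_iff simp del: mem_cball)
          have diff: "p (\<tau>, y) - p (\<tau>, x) = (0, h, Y (\<tau>, y) - Y (\<tau>, x))"
            by (simp add: p_def h_def)
          have norm_diff: "norm (p (\<tau>, y) - p (\<tau>, x)) \<le> norm h + norm (Y (\<tau>, y) - Y (\<tau>, x))"
            unfolding diff using norm_Pair_le[of 0 "(h, Y (\<tau>, y) - Y (\<tau>, x))"]
              norm_Pair_le[of h "Y (\<tau>, y) - Y (\<tau>, x)"] by simp
          have YY: "norm (Y (\<tau>, y) - Y (\<tau>, x)) < \<delta> / 2"
            using \<delta>1(2)[rule_format, OF C\<tau>] y by (simp add: dist_norm)
          have "dist (p (\<tau>, x)) (p (\<tau>, y)) < \<delta>"
            using norm_diff YY y by (simp add: dist_norm norm_minus_commute h_def)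
          then have "norm (g (p (\<tau>, y)) - g (p (\<tau>, x)) - Dg (\<tau>, x) (p (\<tau>, y) - p (\<tau>, x))) \<le>
              \<epsilon> * norm (p (\<tau>, y) - p (\<tau>, x))"
            unfolding Dg_def using \<tau> by (intro \<delta>(2)[THEN conjunct2]) (auto simp: abs_le_iff)
          also have "\<dots> \<le> \<epsilon> * ((1 + Cz) * norm h + M)"
          proof (rule mult_left_mono)
            have "norm (Y (\<tau>, y) - Y (\<tau>, x)) \<le> norm (r \<tau>) + norm (Z (\<tau>, x) h)"
              using norm_triangle_ineq[of "r \<tau>" "Z (\<tau>, x) h"] by (simp add: r_def)
            also have "\<dots> \<le> M + Cz * norm h"
              using M(2)[OF \<tau>] norm_blinfun[of "Z (\<tau>, x)" h] mult_right_mono[OF Cz[OF \<tau>], of "norm h"] by simp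
            finally show "norm (p (\<tau>, y) - p (\<tau>, x)) \<le> (1 + Cz) * norm h + M"
              using norm_diff by (simp add: algebra_simps)
          qed (use \<epsilon> in simp)
          finally have 1: "norm (g (p (\<tau>, y)) - g (p (\<tau>, x)) - Dg (\<tau>, x) (p (\<tau>, y) - p (\<tau>, x))) \<le>
              \<epsilon> * ((1 + Cz) * norm h + M)" .
          \<comment> \<open>The actual increment of the trajectory and its linear prediction differ
            by \<open>r \<tau>\<close> in the last component only. So \<open>\<Phi>\<close> is the
            Taylor remainder of \<open>g\<close> plus a term linear in \<open>r\<close>.\<close>
          have "Dg (\<tau>, x) (0, 0, r \<tau>) = Dg (\<tau>, x) (p (\<tau>, y) - p (\<tau>, x)) - Dg (\<tau>, x) (0, h, Z (\<tau>, x) h)"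
            unfolding linear_diff[OF Dg_linear(1)[OF C\<tau>(1)], symmetric] diff by (simp add: r_def)
          then have "\<Phi> \<tau> = (g (p (\<tau>, y)) - g (p (\<tau>, x)) - Dg (\<tau>, x) (p (\<tau>, y) - p (\<tau>, x))) + Dg (\<tau>, x) (0, 0, r \<tau>)"
            by (simp add: \<Phi>_def p_def)
          moreover have "norm (Dg (\<tau>, x) (0, 0, r \<tau>)) \<le> l * norm (r \<tau>)"
            using Y_bound[OF \<tau> xc, of "r \<tau>"] by (simp add: Dg_def p_def)
          moreover have "l * norm (r \<tau>) \<le> l * M"
            using M(2)[OF \<tau>] a(2) by (rule mult_left_mono)
          ultimately show "norm (\<Phi> \<tau>) \<le> \<epsilon> * ((1 + Cz) * norm h + M) + l * M"
            using 1 norm_triangle_le by (smt (verit))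
        qed
        moreover have "norm (s y - s x - frechet_derivative s (at x) h) \<le> \<epsilon> * norm h"
          using \<delta>2(2)[of y] y by (simp add: h_def)
        ultimately have "norm (r t') \<le> \<epsilon> * norm h + a * (\<epsilon> * ((1 + Cz) * norm h + M) + l * M)"
          by (metis norm_triangle_le add_mono)
        also have "\<dots> = \<epsilon> * (1 + a * (1 + Cz)) * norm h + (a * \<epsilon> + a * l) * M"
          by (simp add: algebra_simps)
        also have "\<dots> \<le> \<epsilon> * (1 + a * (1 + Cz)) * norm h + (1 / 2) * M"
          using \<epsilon>(2) a(3) M(1) by (intro add_left_mono mult_right_mono) auto
        finally show "norm (r t') \<le> \<epsilon> * (1 + a * (1 + Cz)) * norm h + M / 2"
          by simp
      qed
      also have "\<dots> = 2 * (\<epsilon> * (1 + a * (1 + Cz))) * norm h"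
        by simp
      also have "\<dots> \<le> e * norm h"
        using \<epsilon>(3) by (rule mult_right_mono) simp
      finally show "norm (Y (t, y) - Y (t, x) - Z (t, x) (y - x)) \<le> e * norm (y - x)"
        by (simp add: r_def h_def)
    qed
  qed
  have Dt: "((\<lambda>t. Y (t, x)) has_derivative (\<lambda>\<tau>. \<tau> *\<^sub>R g (t, x, Y (t, x)))) (at t)"
    if t: "\<bar>t\<bar> < a" and x: "x \<in> cball z \<rho>" for t x
  proof -
    have "((\<lambda>t. s x + oint (\<lambda>\<tau>. g (\<tau>, x, Y (\<tau>, x))) t) has_vector_derivative 0 + g (t, x, Y (t, x))) (at t)"
      using C_path[OF g_cont x] t
      by (intro has_vector_derivative_add has_vector_derivative_const oint_has_vector_derivative[of a])
        (simp_all add: p_def)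
    then have "((\<lambda>t. Y (t, x)) has_vector_derivative 0 + g (t, x, Y (t, x))) (at t)"
      by (rule has_vector_derivative_transform_within_open[of _ _ _ "{-a<..<a}"])
        (use Y_eq[OF _ x] t in auto)
    then show ?thesis
      by (simp add: has_vector_derivative_def)
  qed
  have der: "(Y has_derivative (\<lambda>q. fst q *\<^sub>R g (t, x, Y (t, x)) + Z (t, x) (snd q))) (at (t, x))"
    if t: "\<bar>t\<bar> < a" and x: "x \<in> ball z \<rho>" for t x
  proof -
    have gb: "blinfun_apply (blinfun_scaleR_left w) = (\<lambda>\<tau>. \<tau> *\<^sub>R w)" for w :: 'e
      by auto
    have mem: "(x, t) \<in> ball z \<rho> \<times> {-a<..<a}"
      using t x by auto
    \<comment> \<open>Total differentiability follows from both partial derivatives and continuity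
      of one of them, here the one in \<open>t\<close>, which is \<open>g\<close> along the
      trajectory. That variable has to come second, hence the exchanged order, undone by
      \<open>prod.swap\<close> below.\<close>
    have "((\<lambda>(x, t). Y (t, x)) has_derivative
        (\<lambda>(tx, ty). Z (t, x) tx + blinfun_scaleR_left (g (t, x, Y (t, x))) ty))
        (at (x, t) within ball z \<rho> \<times> {-a<..<a})"
    proof (rule has_derivative_partialsI[where f = "\<lambda>x t. Y (t, x)"
          and fy = "\<lambda>x t. blinfun_scaleR_left (g (t, x, Y (t, x)))"])
      show "((\<lambda>x. Y (t, x)) has_derivative blinfun_apply (Z (t, x))) (at x within ball z \<rho>)"
        by (rule has_derivative_at_withinI[OF Dx]) (use t x in auto)
      show "((\<lambda>t. Y (t, x)) has_derivative blinfun_apply (blinfun_scaleR_left (g (t, x, Y (t, x)))))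
          (at t within {-a<..<a})" if "x \<in> ball z \<rho>" "t \<in> {-a<..<a}" for x t
        unfolding gb by (rule has_derivative_at_withinI[OF Dt]) (use that in auto)
      have "continuous_on (ball z \<rho> \<times> {-a<..<a}) (\<lambda>w. g (p (snd w, fst w)))"
        by (rule continuous_on_compose2[OF g_cont]) (auto simp: C_iff intro!: continuous_intros)
      then have "continuous_on (ball z \<rho> \<times> {-a<..<a}) (\<lambda>(x, t). g (t, x, Y (t, x)))"
        by (simp add: p_def case_prod_unfold)
      then have "continuous_on (ball z \<rho> \<times> {-a<..<a}) (\<lambda>(x, t). blinfun_scaleR_left (g (t, x, Y (t, x))))"
        unfolding case_prod_unfold by (intro continuous_intros)
      then show "continuous (at (x, t) within ball z \<rho> \<times> {-a<..<a})
          (\<lambda>(x, t). blinfun_scaleR_left (g (t, x, Y (t, x))))"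
        using mem by (simp add: continuous_on_eq_continuous_within)
    qed (use t in auto)
    then have "((\<lambda>(x, t). Y (t, x)) has_derivative
        (\<lambda>(tx, ty). Z (t, x) tx + ty *\<^sub>R g (t, x, Y (t, x)))) (at (prod.swap (t, x)))"
      using at_within_open[OF mem open_Times[OF open_ball open_greaterThanLessThan]] by (simp add: gb)
    moreover have "(prod.swap has_derivative prod.swap) (at (t, x))"
      unfolding prod.swap_def by (auto intro!: derivative_eq_intros)
    ultimately have "((\<lambda>w. (\<lambda>(x, t). Y (t, x)) (prod.swap w)) has_derivative
        (\<lambda>w. (\<lambda>(tx, ty). Z (t, x) tx + ty *\<^sub>R g (t, x, Y (t, x))) (prod.swap w))) (at (t, x))"
      by (rule has_derivative_compose[rotated])
    then show ?thesis
      by (simp add: case_prod_unfold add.commute)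
  qed
  show thesis
    using that[OF Z(1) _ der] Z_eq by (simp add: Dg_def p_def)
qed

text \<open>Local form of the preceding result: compact sets are chosen inside the open domain, and
  \<open>Z\<close> is expressed by \<open>frechet_derivative\<close>, hence does not depend on that
  choice. In this form \<open>Z\<close> can be differentiated further.\<close>

lemma integral_equation_frechet_derivative:
  fixes g :: "real \<times> 'p::euclidean_space \<times> 'e::euclidean_space \<Rightarrow> 'e"
  assumes a: "0 < a" "0 \<le> l" "a * l \<le> 1 / 4"
    and g: "open \<Theta>" "Ck_on 1 \<Theta> g"
    and s: "open P" "Ck_on 1 P s"
    and Y: "continuous_on ({-a<..<a} \<times> P) Y"
    and Y_mem: "\<And>t x. \<bar>t\<bar> < a \<Longrightarrow> x \<in> P \<Longrightarrow> (t, x, Y (t, x)) \<in> \<Theta>"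
    and Y_bound: "\<And>t x v. \<bar>t\<bar> < a \<Longrightarrow> x \<in> P \<Longrightarrow>
      norm (frechet_derivative g (at (t, x, Y (t, x))) (0, 0, v)) \<le> l * norm v"
    and Y_eq: "\<And>t x. \<bar>t\<bar> < a \<Longrightarrow> x \<in> P \<Longrightarrow> Y (t, x) = s x + oint (\<lambda>\<tau>. g (\<tau>, x, Y (\<tau>, x))) t"
  defines "Z \<equiv> \<lambda>u q. frechet_derivative Y (at q) (0, u)"
  shows "continuous_on ({-a<..<a} \<times> P) (Z u)"
    and "\<And>t x. \<bar>t\<bar> < a \<Longrightarrow> x \<in> P \<Longrightarrow> Z u (t, x) = frechet_derivative s (at x) u +
       oint (\<lambda>\<tau>. frechet_derivative g (at (\<tau>, x, Y (\<tau>, x))) (0, u, Z u (\<tau>, x))) t"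
    and "\<And>t x. \<bar>t\<bar> < a \<Longrightarrow> x \<in> P \<Longrightarrow>
       (Y has_derivative (\<lambda>q. fst q *\<^sub>R g (t, x, Y (t, x)) + Z (snd q) (t, x))) (at (t, x))"
proof -
  have local: "\<exists>N W. open N \<and> (t, x) \<in> N \<and> continuous_on N W \<and> (\<forall>q\<in>N. Z u q = W q) \<and>
      Z u (t, x) = frechet_derivative s (at x) u +
        oint (\<lambda>\<tau>. frechet_derivative g (at (\<tau>, x, Y (\<tau>, x))) (0, u, Z u (\<tau>, x))) t \<and>
      (Y has_derivative (\<lambda>q. fst q *\<^sub>R g (t, x, Y (t, x)) + Z (snd q) (t, x))) (at (t, x))"
    if t: "\<bar>t\<bar> < a" and x: "x \<in> P" for t x u
  proof -
    obtain \<rho> where \<rho>: "\<rho> > 0" "cball x \<rho> \<subseteq> P"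
      using s(1) x open_contains_cball by blast
    \<comment> \<open>Midpoint of |t| and a: the time t is interior to the compact interval
      [-a', a'], on which the hypotheses hold.\<close>
    define a' where "a' = (\<bar>t\<bar> + a) / 2"
    have a': "0 < a'" "\<bar>t\<bar> < a'" "a' < a"
      using t a by (auto simp: a'_def)
    have "a' * l \<le> a * l"
      using a' a by (intro mult_right_mono) auto
    then have al: "a' * l \<le> 1 / 4"
      using a by simp
    have Yc: "continuous_on ({-a'..a'} \<times> cball x \<rho>) Y"
      using a' \<rho> by (intro continuous_on_subset[OF Y]) auto
    obtain V :: "real \<times> 'p \<Rightarrow> 'p \<Rightarrow>\<^sub>L 'e" where V: "continuous_on UNIV V"
      "\<And>t y u. \<bar>t\<bar> \<le> a' \<Longrightarrow> y \<in> cball x \<rho> \<Longrightarrow> V (t, y) u = frechet_derivative s (at y) u +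
         oint (\<lambda>\<tau>. frechet_derivative g (at (\<tau>, y, Y (\<tau>, y))) (0, u, V (\<tau>, y) u)) t"
      "\<And>t y. \<bar>t\<bar> < a' \<Longrightarrow> y \<in> ball x \<rho> \<Longrightarrow>
         (Y has_derivative (\<lambda>q. fst q *\<^sub>R g (t, y, Y (t, y)) + V (t, y) (snd q))) (at (t, y))"
    proof (rule integral_equation_has_derivative[OF a'(1) a(2) al g s \<rho> Yc])
      show "\<bar>t\<bar> \<le> a' \<Longrightarrow> y \<in> cball x \<rho> \<Longrightarrow> (t, y, Y (t, y)) \<in> \<Theta>" for t y
        using a' \<rho> by (intro Y_mem) auto
      show "\<bar>t\<bar> \<le> a' \<Longrightarrow> y \<in> cball x \<rho> \<Longrightarrow>
          norm (frechet_derivative g (at (t, y, Y (t, y))) (0, 0, v)) \<le> l * norm v" for t y v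
        using a' \<rho> by (intro Y_bound) auto
      show "\<bar>t\<bar> \<le> a' \<Longrightarrow> y \<in> cball x \<rho> \<Longrightarrow> Y (t, y) = s y + oint (\<lambda>\<tau>. g (\<tau>, y, Y (\<tau>, y))) t" for t y
        using a' \<rho> by (intro Y_eq) auto
    qed (rule that)
    have ZV: "Z u (t, y) = V (t, y) u" if "\<bar>t\<bar> < a'" "y \<in> ball x \<rho>" for t y u
      unfolding Z_def by (subst frechet_derivative_eqI[OF V(3)[OF that]]) simp
    show ?thesis
    proof (intro exI[of _ "{-a'<..<a'} \<times> ball x \<rho>"] exI[of _ "\<lambda>q. V q u"] conjI)
      show "open ({-a'<..<a'} \<times> ball x \<rho>)"
        by (intro open_Times open_ball open_greaterThanLessThan)
      show "(t, x) \<in> {-a'<..<a'} \<times> ball x \<rho>"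
        using a' \<rho> by auto
      show "continuous_on ({-a'<..<a'} \<times> ball x \<rho>) (\<lambda>q. V q u)"
        by (intro continuous_intros continuous_on_subset[OF V(1)]) auto
      show "\<forall>q\<in>{-a'<..<a'} \<times> ball x \<rho>. Z u q = V q u"
        using ZV by auto
      have "Z u (t, x) = V (t, x) u"
        using ZV a' \<rho> by simp
      also have "\<dots> = frechet_derivative s (at x) u +
         oint (\<lambda>\<tau>. frechet_derivative g (at (\<tau>, x, Y (\<tau>, x))) (0, u, V (\<tau>, x) u)) t"
        using a' \<rho> by (intro V(2)) auto
      also have "oint (\<lambda>\<tau>. frechet_derivative g (at (\<tau>, x, Y (\<tau>, x))) (0, u, V (\<tau>, x) u)) t =
          oint (\<lambda>\<tau>. frechet_derivative g (at (\<tau>, x, Y (\<tau>, x))) (0, u, Z u (\<tau>, x))) t"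
        using ZV a' \<rho> by (intro oint_cong) simp
      finally show "Z u (t, x) = frechet_derivative s (at x) u +
          oint (\<lambda>\<tau>. frechet_derivative g (at (\<tau>, x, Y (\<tau>, x))) (0, u, Z u (\<tau>, x))) t" .
      show "(Y has_derivative (\<lambda>q. fst q *\<^sub>R g (t, x, Y (t, x)) + Z (snd q) (t, x))) (at (t, x))"
        using V(3)[OF a'(2), of x] \<rho>(1) by (simp add: ZV[OF a'(2), of x])
    qed
  qed
  show "continuous_on ({-a<..<a} \<times> P) (Z u)"
  proof (rule continuous_at_imp_continuous_on, safe)
    fix t x
    assume tx: "t \<in> {-a<..<a}" "x \<in> P"
    then have "\<bar>t\<bar> < a"
      by auto
    from local[OF this tx(2), of u] obtain N W where N: "open N" "(t, x) \<in> N" "continuous_on N W" "\<forall>q\<in>N. Z u q = W q"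
      by blast
    then have "continuous_on N (Z u)"
      using continuous_on_cong[OF refl, of N "Z u" W] by simp
    then show "isCont (Z u) (t, x)"
      using N continuous_on_eq_continuous_at by blast
  qed
  show "Z u (t, x) = frechet_derivative s (at x) u +
       oint (\<lambda>\<tau>. frechet_derivative g (at (\<tau>, x, Y (\<tau>, x))) (0, u, Z u (\<tau>, x))) t"
    if "\<bar>t\<bar> < a" "x \<in> P" for t x
    using local[OF that, of u] by blast
  show "(Y has_derivative (\<lambda>q. fst q *\<^sub>R g (t, x, Y (t, x)) + Z (snd q) (t, x))) (at (t, x))"
    if "\<bar>t\<bar> < a" "x \<in> P" for t x
    using local[OF that] by blast
qed

lemma linear_basis_sum:
  fixes f :: "'a::euclidean_space \<Rightarrow> 'b::real_vector"
  assumes "linear f"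
  shows "f v = (\<Sum>b\<in>Basis. (v \<bullet> b) *\<^sub>R f b)"
proof -
  have "f (\<Sum>b\<in>Basis. (v \<bullet> b) *\<^sub>R b) = (\<Sum>b\<in>Basis. (v \<bullet> b) *\<^sub>R f b)"
    by (simp add: linear_sum[OF assms] linear_cmul[OF assms])
  then show ?thesis
    by (simp add: euclidean_representation)
qed

text \<open>Induction on k. The parameter derivative of a solution solves a linear equation with the
  same \<open>A\<close>; the new inhomogeneity contains derivatives of \<open>A\<close> and
  \<open>b\<close> and the solution itself, which is C^k by the induction hypothesis. The time
  derivative is read off from the equation.\<close>

lemma linear_integral_equation_Ck:
  fixes A :: "real \<times> 'p::euclidean_space \<Rightarrow> 'e::euclidean_space \<Rightarrow> 'e"
  assumes a: "0 < a" "0 \<le> l" "a * l \<le> 1 / 4" and P: "open P"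
    and A: "\<And>q. q \<in> {-a<..<a} \<times> P \<Longrightarrow> linear (A q)"
      "\<And>q v. q \<in> {-a<..<a} \<times> P \<Longrightarrow> norm (A q v) \<le> l * norm v"
    and "\<And>v. Ck_on k ({-a<..<a} \<times> P) (\<lambda>q. A q v)"
    and "Ck_on k ({-a<..<a} \<times> P) b" "Ck_on k P s"
    and "continuous_on ({-a<..<a} \<times> P) Y"
    and "\<And>t x. \<bar>t\<bar> < a \<Longrightarrow> x \<in> P \<Longrightarrow> Y (t, x) = s x + oint (\<lambda>\<tau>. A (\<tau>, x) (Y (\<tau>, x)) + b (\<tau>, x)) t"
  shows "Ck_on k ({-a<..<a} \<times> P) Y"
  using assms(7-)
proof (induction k arbitrary: b s Y)
  case 0
  then show ?case
    by simp
next
  case (Suc k)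
  let ?I = "{-a<..<a} \<times> P"
  have oI: "open ?I"
    using P by (intro open_Times) auto
  have lower: "Ck_on k ?I (\<lambda>q. A q v)" "Ck_on k ?I b" "Ck_on k P s" for v
    using Suc.prems Ck_on_Suc_imp by blast+
  have Yk: "Ck_on k ?I Y"
    by (rule Suc.IH[OF lower Suc.prems(4,5)])
  let ?\<Theta> = "{-a<..<a} \<times> P \<times> (UNIV :: 'e set)"
  let ?q = "\<lambda>w :: real \<times> 'p \<times> 'e. (fst w, fst (snd w))"
  \<comment> \<open>Written in components of the unknown, so that only the functions
    \<open>\<lambda>q. A q i\<close> for basis vectors \<open>i\<close> need to be
    differentiated.\<close>
  define g where "g = (\<lambda>w. (\<Sum>i\<in>Basis. (snd (snd w) \<bullet> i) *\<^sub>R A (?q w) i) + b (?q w))"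
  have o\<Theta>: "open ?\<Theta>"
    using P by (intro open_Times) auto
  have q_Ck: "Ck_on k ?\<Theta> ?q" for k
    by (rule Ck_on_bounded_linear)
      (intro bounded_linear_Pair bounded_linear_fst bounded_linear_compose[OF bounded_linear_fst bounded_linear_snd])
  have y_Ck: "Ck_on k ?\<Theta> (\<lambda>w. snd (snd w))" for k
    by (rule Ck_on_bounded_linear) (intro bounded_linear_compose[OF bounded_linear_snd bounded_linear_snd])
  have g_Ck: "Ck_on (Suc k) ?\<Theta> g"
    unfolding g_def
    using Suc.prems
    by (intro Ck_on_add Ck_on_sum Ck_on_scaleR Ck_on_inner y_Ck Ck_on_const o\<Theta>
        Ck_on_compose[OF o\<Theta> _ q_Ck, where T = ?I]) auto
  then have g1: "Ck_on 1 ?\<Theta> g"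
    by (rule Ck_on_le) simp
  have g_eq: "g (t, x, y) = A (t, x) y + b (t, x)" if "(t, x) \<in> ?I" for t x y
    using linear_basis_sum[OF A(1)[OF that], of y] by (simp add: g_def)
  define DA where "DA = (\<lambda>i q. frechet_derivative (\<lambda>q. A q i) (at q))"
  define Db where "Db = (\<lambda>q. frechet_derivative b (at q))"
  have g_der: "(g has_derivative (\<lambda>w. (\<Sum>i\<in>Basis. (y \<bullet> i) *\<^sub>R DA i (t, x) (?q w) + (snd (snd w) \<bullet> i) *\<^sub>R A (t, x) i)
      + Db (t, x) (?q w))) (at (t, x, y))" if tx: "(t, x) \<in> ?I" for t x y
  proof -
    have q: "(?q has_derivative ?q) (at (t, x, y))"
      by (auto intro!: derivative_eq_intros)
    have "((\<lambda>q. A q i) has_derivative DA i (t, x)) (at (?q (t, x, y)))" for i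
      unfolding DA_def using Ck_on_imp_has_derivative[OF Suc.prems(1) _ tx] by simp
    then have dA: "((\<lambda>w. A (?q w) i) has_derivative (\<lambda>w. DA i (t, x) (?q w))) (at (t, x, y))" for i
      by (rule has_derivative_compose[OF q])
    have "(b has_derivative Db (t, x)) (at (?q (t, x, y)))"
      unfolding Db_def using Ck_on_imp_has_derivative[OF Suc.prems(2) _ tx] by simp
    then have db: "((\<lambda>w. b (?q w)) has_derivative (\<lambda>w. Db (t, x) (?q w))) (at (t, x, y))"
      by (rule has_derivative_compose[OF q])
    have dy: "((\<lambda>w. snd (snd w) \<bullet> i) has_derivative (\<lambda>w. snd (snd w) \<bullet> i)) (at (t, x, y))" for i :: 'e
      by (auto intro!: derivative_eq_intros)
    have "(g has_derivative (\<lambda>w. (\<Sum>i\<in>Basis. (snd (snd (t, x, y)) \<bullet> i) *\<^sub>R DA i (t, x) (?q w) +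
        (snd (snd w) \<bullet> i) *\<^sub>R A (?q (t, x, y)) i) + Db (t, x) (?q w))) (at (t, x, y))"
      unfolding g_def
      by (intro has_derivative_add has_derivative_sum has_derivative_scaleR dA db dy)
    then show ?thesis
      by simp
  qed
  have abs_I: "(t, x) \<in> ?I" if "\<bar>t\<bar> < a" "x \<in> P" for t x
    using that by auto
  have Y_bound: "norm (frechet_derivative g (at (t, x, Y (t, x))) (0, 0, v)) \<le> l * norm v"
    if "\<bar>t\<bar> < a" "x \<in> P" for t x v
  proof -
    note tx = abs_I[OF that]
    have "DA i (t, x) 0 = 0" "Db (t, x) 0 = 0" for i
      using Ck_on_imp_has_derivative[OF Suc.prems(1) _ tx] Ck_on_imp_has_derivative[OF Suc.prems(2) _ tx]
      by (auto simp: DA_def Db_def intro: linear_0 has_derivative_linear)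
    then have "frechet_derivative g (at (t, x, Y (t, x))) (0, 0, v) = A (t, x) v"
      using linear_basis_sum[OF A(1)[OF tx], of v]
      by (simp add: frechet_derivative_eqI[OF g_der[OF tx]] flip: zero_prod_def)
    then show ?thesis
      using A(2)[OF tx] by simp
  qed
  define Z where "Z = (\<lambda>u q. frechet_derivative Y (at q) (0, u))"
  have Y_eq: "Y (t, x) = s x + oint (\<lambda>\<tau>. g (\<tau>, x, Y (\<tau>, x))) t" if "\<bar>t\<bar> < a" "x \<in> P" for t x
  proof -
    have "oint (\<lambda>\<tau>. g (\<tau>, x, Y (\<tau>, x))) t = oint (\<lambda>\<tau>. A (\<tau>, x) (Y (\<tau>, x)) + b (\<tau>, x)) t"
      by (rule oint_cong) (use that in \<open>auto intro!: g_eq\<close>)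
    then show ?thesis
      using Suc.prems(5)[OF that] by simp
  qed
  have s1: "Ck_on 1 P s"
    using Suc.prems(3) by (rule Ck_on_le) simp
  have mem: "(t, x, Y (t, x)) \<in> ?\<Theta>" if "\<bar>t\<bar> < a" "x \<in> P" for t x
    using that by auto
  note deriv_rules = integral_equation_frechet_derivative[OF a o\<Theta> g1 P s1 Suc.prems(4)]
  have deriv:
    "continuous_on ?I (Z u)"
    "\<bar>t\<bar> < a \<Longrightarrow> x \<in> P \<Longrightarrow> Z u (t, x) = frechet_derivative s (at x) u +
       oint (\<lambda>\<tau>. frechet_derivative g (at (\<tau>, x, Y (\<tau>, x))) (0, u, Z u (\<tau>, x))) t"
    "\<bar>t\<bar> < a \<Longrightarrow> x \<in> P \<Longrightarrow>
       (Y has_derivative (\<lambda>q. fst q *\<^sub>R g (t, x, Y (t, x)) + Z (snd q) (t, x))) (at (t, x))" for u t x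
    unfolding Z_def
    by (rule deriv_rules; (assumption | rule mem Y_bound Y_eq; assumption))+
  have Zk: "Ck_on k ?I (Z u)" for u
  proof (rule Suc.IH[OF lower(1)])
    \<comment> \<open>The terms of the differentiated right-hand side that do not contain the
      derivative of the unknown.\<close>
    define b' where "b' = (\<lambda>q. (\<Sum>i\<in>Basis. (Y q \<bullet> i) *\<^sub>R DA i q (0, u)) + Db q (0, u))"
    show "Ck_on k ?I b'"
      unfolding b'_def DA_def Db_def using Suc.prems
      by (intro Ck_on_add Ck_on_sum Ck_on_scaleR Ck_on_inner Yk Ck_on_const oI) auto
    show "Ck_on k P (\<lambda>x. frechet_derivative s (at x) u)"
      using Suc.prems by simp
    show "continuous_on ?I (Z u)"
      by (rule deriv(1))
    fix t x
    assume tx: "\<bar>t\<bar> < a" "x \<in> P"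
    have "frechet_derivative g (at (\<tau>, x, Y (\<tau>, x))) (0, u, Z u (\<tau>, x)) =
        A (\<tau>, x) (Z u (\<tau>, x)) + b' (\<tau>, x)" if "\<bar>\<tau>\<bar> < a" for \<tau>
    proof -
      note I = abs_I[OF that tx(2)]
      show ?thesis
        using linear_basis_sum[OF A(1)[OF I], of "Z u (\<tau>, x)"]
        by (simp add: frechet_derivative_eqI[OF g_der[OF I]] b'_def sum.distrib)
    qed
    then have "oint (\<lambda>\<tau>. frechet_derivative g (at (\<tau>, x, Y (\<tau>, x))) (0, u, Z u (\<tau>, x))) t =
        oint (\<lambda>\<tau>. A (\<tau>, x) (Z u (\<tau>, x)) + b' (\<tau>, x)) t"
      using tx by (intro oint_cong) simp
    then show "Z u (t, x) = frechet_derivative s (at x) u + oint (\<lambda>\<tau>. A (\<tau>, x) (Z u (\<tau>, x)) + b' (\<tau>, x)) t"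
      using deriv(2)[OF tx, of u] by simp
  qed
  show ?case
  proof (rule Ck_on_SucI[OF oI])
    fix q
    assume q: "q \<in> ?I"
    then obtain t x where "q = (t, x)" "\<bar>t\<bar> < a" "x \<in> P"
      by (auto simp: abs_less_iff)
    then show "(Y has_derivative (\<lambda>w. fst w *\<^sub>R (A q (Y q) + b q) + Z (snd w) q)) (at q)"
      using deriv(3)[of t x] g_eq q by simp
  next
    fix u :: "real \<times> 'p"
    have "Ck_on k ?I (\<lambda>q. (\<Sum>i\<in>Basis. (Y q \<bullet> i) *\<^sub>R A q i) + b q)"
      by (intro Ck_on_add Ck_on_sum Ck_on_scaleR Ck_on_inner Yk Ck_on_const oI lower)
    then have "Ck_on k ?I (\<lambda>q. A q (Y q) + b q)"
      using linear_basis_sum[OF A(1)] by (subst Ck_on_cong[OF oI, of _ "\<lambda>q. (\<Sum>i\<in>Basis. (Y q \<bullet> i) *\<^sub>R A q i) + b q"]) auto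
    then have "Ck_on k ?I (\<lambda>q. fst u *\<^sub>R (A q (Y q) + b q))"
      by (rule Ck_on_scaleR[OF oI Ck_on_const])
    then show "Ck_on k ?I (\<lambda>q. fst u *\<^sub>R (A q (Y q) + b q) + Z (snd u) q)"
      by (rule Ck_on_add[OF oI _ Zk])
  qed
qed

section \<open>The flow of a smooth vector field\<close>

text \<open>The sum of the norms of the partial derivatives is continuous, hence bounded on a
  compact set, and it dominates the operator norm.\<close>

lemma frechet_derivative_bound_compact:
  fixes f :: "'e::euclidean_space \<Rightarrow> 'b::real_normed_vector"
  assumes "Ck_on 1 \<Omega> f" "compact C" "C \<subseteq> \<Omega>"
  obtains l where "0 \<le> l" "\<And>y v. y \<in> C \<Longrightarrow> norm (frechet_derivative f (at y) v) \<le> l * norm v"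
proof -
  let ?h = "\<lambda>y. \<Sum>b\<in>Basis. norm (frechet_derivative f (at y) b)"
  have "continuous_on C ?h"
    using continuous_on_frechet_derivative[OF assms(1)] assms(3)
    by (intro continuous_intros) (rule continuous_on_subset)
  then have "bounded (?h ` C)"
    using assms(2) by (intro compact_imp_bounded compact_continuous_image)
  then obtain l where l: "\<And>y. y \<in> C \<Longrightarrow> norm (?h y) \<le> l"
    unfolding bounded_iff by blast
  show thesis
  proof (rule that[of "max l 0"])
    fix y v
    assume y: "y \<in> C"
    have d: "f differentiable (at y)"
      using assms y by (intro Ck_on_imp_differentiable[of 1 \<Omega>]) auto
    have "norm (frechet_derivative f (at y) v) \<le> (\<Sum>b\<in>Basis. norm ((v \<bullet> b) *\<^sub>R frechet_derivative f (at y) b))"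
      by (subst frechet_derivative_basis_sum[OF d]) (rule norm_sum)
    also have "\<dots> \<le> (\<Sum>b\<in>Basis. norm v * norm (frechet_derivative f (at y) b))"
      by (intro sum_mono) (auto intro!: mult_right_mono Basis_le_norm)
    also have "\<dots> = ?h y * norm v"
      by (simp add: sum_distrib_left mult.commute)
    also have "\<dots> \<le> max l 0 * norm v"
      using l[OF y] by (intro mult_right_mono) auto
    finally show "norm (frechet_derivative f (at y) v) \<le> max l 0 * norm v" .
  qed simp
qed

text \<open>\<open>s\<close> parametrizes the initial points, so the flow may start from any smooth
  family. \<open>f\<close> is composed with the projection onto a closed ball, where it is bounded
  and Lipschitz; for short times the solution does not leave the ball and the replacement is
  invisible. Smoothness is bootstrapped: if the solution \<open>Y\<close> is C^k, its parameter
  derivative solves a linear equation with C^k coefficient Df(Y), and \<open>Y\<close> is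
  C^(k+1).\<close>

lemma smooth_flow:
  fixes f :: "'e::euclidean_space \<Rightarrow> 'e" and s :: "'p::euclidean_space \<Rightarrow> 'e"
  assumes \<Omega>: "open \<Omega>" "\<And>k. Ck_on k \<Omega> f"
    and P: "open P" "\<And>k. Ck_on k P s" "z \<in> P" "s z \<in> \<Omega>"
  obtains a r :: real and \<psi> :: "real \<times> 'p \<Rightarrow> 'e" where "0 < a" "0 < r" "ball z r \<subseteq> P"
    "\<And>k. Ck_on k ({-a<..<a} \<times> ball z r) \<psi>"
    "\<And>t x. \<bar>t\<bar> < a \<Longrightarrow> x \<in> ball z r \<Longrightarrow> \<psi> (t, x) \<in> \<Omega>"
    "\<And>x. x \<in> ball z r \<Longrightarrow> \<psi> (0, x) = s x"
    "\<And>t x. \<bar>t\<bar> < a \<Longrightarrow> x \<in> ball z r \<Longrightarrow> frechet_derivative \<psi> (at (t, x)) (1, 0) = f (\<psi> (t, x))"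
proof -
  obtain R where R: "R > 0" "cball (s z) R \<subseteq> \<Omega>"
    using \<Omega>(1) P(4) open_contains_cball by blast
  let ?C = "cball (s z) R"
  define \<kappa> where "\<kappa> = closest_point ?C"
  have C_ne: "?C \<noteq> {}"
    using R by simp
  have \<kappa>: "\<kappa> y \<in> ?C" "y \<in> ?C \<Longrightarrow> \<kappa> y = y" "norm (\<kappa> y - \<kappa> y') \<le> norm (y - y')" for y y'
    unfolding \<kappa>_def using C_ne closest_point_lipschitz[OF convex_cball closed_cball C_ne, of y y']
    by (auto simp: dist_norm simp del: mem_cball intro: closest_point_in_set closest_point_self)
  have f1: "Ck_on 1 \<Omega> f"
    by (rule \<Omega>(2))
  obtain l where l: "0 \<le> l" "\<And>y v. y \<in> ?C \<Longrightarrow> norm (frechet_derivative f (at y) v) \<le> l * norm v"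
    by (rule frechet_derivative_bound_compact[OF f1 compact_cball R(2)]) (rule that)
  have f_lip: "norm (f y - f y') \<le> l * norm (y - y')" if "y \<in> ?C" "y' \<in> ?C" for y y'
  proof (rule differentiable_bound[OF convex_cball _ _ that])
    show "(f has_derivative frechet_derivative f (at x)) (at x within ?C)" if "x \<in> ?C" for x
      by (rule has_derivative_at_withinI[OF Ck_on_imp_has_derivative[OF f1]]) (use that R in auto)
    show "onorm (frechet_derivative f (at x)) \<le> l" if "x \<in> ?C" for x
      using l that by (intro onorm_bound) (auto simp: mult.commute)
  qed
  have f_cont: "continuous_on ?C f"
    using Ck_on_imp_continuous_on[OF f1] R(2) by (rule continuous_on_subset)
  have "bounded (f ` ?C)"
    by (intro compact_imp_bounded compact_continuous_image f_cont compact_cball)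
  then obtain B0 where B0: "\<And>y. y \<in> ?C \<Longrightarrow> norm (f y) \<le> B0"
    unfolding bounded_iff by blast
  define B where "B = max B0 0"
  have B: "0 \<le> B" "\<And>y. y \<in> ?C \<Longrightarrow> norm (f y) \<le> B"
    using order_trans[OF B0 max.cobounded1] by (auto simp: B_def)
  have s_cont: "continuous_on P s"
    using P(2)[of 0] by simp
  then have "open (P \<inter> s -` ball (s z) (R / 2))"
    using P(1) by (intro continuous_open_preimage) auto
  moreover have "z \<in> P \<inter> s -` ball (s z) (R / 2)"
    using P R by simp
  ultimately obtain r where r: "r > 0" "cball z r \<subseteq> P \<inter> s -` ball (s z) (R / 2)"
    by (meson open_contains_cball)
  define \<kappa>' where "\<kappa>' = closest_point (cball z r)"
  have z_ne: "cball z r \<noteq> {}"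
    using r by simp
  have \<kappa>': "continuous_on UNIV \<kappa>'" "\<kappa>' x \<in> cball z r" "x \<in> cball z r \<Longrightarrow> \<kappa>' x = x" for x
    unfolding \<kappa>'_def using z_ne
    by (auto intro!: continuous_on_closest_point closest_point_in_set closest_point_self simp del: mem_cball)
  have s_ball: "norm (s x - s z) \<le> R / 2" if "x \<in> cball z r" for x
    using r(2) that by (auto simp: dist_norm norm_minus_commute subset_iff)
  \<comment> \<open>The first bound makes the integral operator a contraction. The second keeps the
    solution within R of \<open>s z\<close>: R/2 is spent on the spread of the initial points and
    R/2 on the motion. The summands 1 avoid division by zero.\<close>
  define a where "a = min (1 / (4 * (l + 1))) (R / (2 * (B + 1)))"
  have a: "0 < a" "a * l \<le> 1 / 4" "a * B \<le> R / 2"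
  proof -
    show "0 < a"
      using l B R by (auto simp: a_def)
    have "a * l \<le> 1 / (4 * (l + 1)) * (l + 1)"
      using l by (intro mult_mono) (auto simp: a_def)
    also have "\<dots> = 1 / 4"
      unfolding times_divide_eq_left by (rule mult_divide_mult_cancel_right) (use l in simp)
    finally show "a * l \<le> 1 / 4" .
    have "a * B \<le> R / (2 * (B + 1)) * (B + 1)"
      using B R by (intro mult_mono) (auto simp: a_def)
    also have "\<dots> = R / 2"
      unfolding times_divide_eq_left by (rule mult_divide_mult_cancel_right) (use B in simp)
    finally show "a * B \<le> R / 2" .
  qed
  obtain Y where Y: "continuous_on UNIV Y"
    "\<And>t x. \<bar>t\<bar> \<le> a \<Longrightarrow> Y (t, x) = s (\<kappa>' x) + oint (\<lambda>\<tau>. f (\<kappa> (Y (\<tau>, x)))) t"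
  proof (rule picard_exists[of a l "\<lambda>q y. f (\<kappa> y)" B "\<lambda>x. s (\<kappa>' x)" "norm (s z) + R / 2"])
    have "continuous_on UNIV (\<lambda>y. f (\<kappa> y))"
      unfolding \<kappa>_def using C_ne \<kappa>(1)
      by (intro continuous_on_compose2[OF f_cont] continuous_on_closest_point) (auto simp: \<kappa>_def)
    from continuous_on_compose2[OF this, of UNIV snd]
    show "continuous_on UNIV (\<lambda>(q :: real \<times> 'p, y). f (\<kappa> y))"
      by (simp add: case_prod_unfold continuous_on_snd)
    show "norm (f (\<kappa> y) - f (\<kappa> y')) \<le> l * norm (y - y')" for y y'
      using f_lip[OF \<kappa>(1,1), of y y'] mult_left_mono[OF \<kappa>(3)[of y y'] l(1)] by simp
    show "norm (f (\<kappa> 0)) \<le> B"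
      by (rule B(2)[OF \<kappa>(1)])
    show "continuous_on UNIV (\<lambda>x. s (\<kappa>' x))"
      using \<kappa>' r(2) by (intro continuous_on_compose2[OF s_cont]) blast+
    show "norm (s (\<kappa>' x)) \<le> norm (s z) + R / 2" for x
      using s_ball[OF \<kappa>'(2)[of x]] norm_triangle_sub[of "s (\<kappa>' x)" "s z"] by simp
  qed (use a l in auto)
  have fY_cont: "continuous_on S (\<lambda>\<tau>. f (\<kappa> (Y (\<tau>, x))))" for S x
  proof -
    have "continuous_on S (\<lambda>\<tau>. Y (\<tau>, x))"
      by (rule continuous_on_compose2[OF Y(1)]) (auto intro: continuous_intros)
    then have "continuous_on S (\<lambda>\<tau>. \<kappa> (Y (\<tau>, x)))"
      unfolding \<kappa>_def using C_ne
      by (intro continuous_on_compose2[OF continuous_on_closest_point[OF convex_cball closed_cball C_ne, of UNIV]]) auto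
    then show ?thesis
      using \<kappa>(1) by (intro continuous_on_compose2[OF f_cont]) auto
  qed
  have Y_mem: "Y (t, x) \<in> ?C" if "\<bar>t\<bar> \<le> a" for t x
  proof -
    have "norm (oint (\<lambda>\<tau>. f (\<kappa> (Y (\<tau>, x)))) t) \<le> a * B"
      by (rule norm_oint_le[OF fY_cont that B(2)[OF \<kappa>(1)] B(1)])
    then have "norm ((s (\<kappa>' x) - s z) + oint (\<lambda>\<tau>. f (\<kappa> (Y (\<tau>, x)))) t) \<le> R / 2 + R / 2"
      using s_ball[OF \<kappa>'(2)[of x]] a(3) by (intro norm_triangle_le add_mono) auto
    then have "norm (Y (t, x) - s z) \<le> R"
      unfolding Y(2)[OF that] by (simp add: algebra_simps)
    then show ?thesis
      by (simp add: dist_norm norm_minus_commute)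
  qed
  have Y_eq: "Y (t, x) = s x + oint (\<lambda>\<tau>. f (Y (\<tau>, x))) t" if "\<bar>t\<bar> < a" "x \<in> ball z r" for t x
  proof -
    have "oint (\<lambda>\<tau>. f (\<kappa> (Y (\<tau>, x)))) t = oint (\<lambda>\<tau>. f (Y (\<tau>, x))) t"
      using that \<kappa>(2)[OF Y_mem] by (intro oint_cong) simp
    moreover have "\<kappa>' x = x"
      using that by (intro \<kappa>') auto
    ultimately show ?thesis
      using Y(2)[of t x] that by simp
  qed
  let ?I = "{-a<..<a} \<times> ball z r"
  have oI: "open ?I"
    by (intro open_Times open_ball open_greaterThanLessThan)
  have Y_I: "Y q \<in> ?C" "Y q \<in> \<Omega>" if "q \<in> ?I" for q
    using that Y_mem[of "fst q" "snd q"] R(2) by (auto simp: abs_le_iff)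
  let ?\<Theta> = "(UNIV :: real set) \<times> (UNIV :: 'p set) \<times> \<Omega>"
  \<comment> \<open>The autonomous field in the general form of the preceding lemmas; time and
    parameter enter trivially.\<close>
  define g where "g = (\<lambda>w :: real \<times> 'p \<times> 'e. f (snd (snd w)))"
  have o\<Theta>: "open ?\<Theta>"
    using \<Omega>(1) by (intro open_Times) auto
  have bl: "bounded_linear (\<lambda>w :: real \<times> 'p \<times> 'e. snd (snd w))"
    by (intro bounded_linear_compose[OF bounded_linear_snd bounded_linear_snd])
  have g1: "Ck_on 1 ?\<Theta> g"
    unfolding g_def by (rule Ck_on_compose[OF o\<Theta> f1 Ck_on_bounded_linear[OF bl]]) auto
  have g_der: "frechet_derivative g (at (t, x, y)) w = frechet_derivative f (at y) (snd (snd w))"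
    if "y \<in> \<Omega>" for t x y w
  proof -
    have "(f has_derivative frechet_derivative f (at y)) (at (snd (snd (t, x, y))))"
      using Ck_on_imp_has_derivative[OF f1 _ that] by simp
    from has_derivative_compose[OF bounded_linear_imp_has_derivative[OF bl] this]
    have "(g has_derivative (\<lambda>w. frechet_derivative f (at y) (snd (snd w)))) (at (t, x, y))"
      unfolding g_def .
    then show ?thesis
      by (simp add: frechet_derivative_eqI)
  qed
  have s1: "Ck_on k (ball z r) s" for k
    by (rule Ck_on_subset[OF P(2)]) (use r in auto)
  have Yc: "continuous_on ?I Y"
    by (rule continuous_on_subset[OF Y(1)]) auto
  define Z where "Z = (\<lambda>u q. frechet_derivative Y (at q) (0, u))"
  have g_mem: "(t, x, Y (t, x)) \<in> ?\<Theta>" if "\<bar>t\<bar> < a" "x \<in> ball z r" for t x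
    using Y_mem[of t x] that R(2) by auto
  have g_bound: "norm (frechet_derivative g (at (t, x, Y (t, x))) (0, 0, v)) \<le> l * norm v"
    if "\<bar>t\<bar> < a" "x \<in> ball z r" for t x v
    using l(2)[OF Y_I(1), of "(t, x)" v] that Y_I(2)[of "(t, x)"] by (simp add: g_der abs_less_iff)
  have g_eq: "Y (t, x) = s x + oint (\<lambda>\<tau>. g (\<tau>, x, Y (\<tau>, x))) t" if "\<bar>t\<bar> < a" "x \<in> ball z r" for t x
    using Y_eq[OF that] by (simp add: g_def)
  note deriv_rules = integral_equation_frechet_derivative[OF a(1) l(1) a(2) o\<Theta> g1 open_ball s1 Yc]
  have deriv:
    "continuous_on ?I (Z u)"
    "\<bar>t\<bar> < a \<Longrightarrow> x \<in> ball z r \<Longrightarrow> Z u (t, x) = frechet_derivative s (at x) u +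
       oint (\<lambda>\<tau>. frechet_derivative g (at (\<tau>, x, Y (\<tau>, x))) (0, u, Z u (\<tau>, x))) t"
    "\<bar>t\<bar> < a \<Longrightarrow> x \<in> ball z r \<Longrightarrow>
       (Y has_derivative (\<lambda>q. fst q *\<^sub>R g (t, x, Y (t, x)) + Z (snd q) (t, x))) (at (t, x))" for u t x
    unfolding Z_def
    by (rule deriv_rules; (assumption | rule g_mem g_bound g_eq; assumption))+
  have Z_eq: "Z u (t, x) = frechet_derivative s (at x) u +
      oint (\<lambda>\<tau>. frechet_derivative f (at (Y (\<tau>, x))) (Z u (\<tau>, x)) + 0) t"
    if tx: "\<bar>t\<bar> < a" "x \<in> ball z r" for t x u
  proof -
    have "frechet_derivative g (at (\<tau>, x, Y (\<tau>, x))) (0, u, Z u (\<tau>, x)) =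
        frechet_derivative f (at (Y (\<tau>, x))) (Z u (\<tau>, x)) + 0" if "\<bar>\<tau>\<bar> \<le> \<bar>t\<bar>" for \<tau>
    proof -
      have "\<bar>\<tau>\<bar> < a"
        using that tx by linarith
      then show ?thesis
        using Y_I(2)[of "(\<tau>, x)"] tx by (simp add: g_der abs_less_iff)
    qed
    then show ?thesis
      unfolding deriv(2)[OF tx, of u] by (intro arg_cong2[of _ _ _ _ "(+)"] refl oint_cong)
  qed
  have Y_der: "(Y has_derivative (\<lambda>w. fst w *\<^sub>R f (Y q) + Z (snd w) q)) (at q)" if "q \<in> ?I" for q
    using deriv(3)[of "fst q" "snd q"] that by (auto simp: g_def abs_less_iff)
  have Yk: "Ck_on k ?I Y" for k
  proof (induction k)
    case 0
    then show ?case
      using Yc by simp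
  next
    case (Suc k)
    \<comment> \<open>A homogeneous linear equation along the solution; its coefficient Df(Y) is C^k
      because \<open>Y\<close> is.\<close>
    have "Ck_on k ?I (Z u)" for u
    proof (rule linear_integral_equation_Ck[where A = "\<lambda>q. frechet_derivative f (at (Y q))" and b = "\<lambda>q. 0"
          and s = "\<lambda>x. frechet_derivative s (at x) u", OF a(1) l(1) a(2) open_ball])
      show "linear (frechet_derivative f (at (Y q)))" if "q \<in> ?I" for q
        using Ck_on_imp_has_derivative[OF f1 _ Y_I(2)[OF that]] has_derivative_linear by auto
      show "norm (frechet_derivative f (at (Y q)) v) \<le> l * norm v" if "q \<in> ?I" for q v
        by (rule l(2)[OF Y_I(1)[OF that]])
      show "Ck_on k ?I (\<lambda>q. frechet_derivative f (at (Y q)) v)" for v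
        by (rule Ck_on_frechet_derivative[OF oI \<Omega>(2) Suc Ck_on_const Y_I(2)])
      show "Ck_on k (ball z r) (\<lambda>x. frechet_derivative s (at x) u)"
        using s1[of "Suc k"] by simp
    qed (use deriv(1) Z_eq Ck_on_const in auto)
    then have D: "Ck_on k ?I (\<lambda>q. fst u *\<^sub>R f (Y q) + Z (snd u) q)" for u
      by (intro Ck_on_add[OF oI] Ck_on_scaleR[OF oI Ck_on_const] Ck_on_compose[OF oI \<Omega>(2) Suc Y_I(2)])
    show ?case
      by (rule Ck_on_SucI[OF oI Y_der D])
  qed
  show thesis
  proof (rule that[of a r Y])
    show "0 < a" "0 < r"
      using a(1) r(1) by auto
    show "Ck_on k ?I Y" for k
      by (rule Yk)
    show "ball z r \<subseteq> P"
      using r(2) by auto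
    show "Y (t, x) \<in> \<Omega>" if "\<bar>t\<bar> < a" "x \<in> ball z r" for t x
      using Y_mem[of t x] that R(2) by auto
    show "Y (0, x) = s x" if "x \<in> ball z r" for x
      using Y_eq[of 0 x] that a(1) by simp
    show "frechet_derivative Y (at (t, x)) (1, 0) = f (Y (t, x))" if tx: "\<bar>t\<bar> < a" "x \<in> ball z r" for t x
    proof -
      have I: "(t, x) \<in> ?I"
        using tx by auto
      have "linear (frechet_derivative Y (at (t, x)))"
        using has_derivative_linear[OF Y_der[OF I]] by (simp only: frechet_derivative_eqI[OF Y_der[OF I]])
      then have "Z 0 (t, x) = 0"
        by (simp add: Z_def linear_0 flip: zero_prod_def)
      then show ?thesis
        by (simp add: frechet_derivative_eqI[OF Y_der[OF I]])
    qed
  qed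
qed

section \<open>Smooth local inverses\<close>

text \<open>A product rule in which the second factor is merely continuous, because the first one
  vanishes at the point. It allows the inverse of a linear map to be differentiated when only its
  continuity is known.\<close>

lemma has_derivative_scaleR_vanishing:
  fixes \<phi> :: "'a::real_normed_vector \<Rightarrow> real" and c :: "'a \<Rightarrow> 'b::real_normed_vector"
  assumes \<phi>: "(\<phi> has_derivative \<phi>') (at x)" "\<phi> x = 0" and c: "isCont c x"
  shows "((\<lambda>y. \<phi> y *\<^sub>R c y) has_derivative (\<lambda>h. \<phi>' h *\<^sub>R c x)) (at x)"
  unfolding has_derivative_at_alt
proof (intro conjI allI impI)
  show "bounded_linear (\<lambda>h. \<phi>' h *\<^sub>R c x)"
    using \<phi>(1) has_derivative_bounded_linear bounded_linear_scaleR_const by blast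
  fix e :: real
  assume e: "e > 0"
  obtain B where B: "B > 0" "\<And>h. norm (\<phi>' h) \<le> norm h * B"
    using has_derivative_bounded_linear[OF \<phi>(1)] bounded_linear.pos_bounded by blast
  define \<epsilon> where "\<epsilon> = e / 2 / (norm (c x) + 1)"
  have \<epsilon>: "\<epsilon> > 0" "\<epsilon> * norm (c x) \<le> e / 2"
  proof -
    have p: "0 < norm (c x) + 1"
      by (simp add: add_nonneg_pos)
    then show "\<epsilon> > 0"
      using e by (simp add: \<epsilon>_def)
    have "\<epsilon> * norm (c x) \<le> \<epsilon> * (norm (c x) + 1)"
      using \<open>\<epsilon> > 0\<close> by (intro mult_left_mono) auto
    also have "\<dots> = e / 2"
      unfolding \<epsilon>_def by (rule nonzero_eq_divide_eq[THEN iffD1, OF _ refl]) (use p in simp)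
    finally show "\<epsilon> * norm (c x) \<le> e / 2" .
  qed
  obtain d1 where d1: "d1 > 0" "\<And>y. norm (y - x) < d1 \<Longrightarrow> norm (\<phi> y - \<phi> x - \<phi>' (y - x)) \<le> min 1 \<epsilon> * norm (y - x)"
  proof -
    have "min 1 \<epsilon> > 0"
      using \<epsilon> by simp
    then show thesis
      using \<phi>(1) that unfolding has_derivative_at_alt by blast
  qed
  have "e / 2 / (B + 1) > 0"
    using e B by simp
  then obtain d2 where d2: "d2 > 0" "\<And>y. dist y x < d2 \<Longrightarrow> dist (c y) (c x) < e / 2 / (B + 1)"
    using c unfolding continuous_at_eps_delta by blast
  show "\<exists>d>0. \<forall>y. norm (y - x) < d \<longrightarrow>
      norm (\<phi> y *\<^sub>R c y - \<phi> x *\<^sub>R c x - \<phi>' (y - x) *\<^sub>R c x) \<le> e * norm (y - x)"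
  proof (intro exI[of _ "min d1 d2"] conjI allI impI)
    show "min d1 d2 > 0"
      using d1 d2 by simp
    fix y
    assume y: "norm (y - x) < min d1 d2"
    have 1: "norm (\<phi> y - \<phi>' (y - x)) \<le> min 1 \<epsilon> * norm (y - x)"
      using d1(2)[of y] y \<phi>(2) by simp
    also have "\<dots> \<le> 1 * norm (y - x)"
      by (intro mult_right_mono) auto
    finally have "norm (\<phi> y) \<le> (B + 1) * norm (y - x)"
      using B(2)[of "y - x"] norm_triangle_sub[of "\<phi> y" "\<phi>' (y - x)"] by (simp add: algebra_simps)
    then have 2: "norm (\<phi> y) * norm (c y - c x) \<le> ((B + 1) * norm (y - x)) * (e / 2 / (B + 1))"
      using d2(2)[of y] y B(1) by (intro mult_mono) (auto simp: dist_norm)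
    have "e / 2 / (B + 1) * (B + 1) = e / 2"
      by (rule nonzero_eq_divide_eq[THEN iffD1, OF _ refl]) (use B(1) in simp)
    then have 3: "((B + 1) * norm (y - x)) * (e / 2 / (B + 1)) = e / 2 * norm (y - x)"
      by (metis mult.assoc mult.commute)
    have "norm (\<phi> y - \<phi>' (y - x)) * norm (c x) \<le> (\<epsilon> * norm (y - x)) * norm (c x)"
    proof (rule mult_right_mono)
      show "norm (\<phi> y - \<phi>' (y - x)) \<le> \<epsilon> * norm (y - x)"
        by (rule order_trans[OF 1]) (intro mult_right_mono, auto)
    qed simp
    also have "\<dots> \<le> e / 2 * norm (y - x)"
      using mult_right_mono[OF \<epsilon>(2), of "norm (y - x)"] by (simp add: mult_ac)
    finally have 4: "norm (\<phi> y - \<phi>' (y - x)) * norm (c x) \<le> e / 2 * norm (y - x)" .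
    have "\<phi> y *\<^sub>R c y - \<phi> x *\<^sub>R c x - \<phi>' (y - x) *\<^sub>R c x =
        \<phi> y *\<^sub>R (c y - c x) + (\<phi> y - \<phi>' (y - x)) *\<^sub>R c x"
      using \<phi>(2) by (simp add: scaleR_diff_left scaleR_diff_right)
    then have "norm (\<phi> y *\<^sub>R c y - \<phi> x *\<^sub>R c x - \<phi>' (y - x) *\<^sub>R c x) \<le>
        norm (\<phi> y) * norm (c y - c x) + norm (\<phi> y - \<phi>' (y - x)) * norm (c x)"
      using norm_triangle_ineq[of "\<phi> y *\<^sub>R (c y - c x)" "(\<phi> y - \<phi>' (y - x)) *\<^sub>R c x"] by simp
    also have "\<dots> \<le> e / 2 * norm (y - x) + e / 2 * norm (y - x)"
      using 2 4 unfolding 3 by (rule add_mono)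
    finally show "norm (\<phi> y *\<^sub>R c y - \<phi> x *\<^sub>R c x - \<phi>' (y - x) *\<^sub>R c x) \<le> e * norm (y - x)"
      by simp
  qed
qed

text \<open>A lower bound |A(x) v| \<ge> m |v| persists nearby with m/2. With B the pointwise
  inverse, A(y)(B(y)u - B(x)u) = (A(x) - A(y)) B(x)u then controls B(y)u - B(x)u.\<close>

lemma continuous_on_linear_inverse:
  fixes A :: "'a::metric_space \<Rightarrow> 'e::euclidean_space \<Rightarrow> 'e"
  assumes "open S" and A: "\<And>x. x \<in> S \<Longrightarrow> linear (A x)" "\<And>x. x \<in> S \<Longrightarrow> bij (A x)"
    and A_cont: "\<And>v. continuous_on S (\<lambda>x. A x v)"
  shows "continuous_on S (\<lambda>x. inv (A x) u)"
proof (rule continuous_at_imp_continuous_on, rule ballI)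
  fix x
  assume x: "x \<in> S"
  obtain m where m: "m > 0" "\<And>v. m * norm v \<le> norm (A x v)"
    using linear_inj_bounded_below_pos[OF A(1)[OF x] bij_is_inj[OF A(2)[OF x]]] by metis
  have A_at: "((\<lambda>y. A y v) \<longlongrightarrow> A x v) (at x)" for v
    using A_cont[of v] x \<open>open S\<close> by (simp add: continuous_on_eq_continuous_at isCont_def)
  have "((\<lambda>y. \<Sum>b\<in>Basis. norm (A y b - A x b)) \<longlongrightarrow> (\<Sum>b\<in>(Basis :: 'e set). norm (A x b - A x b))) (at x)"
    by (intro tendsto_intros A_at)
  then have "\<forall>\<^sub>F y in at x. (\<Sum>b\<in>Basis. norm (A y b - A x b)) < m / 2"
    using m(1) by (intro order_tendstoD(2)) auto
  moreover have "\<forall>\<^sub>F y in at x. y \<in> S"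
    using x \<open>open S\<close> by (intro eventually_at_in_open') auto
  ultimately have ev: "\<forall>\<^sub>F y in at x. norm (inv (A y) u - inv (A x) u) \<le> 2 / m * norm (A x (inv (A x) u) - A y (inv (A x) u))"
  proof eventually_elim
    fix y
    assume small: "(\<Sum>b\<in>Basis. norm (A y b - A x b)) < m / 2" and y: "y \<in> S"
    have low: "m / 2 * norm v \<le> norm (A y v)" for v
    proof -
      have "linear (\<lambda>v. A y v - A x v)"
        using A(1)[OF x] A(1)[OF y] by (rule linear_compose_sub[rotated])
      from linear_basis_sum[OF this, of v]
      have "norm (A y v - A x v) \<le> (\<Sum>b\<in>Basis. norm ((v \<bullet> b) *\<^sub>R (A y b - A x b)))"
        by (simp only: norm_sum)
      also have "\<dots> \<le> (\<Sum>b\<in>Basis. norm v * norm (A y b - A x b))"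
        by (intro sum_mono) (auto intro!: mult_right_mono Basis_le_norm)
      also have "\<dots> = norm v * (\<Sum>b\<in>Basis. norm (A y b - A x b))"
        by (simp add: sum_distrib_left)
      also have "\<dots> \<le> norm v * (m / 2)"
        using small by (intro mult_left_mono) auto
      finally have "norm (A y v - A x v) \<le> norm v * (m / 2)" .
      moreover have "norm (A x v) \<le> norm (A y v) + norm (A y v - A x v)"
        using norm_triangle_sub[of "A x v" "A y v"] by (simp add: norm_minus_commute)
      ultimately show ?thesis
        using m(2)[of v] by (simp add: algebra_simps)
    qed
    have "A y (inv (A y) u - inv (A x) u) = A x (inv (A x) u) - A y (inv (A x) u)"
      using A x y by (simp add: linear_diff surj_f_inv_f bij_is_surj)
    then have "m / 2 * norm (inv (A y) u - inv (A x) u) \<le> norm (A x (inv (A x) u) - A y (inv (A x) u))"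
      using low[of "inv (A y) u - inv (A x) u"] by simp
    then show "norm (inv (A y) u - inv (A x) u) \<le> 2 / m * norm (A x (inv (A x) u) - A y (inv (A x) u))"
      using m(1) by (simp add: field_simps)
  qed
  have "((\<lambda>y. 2 / m * norm (A x (inv (A x) u) - A y (inv (A x) u))) \<longlongrightarrow>
      2 / m * norm (A x (inv (A x) u) - A x (inv (A x) u))) (at x)"
    by (intro tendsto_intros A_at)
  then have "((\<lambda>y. 2 / m * norm (A x (inv (A x) u) - A y (inv (A x) u))) \<longlongrightarrow> 0) (at x)"
    by simp
  from Lim_null_comparison[OF ev this] have "((\<lambda>y. inv (A y) u) \<longlongrightarrow> inv (A x) u) (at x)"
    by (simp add: Lim_null[symmetric])
  then show "isCont (\<lambda>x. inv (A x) u) x"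
    by (simp add: isCont_def)
qed

text \<open>From B(y)u = B(x)u - B(y)(A(y) - A(x))B(x)u the derivative at \<open>x\<close> comes out
  as -B (DA) B u: the difference A(y) - A(x) vanishes at y = x, so continuity of B is enough. The
  formula involves B again, which closes the induction.\<close>

lemma Ck_on_linear_inverse:
  fixes A :: "'a::euclidean_space \<Rightarrow> 'e::euclidean_space \<Rightarrow> 'e"
  assumes "open S" and A: "\<And>x. x \<in> S \<Longrightarrow> linear (A x)" "\<And>x. x \<in> S \<Longrightarrow> bij (A x)"
    and A_Ck: "\<And>v. Ck_on k S (\<lambda>x. A x v)"
  shows "Ck_on k S (\<lambda>x. inv (A x) u)"
  using A_Ck
proof (induction k arbitrary: u)
  case 0
  then show ?case
    using continuous_on_linear_inverse[OF assms(1) A] by simp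
next
  case (Suc k)
  define B where "B = (\<lambda>x. inv (A x))"
  have B: "A x (B x v) = v" "B x (A x v) = v" if "x \<in> S" for x v
    unfolding B_def using A(2)[OF that] by (auto simp: surj_f_inv_f bij_is_surj bij_is_inj)
  have B_lin: "linear (B x)" if "x \<in> S" for x
    unfolding B_def by (rule inj_linear_imp_inv_linear[OF A(1)[OF that] bij_is_inj[OF A(2)[OF that]]])
  define DA where "DA = (\<lambda>i x. frechet_derivative (\<lambda>x. A x i) (at x))"
  have Bk: "Ck_on k S (\<lambda>x. B x v)" for v
    unfolding B_def by (rule Suc.IH) (rule Ck_on_Suc_imp[OF Suc.prems])
  define D where "D = (\<lambda>x h. - (\<Sum>b\<in>Basis. ((\<Sum>i\<in>Basis. (B x u \<bullet> i) *\<^sub>R DA i x h) \<bullet> b) *\<^sub>R B x b))"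
  have der: "((\<lambda>x. B x u) has_derivative D x) (at x)" if x: "x \<in> S" for x
  proof -
    \<comment> \<open>Component \<open>b\<close> of (A(y) - A(x)) B(x)u, a scalar function vanishing
      at y = x.\<close>
    define \<phi> where "\<phi> = (\<lambda>b y. \<Sum>i\<in>Basis. (B x u \<bullet> i) *\<^sub>R ((A y i - A x i) \<bullet> b))"
    have dA: "((\<lambda>y. A y i) has_derivative DA i x) (at x)" for i
      unfolding DA_def by (rule Ck_on_imp_has_derivative[OF Suc.prems _ x]) simp
    have "((\<lambda>y. (A y i - A x i) \<bullet> b) has_derivative (\<lambda>h. DA i x h \<bullet> b)) (at x)" for i b
    proof -
      have "((\<lambda>y. A y i - A x i) has_derivative (\<lambda>h. DA i x h - 0)) (at x)"
        by (rule has_derivative_diff[OF dA has_derivative_const])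
      from has_derivative_inner_left[OF this, of b] show ?thesis
        by simp
    qed
    then have "(\<phi> b has_derivative (\<lambda>h. \<Sum>i\<in>Basis. (B x u \<bullet> i) *\<^sub>R (DA i x h \<bullet> b))) (at x)" for b
      unfolding \<phi>_def by (rule has_derivative_sum[OF has_derivative_scaleR_right])
    then have "((\<lambda>y. \<phi> b y *\<^sub>R B y b) has_derivative (\<lambda>h. (\<Sum>i\<in>Basis. (B x u \<bullet> i) *\<^sub>R (DA i x h \<bullet> b)) *\<^sub>R B x b)) (at x)" for b
      using Ck_on_imp_continuous_on[OF Bk[of b]] x \<open>open S\<close>
      by (intro has_derivative_scaleR_vanishing) (auto simp: \<phi>_def continuous_on_eq_continuous_at)
    then have "((\<lambda>y. \<Sum>b\<in>Basis. \<phi> b y *\<^sub>R B y b) has_derivative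
        (\<lambda>h. \<Sum>b\<in>Basis. (\<Sum>i\<in>Basis. (B x u \<bullet> i) *\<^sub>R (DA i x h \<bullet> b)) *\<^sub>R B x b)) (at x)"
      by (rule has_derivative_sum)
    then have "((\<lambda>y. B x u - (\<Sum>b\<in>Basis. \<phi> b y *\<^sub>R B y b)) has_derivative
        (\<lambda>h. 0 - (\<Sum>b\<in>Basis. (\<Sum>i\<in>Basis. (B x u \<bullet> i) *\<^sub>R (DA i x h \<bullet> b)) *\<^sub>R B x b))) (at x)"
      by (rule has_derivative_diff[OF has_derivative_const])
    moreover have "B x u - (\<Sum>b\<in>Basis. \<phi> b y *\<^sub>R B y b) = B y u" if y: "y \<in> S" for y
    proof -
      have "(\<Sum>b\<in>Basis. \<phi> b y *\<^sub>R B y b) = (\<Sum>b\<in>Basis. ((A y (B x u) - A x (B x u)) \<bullet> b) *\<^sub>R B y b)"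
        unfolding \<phi>_def linear_basis_sum[OF A(1)[OF y], of "B x u"] linear_basis_sum[OF A(1)[OF x], of "B x u"]
        by (simp add: inner_diff_left inner_sum_left sum_subtractf right_diff_distrib)
      also have "\<dots> = B y (A y (B x u) - A x (B x u))"
        by (rule linear_basis_sum[OF B_lin[OF y], symmetric])
      also have "\<dots> = B x u - B y u"
        using B[OF x] B[OF y] by (simp add: linear_diff[OF B_lin[OF y]])
      finally show ?thesis
        by simp
    qed
    ultimately have "((\<lambda>y. B y u) has_derivative
        (\<lambda>h. 0 - (\<Sum>b\<in>Basis. (\<Sum>i\<in>Basis. (B x u \<bullet> i) *\<^sub>R (DA i x h \<bullet> b)) *\<^sub>R B x b))) (at x)"
      by (rule has_derivative_transform_within_open[OF _ \<open>open S\<close> x])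
    then show ?thesis
      by (simp add: D_def inner_sum_left)
  qed
  have D_Ck: "Ck_on k S (\<lambda>x. D x h)" for h
    unfolding D_def DA_def
    using Suc.prems
    by (intro Ck_on_minus Ck_on_sum Ck_on_scaleR Ck_on_inner Ck_on_const Bk \<open>open S\<close>) auto
  have "Ck_on (Suc k) S (\<lambda>x. B x u)"
    by (rule Ck_on_SucI[OF \<open>open S\<close> der D_Ck])
  then show ?case
    unfolding B_def .
qed

text \<open>The C^1 theorem provides \<open>g\<close>, whose derivative is the inverse of Df(g y).
  If \<open>g\<close> is C^k, so is this derivative, and \<open>g\<close> is C^(k+1).\<close>

theorem smooth_inverse_function:
  fixes f :: "'e::euclidean_space \<Rightarrow> 'e"
  assumes "open U" and f: "\<And>k. Ck_on k U f" and "x0 \<in> U" and inj: "inj (frechet_derivative f (at x0))"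
  obtains U' V g where "open U'" "U' \<subseteq> U" "x0 \<in> U'" "open V" "homeomorphism U' V f g"
    "\<And>k. Ck_on k V g" "\<And>x. x \<in> U' \<Longrightarrow> bij (frechet_derivative f (at x))"
proof -
  define f' where "f' = (\<lambda>x. Blinfun (frechet_derivative f (at x)))"
  have der: "(f has_derivative frechet_derivative f (at x)) (at x)" if "x \<in> U" for x
    by (rule Ck_on_imp_has_derivative[OF f _ that, of 1]) simp
  have f': "blinfun_apply (f' x) = frechet_derivative f (at x)" if "x \<in> U" for x
    unfolding f'_def by (intro bounded_linear_Blinfun_apply has_derivative_bounded_linear[OF der[OF that]])
  have derf: "(f has_derivative blinfun_apply (f' x)) (at x)" if "x \<in> U" for x
    using der that f' by simp
  have contf: "continuous_on U f'"
  proof (rule continuous_on_blinfun_componentwise)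
    fix i :: 'e
    have "continuous_on U (\<lambda>x. frechet_derivative f (at x) i)"
      by (rule continuous_on_frechet_derivative[OF f])
    then show "continuous_on U (\<lambda>x. blinfun_apply (f' x) i)"
      by (subst continuous_on_cong[OF refl, where g = "\<lambda>x. frechet_derivative f (at x) i"]) (simp_all add: f')
  qed
  have lin: "linear (frechet_derivative f (at x))" if "x \<in> U" for x
    by (rule has_derivative_linear[OF der[OF that]])
  obtain h where h: "linear h" "h \<circ> frechet_derivative f (at x0) = id"
    using linear_injective_left_inverse[OF lin[OF assms(3)] inj] by blast
  have inv: "Blinfun h o\<^sub>L f' x0 = id_blinfun"
    using h by (intro blinfun_eqI)
      (auto simp: f'[OF assms(3)] bounded_linear_Blinfun_apply linear_conv_bounded_linear[symmetric] fun_eq_iff)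
  obtain U' V g g' where 1: "open U'" "U' \<subseteq> U" "x0 \<in> U'" "open V" "f x0 \<in> V" "homeomorphism U' V f g"
      and g: "\<And>y. y \<in> V \<Longrightarrow> (g has_derivative (g' y)) (at y)"
      "\<And>y. y \<in> V \<Longrightarrow> g' y = inv (blinfun_apply (f'(g y)))"
      "\<And>y. y \<in> V \<Longrightarrow> bij (blinfun_apply (f'(g y)))"
    by (rule inverse_function_theorem[OF assms(1) derf contf assms(3) inv]) (assumption | rule that)+
  have gV: "g y \<in> U" if "y \<in> V" for y
    using that 1(2,6) by (auto simp: homeomorphism_def)
  have g_der: "(g has_derivative inv (frechet_derivative f (at (g y)))) (at y)" if "y \<in> V" for y
    using g(1)[OF that] g(2)[OF that] f'[OF gV[OF that]] by simp
  have bij: "bij (frechet_derivative f (at (g y)))" if "y \<in> V" for y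
    using g(3)[OF that] f'[OF gV[OF that]] by simp
  have gk: "Ck_on k V g" for k
  proof (induction k)
    case 0
    then show ?case
      using 1(6) by (simp add: homeomorphism_def)
  next
    case (Suc k)
    have "Ck_on k V (\<lambda>y. inv (frechet_derivative f (at (g y))) u)" for u
      by (rule Ck_on_linear_inverse[OF 1(4) lin[OF gV] bij Ck_on_frechet_derivative[OF 1(4) f Suc Ck_on_const gV]])
    then show ?case
      using Ck_on_SucI[OF 1(4) g_der] by blast
  qed
  have "bij (frechet_derivative f (at x))" if "x \<in> U'" for x
  proof -
    have "f x \<in> V" "g (f x) = x"
      using 1(6) that by (auto simp: homeomorphism_def)
    then show ?thesis
      using bij[of "f x"] by simp
  qed
  then show thesis
    by (rule that[OF 1(1-4,6) gk])
qed

lemma Ck_on_transfer: "open S \<Longrightarrow> Ck_on k S f \<Longrightarrow> (\<And>x. x \<in> S \<Longrightarrow> f x = g x) \<Longrightarrow> Ck_on k S g"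
  using Ck_on_cong[of S f g k] by simp

section \<open>Charts and tangent vectors\<close>

lemma chart_inj: "smooth_atlas M \<Longrightarrow> c \<in> M \<Longrightarrow> inj_on (snd c) (fst c)"
  by (simp add: smooth_atlas_def)

lemma chart_inv_left: "smooth_atlas M \<Longrightarrow> c \<in> M \<Longrightarrow> p \<in> fst c \<Longrightarrow> chart_inv c (snd c p) = p"
  unfolding chart_inv_def by (simp add: chart_inj inv_into_f_f)

lemma chart_inv_mem: "x \<in> snd c ` fst c \<Longrightarrow> chart_inv c x \<in> fst c"
  unfolding chart_inv_def by (rule inv_into_into)

lemma chart_inv_right: "x \<in> snd c ` fst c \<Longrightarrow> snd c (chart_inv c x) = x"
  unfolding chart_inv_def by (rule f_inv_into_f)

lemma chart_transition:
  assumes "smooth_atlas M" "c \<in> M" "d \<in> M"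
  shows "open (snd c ` (fst c \<inter> fst d))" "Ck_on k (snd c ` (fst c \<inter> fst d)) (snd d \<circ> chart_inv c)"
  using assms by (auto simp: smooth_atlas_def)

lemma open_chart_range: "smooth_atlas M \<Longrightarrow> c \<in> M \<Longrightarrow> open (snd c ` fst c)"
  using chart_transition(1)[of M c c] by simp

lemma chart_image_Int:
  assumes "smooth_atlas M" "c \<in> M"
  shows "snd c ` (W \<inter> fst c) = {x \<in> snd c ` fst c. chart_inv c x \<in> W}"
  using chart_inv_left[OF assms] by force

lemma mem_mfd_space: "c \<in> M \<Longrightarrow> p \<in> fst c \<Longrightarrow> p \<in> mfd_space M"
  by (auto simp: mfd_space_def)

lemma chart_at_props:
  assumes "p \<in> mfd_space M"
  shows "chart_at M p \<in> M" "p \<in> fst (chart_at M p)"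
proof -
  have "\<exists>c. c \<in> M \<and> p \<in> fst c"
    using assms by (auto simp: mfd_space_def)
  from someI_ex[OF this] show "chart_at M p \<in> M" "p \<in> fst (chart_at M p)"
    by (simp_all add: chart_at_def)
qed

lemma open_chart_image:
  "smooth_atlas M \<Longrightarrow> c \<in> M \<Longrightarrow> openin (mfd_top M) W \<Longrightarrow> open (snd c ` (W \<inter> fst c))"
  by (simp add: openin_mfd_top)

text \<open>Openness has to be tested in every chart \<open>d\<close>; there the set is the preimage
  of \<open>V\<close> under the transition map.\<close>

lemma openin_chart_preimage:
  assumes "smooth_atlas M" "c \<in> M" "open V" "V \<subseteq> snd c ` fst c"
  shows "openin (mfd_top M) (chart_inv c ` V)"
  unfolding openin_mfd_top[OF assms(1)]
proof (intro conjI ballI)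
  show "chart_inv c ` V \<subseteq> mfd_space M"
    using mem_mfd_space[OF assms(2)] chart_inv_mem[of _ c] assms(4) by blast
  fix d
  assume d: "d \<in> M"
  let ?S = "snd d ` (fst d \<inter> fst c)"
  have "snd d ` (chart_inv c ` V \<inter> fst d) = ?S \<inter> (snd c \<circ> chart_inv d) -` V"
  proof (intro equalityI subsetI)
    fix y
    assume "y \<in> snd d ` (chart_inv c ` V \<inter> fst d)"
    then obtain x where x: "x \<in> V" "chart_inv c x \<in> fst d" "y = snd d (chart_inv c x)"
      by auto
    then show "y \<in> ?S \<inter> (snd c \<circ> chart_inv d) -` V"
      using assms(4) chart_inv_mem[of x c] chart_inv_right[of x c] chart_inv_left[OF assms(1) d] by auto
  next
    fix y
    assume "y \<in> ?S \<inter> (snd c \<circ> chart_inv d) -` V"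
    then obtain p where "p \<in> fst d" "p \<in> fst c" "y = snd d p" "snd c p \<in> V"
      using chart_inv_left[OF assms(1) d] by auto
    then show "y \<in> snd d ` (chart_inv c ` V \<inter> fst d)"
      using chart_inv_left[OF assms(1,2)] by (auto intro!: imageI image_eqI[of p _ "snd c p"])
  qed
  moreover have "open (?S \<inter> (snd c \<circ> chart_inv d) -` V)"
    using chart_transition(1)[OF assms(1) d assms(2)] chart_transition(2)[OF assms(1) d assms(2), of 0] assms(3)
    by (intro continuous_open_preimage) auto
  ultimately show "open (snd d ` (chart_inv c ` V \<inter> fst d))"
    by simp
qed

lemma openin_chart_domain: "smooth_atlas M \<Longrightarrow> c \<in> M \<Longrightarrow> openin (mfd_top M) (fst c)"
proof -
  assume M: "smooth_atlas M" "c \<in> M"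
  have "chart_inv c ` snd c ` fst c = fst c"
    using chart_inv_left[OF M] by force
  then show ?thesis
    using openin_chart_preimage[OF M open_chart_range[OF M]] by simp
qed

text \<open>Inverse of the coordinate isomorphism \<open>\<lambda>v. v c\<close> from the tangent
  space at \<open>p\<close> to the model space.\<close>

definition tvec ::
  "('a, 'e::euclidean_space) chart set \<Rightarrow> 'a \<Rightarrow> ('a, 'e) chart \<Rightarrow> 'e \<Rightarrow> ('a, 'e) tvec" where
  "tvec M p c y =
     (\<lambda>d. if d \<in> M \<and> p \<in> fst d then frechet_derivative (snd d \<circ> chart_inv c) (at (snd c p)) y else 0)"

lemma chart_transition_has_derivative:
  assumes "smooth_atlas M" "c \<in> M" "d \<in> M" "p \<in> fst c" "p \<in> fst d"
  shows "((snd d \<circ> chart_inv c) has_derivative frechet_derivative (snd d \<circ> chart_inv c) (at (snd c p)))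
    (at (snd c p))"
  by (rule Ck_on_imp_has_derivative[OF chart_transition(2)[OF assms(1-3), of 1]]) (use assms(4,5) in auto)

text \<open>Chain rule through the transition map; it is behind every statement that a differential
  does not depend on the chart.\<close>

lemma frechet_derivative_chart_change:
  assumes "smooth_atlas M" "c \<in> M" "d \<in> M" "p \<in> fst c" "p \<in> fst d"
    and f: "(f \<circ> chart_inv d) differentiable (at (snd d p))"
  shows "((f \<circ> chart_inv c) has_derivative
    (\<lambda>y. frechet_derivative (f \<circ> chart_inv d) (at (snd d p)) (frechet_derivative (snd d \<circ> chart_inv c) (at (snd c p)) y)))
    (at (snd c p))"
proof -
  have eq: "(snd d \<circ> chart_inv c) (snd c p) = snd d p"
    using assms chart_inv_left[OF assms(1,2)] by simp
  have "((\<lambda>x. (f \<circ> chart_inv d) ((snd d \<circ> chart_inv c) x)) has_derivative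
    (\<lambda>y. frechet_derivative (f \<circ> chart_inv d) (at (snd d p)) (frechet_derivative (snd d \<circ> chart_inv c) (at (snd c p)) y)))
    (at (snd c p))"
    by (rule has_derivative_compose[OF chart_transition_has_derivative[OF assms(1-5)]])
      (use f in \<open>simp only: eq frechet_derivative_works\<close>)
  then show ?thesis
  proof (rule has_derivative_transform_within_open[OF _ chart_transition(1)[OF assms(1-3)]])
    show "(f \<circ> chart_inv d) ((snd d \<circ> chart_inv c) x) = (f \<circ> chart_inv c) x"
      if "x \<in> snd c ` (fst c \<inter> fst d)" for x
      using that chart_inv_left[OF assms(1,2)] chart_inv_left[OF assms(1,3)] by auto
  qed (use assms in auto)
qed

lemma frechet_derivative_transition_self:
  assumes "smooth_atlas M" "c \<in> M" "p \<in> fst c"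
  shows "frechet_derivative (snd c \<circ> chart_inv c) (at (snd c p)) y = y"
proof -
  have "((\<lambda>x. x) has_derivative (\<lambda>y. y)) (at (snd c p))"
    by (rule has_derivative_ident)
  then have "((snd c \<circ> chart_inv c) has_derivative (\<lambda>y. y)) (at (snd c p))"
    by (rule has_derivative_transform_within_open[OF _ open_chart_range[OF assms(1,2)]])
      (use assms(3) chart_inv_right[of _ c] in auto)
  then show ?thesis
    by (simp add: frechet_derivative_eqI)
qed

lemma tangent_space_transform:
  "v \<in> tangent_space M p \<Longrightarrow> c \<in> M \<Longrightarrow> d \<in> M \<Longrightarrow> p \<in> fst c \<Longrightarrow> p \<in> fst d \<Longrightarrow>
    v d = frechet_derivative (snd d \<circ> chart_inv c) (at (snd c p)) (v c)"
  unfolding tangent_space_def by blast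

lemma tangent_space_outside: "v \<in> tangent_space M p \<Longrightarrow> \<not> (c \<in> M \<and> p \<in> fst c) \<Longrightarrow> v c = 0"
  unfolding tangent_space_def by blast

lemma tangent_spaceI:
  assumes "\<And>c. \<not> (c \<in> M \<and> p \<in> fst c) \<Longrightarrow> v c = 0"
    "\<And>c d. c \<in> M \<Longrightarrow> d \<in> M \<Longrightarrow> p \<in> fst c \<Longrightarrow> p \<in> fst d \<Longrightarrow>
      v d = frechet_derivative (snd d \<circ> chart_inv c) (at (snd c p)) (v c)"
  shows "v \<in> tangent_space M p"
  unfolding tangent_space_def using assms by blast

text \<open>The transformation rule for the family of components is the chain rule for transition
  maps.\<close>

lemma tvec_in_tangent_space:
  assumes "smooth_atlas M" "c \<in> M" "p \<in> fst c"
  shows "tvec M p c y \<in> tangent_space M p"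
proof -
  have *: "frechet_derivative (snd e \<circ> chart_inv c) (at (snd c p)) y =
      frechet_derivative (snd e \<circ> chart_inv d) (at (snd d p)) (frechet_derivative (snd d \<circ> chart_inv c) (at (snd c p)) y)"
    if "d \<in> M" "e \<in> M" "p \<in> fst d" "p \<in> fst e" for d e
  proof -
    have "(snd e \<circ> chart_inv d) differentiable (at (snd d p))"
      using chart_transition_has_derivative[OF assms(1) that] by (rule differentiableI)
    from frechet_derivative_chart_change[OF assms(1,2) that(1) assms(3) that(3) this] show ?thesis
      by (simp add: frechet_derivative_eqI)
  qed
  show ?thesis
  proof (rule tangent_spaceI)
    fix d e
    assume "d \<in> M" "e \<in> M" "p \<in> fst d" "p \<in> fst e"
    then show "tvec M p c y e = frechet_derivative (snd e \<circ> chart_inv d) (at (snd d p)) (tvec M p c y d)"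
      using *[of d e] unfolding tvec_def by simp
  qed (auto simp: tvec_def)
qed

lemma tvec_component:
  "smooth_atlas M \<Longrightarrow> c \<in> M \<Longrightarrow> p \<in> fst c \<Longrightarrow> tvec M p c y c = y"
  by (simp add: tvec_def frechet_derivative_transition_self)

lemma tvec_eq:
  assumes "v \<in> tangent_space M p" "c \<in> M" "p \<in> fst c"
  shows "tvec M p c (v c) = v"
proof
  fix d
  show "tvec M p c (v c) d = v d"
    using tangent_space_transform[OF assms(1,2) _ assms(3), of d] tangent_space_outside[OF assms(1), of d]
    unfolding tvec_def by metis
qed

lemma tangent_space_eqI:
  "v \<in> tangent_space M p \<Longrightarrow> w \<in> tangent_space M p \<Longrightarrow> c \<in> M \<Longrightarrow> p \<in> fst c \<Longrightarrow> v c = w c \<Longrightarrow> v = w"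
  by (metis tvec_eq)

lemma tangent_space_lincomb:
  assumes M: "smooth_atlas M" and v: "v \<in> tangent_space M p" and w: "w \<in> tangent_space M p"
  shows "a *\<^sub>R v + b *\<^sub>R w \<in> tangent_space M p"
proof -
  have *: "(a *\<^sub>R v + b *\<^sub>R w) d = frechet_derivative (snd d \<circ> chart_inv c) (at (snd c p)) ((a *\<^sub>R v + b *\<^sub>R w) c)"
    if "c \<in> M" "d \<in> M" "p \<in> fst c" "p \<in> fst d" for c d
  proof -
    have "linear (frechet_derivative (snd d \<circ> chart_inv c) (at (snd c p)))"
      using chart_transition_has_derivative[OF M that] by (rule has_derivative_linear)
    moreover have "v d = frechet_derivative (snd d \<circ> chart_inv c) (at (snd c p)) (v c)"
      "w d = frechet_derivative (snd d \<circ> chart_inv c) (at (snd c p)) (w c)"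
      using tangent_space_transform[OF v that] tangent_space_transform[OF w that] .
    ultimately show ?thesis
      by (simp only: plus_fun_apply scaleR_fun_def linear_add linear_cmul)
  qed
  show ?thesis
  proof (rule tangent_spaceI)
    show "(a *\<^sub>R v + b *\<^sub>R w) c = 0" if "\<not> (c \<in> M \<and> p \<in> fst c)" for c
      using tangent_space_outside[OF v that] tangent_space_outside[OF w that] by (simp add: scaleR_fun_def)
  qed (rule *)
qed

lemma tangent_space_0:
  fixes M :: "('a, 'b::euclidean_space) chart set"
  shows "smooth_atlas M \<Longrightarrow> 0 \<in> tangent_space M p"
proof (rule tangent_spaceI)
  fix c d
  assume "smooth_atlas M" "c \<in> M" "d \<in> M" "p \<in> fst c" "p \<in> fst d"
  from linear_0[OF has_derivative_linear[OF chart_transition_has_derivative[OF this]]]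
  show "(0 :: ('a, 'b) tvec) d = frechet_derivative (snd d \<circ> chart_inv c) (at (snd c p)) ((0 :: ('a, 'b) tvec) c)"
    by simp
qed simp

lemma tangent_space_add: "smooth_atlas M \<Longrightarrow> v \<in> tangent_space M p \<Longrightarrow> w \<in> tangent_space M p \<Longrightarrow> v + w \<in> tangent_space M p"
  and tangent_space_scaleR: "smooth_atlas M \<Longrightarrow> v \<in> tangent_space M p \<Longrightarrow> a *\<^sub>R v \<in> tangent_space M p"
  and tangent_space_minus: "smooth_atlas M \<Longrightarrow> v \<in> tangent_space M p \<Longrightarrow> - v \<in> tangent_space M p"
  using tangent_space_lincomb[of M v p w 1 1]
    tangent_space_lincomb[of M v p v a 0] tangent_space_lincomb[of M v p v "-1" 0]
  by auto

lemma subspace_tangent_space: "smooth_atlas M \<Longrightarrow> subspace (tangent_space M p)"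
  by (simp add: subspace_def tangent_space_0 tangent_space_add tangent_space_scaleR)

lemma scaleR_fun_apply [simp]: "(r *\<^sub>R f) x = r *\<^sub>R f x"
  by (simp add: scaleR_fun_def)

lemma tvec_linear:
  assumes "smooth_atlas M" "c \<in> M" "p \<in> fst c"
  shows "tvec M p c (a *\<^sub>R y + b *\<^sub>R y') = a *\<^sub>R tvec M p c y + b *\<^sub>R tvec M p c y'"
  by (rule tangent_space_eqI[OF _ _ assms(2,3)])
    (simp_all add: tvec_in_tangent_space tvec_component tangent_space_lincomb assms)

lemma tvec_0: "smooth_atlas M \<Longrightarrow> c \<in> M \<Longrightarrow> p \<in> fst c \<Longrightarrow> tvec M p c 0 = 0"
  using tvec_linear[of M c p 0 0 0 0] by simp

section \<open>Natural coordinates on the tangent bundle\<close>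

lemma fst_tb_chart: "fst (tb_chart M c) = Sigma (fst c) (tangent_space M)"
  and snd_tb_chart: "snd (tb_chart M c) (p, v) = (snd c p, v c)"
  by (auto simp: tb_chart_def)

lemma tb_chart_inj:
  assumes "smooth_atlas M" "c \<in> M"
  shows "inj_on (snd (tb_chart M c)) (fst (tb_chart M c))"
proof (rule inj_onI, clarsimp simp: fst_tb_chart snd_tb_chart)
  fix p v q w
  assume *: "p \<in> fst c" "v \<in> tangent_space M p" "q \<in> fst c" "w \<in> tangent_space M q" "snd c p = snd c q" "v c = w c"
  then have "p = q"
    using chart_inj[OF assms] by (auto dest: inj_onD)
  then show "p = q \<and> v = w"
    using tangent_space_eqI * assms by metis
qed

lemma chart_inv_tb_chart:
  assumes "smooth_atlas M" "c \<in> M" "x \<in> snd c ` fst c"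
  shows "chart_inv (tb_chart M c) (x, y) = (chart_inv c x, tvec M (chart_inv c x) c y)"
proof -
  have mem: "chart_inv c x \<in> fst c"
    using assms(3) by (rule chart_inv_mem)
  let ?q = "(chart_inv c x, tvec M (chart_inv c x) c y)"
  have "?q \<in> fst (tb_chart M c)" "snd (tb_chart M c) ?q = (x, y)"
    using mem assms by (auto simp: fst_tb_chart snd_tb_chart tvec_in_tangent_space tvec_component chart_inv_right)
  then show ?thesis
    unfolding chart_inv_def[of "tb_chart M c"] using inv_into_f_f[OF tb_chart_inj[OF assms(1,2)]] by metis
qed

lemma chart_inv_tb_chart_left:
  assumes "smooth_atlas M" "c \<in> M" "p \<in> fst c" "v \<in> tangent_space M p"
  shows "chart_inv (tb_chart M c) (snd c p, v c) = (p, v)"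
  using assms by (simp add: chart_inv_tb_chart chart_inv_left tvec_eq)

lemma tb_chart_image:
  assumes "smooth_atlas M" "c \<in> M"
  shows "snd (tb_chart M c) ` (W \<inter> fst (tb_chart M c)) =
    {(x, y). x \<in> snd c ` fst c \<and> (chart_inv c x, tvec M (chart_inv c x) c y) \<in> W}"
proof (intro equalityI subsetI)
  fix z
  assume "z \<in> snd (tb_chart M c) ` (W \<inter> fst (tb_chart M c))"
  then obtain p v where "(p, v) \<in> W" "p \<in> fst c" "v \<in> tangent_space M p" "z = (snd c p, v c)"
    by (auto simp: fst_tb_chart snd_tb_chart)
  then show "z \<in> {(x, y). x \<in> snd c ` fst c \<and> (chart_inv c x, tvec M (chart_inv c x) c y) \<in> W}"
    using assms by (simp add: chart_inv_left tvec_eq)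
next
  fix z
  assume "z \<in> {(x, y). x \<in> snd c ` fst c \<and> (chart_inv c x, tvec M (chart_inv c x) c y) \<in> W}"
  then obtain x y where z: "z = (x, y)" "x \<in> snd c ` fst c" "(chart_inv c x, tvec M (chart_inv c x) c y) \<in> W"
    by auto
  then have "snd (tb_chart M c) (chart_inv c x, tvec M (chart_inv c x) c y) = z"
    "(chart_inv c x, tvec M (chart_inv c x) c y) \<in> fst (tb_chart M c)"
    using assms chart_inv_mem[OF z(2)]
    by (auto simp: fst_tb_chart snd_tb_chart tvec_in_tangent_space tvec_component chart_inv_right)
  then show "z \<in> snd (tb_chart M c) ` (W \<inter> fst (tb_chart M c))"
    using z(3) by (metis IntI imageI)
qed

lemma tb_chart_image_bundle:
  assumes "smooth_atlas M" "c \<in> M"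
  shows "snd (tb_chart M c) ` (tangent_bundle M \<inter> fst (tb_chart M c)) = (snd c ` fst c) \<times> UNIV"
  unfolding tb_chart_image[OF assms] tangent_bundle_def
  using assms chart_inv_mem[of _ c] mem_mfd_space[OF assms(2)] by (auto intro: tvec_in_tangent_space)

lemma mfd_space_tb_atlas: "mfd_space (tb_atlas M) = tangent_bundle M"
  by (auto simp: mfd_space_def tb_atlas_def fst_tb_chart tangent_bundle_def)

text \<open>With t a transition map of the base, the transition map of the bundle sends (x, y) to (t
  x, Dt(x) y), so its smoothness is that of t and Dt.\<close>

lemma smooth_atlas_tb_atlas:
  assumes "smooth_atlas M"
  shows "smooth_atlas (tb_atlas M)"
  unfolding smooth_atlas_def tb_atlas_def ball_simps
proof (intro conjI ballI)
  show "inj_on (snd (tb_chart M c)) (fst (tb_chart M c))" if "c \<in> M" for c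
    by (rule tb_chart_inj[OF assms that])
  fix c d
  assume cd: "c \<in> M" "d \<in> M"
  let ?O = "snd c ` (fst c \<inter> fst d)"
  have im: "snd (tb_chart M c) ` (fst (tb_chart M c) \<inter> fst (tb_chart M d)) = ?O \<times> UNIV"
  proof -
    have "snd (tb_chart M c) ` (fst (tb_chart M d) \<inter> fst (tb_chart M c)) =
        {x \<in> snd c ` fst c. chart_inv c x \<in> fst d} \<times> UNIV"
      unfolding tb_chart_image[OF assms cd(1)]
      using assms cd chart_inv_mem[of _ c] by (auto simp: fst_tb_chart intro: tvec_in_tangent_space)
    then show ?thesis
      using chart_image_Int[OF assms cd(1), of "fst d"] by (simp add: Int_commute)
  qed
  have O: "open (?O \<times> (UNIV :: 'b set))"
    using chart_transition(1)[OF assms cd] by (intro open_Times) auto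
  show "open (snd (tb_chart M c) ` (fst (tb_chart M c) \<inter> fst (tb_chart M d)))"
    unfolding im by (rule O)
  show "\<forall>k. Ck_on k (snd (tb_chart M c) ` (fst (tb_chart M c) \<inter> fst (tb_chart M d))) (snd (tb_chart M d) \<circ> chart_inv (tb_chart M c))"
    unfolding im
  proof
    fix k
    let ?t = "snd d \<circ> chart_inv c"
    have "Ck_on k (?O \<times> UNIV) (\<lambda>z. (?t (fst z), frechet_derivative ?t (at (fst z)) (snd z)))"
      by (intro Ck_on_Pair O Ck_on_compose[OF O chart_transition(2)[OF assms cd] Ck_on_fst]
          Ck_on_frechet_derivative[OF O chart_transition(2)[OF assms cd] Ck_on_fst Ck_on_snd]) auto
    moreover have "(?t (fst z), frechet_derivative ?t (at (fst z)) (snd z)) = (snd (tb_chart M d) \<circ> chart_inv (tb_chart M c)) z"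
      if "z \<in> ?O \<times> UNIV" for z
    proof -
      obtain x y where z: "z = (x, y)" "x \<in> snd c ` fst c" "chart_inv c x \<in> fst d"
        using \<open>z \<in> ?O \<times> UNIV\<close> chart_inv_left[OF assms cd(1)] by auto
      then show ?thesis
        using cd chart_inv_right[OF z(2)] by (simp add: chart_inv_tb_chart assms snd_tb_chart tvec_def)
    qed
    ultimately show "Ck_on k (?O \<times> UNIV) (snd (tb_chart M d) \<circ> chart_inv (tb_chart M c))"
      by (rule Ck_on_transfer[OF O])
  qed
qed

section \<open>Maps between manifolds\<close>

lemma smooth_map_on_chart:
  assumes M: "smooth_atlas M" and N: "smooth_atlas N" and W: "openin (mfd_top M) W"
    and f: "smooth_map_on M N W f" and c: "c \<in> M" "d \<in> N"
  defines "S \<equiv> snd c ` (W \<inter> fst c \<inter> f -` fst d)"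
  shows "open S" "Ck_on k S (snd d \<circ> f \<circ> chart_inv c)"
proof -
  have "openin (subtopology (mfd_top M) W) {p \<in> topspace (subtopology (mfd_top M) W). f p \<in> fst d}"
  proof (rule openin_continuous_map_preimage[OF _ openin_chart_domain[OF N c(2)]])
    show "continuous_map (subtopology (mfd_top M) W) (mfd_top N) f"
      using f by (simp add: smooth_map_on_def)
  qed
  moreover have "W \<subseteq> mfd_space M"
    using W openin_mfd_top[OF M] by blast
  then have "{p \<in> topspace (subtopology (mfd_top M) W). f p \<in> fst d} = W \<inter> f -` fst d"
    using topspace_mfd_top[OF M] by auto
  ultimately have "openin (mfd_top M) (W \<inter> f -` fst d)"
    using W by (simp add: openin_open_subtopology)
  from open_chart_image[OF M c(1) this] show "open S"
    by (simp add: S_def Int_assoc Int_commute[of "fst c"])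
  show "Ck_on k S (snd d \<circ> f \<circ> chart_inv c)"
    using f c by (simp add: smooth_map_on_def S_def)
qed

lemma smooth_map_on_mem:
  "smooth_map_on M N W f \<Longrightarrow> smooth_atlas M \<Longrightarrow> smooth_atlas N \<Longrightarrow> W \<subseteq> mfd_space M \<Longrightarrow> p \<in> W \<Longrightarrow> f p \<in> mfd_space N"
  by (auto simp: smooth_map_on_def continuous_map_def topspace_mfd_top Pi_iff)

text \<open>Once a single pair of charts suffices for the map, all other pairs are reached by
  composing the coordinate expression \<open>h\<close> with transition maps. The splitting map and
  its inverse are of this kind.\<close>

lemma smooth_map_on_single_chart:
  assumes M: "smooth_atlas M" and N: "smooth_atlas N" and W: "openin (mfd_top M) W"
    and c: "c \<in> M" "W \<subseteq> fst c" and d: "d \<in> N"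
    and h: "\<And>k. Ck_on k (snd c ` W) h" "\<And>x. x \<in> snd c ` W \<Longrightarrow> h x \<in> snd d ` fst d"
    and f: "\<And>p. p \<in> W \<Longrightarrow> f p = chart_inv d (h (snd c p))"
  shows "smooth_map_on M N W f"
proof -
  have cW: "open (snd c ` W)"
    using open_chart_image[OF M c(1) W] c(2) by (simp add: Int_absorb2)
  have Ws: "W \<subseteq> mfd_space M"
    using mem_mfd_space[OF c(1)] c(2) by blast
  have f_mem: "f p \<in> fst d" if "p \<in> W" for p
    unfolding f[OF that] by (rule chart_inv_mem[OF h(2)]) (use that in simp)
  have pre: "openin (mfd_top M) {p \<in> W. f p \<in> V}" if V: "openin (mfd_top N) V" for V
  proof -
    have "{p \<in> W. f p \<in> V} = chart_inv c ` (snd c ` W \<inter> h -` (snd d ` (V \<inter> fst d)))"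
    proof (intro equalityI subsetI)
      fix p
      assume p: "p \<in> {p \<in> W. f p \<in> V}"
      then have "h (snd c p) = snd d (f p)"
        using f[of p] chart_inv_right[OF h(2)[of "snd c p"]] by simp
      then have "snd c p \<in> snd c ` W \<inter> h -` (snd d ` (V \<inter> fst d))"
        using p f_mem by auto
      then show "p \<in> chart_inv c ` (snd c ` W \<inter> h -` (snd d ` (V \<inter> fst d)))"
        using chart_inv_left[OF M c(1), of p] p c(2) by (intro image_eqI[of p _ "snd c p"]) auto
    next
      fix p
      assume "p \<in> chart_inv c ` (snd c ` W \<inter> h -` (snd d ` (V \<inter> fst d)))"
      then obtain q where q: "q \<in> W" "p = chart_inv c (snd c q)" "h (snd c q) \<in> snd d ` (V \<inter> fst d)"
        by auto
      then have "p = q"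
        using chart_inv_left[OF M c(1)] c(2) by auto
      then show "p \<in> {p \<in> W. f p \<in> V}"
        using q f[of q] chart_inv_left[OF N d] by auto
    qed
    moreover have "open (snd c ` W \<inter> h -` (snd d ` (V \<inter> fst d)))"
      using cW open_chart_image[OF N d V] h(1)[of 0] by (intro continuous_open_preimage) auto
    ultimately show ?thesis
      using openin_chart_preimage[OF M c(1)] c(2) by (simp add: image_mono inf.coboundedI1)
  qed
  have cont: "continuous_map (subtopology (mfd_top M) W) (mfd_top N) f"
    unfolding continuous_map_def
  proof (intro conjI allI impI)
    show "f \<in> topspace (subtopology (mfd_top M) W) \<rightarrow> topspace (mfd_top N)"
      using f_mem mem_mfd_space[OF d] by (auto simp: topspace_mfd_top[OF N])
    show "openin (subtopology (mfd_top M) W) {p \<in> topspace (subtopology (mfd_top M) W). f p \<in> V}"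
      if "openin (mfd_top N) V" for V
    proof -
      have "{p \<in> topspace (subtopology (mfd_top M) W). f p \<in> V} = {p \<in> W. f p \<in> V}"
        using Ws by (auto simp: topspace_mfd_top[OF M])
      then show ?thesis
        using pre[OF that] W by (simp add: openin_open_subtopology)
    qed
  qed
  have "Ck_on k (snd c' ` (W \<inter> fst c' \<inter> f -` fst d')) (snd d' \<circ> f \<circ> chart_inv c')"
    if c': "c' \<in> M" and d': "d' \<in> N" for c' d' k
  proof -
    let ?S = "snd c' ` (W \<inter> fst c' \<inter> f -` fst d')"
    have "{p \<in> W. f p \<in> fst d'} \<inter> fst c' = W \<inter> fst c' \<inter> f -` fst d'"
      by auto
    then have S: "open ?S"
      using open_chart_image[OF M c' pre[OF openin_chart_domain[OF N d']]] by simp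
    have Sp: "\<exists>p. p \<in> W \<and> p \<in> fst c' \<and> p \<in> fst c \<and> f p \<in> fst d' \<and> f p \<in> fst d \<and> x = snd c' p \<and>
        chart_inv c' x = p \<and> chart_inv c (snd c p) = p \<and> snd d (f p) = h (snd c p)" if xS: "x \<in> ?S" for x
    proof -
      obtain p where p: "p \<in> W" "p \<in> fst c'" "f p \<in> fst d'" "x = snd c' p"
        using xS by auto
      moreover have "snd d (f p) = h (snd c p)"
        using f[OF p(1)] chart_inv_right[OF h(2)[of "snd c p"]] p(1) by simp
      ultimately show ?thesis
        using c(2) f_mem chart_inv_left[OF M c'] chart_inv_left[OF M c(1)] by blast
    qed
    have 1: "Ck_on k ?S (snd c \<circ> chart_inv c')"
      by (rule Ck_on_subset[OF chart_transition(2)[OF M c' c(1)]]) (use c(2) in auto)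
    have 2: "Ck_on k ?S (\<lambda>x. h ((snd c \<circ> chart_inv c') x))"
      by (rule Ck_on_compose[OF S h(1) 1]) (use Sp in auto)
    have "Ck_on k ?S (\<lambda>x. (snd d' \<circ> chart_inv d) (h ((snd c \<circ> chart_inv c') x)))"
    proof (rule Ck_on_compose[OF S chart_transition(2)[OF N d d'] 2])
      fix x
      assume "x \<in> ?S"
      from Sp[OF this] obtain p where "f p \<in> fst d \<inter> fst d'" "h ((snd c \<circ> chart_inv c') x) = snd d (f p)"
        by auto
      then show "h ((snd c \<circ> chart_inv c') x) \<in> snd d ` (fst d \<inter> fst d')"
        by simp
    qed
    moreover have "(snd d' \<circ> chart_inv d) (h ((snd c \<circ> chart_inv c') x)) = (snd d' \<circ> f \<circ> chart_inv c') x"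
      if "x \<in> ?S" for x
      using Sp[OF that] f by auto
    ultimately show ?thesis
      by (rule Ck_on_transfer[OF S])
  qed
  then show ?thesis
    using cont by (simp add: smooth_map_on_def)
qed

text \<open>Frees the differential from the particular chart selected by
  \<open>chart_at\<close>.\<close>

lemma tangent_map_component:
  assumes M: "smooth_atlas M" "c \<in> M" "p \<in> fst c" and v: "v \<in> tangent_space M p"
    and d: "d \<in> N" "f p \<in> fst d" and diff: "(snd d \<circ> f \<circ> chart_inv c) differentiable (at (snd c p))"
  shows "tangent_map M N f p v d = frechet_derivative (snd d \<circ> f \<circ> chart_inv c) (at (snd c p)) (v c)"
proof -
  let ?b = "chart_at M p"
  have b: "?b \<in> M" "p \<in> fst ?b"
    using chart_at_props[OF mem_mfd_space[OF M(2,3)]] by simp_all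
  have "v c = frechet_derivative (snd c \<circ> chart_inv ?b) (at (snd ?b p)) (v ?b)"
    by (rule tangent_space_transform[OF v b(1) M(2) b(2) M(3)])
  then show ?thesis
    using frechet_derivative_chart_change[OF M(1) b(1) M(2) b(2) M(3) diff] d
    by (simp add: tangent_map_def Let_def frechet_derivative_eqI)
qed

lemma dfun_component:
  assumes M: "smooth_atlas M" "c \<in> M" "p \<in> fst c" and v: "v \<in> tangent_space M p"
    and diff: "(f \<circ> chart_inv c) differentiable (at (snd c p))"
  shows "dfun M f p v = frechet_derivative (f \<circ> chart_inv c) (at (snd c p)) (v c)"
proof -
  let ?b = "chart_at M p"
  have b: "?b \<in> M" "p \<in> fst ?b"
    using chart_at_props[OF mem_mfd_space[OF M(2,3)]] by simp_all
  have "v c = frechet_derivative (snd c \<circ> chart_inv ?b) (at (snd ?b p)) (v ?b)"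
    by (rule tangent_space_transform[OF v b(1) M(2) b(2) M(3)])
  then show ?thesis
    using frechet_derivative_chart_change[OF M(1) b(1) M(2) b(2) M(3) diff]
    by (simp add: dfun_def Let_def frechet_derivative_eqI)
qed

text \<open>The chain rule in the target collects all components of the image vector in one formula;
  in this form differentials are computed later.\<close>

lemma tangent_map_eqI:
  assumes M: "smooth_atlas M" and N: "smooth_atlas N" and W: "openin (mfd_top M) W" "p \<in> W"
    and f: "smooth_map_on M N W f" and c: "c \<in> M" "p \<in> fst c" and d: "d \<in> N" "f p \<in> fst d"
    and v: "v \<in> tangent_space M p"
  shows "tangent_map M N f p v =
    tvec N (f p) d (frechet_derivative (snd d \<circ> f \<circ> chart_inv c) (at (snd c p)) (v c))"
proof
  fix e
  show "tangent_map M N f p v e =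
    tvec N (f p) d (frechet_derivative (snd d \<circ> f \<circ> chart_inv c) (at (snd c p)) (v c)) e"
  proof (cases "e \<in> N \<and> f p \<in> fst e")
    case True
    have der: "((snd e' \<circ> f \<circ> chart_inv c) has_derivative frechet_derivative (snd e' \<circ> f \<circ> chart_inv c) (at (snd c p))) (at (snd c p))"
      if "e' \<in> N" "f p \<in> fst e'" for e'
      using smooth_map_on_chart(2)[OF M N W(1) f c(1) that(1), of 1] W(2) c(2) that(2)
      by (intro Ck_on_imp_has_derivative[of 1 "snd c ` (W \<inter> fst c \<inter> f -` fst e')"]) auto
    let ?S = "snd c ` (W \<inter> fst c \<inter> f -` fst d)" and ?S' = "snd c ` (W \<inter> fst c \<inter> f -` fst e)"
    have pq: "(snd d \<circ> f \<circ> chart_inv c) (snd c p) = snd d (f p)"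
      using chart_inv_left[OF M c] by simp
    have e_der: "((snd e \<circ> chart_inv d) has_derivative frechet_derivative (snd e \<circ> chart_inv d) (at (snd d (f p))))
        (at ((snd d \<circ> f \<circ> chart_inv c) (snd c p)))"
      unfolding pq by (rule chart_transition_has_derivative[OF N d(1) _ d(2)]) (use True in auto)
    have "((\<lambda>x. (snd e \<circ> chart_inv d) ((snd d \<circ> f \<circ> chart_inv c) x)) has_derivative
        (\<lambda>y. frechet_derivative (snd e \<circ> chart_inv d) (at (snd d (f p)))
          (frechet_derivative (snd d \<circ> f \<circ> chart_inv c) (at (snd c p)) y))) (at (snd c p))"
      by (rule has_derivative_compose[OF der[OF d] e_der])
    then have "((snd e \<circ> f \<circ> chart_inv c) has_derivative
        (\<lambda>y. frechet_derivative (snd e \<circ> chart_inv d) (at (snd d (f p)))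
          (frechet_derivative (snd d \<circ> f \<circ> chart_inv c) (at (snd c p)) y))) (at (snd c p))"
    proof (rule has_derivative_transform_within_open[OF _ smooth_map_on_chart(1)[OF M N W(1) f c(1) d(1)]])
      show "(snd e \<circ> chart_inv d) ((snd d \<circ> f \<circ> chart_inv c) x) = (snd e \<circ> f \<circ> chart_inv c) x"
        if "x \<in> ?S" for x
        using that chart_inv_left[OF M c(1)] chart_inv_left[OF N d(1)] by auto
    qed (use W(2) c(2) d(2) in auto)
    then show ?thesis
      using tangent_map_component[OF M c v _ _ differentiableI[OF der], of e N] True
      by (simp add: tvec_def frechet_derivative_eqI)
  qed (auto simp: tangent_map_def tvec_def Let_def)
qed

section \<open>Products of a manifold with an interval\<close>

abbreviation prod_chart :: "real set \<Rightarrow> ('a, 'e) chart \<Rightarrow> (real \<times> 'a, real \<times> 'e) chart" where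
  "prod_chart I c \<equiv> (I \<times> fst c, \<lambda>(t, x). (t, snd c x))"

lemma prod_chart_range: "snd (prod_chart I c) ` fst (prod_chart I c) = I \<times> snd c ` fst c"
  by force

lemma prod_atlas_inj:
  assumes "smooth_atlas S" "c \<in> S"
  shows "inj_on (snd (prod_chart I c)) (fst (prod_chart I c))"
  using chart_inj[OF assms] by (auto simp: inj_on_def)

lemma chart_inv_prod_chart:
  assumes "smooth_atlas S" "c \<in> S" "t \<in> I" "x \<in> snd c ` fst c"
  shows "chart_inv (prod_chart I c) (t, x) = (t, chart_inv c x)"
proof -
  have "(t, chart_inv c x) \<in> fst (prod_chart I c)" "snd (prod_chart I c) (t, chart_inv c x) = (t, x)"
    using assms(3) chart_inv_mem[OF assms(4)] chart_inv_right[OF assms(4)] by auto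
  then show ?thesis
    unfolding chart_inv_def[of "prod_chart I c"] using inv_into_f_f[OF prod_atlas_inj[OF assms(1,2)]] by metis
qed

lemma mfd_space_prod_atlas: "mfd_space (prod_atlas I S) = I \<times> mfd_space S"
  by (auto simp: mfd_space_def prod_atlas_def)

lemma smooth_atlas_prod_atlas:
  fixes S :: "('a, 'e::euclidean_space) chart set"
  assumes "smooth_atlas S" "open I"
  shows "smooth_atlas (prod_atlas I S)"
  unfolding smooth_atlas_def prod_atlas_def ball_simps
proof (intro conjI ballI)
  show "inj_on (snd (prod_chart I c)) (fst (prod_chart I c))" if "c \<in> S" for c
    by (rule prod_atlas_inj[OF assms(1) that])
  fix c d
  assume cd: "c \<in> S" "d \<in> S"
  let ?O = "I \<times> snd c ` (fst c \<inter> fst d)"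
  have im: "snd (prod_chart I c) ` (fst (prod_chart I c) \<inter> fst (prod_chart I d)) = ?O"
    by force
  have O: "open ?O"
    using chart_transition(1)[OF assms(1) cd] assms(2) by (intro open_Times)
  show "open (snd (prod_chart I c) ` (fst (prod_chart I c) \<inter> fst (prod_chart I d)))"
    unfolding im by (rule O)
  show "\<forall>k. Ck_on k (snd (prod_chart I c) ` (fst (prod_chart I c) \<inter> fst (prod_chart I d)))
      (snd (prod_chart I d) \<circ> chart_inv (prod_chart I c))"
    unfolding im
  proof
    fix k
    have "Ck_on k ?O (\<lambda>z. (fst z, (snd d \<circ> chart_inv c) (snd z)))"
      by (intro Ck_on_Pair O Ck_on_fst Ck_on_compose[OF O chart_transition(2)[OF assms(1) cd] Ck_on_snd]) auto
    moreover have "(fst z, (snd d \<circ> chart_inv c) (snd z)) = (snd (prod_chart I d) \<circ> chart_inv (prod_chart I c)) z"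
      if z: "z \<in> ?O" for z
    proof -
      obtain t x where "z = (t, x)" "t \<in> I" "x \<in> snd c ` fst c"
        using z by auto
      then show ?thesis
        using chart_inv_prod_chart[OF assms(1) cd(1)] by simp
    qed
    ultimately show "Ck_on k ?O (snd (prod_chart I d) \<circ> chart_inv (prod_chart I c))"
      by (rule Ck_on_transfer[OF O])
  qed
qed

section \<open>Manifolds with a single chart\<close>

lemma prod_chart_mem: "c \<in> S \<Longrightarrow> prod_chart I c \<in> prod_atlas I S"
  unfolding prod_atlas_def by (rule image_eqI[of _ _ c]) simp_all

lemma dfun_prod_fst:
  fixes S :: "('s, 'e::euclidean_space) chart set"
  assumes S: "smooth_atlas S" and I: "open I" and d: "d \<in> S" and t: "t \<in> I" and s: "s \<in> fst d" and u: "u \<in> tangent_space (prod_atlas I S) (t, s)"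
  shows "dfun (prod_atlas I S) fst (t, s) u = fst (u (prod_chart I d))"
proof -
  have q: "(t, s) \<in> fst (prod_chart I d)"
    using t s by simp
  have o: "open (I \<times> snd d ` fst d)"
    by (intro open_Times I open_chart_range[OF S d])
  have e: "snd (prod_chart I d) (t, s) \<in> I \<times> snd d ` fst d"
    using t s by simp
  have "(fst has_derivative fst) (at (snd (prod_chart I d) (t, s)))"
    by (rule bounded_linear_imp_has_derivative[OF bounded_linear_fst])
  then have der: "((fst \<circ> chart_inv (prod_chart I d)) has_derivative fst) (at (snd (prod_chart I d) (t, s)))"
  proof (rule has_derivative_transform_within_open[OF _ o e])
    fix w :: "real \<times> 'e"
    assume "w \<in> I \<times> snd d ` fst d"
    then obtain t' x where w: "w = (t', x)" "t' \<in> I" "x \<in> snd d ` fst d"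
      by (rule SigmaE)
    show "fst w = (fst \<circ> chart_inv (prod_chart I d)) w"
      unfolding w(1) o_apply chart_inv_prod_chart[OF S d w(2,3)] by simp
  qed
  show ?thesis
    unfolding dfun_component[OF smooth_atlas_prod_atlas[OF S I] prod_chart_mem[OF d] q u differentiableI[OF der]] frechet_derivative_eqI[OF der] ..
qed

lemma tangent_map_prod_snd:
  fixes S :: "('s, 'e::euclidean_space) chart set"
  assumes S: "smooth_atlas S" and I: "open I" and d: "d \<in> S" and t: "t \<in> I" and s: "s \<in> fst d" and u: "u \<in> tangent_space (prod_atlas I S) (t, s)"
  shows "tangent_map (prod_atlas I S) S snd (t, s) u = tvec S s d (snd (u (prod_chart I d)))"
proof
  fix d'
  have q: "(t, s) \<in> fst (prod_chart I d)"
    using t s by simp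
  have o: "open (I \<times> snd d ` fst d)"
    by (intro open_Times I open_chart_range[OF S d])
  have e: "snd (prod_chart I d) (t, s) \<in> I \<times> snd d ` fst d"
    using t s by simp
  show "tangent_map (prod_atlas I S) S snd (t, s) u d' = tvec S s d (snd (u (prod_chart I d))) d'"
  proof (cases "d' \<in> S \<and> s \<in> fst d'")
    case True
    then have d': "d' \<in> S" "s \<in> fst d'" "snd (t, s) \<in> fst d'"
      by simp_all
    let ?D = "frechet_derivative (snd d' \<circ> chart_inv d) (at (snd d s))"
    have tr: "((snd d' \<circ> chart_inv d) has_derivative ?D) (at (snd (snd (prod_chart I d) (t, s))))"
      using chart_transition_has_derivative[OF S d d'(1) s d'(2)] by (simp only: snd_conv prod.case)
    have "((\<lambda>w. (snd d' \<circ> chart_inv d) (snd w)) has_derivative (\<lambda>w. ?D (snd w))) (at (snd (prod_chart I d) (t, s)))"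
      by (rule has_derivative_compose[OF bounded_linear_imp_has_derivative[OF bounded_linear_snd] tr])
    then have der: "((snd d' \<circ> snd \<circ> chart_inv (prod_chart I d)) has_derivative (\<lambda>w. ?D (snd w))) (at (snd (prod_chart I d) (t, s)))"
    proof (rule has_derivative_transform_within_open[OF _ o e])
      fix w :: "real \<times> 'e"
      assume "w \<in> I \<times> snd d ` fst d"
      then obtain t' x where w: "w = (t', x)" "t' \<in> I" "x \<in> snd d ` fst d"
        by (rule SigmaE)
      show "(snd d' \<circ> chart_inv d) (snd w) = (snd d' \<circ> snd \<circ> chart_inv (prod_chart I d)) w"
        unfolding w(1) o_apply chart_inv_prod_chart[OF S d w(2,3)] by simp
    qed
    show ?thesis
      unfolding tangent_map_component[OF smooth_atlas_prod_atlas[OF S I] prod_chart_mem[OF d] q u d'(1,3) differentiableI[OF der]] frechet_derivative_eqI[OF der]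
      using True by (simp add: tvec_def)
  next
    case False
    then show ?thesis
      by (auto simp: tangent_map_def tvec_def Let_def)
  qed
qed

lemma smooth_atlas_single:
  fixes c :: "('a, 'e::euclidean_space) chart"
  assumes "inj_on (snd c) (fst c)" "open (snd c ` fst c)"
  shows "smooth_atlas {c}"
proof -
  have "Ck_on k (snd c ` fst c) (snd c \<circ> chart_inv c)" for k
    using Ck_on_cong[OF assms(2), of "snd c \<circ> chart_inv c" "\<lambda>x. x"] Ck_on_ident chart_inv_right[of _ c] by auto
  then show ?thesis
    using assms by (simp add: smooth_atlas_def)
qed

text \<open>The chart is a homeomorphism onto an open subset of a Euclidean space, so separation and
  paracompactness are pulled back from there. It is applied to the hypersurface of a splitting,
  which one chart covers.\<close>

lemma smooth_manifold_single:
  fixes c :: "('a, 'e::euclidean_space) chart"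
  assumes c: "inj_on (snd c) (fst c)" "open (snd c ` fst c)"
  shows "smooth_manifold {c}"
proof -
  let ?X = "mfd_top {c}"
  note atlas = smooth_atlas_single[OF c]
  have space: "mfd_space {c} = fst c"
    by (simp add: mfd_space_def)
  have left: "chart_inv c (snd c p) = p" if "p \<in> fst c" for p
    using chart_inv_left[OF atlas _ that] by simp
  have openX: "openin ?X (chart_inv c ` V)" if "open V" "V \<subseteq> snd c ` fst c" for V
    using openin_chart_preimage[OF atlas _ that] by simp
  have openim: "open (snd c ` U)" "U \<subseteq> fst c" if "openin ?X U" for U
    using that openin_mfd_top[OF atlas, of U] space by (auto simp: Int_absorb2)
  have "Hausdorff_space ?X"
    unfolding Hausdorff_space_def topspace_mfd_top[OF atlas] space
  proof (intro allI impI)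
    fix p q
    assume pq: "p \<in> fst c \<and> q \<in> fst c \<and> p \<noteq> q"
    then have "snd c p \<noteq> snd c q"
      using c(1) by (auto dest: inj_onD)
    then obtain U V where UV: "open U" "open V" "snd c p \<in> U" "snd c q \<in> V" "U \<inter> V = {}"
      by (metis hausdorff)
    let ?f = "\<lambda>U. chart_inv c ` (U \<inter> snd c ` fst c)"
    have mem: "x \<in> ?f U" if "x \<in> fst c" "snd c x \<in> U" for x U
      using left[OF that(1)] that by (auto intro!: image_eqI[of _ _ "snd c x"])
    have "disjnt (?f U) (?f V)"
      using UV(5) left unfolding disjnt_def by (auto simp: chart_inv_def)
    then show "\<exists>U V. openin ?X U \<and> openin ?X V \<and> p \<in> U \<and> q \<in> V \<and> disjnt U V"
      using openX[of "U \<inter> snd c ` fst c"] openX[of "V \<inter> snd c ` fst c"] mem pq UV c(2)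
      by (intro exI[of _ "?f U"] exI[of _ "?f V"]) (auto simp: open_Int)
  qed
  moreover have "paracompact_space ?X"
    unfolding paracompact_space_def topspace_mfd_top[OF atlas] space
  proof (intro allI impI)
    fix \<U> :: "'a set set"
    assume U: "(\<forall>U\<in>\<U>. openin ?X U) \<and> \<Union>\<U> = fst c"
    have cov: "snd c ` fst c \<subseteq> \<Union>((`) (snd c) ` \<U>)" "\<And>T. T \<in> (`) (snd c) ` \<U> \<Longrightarrow> open T"
      using U openim(1) image_Union[of "snd c" \<U>] by auto
    obtain \<C> where C: "snd c ` fst c \<subseteq> \<Union>\<C>"
      "\<And>V. V \<in> \<C> \<Longrightarrow> open V \<and> (\<exists>T. T \<in> (`) (snd c) ` \<U> \<and> V \<subseteq> T)"
      "\<And>x. x \<in> snd c ` fst c \<Longrightarrow> \<exists>V. open V \<and> x \<in> V \<and> finite {U. U \<in> \<C> \<and> (U \<inter> V \<noteq> {})}"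
      by (rule paracompact[OF cov]) (assumption | rule that)+
    have C_sub: "\<exists>U\<in>\<U>. V \<subseteq> snd c ` U \<and> U \<subseteq> fst c" if "V \<in> \<C>" for V
      using C(2)[OF that] U openim(2) by auto
    have C_range: "V \<subseteq> snd c ` fst c" if "V \<in> \<C>" for V
      using C_sub[OF that] by blast
    let ?V = "(`) (chart_inv c) ` \<C>"
    have cover: "\<Union>?V = fst c"
    proof (intro equalityI subsetI)
      fix p
      assume "p \<in> \<Union>?V"
      then show "p \<in> fst c"
        using C_range chart_inv_mem[of _ c] by blast
    next
      fix p
      assume p: "p \<in> fst c"
      then obtain V where "V \<in> \<C>" "snd c p \<in> V"
        using C(1) by blast
      then show "p \<in> \<Union>?V"
        using left[OF p] by (auto intro!: bexI[of _ V] image_eqI[of p _ "snd c p"])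
    qed
    have lf: "locally_finite_in ?X ?V"
      unfolding locally_finite_in_def topspace_mfd_top[OF atlas] space cover
    proof (intro conjI ballI subset_refl)
      fix p
      assume p: "p \<in> fst c"
      then obtain N where N: "open N" "snd c p \<in> N" "finite {U. U \<in> \<C> \<and> (U \<inter> N \<noteq> {})}"
        using C(3)[of "snd c p"] by auto
      let ?N = "chart_inv c ` (N \<inter> snd c ` fst c)"
      have "{U \<in> ?V. U \<inter> ?N \<noteq> {}} \<subseteq> (`) (chart_inv c) ` {U. U \<in> \<C> \<and> (U \<inter> N \<noteq> {})}"
      proof
        fix U
        assume "U \<in> {U \<in> ?V. U \<inter> ?N \<noteq> {}}"
        then obtain V x y where V: "V \<in> \<C>" "U = chart_inv c ` V" "x \<in> V" "y \<in> N" "y \<in> snd c ` fst c" "chart_inv c x = chart_inv c y"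
          by auto
        then have "x = y"
          using C_range[OF V(1)] chart_inv_right[of x c] chart_inv_right[of y c] by auto
        then show "U \<in> (`) (chart_inv c) ` {U. U \<in> \<C> \<and> (U \<inter> N \<noteq> {})}"
          using V by auto
      qed
      then have "finite {U \<in> ?V. U \<inter> ?N \<noteq> {}}"
        using N(3) by (meson finite_imageI finite_subset)
      moreover have "p \<in> ?N"
        using left[OF p] N(2) p by (auto intro!: image_eqI[of p _ "snd c p"])
      ultimately show "\<exists>V. openin ?X V \<and> p \<in> V \<and> finite {U \<in> ?V. U \<inter> V \<noteq> {}}"
        using openX[of "N \<inter> snd c ` fst c"] N(1) c(2) by (intro exI[of _ ?N]) (auto simp: open_Int)
    qed
    have refine: "\<exists>U\<in>\<U>. V \<subseteq> U" if "V \<in> ?V" for V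
    proof -
      obtain V' where V': "V' \<in> \<C>" "V = chart_inv c ` V'"
        using \<open>V \<in> ?V\<close> by auto
      then obtain U where "U \<in> \<U>" "V' \<subseteq> snd c ` U" "U \<subseteq> fst c"
        using C_sub by blast
      then show ?thesis
        using left V'(2) by (intro bexI[of _ U]) (auto dest!: subsetD)
    qed
    have "openin ?X V" if "V \<in> ?V" for V
      using that C(2) C_range openX by auto
    then show "\<exists>\<V>. (\<forall>V\<in>\<V>. openin ?X V) \<and> \<Union>\<V> = fst c \<and> (\<forall>V\<in>\<V>. \<exists>U\<in>\<U>. V \<subseteq> U) \<and> locally_finite_in ?X \<V>"
      using cover lf refine by (intro exI[of _ ?V] conjI ballI) simp_all
  qed
  ultimately show ?thesis
    using atlas by (simp add: smooth_manifold_def)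
qed

section \<open>Homogeneous functions\<close>

lemma Ck_on_derivative:
  "Ck_on k S f \<Longrightarrow> k = Suc j \<Longrightarrow> Ck_on j S (\<lambda>x. frechet_derivative f (at x) u)"
  by simp

lemma has_derivative_homogeneous:
  fixes h :: "'x::euclidean_space \<times> 'y::euclidean_space \<Rightarrow> real"
  assumes "open A" "(x, y) \<in> A" "(x, r *\<^sub>R y) \<in> A" "h differentiable (at (x, y))" "h differentiable (at (x, r *\<^sub>R y))"
    and hom: "\<And>x y. (x, y) \<in> A \<Longrightarrow> h (x, r *\<^sub>R y) = m * h (x, y)"
  shows "frechet_derivative h (at (x, r *\<^sub>R y)) (a, r *\<^sub>R b) = m * frechet_derivative h (at (x, y)) (a, b)"
proof -
  have s: "((\<lambda>z. (fst z, r *\<^sub>R snd z)) has_derivative (\<lambda>z. (fst z, r *\<^sub>R snd z))) (at (x, y))"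
    by (auto intro!: derivative_eq_intros)
  have "(h has_derivative frechet_derivative h (at (x, r *\<^sub>R y))) (at (fst (x, y), r *\<^sub>R snd (x, y)))"
    using assms(5) by (simp add: frechet_derivative_works)
  from has_derivative_compose[OF s this]
  have 1: "((\<lambda>z. h (fst z, r *\<^sub>R snd z)) has_derivative (\<lambda>z. frechet_derivative h (at (x, r *\<^sub>R y)) (fst z, r *\<^sub>R snd z))) (at (x, y))" .
  have "(h has_derivative frechet_derivative h (at (x, y))) (at (x, y))"
    using assms(4) by (simp add: frechet_derivative_works)
  then have "((\<lambda>z. m * h z) has_derivative (\<lambda>z. m * frechet_derivative h (at (x, y)) z)) (at (x, y))"
    by (rule has_derivative_mult_right)
  then have "((\<lambda>z. h (fst z, r *\<^sub>R snd z)) has_derivative (\<lambda>z. m * frechet_derivative h (at (x, y)) z)) (at (x, y))"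
    by (rule has_derivative_transform_within_open[OF _ assms(1,2)]) (use hom in auto)
  from has_derivative_unique[OF 1 this] show ?thesis
    by (metis fst_conv snd_conv)
qed

lemma homogeneous_zero:
  fixes h :: "'x \<times> 'y::real_vector \<Rightarrow> real"
  assumes "\<And>r. r > 0 \<Longrightarrow> h (x, r *\<^sub>R 0) = r\<^sup>2 * h (x, 0)"
  shows "h (x, 0) = 0"
  using assms[of 2] by simp

text \<open>The unit sphere bundle over a closed ball is compact; scaling from it yields |h| \<le> C
  |y|^2 and |Dh (a, b)| \<le> C |y| (|y| |a| + |b|). Hence \<open>h\<close> has derivative 0 at the
  zero section and Dh is continuous there. To be applied to F^2, whose regularity is given only off
  the zero section.\<close>

lemma homogeneous_C1:
  fixes h :: "'x::euclidean_space \<times> 'y::euclidean_space \<Rightarrow> real"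
  assumes W: "open W" and h1: "Ck_on 1 (W \<times> - {0}) h"
    and hom: "\<And>x y r. x \<in> W \<Longrightarrow> r > 0 \<Longrightarrow> h (x, r *\<^sub>R y) = r\<^sup>2 * h (x, y)"
  shows "Ck_on 1 (W \<times> UNIV) h"
proof -
  let ?A = "W \<times> - {0 :: 'y}"
  have A: "open ?A"
    using W by (intro open_Times) auto
  have h0: "h (x, 0) = 0" if "x \<in> W" for x
    by (rule homogeneous_zero) (rule hom[OF that])
  have local: "\<exists>\<rho> C. 0 < \<rho> \<and> cball x0 \<rho> \<subseteq> W \<and> 0 \<le> C \<and>
      (\<forall>x\<in>cball x0 \<rho>. \<forall>y. \<bar>h (x, y)\<bar> \<le> C * (norm y)\<^sup>2) \<and>
      (\<forall>x\<in>cball x0 \<rho>. \<forall>y. y \<noteq> 0 \<longrightarrow> (\<forall>a b. \<bar>frechet_derivative h (at (x, y)) (a, b)\<bar> \<le>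
        C * (norm y * (norm y * norm a + norm b))))"
    if x0: "x0 \<in> W" for x0
  proof -
    obtain \<rho> where \<rho>: "\<rho> > 0" "cball x0 \<rho> \<subseteq> W"
      using W x0 open_contains_cball by blast
    let ?K = "cball x0 \<rho> \<times> sphere (0 :: 'y) 1"
    have K: "compact ?K" "?K \<subseteq> ?A"
      using \<rho> by (auto intro!: compact_Times)
    obtain C1 where C1: "0 \<le> C1" "\<And>z v. z \<in> ?K \<Longrightarrow> norm (frechet_derivative h (at z) v) \<le> C1 * norm v"
      by (rule frechet_derivative_bound_compact[OF h1 K]) (rule that)
    have "bounded (h ` ?K)"
      by (intro compact_imp_bounded compact_continuous_image K continuous_on_subset[OF Ck_on_imp_continuous_on[OF h1] K(2)])
    then obtain C2 where C2: "\<forall>z\<in>?K. norm (h z) \<le> C2"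
      by (auto simp: bounded_iff)
    define C where "C = max C1 C2"
    have C: "0 \<le> C"
      using C1(1) by (simp add: C_def)
    have norm_y: "y = norm y *\<^sub>R (y /\<^sub>R norm y)" "y /\<^sub>R norm y \<in> sphere 0 1" "norm y > 0" if "y \<noteq> 0" for y :: 'y
      using that by auto
    have b1: "\<bar>h (x, y)\<bar> \<le> C * (norm y)\<^sup>2" if x: "x \<in> cball x0 \<rho>" for x y
    proof (cases "y = 0")
      case True
      then show ?thesis
        using h0 \<rho>(2) x by auto
    next
      case False
      have "h (x, y) = (norm y)\<^sup>2 * h (x, y /\<^sub>R norm y)"
        using hom[of x "norm y" "y /\<^sub>R norm y"] \<rho>(2) x norm_y[OF False] by (metis subsetD)
      moreover have "\<bar>h (x, y /\<^sub>R norm y)\<bar> \<le> C"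
        using C2[rule_format, of "(x, y /\<^sub>R norm y)"] x norm_y(2)[OF False] unfolding C_def by auto
      then have "(norm y)\<^sup>2 * \<bar>h (x, y /\<^sub>R norm y)\<bar> \<le> (norm y)\<^sup>2 * C"
        by (rule mult_left_mono) simp
      ultimately show ?thesis
        by (simp add: abs_mult mult.commute)
    qed
    have b2: "\<bar>frechet_derivative h (at (x, y)) (a, b)\<bar> \<le> C * (norm y * (norm y * norm a + norm b))"
      if x: "x \<in> cball x0 \<rho>" and y: "y \<noteq> 0" for x y a b
    proof -
      let ?e = "y /\<^sub>R norm y" and ?r = "norm y"
      have xW: "x \<in> W"
        using x \<rho>(2) by auto
      have e: "?e \<noteq> 0"
        using y by simp
      have d: "h differentiable (at (x, w))" if "w \<noteq> 0" for w
        using h1 xW that by (intro Ck_on_imp_differentiable[OF h1]) auto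
      \<comment> \<open>A vertical vector scales together with the fibre point, so \<open>b\<close>
        is written as |y| (b / |y|), while the horizontal vector \<open>a\<close> stays
        fixed.\<close>
      have "frechet_derivative h (at (x, ?r *\<^sub>R ?e)) (a, ?r *\<^sub>R (b /\<^sub>R ?r)) =
          ?r\<^sup>2 * frechet_derivative h (at (x, ?e)) (a, b /\<^sub>R ?r)"
        by (rule has_derivative_homogeneous[OF A]) (use y xW e d[OF e] d[OF y] hom in auto)
      then have eq: "frechet_derivative h (at (x, y)) (a, b) = ?r\<^sup>2 * frechet_derivative h (at (x, ?e)) (a, b /\<^sub>R ?r)"
        using y by simp
      have "norm (frechet_derivative h (at (x, ?e)) (a, b /\<^sub>R ?r)) \<le> C1 * norm (a, b /\<^sub>R ?r)"
        using C1(2)[of "(x, ?e)"] x norm_y(2)[OF y] by simp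
      also have "\<dots> \<le> C * (norm a + norm (b /\<^sub>R ?r))"
        using C1(1) by (intro mult_mono norm_Pair_le) (auto simp: C_def)
      finally have "\<bar>frechet_derivative h (at (x, y)) (a, b)\<bar> \<le> ?r\<^sup>2 * (C * (norm a + norm (b /\<^sub>R ?r)))"
        unfolding eq by (simp add: abs_mult mult_left_mono)
      also have "\<dots> = C * (norm y * (norm y * norm a + norm b))"
        using y by (simp add: power2_eq_square field_simps)
      finally show ?thesis .
    qed
    show ?thesis
      using \<rho> C b1 b2 by (intro exI[of _ \<rho>] exI[of _ C]) blast
  qed
  have der0: "(h has_derivative (\<lambda>_. 0)) (at (x0, 0))" if x0: "x0 \<in> W" for x0
  proof -
    obtain \<rho> C where \<rho>: "0 < \<rho>" "0 \<le> C" "\<forall>x\<in>cball x0 \<rho>. \<forall>y. \<bar>h (x, y)\<bar> \<le> C * (norm y)\<^sup>2"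
      using local[OF x0] by blast
    show ?thesis
      unfolding has_derivative_at_alt
    proof (intro conjI allI impI)
      fix e :: real
      assume e: "e > 0"
      show "\<exists>d>0. \<forall>z. norm (z - (x0, 0)) < d \<longrightarrow> norm (h z - h (x0, 0) - 0) \<le> e * norm (z - (x0, 0))"
      proof (intro exI[of _ "min \<rho> (e / (C + 1))"] conjI allI impI)
        show "0 < min \<rho> (e / (C + 1))"
          using \<rho> e by auto
        fix z :: "'x \<times> 'y"
        assume z: "norm (z - (x0, 0)) < min \<rho> (e / (C + 1))"
        obtain x :: 'x and y :: 'y where xy: "z = (x, y)"
          by (cases z)
        have nx: "norm (x - x0) \<le> norm (z - (x0, 0))" "norm y \<le> norm (z - (x0, 0))"
          using norm_fst_le[of "x - x0" y] norm_snd_le[of y "x - x0"] by (auto simp: xy)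
        have "\<bar>h (x, y)\<bar> \<le> C * (norm y)\<^sup>2"
          using \<rho>(3) nx z by (auto simp: dist_norm norm_minus_commute)
        also have "\<dots> = (C * norm y) * norm y"
          by (simp add: power2_eq_square)
        also have "\<dots> \<le> e * norm (z - (x0, 0))"
        proof (rule mult_mono)
          have "C * norm y \<le> (C + 1) * (e / (C + 1))"
            using nx z \<rho>(2) by (intro mult_mono) auto
          then show "C * norm y \<le> e"
            using \<rho>(2) by simp
        qed (use nx e in auto)
        finally show "norm (h z - h (x0, 0) - 0) \<le> e * norm (z - (x0, 0))"
          using h0[OF x0] by (simp add: xy)
      qed
    qed simp
  qed
  have diff: "h differentiable (at (x, y))" if "x \<in> W" for x y
  proof (cases "y = 0")
    case True
    then show ?thesis
      using der0[OF that] differentiableI by metis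
  next
    case False
    then show ?thesis
      using that by (intro Ck_on_imp_differentiable[OF h1]) auto
  qed
  have cont: "isCont (\<lambda>z. frechet_derivative h (at z) u) (x0, y0)" if x0: "x0 \<in> W" for x0 y0 u
  proof (cases "y0 = 0")
    case False
    have "continuous_on ?A (\<lambda>z. frechet_derivative h (at z) u)"
      by (rule continuous_on_frechet_derivative[OF h1])
    then show ?thesis
      using False x0 A by (simp add: continuous_on_eq_continuous_at)
  next
    case True
    obtain \<rho> C where \<rho>: "0 < \<rho>" "cball x0 \<rho> \<subseteq> W" "0 \<le> C"
      "\<forall>x\<in>cball x0 \<rho>. \<forall>y. y \<noteq> 0 \<longrightarrow> (\<forall>a b. \<bar>frechet_derivative h (at (x, y)) (a, b)\<bar> \<le>
        C * (norm y * (norm y * norm a + norm b)))"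
      using local[OF x0] by blast
    obtain a b where u: "u = (a, b)"
      by (cases u)
    have z0: "frechet_derivative h (at (x, 0)) u = 0" if "x \<in> W" for x
      using frechet_derivative_eqI[OF der0[OF that]] by simp
    have "\<forall>\<^sub>F z in at (x0, 0 :: 'y). fst z \<in> ball x0 \<rho>"
    proof (rule eventually_at_in_open'[of "ball x0 \<rho> \<times> UNIV", THEN eventually_mono])
      show "open (ball x0 \<rho> \<times> (UNIV :: 'y set))"
        by (intro open_Times) auto
    qed (use \<rho> in auto)
    then have ev: "\<forall>\<^sub>F z in at (x0, 0 :: 'y). norm (frechet_derivative h (at z) u) \<le> C * (norm (snd z) * (norm (snd z) * norm a + norm b))"
    proof eventually_elim
      fix z :: "'x \<times> 'y"
      assume z: "fst z \<in> ball x0 \<rho>"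
      obtain x y where xy: "z = (x, y)"
        by (cases z)
      have x: "x \<in> cball x0 \<rho>" "x \<in> W"
        using z \<rho>(2) by (auto simp: xy)
      show "norm (frechet_derivative h (at z) u) \<le> C * (norm (snd z) * (norm (snd z) * norm a + norm b))"
      proof (cases "y = 0")
        case True
        then show ?thesis
          using z0[OF x(2)] by (simp add: xy)
      next
        case False
        then show ?thesis
          using \<rho>(4)[rule_format, OF x(1) False, of a b] by (simp add: xy u)
      qed
    qed
    have "isCont (\<lambda>z. C * (norm (snd z) * (norm (snd z) * norm a + norm b))) (x0, 0 :: 'y)"
      by (intro continuous_intros)
    then have "((\<lambda>z. C * (norm (snd z) * (norm (snd z) * norm a + norm b))) \<longlongrightarrow> 0) (at (x0, 0 :: 'y))"
      by (simp add: isCont_def)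
    from Lim_null_comparison[OF ev this] show ?thesis
      using True z0[OF x0] by (simp add: isCont_def)
  qed
  show ?thesis
    using diff cont by (auto intro!: continuous_at_imp_continuous_on)
qed

text \<open>The function y -> Df(y) u is homogeneous of degree 1. Such a function equals its
  differential at 0 if it is differentiable there; hence Df(y) u is linear in y, and
  \<open>f\<close> is a quadratic form.\<close>

lemma twice_differentiable_homogeneous:
  fixes f :: "'e::euclidean_space \<Rightarrow> real"
  assumes f: "twice_differentiable_at f 0" and hom: "\<And>r y. r > 0 \<Longrightarrow> f (r *\<^sub>R y) = r\<^sup>2 * f y"
  defines "B \<equiv> \<lambda>u. frechet_derivative (\<lambda>x. frechet_derivative f (at x) u) (at 0)"
  shows "linear (B u)" "(f has_derivative (\<lambda>u. B u y)) (at y)"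
proof -
  obtain S where S: "open S" "0 \<in> S" "\<And>x. x \<in> S \<Longrightarrow> f differentiable (at x)"
    using f unfolding twice_differentiable_at_def eventually_nhds by blast
  obtain e where e: "e > 0" "ball 0 e \<subseteq> S"
    using S openE by blast
  let ?D = "\<lambda>y. frechet_derivative f (at y)"
  have scale: "(f has_derivative (\<lambda>u. r * ?D y u)) (at (r *\<^sub>R y))" if "r > 0" "f differentiable (at y)" for r y
  proof -
    have "((\<lambda>x. inverse r *\<^sub>R x) has_derivative (\<lambda>x. inverse r *\<^sub>R x)) (at (r *\<^sub>R y))"
      by (auto intro!: derivative_eq_intros)
    moreover have "(f has_derivative ?D y) (at (inverse r *\<^sub>R r *\<^sub>R y))"
      using that by (simp add: frechet_derivative_works)
    ultimately have "((\<lambda>x. f (inverse r *\<^sub>R x)) has_derivative (\<lambda>u. ?D y (inverse r *\<^sub>R u))) (at (r *\<^sub>R y))"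
      by (rule has_derivative_compose)
    then have "((\<lambda>x. r\<^sup>2 * f (inverse r *\<^sub>R x)) has_derivative (\<lambda>u. r\<^sup>2 * ?D y (inverse r *\<^sub>R u))) (at (r *\<^sub>R y))"
      by (rule has_derivative_mult_right)
    moreover have "r\<^sup>2 * f (inverse r *\<^sub>R x) = f x" for x
      using hom[OF that(1), of "inverse r *\<^sub>R x"] that(1) by simp
    moreover have "r\<^sup>2 * ?D y (inverse r *\<^sub>R u) = r * ?D y u" for u
      using linear_cmul[OF linear_frechet_derivative[OF that(2)], of "inverse r" u] that(1)
      by (simp add: power2_eq_square)
    ultimately show ?thesis
      by simp
  qed
  have diff: "f differentiable (at y)" for y
  proof -
    \<comment> \<open>The scale that brings \<open>y\<close> into the ball where \<open>f\<close> is
      known to be differentiable; homogeneity carries differentiability back to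
      \<open>y\<close>.\<close>
    define r where "r = 2 * (norm y + 1) / e"
    have r: "r > 0"
      using e by (auto simp: r_def intro!: divide_pos_pos mult_pos_pos add_nonneg_pos)
    have "norm (inverse r *\<^sub>R y) = norm y * e / (2 * (norm y + 1))"
      using e by (simp add: r_def abs_mult)
    also have "\<dots> < e"
    proof -
      have n: "0 < norm y + 1"
        by (rule add_nonneg_pos[OF norm_ge_zero zero_less_one])
      have pos: "0 < 2 * (norm y + 1)"
        by (rule mult_pos_pos[OF zero_less_numeral n])
      have "norm y < norm y + 1"
        by (rule less_add_one)
      also have "\<dots> < (norm y + 1) + (norm y + 1)"
        using n by (simp only: less_add_same_cancel1)
      finally have "norm y < 2 * (norm y + 1)"
        by (simp only: mult_2)
      then have "norm y * e < (2 * (norm y + 1)) * e"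
        using e(1) by (rule mult_strict_right_mono)
      then show ?thesis
        unfolding pos_divide_less_eq[OF pos] by (simp only: mult.commute)
    qed
    finally have "f differentiable (at (inverse r *\<^sub>R y))"
      using e(2) S(3) by (auto simp: subset_iff)
    from scale[OF r this] show ?thesis
      using r differentiableI by fastforce
  qed
  have D_hom: "?D (r *\<^sub>R y) u = r * ?D y u" if "r > 0" for r y u
    by (subst frechet_derivative_eqI[OF scale[OF that diff]]) simp
  have D_0: "?D 0 u = 0" for u
    using D_hom[of 2 0 u] by simp
  have B: "((\<lambda>x. ?D x u) has_derivative B u) (at 0)" for u
    using f by (simp add: B_def twice_differentiable_at_def frechet_derivative_works)
  show lin: "linear (B u)" for u
    using B has_derivative_linear by blast
  have "?D y u = B u y" for y u
  proof -
    have "(\<lambda>x. ?D x u) differentiable (at 0)"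
      using B differentiableI by blast
    have "((\<lambda>t. ?D (0 + t *\<^sub>R y) u) has_vector_derivative B u y) (at 0)"
      by (rule has_vector_derivative_line) (use B in simp)
    then have "((\<lambda>t. ?D (t *\<^sub>R y) u) has_real_derivative B u y) (at 0)"
      by (simp add: has_real_derivative_iff_has_vector_derivative)
    then have "((\<lambda>t. (?D ((0 + t) *\<^sub>R y) u - ?D (0 *\<^sub>R y) u) / t) \<longlongrightarrow> B u y) (at 0)"
      unfolding has_field_derivative_def DERIV_def by (simp add: DERIV_def has_field_derivative_def[symmetric])
    then have "((\<lambda>t. (?D (t *\<^sub>R y) u) / t) \<longlongrightarrow> B u y) (at_right 0)"
      by (auto simp: D_0 intro: tendsto_mono[OF at_le])
    \<comment> \<open>By homogeneity the difference quotient along the ray is constant for t > 0, so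
      its limit is its value.\<close>
    moreover have "\<forall>\<^sub>F t in at_right 0. ?D (t *\<^sub>R y) u / t = ?D y u"
      by (rule eventually_at_right_less[THEN eventually_mono]) (simp add: D_hom)
    ultimately have "((\<lambda>t. ?D y u) \<longlongrightarrow> B u y) (at_right (0::real))"
      by (rule Lim_transform_eventually)
    then show ?thesis
      by (simp add: tendsto_const_iff)
  qed
  then have "frechet_derivative f (at y) = (\<lambda>u. B u y)"
    by (rule ext)
  then show "(f has_derivative (\<lambda>u. B u y)) (at y)"
    using diff[of y] unfolding frechet_derivative_works by (simp only:)
qed

section \<open>Invariance under the flow of a Killing field\<close>

text \<open>Contract the Killing equation with y^l y^j. Since L = G_lj y^l y^j, its first term is
  the part of dL that differentiates the coefficients, and the two others are the part that
  differentiates the factors y^l and y^j; together they are the derivative of \<open>L\<close> along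
  the complete lift.\<close>

lemma killing_identity:
  fixes L :: "'e::euclidean_space \<times> 'e \<Rightarrow> real" and G :: "'e \<Rightarrow> 'e \<Rightarrow> 'e \<times> 'e \<Rightarrow> real"
  assumes "open A" "(x, y) \<in> A"
    and L: "\<And>x y. (x, y) \<in> A \<Longrightarrow> L (x, y) = (\<Sum>l\<in>Basis. \<Sum>j\<in>Basis. G l j (x, y) * (y \<bullet> l) * (y \<bullet> j))"
    and G: "\<And>l j. l \<in> Basis \<Longrightarrow> j \<in> Basis \<Longrightarrow> G l j differentiable (at (x, y))"
    and dk: "linear dk"
    and killing: "\<And>l j. l \<in> Basis \<Longrightarrow> j \<in> Basis \<Longrightarrow>
      frechet_derivative (G l j) (at (x, y)) (k, dk y) + (\<Sum>h\<in>Basis. (dk l \<bullet> h) * G h j (x, y)) +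
        (\<Sum>h\<in>Basis. (dk j \<bullet> h) * G l h (x, y)) = 0"
  shows "frechet_derivative L (at (x, y)) (k, dk y) = 0"
proof -
  let ?z = "(x, y)" and ?m = "dk y"
  have dG: "(G l j has_derivative frechet_derivative (G l j) (at ?z)) (at ?z)" if "l \<in> Basis" "j \<in> Basis" for l j
    using G[OF that] by (simp add: frechet_derivative_works)
  have dy: "((\<lambda>w. snd w \<bullet> l) has_derivative (\<lambda>w. snd w \<bullet> l)) (at ?z)" for l :: 'e
    by (auto intro!: derivative_eq_intros)
  have "((\<lambda>w. \<Sum>l\<in>Basis. \<Sum>j\<in>Basis. G l j w * (snd w \<bullet> l) * (snd w \<bullet> j)) has_derivative
      (\<lambda>w. \<Sum>l\<in>Basis. \<Sum>j\<in>Basis. (G l j ?z * (snd ?z \<bullet> l)) * (snd w \<bullet> j) +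
         (G l j ?z * (snd w \<bullet> l) + frechet_derivative (G l j) (at ?z) w * (snd ?z \<bullet> l)) * (snd ?z \<bullet> j))) (at ?z)"
    by (intro has_derivative_sum has_derivative_mult dG dy)
  then have "(L has_derivative
      (\<lambda>w. \<Sum>l\<in>Basis. \<Sum>j\<in>Basis. (G l j ?z * (snd ?z \<bullet> l)) * (snd w \<bullet> j) +
         (G l j ?z * (snd w \<bullet> l) + frechet_derivative (G l j) (at ?z) w * (snd ?z \<bullet> l)) * (snd ?z \<bullet> j))) (at ?z)"
    by (rule has_derivative_transform_within_open[OF _ assms(1,2)]) (use L in auto)
  then have "frechet_derivative L (at ?z) (k, ?m) =
      (\<Sum>l\<in>Basis. \<Sum>j\<in>Basis. (G l j ?z * (y \<bullet> l)) * (?m \<bullet> j) +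
         (G l j ?z * (?m \<bullet> l) + frechet_derivative (G l j) (at ?z) (k, ?m) * (y \<bullet> l)) * (y \<bullet> j))"
    by (simp add: frechet_derivative_eqI)
  also have "\<dots> = (\<Sum>l\<in>Basis. \<Sum>j\<in>Basis. G l j ?z * (y \<bullet> l) * (?m \<bullet> j)) +
      (\<Sum>l\<in>Basis. \<Sum>j\<in>Basis. G l j ?z * (?m \<bullet> l) * (y \<bullet> j)) +
      (\<Sum>l\<in>Basis. \<Sum>j\<in>Basis. frechet_derivative (G l j) (at ?z) (k, ?m) * (y \<bullet> l) * (y \<bullet> j))"
    by (simp add: sum.distrib algebra_simps)
  also have "(\<Sum>l\<in>Basis. \<Sum>j\<in>Basis. frechet_derivative (G l j) (at ?z) (k, ?m) * (y \<bullet> l) * (y \<bullet> j)) =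
      (\<Sum>l\<in>Basis. \<Sum>j\<in>Basis. - ((\<Sum>h\<in>Basis. (dk l \<bullet> h) * G h j ?z) * (y \<bullet> l) * (y \<bullet> j)) -
         (\<Sum>h\<in>Basis. (dk j \<bullet> h) * G l h ?z) * (y \<bullet> l) * (y \<bullet> j))"
  proof (intro sum.cong refl)
    fix l j :: 'e
    assume "l \<in> Basis" "j \<in> Basis"
    from killing[OF this] have "frechet_derivative (G l j) (at ?z) (k, ?m) =
        - (\<Sum>h\<in>Basis. (dk l \<bullet> h) * G h j ?z) - (\<Sum>h\<in>Basis. (dk j \<bullet> h) * G l h ?z)"
      by simp
    then show "frechet_derivative (G l j) (at ?z) (k, ?m) * (y \<bullet> l) * (y \<bullet> j) =
        - ((\<Sum>h\<in>Basis. (dk l \<bullet> h) * G h j ?z) * (y \<bullet> l) * (y \<bullet> j)) -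
         (\<Sum>h\<in>Basis. (dk j \<bullet> h) * G l h ?z) * (y \<bullet> l) * (y \<bullet> j)"
      by (simp only: left_diff_distrib mult_minus_left)
  qed
  also have "\<dots> = - (\<Sum>l\<in>Basis. \<Sum>j\<in>Basis. (\<Sum>h\<in>Basis. (dk l \<bullet> h) * G h j ?z) * (y \<bullet> l) * (y \<bullet> j)) -
      (\<Sum>l\<in>Basis. \<Sum>j\<in>Basis. (\<Sum>h\<in>Basis. (dk j \<bullet> h) * G l h ?z) * (y \<bullet> l) * (y \<bullet> j))"
    by (simp add: sum_subtractf sum_negf)
  \<comment> \<open>After exchanging sums, linearity of \<open>dk\<close> allows the sum over
    \<open>l\<close> to be carried out: y^l dk(e_l) adds up to dk(y).\<close>
  also have "(\<Sum>l\<in>Basis. \<Sum>j\<in>Basis. (\<Sum>h\<in>Basis. (dk l \<bullet> h) * G h j ?z) * (y \<bullet> l) * (y \<bullet> j)) =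
      (\<Sum>l\<in>Basis. \<Sum>j\<in>Basis. G l j ?z * (?m \<bullet> l) * (y \<bullet> j))"
  proof -
    have m: "?m \<bullet> h = (\<Sum>l\<in>Basis. (y \<bullet> l) * (dk l \<bullet> h))" for h
      by (subst linear_basis_sum[OF dk, of y]) (simp add: inner_sum_left)
    have "(\<Sum>l\<in>Basis. \<Sum>j\<in>Basis. (\<Sum>h\<in>Basis. (dk l \<bullet> h) * G h j ?z) * (y \<bullet> l) * (y \<bullet> j)) =
        (\<Sum>l\<in>Basis. \<Sum>j\<in>Basis. \<Sum>h\<in>Basis. (dk l \<bullet> h) * G h j ?z * (y \<bullet> l) * (y \<bullet> j))"
      by (simp add: sum_distrib_right)
    also have "\<dots> = (\<Sum>l\<in>Basis. \<Sum>h\<in>Basis. \<Sum>j\<in>Basis. (dk l \<bullet> h) * G h j ?z * (y \<bullet> l) * (y \<bullet> j))"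
      by (rule sum.cong[OF refl sum.swap])
    also have "\<dots> = (\<Sum>h\<in>Basis. \<Sum>l\<in>Basis. \<Sum>j\<in>Basis. (dk l \<bullet> h) * G h j ?z * (y \<bullet> l) * (y \<bullet> j))"
      by (rule sum.swap)
    also have "\<dots> = (\<Sum>h\<in>Basis. \<Sum>j\<in>Basis. \<Sum>l\<in>Basis. (dk l \<bullet> h) * G h j ?z * (y \<bullet> l) * (y \<bullet> j))"
      by (rule sum.cong[OF refl sum.swap])
    also have "\<dots> = (\<Sum>h\<in>Basis. \<Sum>j\<in>Basis. G h j ?z * (?m \<bullet> h) * (y \<bullet> j))"
      unfolding m by (intro sum.cong refl) (simp add: sum_distrib_left sum_distrib_right mult_ac)
    finally show ?thesis .
  qed
  also have "(\<Sum>l\<in>Basis. \<Sum>j\<in>Basis. (\<Sum>h\<in>Basis. (dk j \<bullet> h) * G l h ?z) * (y \<bullet> l) * (y \<bullet> j)) =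
      (\<Sum>l\<in>Basis. \<Sum>j\<in>Basis. G l j ?z * (y \<bullet> l) * (?m \<bullet> j))"
  proof (rule sum.cong[OF refl])
    fix l :: 'e
    have m: "?m \<bullet> h = (\<Sum>l\<in>Basis. (y \<bullet> l) * (dk l \<bullet> h))" for h
      by (subst linear_basis_sum[OF dk, of y]) (simp add: inner_sum_left)
    have "(\<Sum>j\<in>Basis. (\<Sum>h\<in>Basis. (dk j \<bullet> h) * G l h ?z) * (y \<bullet> l) * (y \<bullet> j)) =
        (\<Sum>j\<in>Basis. \<Sum>h\<in>Basis. (dk j \<bullet> h) * G l h ?z * (y \<bullet> l) * (y \<bullet> j))"
      by (simp add: sum_distrib_right)
    also have "\<dots> = (\<Sum>h\<in>Basis. \<Sum>j\<in>Basis. (dk j \<bullet> h) * G l h ?z * (y \<bullet> l) * (y \<bullet> j))"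
      by (rule sum.swap)
    also have "\<dots> = (\<Sum>h\<in>Basis. G l h ?z * (y \<bullet> l) * (?m \<bullet> h))"
      unfolding m by (intro sum.cong refl) (simp add: sum_distrib_left sum_distrib_right mult_ac)
    finally show "(\<Sum>j\<in>Basis. (\<Sum>h\<in>Basis. (dk j \<bullet> h) * G l h ?z) * (y \<bullet> l) * (y \<bullet> j)) =
        (\<Sum>j\<in>Basis. G l j ?z * (y \<bullet> l) * (?m \<bullet> j))" .
  qed
  finally show ?thesis
    by simp
qed

text \<open>By symmetry of second derivatives the time derivative of y = D\<psi> w is Dk(\<psi>) y.
  So (\<psi>, y) is an integral curve of the complete lift of \<open>k\<close>, along which the
  derivative of \<open>L\<close> vanishes by hypothesis.\<close>

lemma flow_invariance:
  fixes L :: "'e::euclidean_space \<times> 'e \<Rightarrow> real" and \<psi> :: "real \<times> 'p::euclidean_space \<Rightarrow> 'e"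
    and w :: "real \<times> 'p"
  assumes Q: "open Q" and \<psi>: "Ck_on 2 Q \<psi>" and flow: "\<And>q. q \<in> Q \<Longrightarrow> frechet_derivative \<psi> (at q) (1, 0) = k (\<psi> q)"
    and tx: "(t, x) \<in> Q" and k: "k differentiable (at (\<psi> (t, x)))"
  defines "y \<equiv> \<lambda>q. frechet_derivative \<psi> (at q) w"
  assumes L: "L differentiable (at (\<psi> (t, x), y (t, x)))"
    and inv: "frechet_derivative L (at (\<psi> (t, x), y (t, x)))
      (k (\<psi> (t, x)), frechet_derivative k (at (\<psi> (t, x))) (y (t, x))) = 0"
  shows "((\<lambda>s. L (\<psi> (s, x), y (s, x))) has_real_derivative 0) (at t)"
proof -
  let ?q = "(t, x)"
  have d\<psi>: "(\<psi> has_derivative frechet_derivative \<psi> (at ?q)) (at ?q)"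
    by (rule Ck_on_imp_has_derivative[OF \<psi> _ tx]) simp
  have y1: "Ck_on 1 Q y"
    unfolding y_def by (rule Ck_on_derivative[OF \<psi>]) simp
  have dy: "(y has_derivative frechet_derivative y (at ?q)) (at ?q)"
    by (rule Ck_on_imp_has_derivative[OF y1 _ tx]) simp
  have dk: "(k has_derivative frechet_derivative k (at (\<psi> ?q))) (at (\<psi> ?q))"
    using k by (simp add: frechet_derivative_works)
  have "frechet_derivative y (at ?q) (1, 0) =
      frechet_derivative (\<lambda>q. frechet_derivative \<psi> (at q) (1, 0)) (at ?q) w"
    unfolding y_def by (rule second_derivative_symmetric[OF Q \<psi> tx])
  also have "\<dots> = frechet_derivative (\<lambda>q. k (\<psi> q)) (at ?q) w"
    by (rule fun_cong[OF frechet_derivative_cong_open[OF Q tx]]) (rule flow)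
  also have "\<dots> = frechet_derivative k (at (\<psi> ?q)) (y ?q)"
    by (simp add: frechet_derivative_eqI[OF has_derivative_compose[OF d\<psi> dk]] y_def)
  finally have y_t: "frechet_derivative y (at ?q) (1, 0) = frechet_derivative k (at (\<psi> ?q)) (y ?q)" .
  have line: "((\<lambda>s. (s, x)) has_derivative (\<lambda>s. (s, 0))) (at t)"
    by (auto intro!: derivative_eq_intros)
  have "((\<lambda>q. (\<psi> q, y q)) has_derivative (\<lambda>v. (frechet_derivative \<psi> (at ?q) v, frechet_derivative y (at ?q) v))) (at ?q)"
    by (rule has_derivative_Pair[OF d\<psi> dy])
  moreover have "(L has_derivative frechet_derivative L (at (\<psi> ?q, y ?q))) (at (\<psi> ?q, y ?q))"
    using L by (simp add: frechet_derivative_works)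
  ultimately have "((\<lambda>q. L (\<psi> q, y q)) has_derivative
      (\<lambda>v. frechet_derivative L (at (\<psi> ?q, y ?q)) (frechet_derivative \<psi> (at ?q) v, frechet_derivative y (at ?q) v))) (at ?q)"
    by (rule has_derivative_compose)
  from has_derivative_compose[OF line this]
  have d: "((\<lambda>s. L (\<psi> (s, x), y (s, x))) has_derivative
      (\<lambda>s. frechet_derivative L (at (\<psi> ?q, y ?q)) (frechet_derivative \<psi> (at ?q) (s, 0), frechet_derivative y (at ?q) (s, 0)))) (at t)" .
  have "frechet_derivative L (at (\<psi> ?q, y ?q)) (frechet_derivative \<psi> (at ?q) (s, 0), frechet_derivative y (at ?q) (s, 0)) = 0" for s
  proof -
    have "frechet_derivative \<psi> (at ?q) (s, 0) = s *\<^sub>R k (\<psi> ?q)"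
      using linear_cmul[OF has_derivative_linear[OF d\<psi>], of s "(1, 0)"] flow[OF tx] by simp
    moreover have "frechet_derivative y (at ?q) (s, 0) = s *\<^sub>R frechet_derivative k (at (\<psi> ?q)) (y ?q)"
      using linear_cmul[OF has_derivative_linear[OF dy], of s "(1, 0)"] y_t by simp
    ultimately have "(frechet_derivative \<psi> (at ?q) (s, 0), frechet_derivative y (at ?q) (s, 0)) =
        s *\<^sub>R (k (\<psi> ?q), frechet_derivative k (at (\<psi> ?q)) (y ?q))"
      by simp
    then show ?thesis
      using linear_cmul[OF linear_frechet_derivative[OF L], of s] inv by (simp only: scaleR_zero_right)
  qed
  then have "((\<lambda>s. L (\<psi> (s, x), y (s, x))) has_derivative (\<lambda>s. 0)) (at t)"
    using d by (simp only:)
  moreover have "(*) (0 :: real) = (\<lambda>s. 0)"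
    by (rule ext) simp
  ultimately show ?thesis
    unfolding has_field_derivative_def by (simp only:)
qed

section \<open>Stationary Finsler spacetimes in natural coordinates\<close>

lemma vector_field_tangent:
  assumes M: "smooth_atlas M" and W: "W \<subseteq> mfd_space M" and X: "smooth_vector_field_on M W X" and p: "p \<in> W"
  shows "X p \<in> tangent_space M p"
  using smooth_map_on_mem[OF X[unfolded smooth_vector_field_on_def] M smooth_atlas_tb_atlas[OF M] W p]
  by (simp add: mfd_space_tb_atlas tangent_bundle_def)

lemma vector_field_components:
  assumes M: "smooth_atlas M" and W: "openin (mfd_top M) W" and X: "smooth_vector_field_on M W X" and c: "c \<in> M"
  shows "Ck_on k (snd c ` (W \<inter> fst c)) (\<lambda>x. X (chart_inv c x) c)"
proof -
  have Ws: "W \<subseteq> mfd_space M"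
    using W openin_mfd_top[OF M] by blast
  have tc: "tb_chart M c \<in> tb_atlas M"
    using c by (simp add: tb_atlas_def)
  have eq: "W \<inter> fst c \<inter> (\<lambda>p. (p, X p)) -` fst (tb_chart M c) = W \<inter> fst c"
    using vector_field_tangent[OF M Ws X] by (auto simp: fst_tb_chart)
  have "Ck_on k (snd c ` (W \<inter> fst c)) (snd (tb_chart M c) \<circ> (\<lambda>p. (p, X p)) \<circ> chart_inv c)"
    using smooth_map_on_chart(2)[OF M smooth_atlas_tb_atlas[OF M] W X[unfolded smooth_vector_field_on_def] c tc, of k]
    unfolding eq .
  from Ck_on_snd_compose[OF open_chart_image[OF M c W] this] show ?thesis
    by (simp add: snd_tb_chart)
qed

lemma form_index_cong:
  assumes "\<And>u w. u \<in> V \<Longrightarrow> w \<in> V \<Longrightarrow> b u w = b' u w"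
  shows "form_index V b = form_index V b'"
proof -
  have "{dim W |W. subspace W \<and> W \<subseteq> V \<and> (\<forall>w\<in>W. w \<noteq> 0 \<longrightarrow> b w w < 0)} =
      {dim W |W. subspace W \<and> W \<subseteq> V \<and> (\<forall>w\<in>W. w \<noteq> 0 \<longrightarrow> b' w w < 0)}"
    by (rule Collect_cong) (metis assms subsetD)
  then show ?thesis
    by (simp add: form_index_def)
qed

locale killing_spacetime =
  fixes M :: "('a, real \<times> 'e::euclidean_space) chart set"
    and L :: "'a \<times> ('a, real \<times> 'e) tvec \<Rightarrow> real"
    and T :: "('a \<times> ('a, real \<times> 'e) tvec) set"
    and K :: "'a \<Rightarrow> ('a, real \<times> 'e) tvec"
  assumes atlas: "smooth_atlas M"
    and line: "line_subbundle M T"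
    and stationary: "stationary_spacetime M L (tangent_bundle M - T) K"
begin

text \<open>The suffix c marks coordinate expressions with respect to a chart: of \<open>L\<close>,
  of \<open>K\<close>, and of the domain off \<open>T\<close>.\<close>

definition Lc :: "('a, real \<times> 'e) chart \<Rightarrow> (real \<times> 'e) \<times> (real \<times> 'e) \<Rightarrow> real" where
  "Lc c = L \<circ> chart_inv (tb_chart M c)"

definition Kc :: "('a, real \<times> 'e) chart \<Rightarrow> real \<times> 'e \<Rightarrow> real \<times> 'e" where
  "Kc c x = K (chart_inv c x) c"

definition Ac :: "('a, real \<times> 'e) chart \<Rightarrow> ((real \<times> 'e) \<times> (real \<times> 'e)) set" where
  "Ac c = snd (tb_chart M c) ` ((tangent_bundle M - T) \<inter> fst (tb_chart M c))"

text \<open>The fundamental tensor in coordinates. Unlike the iterated \<open>deriv\<close> in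
  \<open>fib_hess\<close>, it can be differentiated in the base point and in the fibre
  point.\<close>

definition hess :: "('a, real \<times> 'e) chart \<Rightarrow> (real \<times> 'e) \<times> (real \<times> 'e) \<Rightarrow> real \<times> 'e \<Rightarrow> real \<times> 'e \<Rightarrow> real" where
  "hess c z u w = 1 / 2 * frechet_derivative (\<lambda>z. frechet_derivative (Lc c) (at z) (0, w)) (at z) (0, u)"

lemma finsler: "finsler_spacetime M L (tangent_bundle M - T)"
  and killing: "killing_field M L (tangent_bundle M - T) K"
  and timelike: "p \<in> mfd_space M \<Longrightarrow> L (p, K p) < 0"
  using stationary by (auto simp: stationary_spacetime_def)

lemma cone: "cone_subset M (tangent_bundle M - T)"
  and L_C0: "Ck_fun (tb_atlas M) 0 (tangent_bundle M) L"
  and L_C3: "Ck_fun (tb_atlas M) 3 (tangent_bundle M - T) L"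
  using finsler by (auto simp: finsler_spacetime_def)

lemma finsler_props:
  "\<forall>(p, v)\<in>tangent_bundle M. \<forall>r>0. L (p, r *\<^sub>R v) = r\<^sup>2 * L (p, v)"
  "\<forall>(p, v)\<in>tangent_bundle M - T. nondeg_index_1 M L p v"
  "\<forall>B. openin (mfd_top (tb_atlas M)) B \<longrightarrow> B \<subseteq> tangent_bundle M - zero_section M \<longrightarrow>
     (\<forall>(p, v)\<in>B. fib_twice_differentiable_at M L p v \<and> nondeg_index_1 M L p v) \<longrightarrow> B \<subseteq> tangent_bundle M - T"
proof -
  note f = finsler[unfolded finsler_spacetime_def]
  show "\<forall>(p, v)\<in>tangent_bundle M. \<forall>r>0. L (p, r *\<^sub>R v) = r\<^sup>2 * L (p, v)"
    using f by (elim conjE)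
  show "\<forall>(p, v)\<in>tangent_bundle M - T. nondeg_index_1 M L p v"
    using f by (elim conjE)
  show "\<forall>B. openin (mfd_top (tb_atlas M)) B \<longrightarrow> B \<subseteq> tangent_bundle M - zero_section M \<longrightarrow>
     (\<forall>(p, v)\<in>B. fib_twice_differentiable_at M L p v \<and> nondeg_index_1 M L p v) \<longrightarrow> B \<subseteq> tangent_bundle M - T"
    using f by (elim conjE)
qed

lemma L_homogeneous: "p \<in> mfd_space M \<Longrightarrow> v \<in> tangent_space M p \<Longrightarrow> r > 0 \<Longrightarrow> L (p, r *\<^sub>R v) = r\<^sup>2 * L (p, v)"
  using finsler_props(1) by (auto simp: tangent_bundle_def)

lemma index_1: "(p, v) \<in> tangent_bundle M - T \<Longrightarrow> nondeg_index_1 M L p v"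
  using finsler_props(2) by auto

lemma L_zero: "p \<in> mfd_space M \<Longrightarrow> L (p, 0) = 0"
  by (rule homogeneous_zero) (rule L_homogeneous[OF _ tangent_space_0[OF atlas]])

lemma Lc_tvec: "c \<in> M \<Longrightarrow> x \<in> snd c ` fst c \<Longrightarrow> Lc c (x, y) = L (chart_inv c x, tvec M (chart_inv c x) c y)"
  by (simp add: Lc_def chart_inv_tb_chart atlas)

lemma Lc_eq: "c \<in> M \<Longrightarrow> p \<in> fst c \<Longrightarrow> v \<in> tangent_space M p \<Longrightarrow> Lc c (snd c p, v c) = L (p, v)"
  by (simp add: Lc_def chart_inv_tb_chart_left atlas)

lemma chart_point:
  assumes "c \<in> M" "x \<in> snd c ` fst c"
  obtains p where "p \<in> fst c" "x = snd c p" "chart_inv c x = p" "p \<in> mfd_space M"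
  using assms chart_inv_left[OF atlas assms(1)] mem_mfd_space[OF assms(1)] by auto

lemma Lc_homogeneous: "c \<in> M \<Longrightarrow> x \<in> snd c ` fst c \<Longrightarrow> r > 0 \<Longrightarrow> Lc c (x, r *\<^sub>R y) = r\<^sup>2 * Lc c (x, y)"
proof -
  assume c: "c \<in> M" "x \<in> snd c ` fst c" and r: "r > 0"
  obtain p where p: "p \<in> fst c" "x = snd c p" "chart_inv c x = p" "p \<in> mfd_space M"
    by (rule chart_point[OF c])
  have "tvec M p c (r *\<^sub>R y) = r *\<^sub>R tvec M p c y"
    using tvec_linear[OF atlas c(1) p(1), of r y 0 0] by simp
  then show ?thesis
    unfolding Lc_tvec[OF c] p(3)
    using L_homogeneous[OF p(4) tvec_in_tangent_space[OF atlas c(1) p(1)] r] by simp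
qed

lemma Lc_continuous: "c \<in> M \<Longrightarrow> continuous_on ((snd c ` fst c) \<times> UNIV) (Lc c)"
  using L_C0 tb_chart_image_bundle[OF atlas, of c] by (auto simp: Ck_fun_def tb_atlas_def Lc_def)

lemma K_smooth: "smooth_vector_field_on M (mfd_space M) K"
  using killing by (simp add: killing_field_def)

lemma openin_mfd_space: "openin (mfd_top M) (mfd_space M)"
  using topspace_mfd_top[OF atlas] openin_topspace[of "mfd_top M"] by simp

lemma K_tangent: "p \<in> mfd_space M \<Longrightarrow> K p \<in> tangent_space M p"
  by (rule vector_field_tangent[OF atlas subset_refl K_smooth])

lemma Kc_smooth: "c \<in> M \<Longrightarrow> Ck_on k (snd c ` fst c) (Kc c)"
proof -
  assume c: "c \<in> M"
  have "mfd_space M \<inter> fst c = fst c"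
    using mem_mfd_space[OF c] by blast
  then show ?thesis
    using vector_field_components[OF atlas openin_mfd_space K_smooth c, of k] by (simp add: Kc_def[abs_def])
qed

lemma Kc_eq: "c \<in> M \<Longrightarrow> p \<in> fst c \<Longrightarrow> Kc c (snd c p) = K p c"
  by (simp add: Kc_def chart_inv_left[OF atlas])

lemma open_Ac: "c \<in> M \<Longrightarrow> open (Ac c)"
  unfolding Ac_def
  by (rule open_chart_image[OF smooth_atlas_tb_atlas[OF atlas]])
    (use cone in \<open>auto simp: tb_atlas_def cone_subset_def\<close>)

lemma Lc_C3: "c \<in> M \<Longrightarrow> Ck_on 3 (Ac c) (Lc c)"
  using L_C3 by (auto simp: Ck_fun_def tb_atlas_def Lc_def Ac_def)

lemma Ac_iff:
  assumes c: "c \<in> M" "p \<in> fst c" and v: "v \<in> tangent_space M p"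
  shows "(snd c p, v c) \<in> Ac c \<longleftrightarrow> (p, v) \<notin> T"
  unfolding Ac_def tb_chart_image[OF atlas c(1)]
  using assms mem_mfd_space[OF c] by (simp add: chart_inv_left[OF atlas c] tvec_eq tangent_bundle_def)

lemma Ac_subset: "c \<in> M \<Longrightarrow> Ac c \<subseteq> (snd c ` fst c) \<times> UNIV"
  unfolding Ac_def using tb_chart_image_bundle[OF atlas, of c] by blast

lemma second_derivative_Ck: "c \<in> M \<Longrightarrow> Ck_on 1 (Ac c) (\<lambda>z. hess c z u w)"
  and first_derivative_Ck: "c \<in> M \<Longrightarrow> Ck_on 2 (Ac c) (\<lambda>z. frechet_derivative (Lc c) (at z) (0, w))"
proof -
  assume c: "c \<in> M"
  show 1: "Ck_on 2 (Ac c) (\<lambda>z. frechet_derivative (Lc c) (at z) (0, w))" for w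
    by (rule Ck_on_derivative[OF Lc_C3[OF c]]) simp
  have "Ck_on 1 (Ac c) (\<lambda>z. frechet_derivative (\<lambda>z. frechet_derivative (Lc c) (at z) (0, w)) (at z) (0, u))"
    by (rule Ck_on_derivative[OF 1]) simp
  then show "Ck_on 1 (Ac c) (\<lambda>z. hess c z u w)"
    unfolding hess_def by (rule Ck_on_mult[OF open_Ac[OF c] Ck_on_const])
qed

lemma hess_linear: "c \<in> M \<Longrightarrow> z \<in> Ac c \<Longrightarrow> linear (\<lambda>u. hess c z u w)"
proof -
  assume c: "c \<in> M" and z: "z \<in> Ac c"
  have "linear (frechet_derivative (\<lambda>z. frechet_derivative (Lc c) (at z) (0, w)) (at z))"
    using first_derivative_Ck[OF c] z by (intro linear_frechet_derivative Ck_on_imp_differentiable[of 2 "Ac c"]) auto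
  note lin = linear_add[OF this] linear_cmul[OF this]
  show ?thesis
  proof (rule linearI)
    show "hess c z (u + v) w = hess c z u w + hess c z v w" for u v
      using lin(1)[of "(0, u)" "(0, v)"] by (simp add: hess_def algebra_simps)
    show "hess c z (r *\<^sub>R u) w = r *\<^sub>R hess c z u w" for r u
      using lin(2)[of r "(0, u)"] by (simp add: hess_def)
  qed
qed

lemma hess_sym: "c \<in> M \<Longrightarrow> z \<in> Ac c \<Longrightarrow> hess c z u w = hess c z w u"
proof -
  assume c: "c \<in> M" and z: "z \<in> Ac c"
  have "Ck_on 2 (Ac c) (Lc c)"
    by (rule Ck_on_le[OF Lc_C3[OF c]]) simp
  from second_derivative_symmetric_real[OF open_Ac[OF c] this z] show ?thesis
    by (simp add: hess_def)
qed

lemma L_line: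
  assumes c: "c \<in> M" "p \<in> fst c" and v: "v \<in> tangent_space M p" "u \<in> tangent_space M p"
    and f: "Lc c differentiable (at (snd c p, v c))"
  shows "((\<lambda>s. L (p, v + s *\<^sub>R u)) has_real_derivative frechet_derivative (Lc c) (at (snd c p, v c)) (0, u c)) (at 0)"
proof -
  have "((\<lambda>s. Lc c ((snd c p, v c) + s *\<^sub>R (0, u c))) has_vector_derivative
      frechet_derivative (Lc c) (at (snd c p, v c)) (0, u c)) (at 0)"
    by (rule has_vector_derivative_line) (use f in \<open>simp add: frechet_derivative_works\<close>)
  moreover have "Lc c ((snd c p, v c) + s *\<^sub>R (0, u c)) = L (p, v + s *\<^sub>R u)" for s
    using Lc_eq[OF c tangent_space_add[OF atlas v(1) tangent_space_scaleR[OF atlas v(2)]], of s] by simp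
  ultimately show ?thesis
    by (simp add: has_real_derivative_iff_has_vector_derivative)
qed

text \<open>The outer \<open>deriv\<close> needs the inner one only at vectors v + s u with s small,
  and these are off \<open>T\<close> because the domain is open.\<close>

lemma fib_hess_eq:
  assumes c: "c \<in> M" "p \<in> fst c" and v: "v \<in> tangent_space M p" "(p, v) \<notin> T"
    and u: "u \<in> tangent_space M p" "w \<in> tangent_space M p"
  shows "fib_hess L p v u w = hess c (snd c p, v c) (u c) (w c)"
proof -
  let ?D = "\<lambda>z. frechet_derivative (Lc c) (at z) (0, w c)"
  have z: "(snd c p, v c) \<in> Ac c"
    using Ac_iff[OF c v(1)] v(2) by simp
  have line: "(snd c p, (v + s *\<^sub>R u) c) = (snd c p, v c) + s *\<^sub>R (0, u c)" for s
    by simp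
  have "((\<lambda>s. (snd c p, v c) + s *\<^sub>R (0, u c)) \<longlongrightarrow> (snd c p, v c) + 0 *\<^sub>R (0, u c)) (nhds (0::real))"
    by (intro tendsto_intros filterlim_ident)
  then have ev: "\<forall>\<^sub>F s in nhds 0. (snd c p, v c) + s *\<^sub>R (0, u c) \<in> Ac c"
    using open_Ac[OF c(1)] z by (intro topological_tendstoD) auto
  have inner: "\<forall>\<^sub>F s in nhds 0. deriv (\<lambda>s\<^sub>2. L (p, v + s *\<^sub>R u + s\<^sub>2 *\<^sub>R w)) 0 = ?D ((snd c p, v c) + s *\<^sub>R (0, u c))"
    using ev
  proof eventually_elim
    case (elim s)
    have vs: "v + s *\<^sub>R u \<in> tangent_space M p"
      by (intro tangent_space_add tangent_space_scaleR atlas v u)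
    have "Lc c differentiable (at (snd c p, (v + s *\<^sub>R u) c))"
      unfolding line using Lc_C3[OF c(1)] elim by (intro Ck_on_imp_differentiable[of 3 "Ac c"]) auto
    from DERIV_imp_deriv[OF L_line[OF c vs u(2) this]] show ?case
      unfolding line .
  qed
  have "(?D has_derivative frechet_derivative ?D (at (snd c p, v c))) (at (snd c p, v c))"
    using first_derivative_Ck[OF c(1)] z by (intro Ck_on_imp_has_derivative[of 2 "Ac c"]) auto
  then have "((\<lambda>s. ?D ((snd c p, v c) + s *\<^sub>R (0, u c))) has_vector_derivative frechet_derivative ?D (at (snd c p, v c)) (0, u c)) (at 0)"
    by (intro has_vector_derivative_line) simp
  then have "deriv (\<lambda>s. ?D ((snd c p, v c) + s *\<^sub>R (0, u c))) 0 = frechet_derivative ?D (at (snd c p, v c)) (0, u c)"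
    by (intro DERIV_imp_deriv) (simp add: has_real_derivative_iff_has_vector_derivative)
  then have "deriv (\<lambda>s. deriv (\<lambda>s\<^sub>2. L (p, v + s *\<^sub>R u + s\<^sub>2 *\<^sub>R w)) 0) 0 = frechet_derivative ?D (at (snd c p, v c)) (0, u c)"
    using deriv_cong_ev[OF inner refl] by simp
  then show ?thesis
    by (simp add: fib_hess_def hess_def)
qed

text \<open>Euler's relation, computed directly from L(v + s v + t v) = (1 + s + t)^2 L(v), which
  holds as long as 1 + s + t > 0.\<close>

lemma fib_hess_self:
  assumes "p \<in> mfd_space M" "v \<in> tangent_space M p"
  shows "fib_hess L p v v v = L (p, v)"
proof -
  have L: "L (p, v + s *\<^sub>R v + t *\<^sub>R v) = (1 + s + t)\<^sup>2 * L (p, v)" if "1 + s + t > 0" for s t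
    using L_homogeneous[OF assms that] by (simp add: scaleR_left_distrib)
  have inner: "\<forall>\<^sub>F s in nhds 0. deriv (\<lambda>t. L (p, v + s *\<^sub>R v + t *\<^sub>R v)) 0 = 2 * (1 + s) * L (p, v)"
  proof -
    have "\<forall>\<^sub>F s in nhds (0::real). s \<in> {-1<..}"
      by (intro eventually_nhds_in_open) auto
    then show ?thesis
    proof eventually_elim
      case (elim s)
      have "\<forall>\<^sub>F t in nhds (0::real). t \<in> {-1 - s<..}"
        using elim by (intro eventually_nhds_in_open) auto
      then have ev: "\<forall>\<^sub>F t in nhds 0. L (p, v + s *\<^sub>R v + t *\<^sub>R v) = (1 + s + t)\<^sup>2 * L (p, v)"
        by eventually_elim (auto intro: L)
      have der: "((\<lambda>t. (1 + s + t)\<^sup>2 * L (p, v)) has_real_derivative 2 * (1 + s) * L (p, v)) (at 0)"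
        by (auto intro!: derivative_eq_intros)
      show ?case
        using deriv_cong_ev[OF ev refl] DERIV_imp_deriv[OF der] by simp
    qed
  qed
  have "((\<lambda>s. 2 * (1 + s) * L (p, v)) has_real_derivative 2 * L (p, v)) (at 0)"
    by (auto intro!: derivative_eq_intros)
  then show ?thesis
    using deriv_cong_ev[OF inner refl] by (simp add: fib_hess_def DERIV_imp_deriv)
qed

text \<open>Euler's relation writes \<open>L\<close> as a quadratic expression in y with
  coefficients \<open>hess\<close>; the Killing equation is then the hypothesis of
  \<open>killing_identity\<close>.\<close>

lemma Lc_killing:
  assumes c: "c \<in> M" and z: "(x, y) \<in> Ac c"
  shows "frechet_derivative (Lc c) (at (x, y)) (Kc c x, frechet_derivative (Kc c) (at x) y) = 0"
proof -
  let ?dK = "frechet_derivative (Kc c) (at x)" and ?G = "\<lambda>l j z. hess c z l j"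
  have xR: "x \<in> snd c ` fst c" if "(x, y) \<in> Ac c" for x y
    using Ac_subset[OF c] that by auto
  have dK: "(Kc c has_derivative ?dK) (at x)"
    using Kc_smooth[OF c, of 1] xR[OF z] by (intro Ck_on_imp_has_derivative) auto
  have g: "g_coord M L c l j z = hess c z l j" if zA: "z \<in> Ac c" for l j z
  proof -
    obtain x y where xy: "z = (x, y)" "x \<in> snd c ` fst c"
      using xR zA by (cases z) auto
    obtain p where p: "p \<in> fst c" "x = snd c p" "chart_inv c x = p" "p \<in> mfd_space M"
      by (rule chart_point[OF c xy(2)])
    have t: "tvec M p c b \<in> tangent_space M p" "tvec M p c b c = b" for b
      using tvec_in_tangent_space[OF atlas c p(1)] tvec_component[OF atlas c p(1)] by auto
    have "(p, tvec M p c y) \<notin> T"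
      using Ac_iff[OF c p(1) t(1)] zA by (simp add: t xy p)
    then show ?thesis
      using fib_hess_eq[OF c p(1) t(1) _ t(1) t(1)] xy p by (simp add: g_coord_def chart_inv_tb_chart atlas c t)
  qed
  have vf: "vf_coord c K h = (\<lambda>x. Kc c x \<bullet> h)" for h
    by (simp add: vf_coord_def Kc_def fun_eq_iff)
  have pvf: "partial (vf_coord c K h) i x = ?dK i \<bullet> h" for h i
    unfolding vf partial_def using has_derivative_inner_left[OF dK, of h] by (simp add: frechet_derivative_eqI)
  have pg: "partial (g_coord M L c l j) w (x, y) = frechet_derivative (?G l j) (at (x, y)) w" for l j w
    unfolding partial_def by (rule fun_cong[OF frechet_derivative_cong_open[OF open_Ac[OF c] z g]])
  have dG: "?G l j differentiable (at (x, y))" for l j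
    using second_derivative_Ck[OF c] z by (intro Ck_on_imp_differentiable[of 1 "Ac c"]) auto
  show ?thesis
  proof (rule killing_identity[where dk = ?dK and G = ?G, OF open_Ac[OF c] z])
    show "linear ?dK"
      using dK by (rule has_derivative_linear)
    show "?G l j differentiable (at (x, y))" for l j
      by (rule dG)
    show "Lc c (x, y) = (\<Sum>l\<in>Basis. \<Sum>j\<in>Basis. hess c (x, y) l j * (y \<bullet> l) * (y \<bullet> j))"
      if xy: "(x, y) \<in> Ac c" for x y
    proof -
      obtain p where p: "p \<in> fst c" "x = snd c p" "chart_inv c x = p" "p \<in> mfd_space M"
        by (rule chart_point[OF c xR[OF xy]])
      let ?v = "tvec M p c y"
      have v: "?v \<in> tangent_space M p" "?v c = y"
        using tvec_in_tangent_space[OF atlas c p(1)] tvec_component[OF atlas c p(1)] by auto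
      have "(p, ?v) \<notin> T"
        using Ac_iff[OF c p(1) v(1)] xy v(2) p(2) by simp
      then have "Lc c (x, y) = hess c (x, y) y y"
        using fib_hess_eq[OF c p(1) v(1) _ v(1) v(1)] fib_hess_self[OF p(4) v(1)] Lc_eq[OF c p(1) v(1)] v(2) p(2) by simp
      also have "\<dots> = (\<Sum>l\<in>Basis. (y \<bullet> l) *\<^sub>R hess c (x, y) l y)"
        by (rule linear_basis_sum[OF hess_linear[OF c xy]])
      also have "\<dots> = (\<Sum>l\<in>Basis. (y \<bullet> l) *\<^sub>R (\<Sum>j\<in>Basis. (y \<bullet> j) *\<^sub>R hess c (x, y) l j))"
      proof (intro sum.cong refl arg_cong[where f = "scaleR _"])
        fix l :: "real \<times> 'e"
        have "hess c (x, y) l y = hess c (x, y) y l"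
          by (rule hess_sym[OF c xy])
        also have "\<dots> = (\<Sum>j\<in>Basis. (y \<bullet> j) *\<^sub>R hess c (x, y) j l)"
          by (rule linear_basis_sum[OF hess_linear[OF c xy]])
        also have "\<dots> = (\<Sum>j\<in>Basis. (y \<bullet> j) *\<^sub>R hess c (x, y) l j)"
          by (simp only: hess_sym[OF c xy, of _ l])
        finally show "hess c (x, y) l y = (\<Sum>j\<in>Basis. (y \<bullet> j) *\<^sub>R hess c (x, y) l j)" .
      qed
      also have "\<dots> = (\<Sum>l\<in>Basis. \<Sum>j\<in>Basis. hess c (x, y) l j * (y \<bullet> l) * (y \<bullet> j))"
        by (simp add: sum_distrib_left mult_ac)
      finally show ?thesis .
    qed
    fix l j :: "real \<times> 'e"
    assume lj: "l \<in> Basis" "j \<in> Basis"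
    have zi: "(x, y) \<in> snd (tb_chart M c) ` ((tangent_bundle M - T) \<inter> fst (tb_chart M c))"
      using z by (simp add: Ac_def)
    have "\<forall>(x, y)\<in>snd (tb_chart M c) ` ((tangent_bundle M - T) \<inter> fst (tb_chart M c)). \<forall>l\<in>Basis. \<forall>j\<in>Basis.
        (\<Sum>h\<in>Basis. vf_coord c K h x * partial (g_coord M L c l j) (h, 0) (x, y)
            + (\<Sum>i\<in>Basis. partial (vf_coord c K h) i x * (y \<bullet> i)) *
                partial (g_coord M L c l j) (0, h) (x, y))
        + (\<Sum>h\<in>Basis. partial (vf_coord c K h) l x * g_coord M L c h j (x, y))
        + (\<Sum>h\<in>Basis. partial (vf_coord c K h) j x * g_coord M L c l h (x, y)) = 0"
      using killing c by (simp add: killing_field_def)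
    from bspec[OF this zi, simplified split_conv, rule_format, OF lj]
    have k0: "(\<Sum>h\<in>Basis. (Kc c x \<bullet> h) * frechet_derivative (?G l j) (at (x, y)) (h, 0)
            + (\<Sum>i\<in>Basis. (?dK i \<bullet> h) * (y \<bullet> i)) * frechet_derivative (?G l j) (at (x, y)) (0, h))
        + (\<Sum>h\<in>Basis. (?dK l \<bullet> h) * hess c (x, y) h j)
        + (\<Sum>h\<in>Basis. (?dK j \<bullet> h) * hess c (x, y) l h) = 0"
      unfolding pvf pg g[OF z] unfolding vf .
    have lin: "linear (frechet_derivative (?G l j) (at (x, y)))"
      by (rule linear_frechet_derivative[OF dG])
    have l1: "linear (\<lambda>a. frechet_derivative (?G l j) (at (x, y)) (a, 0))"
      "linear (\<lambda>a. frechet_derivative (?G l j) (at (x, y)) (0, a))"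
      using linear_compose[OF _ lin, of "\<lambda>a. (a, 0)"] linear_compose[OF _ lin, of "\<lambda>a. (0, a)"]
      by (auto simp: o_def linear_iff)
    have m: "?dK y \<bullet> h = (\<Sum>i\<in>Basis. (?dK i \<bullet> h) * (y \<bullet> i))" for h
      by (subst linear_basis_sum[OF has_derivative_linear[OF dK], of y]) (simp add: inner_sum_left mult.commute)
    have "frechet_derivative (?G l j) (at (x, y)) (Kc c x, ?dK y) =
        frechet_derivative (?G l j) (at (x, y)) (Kc c x, 0) + frechet_derivative (?G l j) (at (x, y)) (0, ?dK y)"
      using linear_add[OF lin, of "(Kc c x, 0)" "(0, ?dK y)"] by simp
    also have "\<dots> = (\<Sum>h\<in>Basis. (Kc c x \<bullet> h) * frechet_derivative (?G l j) (at (x, y)) (h, 0)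
            + (\<Sum>i\<in>Basis. (?dK i \<bullet> h) * (y \<bullet> i)) * frechet_derivative (?G l j) (at (x, y)) (0, h))"
      unfolding linear_basis_sum[OF l1(1), of "Kc c x"] linear_basis_sum[OF l1(2), of "?dK y"] m
      by (simp add: sum.distrib)
    finally show "frechet_derivative (?G l j) (at (x, y)) (Kc c x, ?dK y) + (\<Sum>h\<in>Basis. (?dK l \<bullet> h) * hess c (x, y) h j) +
        (\<Sum>h\<in>Basis. (?dK j \<bullet> h) * hess c (x, y) l h) = 0"
      using k0 by simp
  qed
qed

section \<open>The Killing field spans the line bundle\<close>

text \<open>By homogeneity, twice differentiability at the zero vector alone makes \<open>L\<close>
  a quadratic form on the fibre, and the Hessian of a quadratic form is constant.\<close>

lemma fib_hess_twice_differentiable: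
  assumes p: "p \<in> mfd_space M" and d: "fib_twice_differentiable_at M L p 0"
    and u: "u \<in> tangent_space M p" "w \<in> tangent_space M p" and v: "v \<in> tangent_space M p" "v' \<in> tangent_space M p"
  shows "fib_hess L p v u w = fib_hess L p v' u w"
proof -
  obtain c where c: "c \<in> M" "p \<in> fst c"
    using p by (auto simp: mfd_space_def)
  define f where "f = (\<lambda>y. Lc c (snd c p, y))"
  have cp: "snd c p \<in> snd c ` fst c"
    using c by auto
  have tw: "twice_differentiable_at f 0"
    using d c unfolding fib_twice_differentiable_at_def f_def Lc_def by force
  have hom: "f (r *\<^sub>R y) = r\<^sup>2 * f y" if "r > 0" for r y
    unfolding f_def by (rule Lc_homogeneous[OF c(1) cp that])
  define B where "B = (\<lambda>u. frechet_derivative (\<lambda>x. frechet_derivative f (at x) u) (at 0))"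
  have B: "linear (B u)" "(f has_derivative (\<lambda>u. B u y)) (at y)" for u y
    unfolding B_def by (rule twice_differentiable_homogeneous[OF tw]; rule hom; assumption)+
  have eq: "fib_hess L p v u w = 1 / 2 * B (w c) (u c)" if v: "v \<in> tangent_space M p" for v
  proof -
    have Lf: "L (p, v + s *\<^sub>R u + t *\<^sub>R w) = f ((v c + s *\<^sub>R u c) + t *\<^sub>R w c)" for s t
      using Lc_eq[OF c, of "v + s *\<^sub>R u + t *\<^sub>R w"] v u
      by (simp add: f_def tangent_space_add tangent_space_scaleR atlas)
    have "deriv (\<lambda>t. L (p, v + s *\<^sub>R u + t *\<^sub>R w)) 0 = B (w c) (v c + s *\<^sub>R u c)" for s
    proof (rule DERIV_imp_deriv)
      have "((\<lambda>t. f ((v c + s *\<^sub>R u c) + t *\<^sub>R w c)) has_vector_derivative B (w c) (v c + s *\<^sub>R u c)) (at 0)"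
        by (rule has_vector_derivative_line) (use B(2) in simp)
      then show "((\<lambda>t. L (p, v + s *\<^sub>R u + t *\<^sub>R w)) has_real_derivative B (w c) (v c + s *\<^sub>R u c)) (at 0)"
        by (simp add: Lf has_real_derivative_iff_has_vector_derivative)
    qed
    moreover have "((\<lambda>s. B (w c) (v c + s *\<^sub>R u c)) has_real_derivative B (w c) (u c)) (at 0)"
      using linear_add[OF B(1)] linear_cmul[OF B(1)] by (auto intro!: derivative_eq_intros)
    ultimately show ?thesis
      by (simp add: fib_hess_def DERIV_imp_deriv)
  qed
  show ?thesis
    by (simp only: eq[OF v(1)] eq[OF v(2)])
qed

lemma line_section:
  assumes p: "p \<in> mfd_space M"
  shows "\<exists>X. X \<noteq> 0 \<and> {v. (p, v) \<in> T} = span {X}"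
proof -
  have "\<forall>p\<in>mfd_space M. \<exists>W X. openin (mfd_top M) W \<and> p \<in> W \<and> smooth_vector_field_on M W X \<and>
      (\<forall>q\<in>W. X q \<noteq> 0 \<and> {v. (q, v) \<in> T} = span {X q})"
    using line unfolding line_subbundle_def by (elim conjE)
  from bspec[OF this p] obtain W X where W: "p \<in> W" "\<forall>q\<in>W. X q \<noteq> 0 \<and> {v. (q, v) \<in> T} = span {X q}"
    by (elim exE conjE)
  show ?thesis
    using bspec[OF W(2,1)] by (intro exI[of _ "X p"])
qed

text \<open>On the set \<open>W\<close> where \<open>K\<close> is off \<open>T\<close>, each fibre
  carries a quadratic form whose index is known from one vector of the cone. All nonzero vectors
  over \<open>W\<close> then meet the requirements of the maximal domain, which contradicts that
  \<open>T\<close> excludes a line in each fibre.\<close>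

lemma K_in_T:
  assumes a: "\<And>z. z \<in> mfd_space M \<Longrightarrow> \<not> (\<forall>v\<in>tangent_space M z. fib_twice_differentiable_at M L z v) \<Longrightarrow> (z, K z) \<in> T"
    and z: "z \<in> mfd_space M"
  shows "(z, K z) \<in> T"
proof (rule ccontr)
  assume notin: "(z, K z) \<notin> T"
  let ?A = "tangent_bundle M - T"
  let ?tb = "mfd_top (tb_atlas M)"
  \<comment> \<open>Open, because the domain off \<open>T\<close> is open and \<open>K\<close> is
    continuous.\<close>
  define W where "W = {p \<in> mfd_space M. (p, K p) \<in> ?A}"
  define B where "B = {(p, v). p \<in> W \<and> v \<in> tangent_space M p \<and> v \<noteq> 0}"
  have "openin (subtopology (mfd_top M) (mfd_space M)) {p \<in> topspace (subtopology (mfd_top M) (mfd_space M)). (p, K p) \<in> ?A}"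
  proof (rule openin_continuous_map_preimage[where Y = ?tb])
    show "continuous_map (subtopology (mfd_top M) (mfd_space M)) ?tb (\<lambda>p. (p, K p))"
      using K_smooth by (simp add: smooth_vector_field_on_def smooth_map_on_def)
    show "openin ?tb ?A"
      using cone by (simp add: cone_subset_def)
  qed
  then have W: "openin (mfd_top M) W"
    using openin_mfd_space topspace_mfd_top[OF atlas] by (simp add: W_def openin_open_subtopology)
  have zW: "z \<in> W"
    using z notin K_tangent[OF z] by (auto simp: W_def tangent_bundle_def)
  have Ws: "W \<subseteq> mfd_space M"
    by (auto simp: W_def)
  have Bo: "openin ?tb B"
    unfolding openin_mfd_top[OF smooth_atlas_tb_atlas[OF atlas]] mfd_space_tb_atlas
  proof (intro conjI ballI)
    show "B \<subseteq> tangent_bundle M"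
      using Ws by (auto simp: B_def tangent_bundle_def)
    fix d
    assume "d \<in> tb_atlas M"
    then obtain c where c: "c \<in> M" "d = tb_chart M c"
      by (auto simp: tb_atlas_def)
    have B_iff: "(chart_inv c x, tvec M (chart_inv c x) c y) \<in> B \<longleftrightarrow> chart_inv c x \<in> W \<and> y \<noteq> 0" if x: "x \<in> snd c ` fst c" for x y
    proof -
      obtain p where p: "p \<in> fst c" "x = snd c p" "chart_inv c x = p" "p \<in> mfd_space M"
        by (rule chart_point[OF c(1) x])
      have "tvec M p c y = 0 \<longleftrightarrow> y = 0"
        using tvec_0[OF atlas c(1) p(1)] tvec_component[OF atlas c(1) p(1), of y] by (metis zero_fun_apply)
      then show ?thesis
        using tvec_in_tangent_space[OF atlas c(1) p(1)] by (simp add: B_def p(3))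
    qed
    have "snd d ` (B \<inter> fst d) = (snd c ` (W \<inter> fst c)) \<times> - {0}"
      unfolding c(2) tb_chart_image[OF atlas c(1)] chart_image_Int[OF atlas c(1), of W]
    proof (rule set_eqI)
      fix w :: "(real \<times> 'e) \<times> (real \<times> 'e)"
      obtain x y where w: "w = (x, y)"
        by (cases w)
      show "w \<in> {(x, y). x \<in> snd c ` fst c \<and> (chart_inv c x, tvec M (chart_inv c x) c y) \<in> B} \<longleftrightarrow>
          w \<in> {x \<in> snd c ` fst c. chart_inv c x \<in> W} \<times> - {0}"
        unfolding w using B_iff[of x y] by simp blast
    qed
    then show "open (snd d ` (B \<inter> fst d))"
      using open_chart_image[OF atlas c(1) W] by (auto intro!: open_Times)
  qed
  have Bs: "B \<subseteq> tangent_bundle M - zero_section M"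
    using Ws by (auto simp: B_def tangent_bundle_def zero_section_def)
  have Bt: "fib_twice_differentiable_at M L p v \<and> nondeg_index_1 M L p v" if pv: "(p, v) \<in> B" for p v
  proof -
    have p: "p \<in> W" "p \<in> mfd_space M" "v \<in> tangent_space M p"
      using pv Ws by (auto simp: B_def)
    have tw: "fib_twice_differentiable_at M L p v" if "v \<in> tangent_space M p" for v
      using a[OF p(2)] p(1) that by (auto simp: W_def)
    \<comment> \<open>The cone has a vector in every fibre; nondegeneracy and index are transferred
      from it to \<open>v\<close>.\<close>
    have "p \<in> fst ` ?A"
      using cone p(2) by (simp add: cone_subset_def)
    then obtain v0 where v0: "(p, v0) \<in> ?A"
      by auto
    then have v0t: "v0 \<in> tangent_space M p"
      by (auto simp: tangent_bundle_def)
    have eq: "fib_hess L p v u w = fib_hess L p v0 u w" if "u \<in> tangent_space M p" "w \<in> tangent_space M p" for u w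
      by (rule fib_hess_twice_differentiable[OF p(2) tw[OF tangent_space_0[OF atlas]] that p(3) v0t])
    have "nondegenerate_on (tangent_space M p) (fib_hess L p v) \<longleftrightarrow> nondegenerate_on (tangent_space M p) (fib_hess L p v0)"
      by (simp add: nondegenerate_on_def eq)
    moreover have "form_index (tangent_space M p) (fib_hess L p v) = form_index (tangent_space M p) (fib_hess L p v0)"
      by (rule form_index_cong[OF eq])
    ultimately have "nondeg_index_1 M L p v"
      using index_1[OF v0] by (simp add: nondeg_index_1_def)
    then show ?thesis
      using tw[OF p(3)] by simp
  qed
  have "\<forall>(p, v)\<in>B. fib_twice_differentiable_at M L p v \<and> nondeg_index_1 M L p v"
    using Bt by auto
  from finsler_props(3)[THEN spec, THEN mp, THEN mp, THEN mp, OF Bo Bs this] have "B \<subseteq> ?A" .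
  \<comment> \<open>A nonzero vector on the line over \<open>z\<close> belongs to \<open>B\<close>
    but also to \<open>T\<close>.\<close>
  obtain X where X: "X \<noteq> 0" "{v. (z, v) \<in> T} = span {X}"
    using line_section[OF z] by (elim exE conjE)
  have "X \<in> {v. (z, v) \<in> T}"
    unfolding X(2) by (rule span_base) simp
  then have XT: "(z, X) \<in> T"
    by simp
  then have "X \<in> tangent_space M z"
    using line by (auto simp: line_subbundle_def tangent_bundle_def)
  then have "(z, X) \<in> B"
    using zW X(1) by (simp add: B_def)
  then show False
    using XT \<open>B \<subseteq> ?A\<close> by auto
qed

text \<open>\<open>K\<close> does not vanish, since L(K) < 0 = L(0), so it spans the line in which
  it lies.\<close>

lemma T_iff:
  assumes KT: "(p, K p) \<in> T" and p: "p \<in> mfd_space M"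
  shows "(p, v) \<in> T \<longleftrightarrow> (\<exists>r. v = r *\<^sub>R K p)"
proof -
  obtain X where X: "X \<noteq> 0" "{v. (p, v) \<in> T} = span {X}"
    using line_section[OF p] by (elim exE conjE)
  have T: "(p, v) \<in> T \<longleftrightarrow> (\<exists>r. v = r *\<^sub>R X)" for v
    using X(2) unfolding span_singleton by auto
  obtain k where k: "K p = k *\<^sub>R X"
    using T[of "K p"] KT by auto
  have "K p \<noteq> 0"
    using timelike[OF p] L_zero[OF p] by auto
  then have "k \<noteq> 0"
    using k by auto
  then have X': "X = inverse k *\<^sub>R K p"
    using k by simp
  show ?thesis
    unfolding T by (metis X' k scaleR_scaleR)
qed

end

text \<open>A vector orthogonal to the timelike \<open>k\<close> and of negative square would span
  with \<open>k\<close> a negative definite plane, against index 1. If \<open>a\<close> is null,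
  nondegeneracy provides a vector orthogonal to \<open>k\<close> but not to \<open>a\<close>, and a
  suitable combination of the two has negative square.\<close>

lemma index_1_positive:
  fixes g :: "'v::real_vector \<Rightarrow> 'v \<Rightarrow> real"
  assumes V: "subspace V" "finite B" "V \<subseteq> span B"
    and lin: "\<And>u w y a b. u \<in> V \<Longrightarrow> w \<in> V \<Longrightarrow> y \<in> V \<Longrightarrow> g (a *\<^sub>R u + b *\<^sub>R w) y = a * g u y + b * g w y"
    and sym: "\<And>u w. u \<in> V \<Longrightarrow> w \<in> V \<Longrightarrow> g u w = g w u"
    and nondeg: "nondegenerate_on V g" and index: "form_index V g = 1"
    and k: "k \<in> V" "g k k < 0" and a: "a \<in> V" "g a k = 0" "a \<noteq> 0"
  shows "g a a > 0"
proof (rule ccontr)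
  assume not_pos: "\<not> g a a > 0"
  have quad: "g (x *\<^sub>R u + y *\<^sub>R w) (x *\<^sub>R u + y *\<^sub>R w) = x\<^sup>2 * g u u + 2 * x * y * g u w + y\<^sup>2 * g w w"
    if "u \<in> V" "w \<in> V" for x y u w
  proof -
    have s: "x *\<^sub>R u + y *\<^sub>R w \<in> V"
      using V(1) that by (intro subspace_add subspace_scale)
    have "g (x *\<^sub>R u + y *\<^sub>R w) (x *\<^sub>R u + y *\<^sub>R w) =
        x * g (x *\<^sub>R u + y *\<^sub>R w) u + y * g (x *\<^sub>R u + y *\<^sub>R w) w"
      unfolding lin[OF that s] sym[OF that(1) s] sym[OF that(2) s] ..
    also have "\<dots> = x * (x * g u u + y * g w u) + y * (x * g u w + y * g w w)"
      unfolding lin[OF that that(1)] lin[OF that that(2)] ..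
    also have "\<dots> = x\<^sup>2 * g u u + 2 * x * y * g u w + y\<^sup>2 * g w w"
      unfolding sym[OF that(2,1)] by (simp add: power2_eq_square algebra_simps)
    finally show ?thesis .
  qed
  have no_neg: False if b: "b \<in> V" "g b k = 0" "g b b < 0" for b
  proof -
    have indep: "b \<notin> span {k}" "k \<noteq> 0"
    proof -
      have "g 0 k = 0"
        using lin[OF k(1) k(1) k(1), of 0 0] by simp
      then show "k \<noteq> 0"
        using k(2) by auto
      show "b \<notin> span {k}"
      proof
        assume "b \<in> span {k}"
        then obtain r where r: "b = r *\<^sub>R k"
          by (auto simp: span_singleton)
        then have "r * g k k = 0"
          using b(2) lin[OF k(1) k(1) k(1), of r 0] by simp
        then have "r = 0"
          using k(2) by simp
        then show False
          using b(3) quad[OF k(1) k(1), of 0 0] r by simp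
      qed
    qed
    then have "b \<notin> {k}" "independent {b, k}"
      using span_base[of b "{k}"] by (auto simp: independent_insert)
    then have dim: "dim (span {b, k}) = 2"
      by (simp add: dim_eq_card_independent)
    have neg: "g w w < 0" if w: "w \<in> span {b, k}" "w \<noteq> 0" for w
    proof -
      obtain x y where xy: "w = x *\<^sub>R b + y *\<^sub>R k"
        using w(1) by (auto simp: span_insert span_singleton algebra_simps)
      have "x \<noteq> 0 \<or> y \<noteq> 0"
        using w(2) xy by auto
      then have "x\<^sup>2 * g b b + y\<^sup>2 * g k k < 0"
      proof
        assume "x \<noteq> 0"
        then show ?thesis
          using mult_pos_neg[of "x\<^sup>2" "g b b"] mult_nonneg_nonpos[of "y\<^sup>2" "g k k"] b(3) k(2) by simp
      next
        assume "y \<noteq> 0"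
        then show ?thesis
          using mult_nonneg_nonpos[of "x\<^sup>2" "g b b"] mult_pos_neg[of "y\<^sup>2" "g k k"] b(3) k(2) by simp
      qed
      then show ?thesis
        unfolding xy quad[OF b(1) k(1)] b(2) by simp
    qed
    let ?N = "{dim W |W. subspace W \<and> W \<subseteq> V \<and> (\<forall>w\<in>W. w \<noteq> 0 \<longrightarrow> g w w < 0)}"
    \<comment> \<open>\<open>Max\<close> is informative only for finite sets; the dimensions are
      bounded by the size of the spanning set.\<close>
    have "?N \<subseteq> {..card B}"
      using dim_le_card[OF _ V(2)] V(3) by (auto intro!: dim_le_card V(2))
    then have fin: "finite ?N"
      by (rule finite_subset) simp
    have "span {b, k} \<subseteq> V"
      using b(1) k(1) V(1) by (intro span_minimal) auto
    then have "2 = dim (span {b, k}) \<and> subspace (span {b, k}) \<and> span {b, k} \<subseteq> V \<and>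
        (\<forall>w\<in>span {b, k}. w \<noteq> 0 \<longrightarrow> g w w < 0)"
      by (intro conjI ballI impI dim[symmetric] subspace_span neg)
    then have "2 \<in> ?N"
      by (intro CollectI exI[of _ "span {b, k}"])
    then have "2 \<le> form_index V g"
      unfolding form_index_def using fin by (rule Max_ge[rotated])
    then show False
      using index by simp
  qed
  show False
  proof (cases "g a a < 0")
    case True
    then show False
      using no_neg a by blast
  next
    case False
    then have aa: "g a a = 0"
      using not_pos by simp
    obtain b where b: "b \<in> V" "g a b \<noteq> 0"
      using nondeg a(1,3) unfolding nondegenerate_on_def by blast
    \<comment> \<open>Projection of \<open>b\<close> along \<open>k\<close> onto the orthogonal
      complement of \<open>k\<close>; as \<open>a\<close> is orthogonal to \<open>k\<close>, the
      product with \<open>a\<close> is unchanged.\<close>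
    define b' where "b' = 1 *\<^sub>R b + (- (g b k / g k k)) *\<^sub>R k"
    have b': "b' \<in> V" "g b' k = 0" "g a b' \<noteq> 0"
    proof -
      show "b' \<in> V"
        unfolding b'_def using V(1) b(1) k(1) by (intro subspace_add subspace_scale)
      show "g b' k = 0"
        unfolding b'_def lin[OF b(1) k(1) k(1)] using k(2) by simp
      have "g a b' = g b' a"
        by (rule sym[OF a(1) \<open>b' \<in> V\<close>])
      also have "\<dots> = g b a + - (g b k / g k k) * g k a"
        unfolding b'_def lin[OF b(1) k(1) a(1)] by simp
      also have "\<dots> = g a b"
        using sym[OF b(1) a(1)] sym[OF k(1) a(1)] a(2) by simp
      finally show "g a b' \<noteq> 0"
        using b(2) by simp
    qed
    \<comment> \<open>With these values the square of a + t b' is (g(a,b')^2 / s) (g(b',b') / s -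
      2), and s exceeds both 0 and g(b',b').\<close>
    define s where "s = \<bar>g b' b'\<bar> + 1"
    define t where "t = - g a b' / s"
    have s: "s > 0" "g b' b' < s"
      by (auto simp: s_def)
    let ?w = "1 *\<^sub>R a + t *\<^sub>R b'"
    have "g ?w ?w = 2 * t * g a b' + t\<^sup>2 * g b' b'"
      unfolding quad[OF a(1) b'(1)] aa by simp
    also have "\<dots> = ((g a b')\<^sup>2 / s) * (g b' b' / s - 2)"
      using s(1) by (simp add: t_def power2_eq_square field_simps)
    also have "\<dots> < 0"
    proof (rule mult_pos_neg)
      show "0 < (g a b')\<^sup>2 / s"
        using s(1) b'(3) by simp
      have "g b' b' / s < 1"
        using s by simp
      then show "g b' b' / s - 2 < 0"
        by linarith
    qed
    finally have "g ?w ?w < 0" .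
    moreover have "g ?w k = 0"
      unfolding lin[OF a(1) b'(1) k(1)] using a(2) b'(2) by simp
    moreover have "?w \<in> V"
      using V(1) a(1) b'(1) by (intro subspace_add subspace_scale)
    ultimately show False
      using no_neg by blast
  qed
qed

section \<open>The one-form \<theta>\<close>

locale C1_spacetime = killing_spacetime M L T K
  for M :: "('a, real \<times> 'e::euclidean_space) chart set"
    and L :: "'a \<times> ('a, real \<times> 'e) tvec \<Rightarrow> real"
    and T :: "('a \<times> ('a, real \<times> 'e) tvec) set"
    and K :: "'a \<Rightarrow> ('a, real \<times> 'e) tvec" +
  assumes K_mem_T: "p \<in> mfd_space M \<Longrightarrow> (p, K p) \<in> T"
    and L_C1: "Ck_fun (tb_atlas M) 1 (tangent_bundle M) L"
begin

lemma Lc_C1: "c \<in> M \<Longrightarrow> Ck_on 1 ((snd c ` fst c) \<times> UNIV) (Lc c)"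
proof -
  assume c: "c \<in> M"
  then have "Ck_on 1 (snd (tb_chart M c) ` (tangent_bundle M \<inter> fst (tb_chart M c))) (L \<circ> chart_inv (tb_chart M c))"
    using L_C1 unfolding Ck_fun_def tb_atlas_def by blast
  then show ?thesis
    unfolding tb_chart_image_bundle[OF atlas c] Lc_def .
qed

lemma Lc_differentiable: "c \<in> M \<Longrightarrow> p \<in> fst c \<Longrightarrow> Lc c differentiable (at (snd c p, y))"
  by (rule Ck_on_imp_differentiable[OF Lc_C1]) auto

abbreviation \<theta> :: "'a \<Rightarrow> ('a, real \<times> 'e) tvec \<Rightarrow> real" where
  "\<theta> \<equiv> vertical_dL M L K"

text \<open>A description of \<theta> without coordinates; chart independence and the later formulas
  for \<theta> follow from it by uniqueness of derivatives.\<close>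

lemma theta_line:
  assumes p: "p \<in> mfd_space M" and w: "w \<in> tangent_space M p"
  shows "((\<lambda>s. L (p, K p + s *\<^sub>R w)) has_real_derivative \<theta> p w) (at 0)"
proof -
  let ?c = "chart_at M p"
  note c = chart_at_props[OF p]
  let ?D = "frechet_derivative (Lc ?c) (at (snd ?c p, K p ?c))"
  have lin: "linear (\<lambda>a. ?D (0, a))"
    using linear_compose[OF _ linear_frechet_derivative[OF Lc_differentiable[OF c]], of "\<lambda>a. (0, a)"]
    by (auto simp: o_def linear_iff)
  have "\<theta> p w = ?D (0, w ?c)"
    unfolding linear_basis_sum[OF lin, of "w ?c"]
    by (simp add: vertical_dL_def Let_def partial_def Lc_def mult.commute)
  then show ?thesis
    using L_line[OF c K_tangent[OF p] w Lc_differentiable[OF c]] by simp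
qed

lemma theta_eq:
  assumes c: "c \<in> M" "p \<in> fst c" and w: "w \<in> tangent_space M p"
  shows "\<theta> p w = frechet_derivative (Lc c) (at (snd c p, K p c)) (0, w c)"
proof -
  have p: "p \<in> mfd_space M"
    by (rule mem_mfd_space[OF c])
  show ?thesis
    by (rule DERIV_unique[OF theta_line[OF p w] L_line[OF c K_tangent[OF p] w Lc_differentiable[OF c]]])
qed

lemma theta_lincomb:
  assumes p: "p \<in> mfd_space M" and u: "u \<in> tangent_space M p" "w \<in> tangent_space M p"
  shows "\<theta> p (a *\<^sub>R u + b *\<^sub>R w) = a * \<theta> p u + b * \<theta> p w"
proof -
  let ?c = "chart_at M p"
  note c = chart_at_props[OF p]
  let ?D = "frechet_derivative (Lc ?c) (at (snd ?c p, K p ?c))"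
  have lin: "linear ?D"
    by (rule linear_frechet_derivative[OF Lc_differentiable[OF c]])
  have "?D (0, a *\<^sub>R u ?c + b *\<^sub>R w ?c) = ?D (a *\<^sub>R (0, u ?c) + b *\<^sub>R (0, w ?c))"
    by simp
  also have "\<dots> = a * ?D (0, u ?c) + b * ?D (0, w ?c)"
    unfolding linear_add[OF lin] linear_cmul[OF lin] by simp
  finally show ?thesis
    using theta_eq[OF c u(1)] theta_eq[OF c u(2)] theta_eq[OF c tangent_space_lincomb[OF atlas u]] by simp
qed

lemma theta_0: "p \<in> mfd_space M \<Longrightarrow> \<theta> p 0 = 0"
  using theta_lincomb[OF _ tangent_space_0[OF atlas] tangent_space_0[OF atlas], of p 0 0] by simp

text \<open>Euler's relation for degree 2 at \<open>K\<close>, along the ray (1 + s) K.\<close>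

lemma theta_K:
  assumes p: "p \<in> mfd_space M"
  shows "\<theta> p (K p) = 2 * L (p, K p)"
proof -
  have "((\<lambda>s. (1 + s)\<^sup>2 * L (p, K p)) has_real_derivative 2 * L (p, K p)) (at 0)"
    by (auto intro!: derivative_eq_intros)
  then have "((\<lambda>s. L (p, K p + s *\<^sub>R K p)) has_real_derivative 2 * L (p, K p)) (at 0)"
  proof (rule has_field_derivative_transform_within_open[where S = "{-1<..}"])
    show "(1 + s)\<^sup>2 * L (p, K p) = L (p, K p + s *\<^sub>R K p)" if "s \<in> {-1<..}" for s
      using L_homogeneous[OF p K_tangent[OF p], of "1 + s"] that by (simp add: scaleR_left_distrib)
  qed auto
  from DERIV_unique[OF theta_line[OF p K_tangent[OF p]] this] show ?thesis .
qed

end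

section \<open>Consequences of condition (c)\<close>

locale splitting_conditions = C1_spacetime M L T K
  for M :: "('a, real \<times> 'e::euclidean_space) chart set"
    and L :: "'a \<times> ('a, real \<times> 'e) tvec \<Rightarrow> real"
    and T :: "('a \<times> ('a, real \<times> 'e) tvec) set"
    and K :: "'a \<Rightarrow> ('a, real \<times> 'e) tvec" +
  assumes cond_c: "condition_c M L K"
begin

text \<open>(c) speaks of w + K and w - K only. Applied to w / |\<sigma>|, which is again in the
  kernel, and rescaled by homogeneity, it covers all multiples of \<open>K\<close>; homogeneity
  being only positive, the two signs of \<sigma> need the two signs in (c).\<close>

lemma L_add_K_kernel:
  assumes p: "p \<in> mfd_space M" and w: "w \<in> tangent_space M p" "\<theta> p w = 0"
  shows "L (p, w + \<sigma> *\<^sub>R K p) = L (p, w) + \<sigma>\<^sup>2 * L (p, K p)"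
proof -
  note Kp = K_tangent[OF p]
  have step: "L (p, r *\<^sub>R (inverse r *\<^sub>R w + e *\<^sub>R K p)) = L (p, w) + r\<^sup>2 * L (p, K p)" if r: "r > 0" and e: "e = 1 \<or> e = -1" for r e
  proof -
    let ?w = "inverse r *\<^sub>R w"
    have wt: "?w \<in> tangent_space M p"
      by (rule tangent_space_scaleR[OF atlas w(1)])
    have "\<theta> p ?w = 0"
      using theta_lincomb[OF p w(1) w(1), of "inverse r" 0] w(2) by simp
    then have "L (p, ?w + K p) = L (p, ?w) + L (p, K p)" "L (p, ?w - K p) = L (p, ?w) + L (p, K p)"
      using cond_c p wt unfolding condition_c_def kernel_distribution_def by auto
    then have "L (p, ?w + e *\<^sub>R K p) = L (p, ?w) + L (p, K p)"
      using e by auto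
    then have "L (p, r *\<^sub>R (?w + e *\<^sub>R K p)) = r\<^sup>2 * L (p, ?w) + r\<^sup>2 * L (p, K p)"
      using L_homogeneous[OF p tangent_space_add[OF atlas wt tangent_space_scaleR[OF atlas Kp]] r, of e]
      by (simp add: distrib_left)
    moreover have "r\<^sup>2 * L (p, ?w) = L (p, w)"
      using L_homogeneous[OF p wt r] r by simp
    ultimately show ?thesis
      by simp
  qed
  consider "\<sigma> = 0" | "\<sigma> > 0" | "\<sigma> < 0"
    by linarith
  then show ?thesis
  proof cases
    case 2
    then show ?thesis
      using step[OF 2, of 1] by (simp add: scaleR_add_right)
  next
    case 3
    have s1: "(- \<sigma>) * inverse (- \<sigma>) = 1"
      using 3 by simp
    have s2: "(- \<sigma>) * (- 1) = \<sigma>"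
      by simp
    have eq: "(- \<sigma>) *\<^sub>R (inverse (- \<sigma>) *\<^sub>R w + (- 1) *\<^sub>R K p) = w + \<sigma> *\<^sub>R K p"
      by (simp only: scaleR_add_right scaleR_scaleR s1 s2 scaleR_one)
    have "L (p, (- \<sigma>) *\<^sub>R (inverse (- \<sigma>) *\<^sub>R w + (- 1) *\<^sub>R K p)) = L (p, w) + (- \<sigma>)\<^sup>2 * L (p, K p)"
      by (rule step) (use 3 in simp_all)
    then show ?thesis
      unfolding eq by simp
  qed simp
qed

text \<open>Split w = w0 + \<alpha> K with w0 in ker \<theta>; \<alpha> is determined by \<theta>(K)
  = 2 L(K). Subtracting the kernel case for \<alpha> from that for \<alpha> + \<tau> leaves (2
  \<alpha> \<tau> + \<tau>^2) L(K), and 2 \<alpha> L(K) = \<theta>(w).\<close>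

lemma L_add_K:
  assumes p: "p \<in> mfd_space M" and w: "w \<in> tangent_space M p"
  shows "L (p, w + \<tau> *\<^sub>R K p) = L (p, w) + \<tau> * \<theta> p w + \<tau>\<^sup>2 * L (p, K p)"
proof -
  note Kp = K_tangent[OF p]
  define \<alpha> where "\<alpha> = \<theta> p w / (2 * L (p, K p))"
  define w0 where "w0 = 1 *\<^sub>R w + (- \<alpha>) *\<^sub>R K p"
  have w0: "w0 \<in> tangent_space M p"
    unfolding w0_def by (rule tangent_space_lincomb[OF atlas w Kp])
  have \<alpha>: "\<theta> p w = 2 * \<alpha> * L (p, K p)"
    using timelike[OF p] by (simp add: \<alpha>_def)
  have "\<theta> p w0 = 0"
    unfolding w0_def theta_lincomb[OF p w Kp] theta_K[OF p] \<alpha> by simp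
  note k = L_add_K_kernel[OF p w0 this]
  have w_eq: "w0 + \<alpha> *\<^sub>R K p = w" "w0 + (\<alpha> + \<tau>) *\<^sub>R K p = w + \<tau> *\<^sub>R K p"
    by (simp_all add: w0_def scaleR_left_distrib)
  have "L (p, w) = L (p, w0) + \<alpha>\<^sup>2 * L (p, K p)"
    using k[of \<alpha>] unfolding w_eq .
  moreover have "L (p, w + \<tau> *\<^sub>R K p) = L (p, w0) + (\<alpha> + \<tau>)\<^sup>2 * L (p, K p)"
    using k[of "\<alpha> + \<tau>"] unfolding w_eq .
  ultimately show ?thesis
    unfolding \<alpha> by (simp add: power2_eq_square algebra_simps)
qed

text \<open>\<open>L_add_K\<close> makes L(v + s a + t K) quadratic in t with linear coefficient
  \<theta>(v + s a), so g_v(a, K) = \<theta>(a) / 2. In particular g_v(K, K) = L(K) < 0, and ker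
  \<theta> is the g_v-orthogonal complement of \<open>K\<close> for every \<open>v\<close> off
  \<open>T\<close>; there \<open>index_1_positive\<close> applies.\<close>

lemma hess_positive:
  assumes c: "c \<in> M" "p \<in> fst c" and v: "v \<in> tangent_space M p" "(p, v) \<notin> T"
    and u: "u \<in> tangent_space M p" "\<theta> p u = 0" "u \<noteq> 0"
  shows "fib_hess L p v u u > 0"
proof -
  have p: "p \<in> mfd_space M"
    by (rule mem_mfd_space[OF c])
  note Kp = K_tangent[OF p]
  have z: "(snd c p, v c) \<in> Ac c"
    using Ac_iff[OF c v(1)] v(2) by simp
  let ?V = "tangent_space M p"
  note add = tangent_space_add[OF atlas] and scale = tangent_space_scaleR[OF atlas]
  have inner: "deriv (\<lambda>t. L (p, v + s *\<^sub>R a + t *\<^sub>R K p)) 0 = \<theta> p v + s * \<theta> p a" if a: "a \<in> ?V" for s a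
  proof (rule DERIV_imp_deriv)
    have "L (p, v + s *\<^sub>R a + t *\<^sub>R K p) = L (p, v + s *\<^sub>R a) + t * (\<theta> p v + s * \<theta> p a) + t\<^sup>2 * L (p, K p)" for t
      using L_add_K[OF p add[OF v(1) scale[OF a]], of s t] theta_lincomb[OF p v(1) a, of 1 s] by simp
    then show "((\<lambda>t. L (p, v + s *\<^sub>R a + t *\<^sub>R K p)) has_real_derivative (\<theta> p v + s * \<theta> p a)) (at 0)"
      by (auto intro!: derivative_eq_intros)
  qed
  have gK: "fib_hess L p v a (K p) = \<theta> p a / 2" if a: "a \<in> ?V" for a
  proof -
    have "((\<lambda>s. \<theta> p v + s * \<theta> p a) has_real_derivative \<theta> p a) (at 0)"
      by (auto intro!: derivative_eq_intros)
    then show ?thesis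
      unfolding fib_hess_def inner[OF a] by (simp add: DERIV_imp_deriv)
  qed
  have nd: "nondegenerate_on ?V (fib_hess L p v)" "form_index ?V (fib_hess L p v) = 1"
    using index_1[of p v] v p by (auto simp: nondeg_index_1_def tangent_bundle_def)
  have tl: "linear (tvec M p c)"
    using tvec_linear[OF atlas c, of 1 _ 1] tvec_linear[OF atlas c, of _ _ 0] by (intro linearI) fastforce+
  show ?thesis
  proof (rule index_1_positive[where B = "tvec M p c ` Basis" and k = "K p", OF subspace_tangent_space[OF atlas] _ _ _ _ nd Kp _ u(1) _ u(3)])
    show "?V \<subseteq> span (tvec M p c ` Basis)"
    proof
      fix x
      assume x: "x \<in> ?V"
      have "x = (\<Sum>b\<in>Basis. (x c \<bullet> b) *\<^sub>R tvec M p c b)"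
        using linear_basis_sum[OF tl, of "x c"] tvec_eq[OF x c] by simp
      also have "\<dots> \<in> span (tvec M p c ` Basis)"
        by (intro span_sum span_scale span_base) auto
      finally show "x \<in> span (tvec M p c ` Basis)" .
    qed
    show "fib_hess L p v (a *\<^sub>R x + b *\<^sub>R y) w = a * fib_hess L p v x w + b * fib_hess L p v y w"
      if xyw: "x \<in> ?V" "y \<in> ?V" "w \<in> ?V" for x y w a b
      using linear_add[OF hess_linear[OF c(1) z]] linear_cmul[OF hess_linear[OF c(1) z]]
      by (simp add: fib_hess_eq[OF c v] xyw tangent_space_lincomb[OF atlas])
    show "fib_hess L p v x y = fib_hess L p v y x" if xy: "x \<in> ?V" "y \<in> ?V" for x y
      by (simp add: fib_hess_eq[OF c v] xy hess_sym[OF c(1) z, of "x c"])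
    show "fib_hess L p v (K p) (K p) < 0"
      using gK[OF Kp] theta_K[OF p] timelike[OF p] by simp
    show "fib_hess L p v u (K p) = 0"
      using gK[OF u(1)] u(2) by simp
  qed simp
qed

text \<open>Second derivatives of a function homogeneous of degree 2 are homogeneous of degree 0.
  This reduces positivity to unit vectors.\<close>

lemma hess_scale:
  assumes c: "c \<in> M" and xy: "(x, y) \<in> Ac c" "(x, r *\<^sub>R y) \<in> Ac c" and r: "r > 0"
  shows "hess c (x, r *\<^sub>R y) u w = hess c (x, y) u w"
proof -
  \<comment> \<open>Derivatives are compared at a point and at its rescaling, so both have to be off
    \<open>T\<close>.\<close>
  let ?A = "{z \<in> Ac c. (fst z, r *\<^sub>R snd z) \<in> Ac c}"
  let ?E = "\<lambda>z. frechet_derivative (Lc c) (at z) (0, w)"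
  have A: "open ?A"
  proof -
    have "?A = Ac c \<inter> (\<lambda>z. (fst z, r *\<^sub>R snd z)) -` Ac c"
      by auto
    moreover have "open ((\<lambda>z. (fst z, r *\<^sub>R snd z)) -` Ac c)"
      by (intro open_vimage open_Ac[OF c] continuous_intros)
    ultimately show ?thesis
      using open_Ac[OF c] by (simp add: open_Int)
  qed
  have L: "Lc c differentiable (at z)" "?E differentiable (at z)" if "z \<in> Ac c" for z
    using Ck_on_imp_differentiable[OF Lc_C3[OF c] _ that] Ck_on_imp_differentiable[OF first_derivative_Ck[OF c] _ that]
    by simp_all
  have R: "x \<in> snd c ` fst c" if "(x, y) \<in> Ac c" for x y
    using Ac_subset[OF c] that by auto
  have E: "?E (x, r *\<^sub>R y) = r * ?E (x, y)" if xy: "(x, y) \<in> Ac c" "(x, r *\<^sub>R y) \<in> Ac c" for x y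
  proof -
    have "frechet_derivative (Lc c) (at (x, r *\<^sub>R y)) (0, r *\<^sub>R (inverse r *\<^sub>R w)) =
        r\<^sup>2 * frechet_derivative (Lc c) (at (x, y)) (0, inverse r *\<^sub>R w)"
      by (rule has_derivative_homogeneous[OF open_Ac[OF c] xy L(1)[OF xy(1)] L(1)[OF xy(2)]])
        (use Lc_homogeneous[OF c R r] in auto)
    moreover have "frechet_derivative (Lc c) (at (x, y)) (0, inverse r *\<^sub>R w) = inverse r * ?E (x, y)"
      using linear_cmul[OF linear_frechet_derivative[OF L(1)[OF xy(1)]], of "inverse r" "(0, w)"] by simp
    ultimately show ?thesis
      using r by (simp add: power2_eq_square)
  qed
  have "frechet_derivative ?E (at (x, r *\<^sub>R y)) (0, r *\<^sub>R (inverse r *\<^sub>R u)) =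
      r * frechet_derivative ?E (at (x, y)) (0, inverse r *\<^sub>R u)"
  proof -
    have s: "((\<lambda>z. (fst z, r *\<^sub>R snd z)) has_derivative (\<lambda>z. (fst z, r *\<^sub>R snd z))) (at (x, y))"
      by (auto intro!: derivative_eq_intros)
    have "(?E has_derivative frechet_derivative ?E (at (x, r *\<^sub>R y))) (at (fst (x, y), r *\<^sub>R snd (x, y)))"
      using L(2)[OF xy(2)] by (simp add: frechet_derivative_works)
    from has_derivative_compose[OF s this]
    have 1: "((\<lambda>z. ?E (fst z, r *\<^sub>R snd z)) has_derivative (\<lambda>z. frechet_derivative ?E (at (x, r *\<^sub>R y)) (fst z, r *\<^sub>R snd z))) (at (x, y))" .
    have "(?E has_derivative frechet_derivative ?E (at (x, y))) (at (x, y))"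
      using L(2)[OF xy(1)] by (simp add: frechet_derivative_works)
    then have "((\<lambda>z. r * ?E z) has_derivative (\<lambda>z. r * frechet_derivative ?E (at (x, y)) z)) (at (x, y))"
      by (rule has_derivative_mult_right)
    then have "((\<lambda>z. ?E (fst z, r *\<^sub>R snd z)) has_derivative (\<lambda>z. r * frechet_derivative ?E (at (x, y)) z)) (at (x, y))"
    proof (rule has_derivative_transform_within_open[OF _ A])
      show "r * ?E z = ?E (fst z, r *\<^sub>R snd z)" if "z \<in> ?A" for z
        using E[of "fst z" "snd z"] that by simp
    qed (use xy in simp)
    from fun_cong[OF has_derivative_unique[OF 1 this], of "(0, inverse r *\<^sub>R u)"] show ?thesis
      by simp
  qed
  moreover have "frechet_derivative ?E (at (x, y)) (0, inverse r *\<^sub>R u) = inverse r * frechet_derivative ?E (at (x, y)) (0, u)"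
    using linear_cmul[OF linear_frechet_derivative[OF L(2)[OF xy(1)]], of "inverse r" "(0, u)"] by simp
  ultimately show ?thesis
    using r by (simp add: hess_def)
qed

end

text \<open>On the compact set, f(x0, .) has a positive minimum, and uniform continuity keeps f
  positive for nearby x, uniformly in the second argument. The compact set will be a product of unit
  spheres.\<close>

lemma compact_positive_neighbourhood:
  fixes f :: "'x::euclidean_space \<times> 'k::euclidean_space \<Rightarrow> real"
  assumes N: "open N" "x0 \<in> N" and K: "compact K" and f: "continuous_on (N \<times> K) f"
    and pos: "\<And>k. k \<in> K \<Longrightarrow> f (x0, k) > 0"
  obtains \<rho> where "\<rho> > 0" "ball x0 \<rho> \<subseteq> N" "\<And>x k. x \<in> ball x0 \<rho> \<Longrightarrow> k \<in> K \<Longrightarrow> f (x, k) > 0"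
proof (cases "K = {}")
  case True
  obtain \<rho> where "\<rho> > 0" "ball x0 \<rho> \<subseteq> N"
    using N openE by blast
  then show thesis
    using True by (intro that[of \<rho>]) auto
next
  case False
  obtain \<rho>0 where \<rho>0: "\<rho>0 > 0" "cball x0 \<rho>0 \<subseteq> N"
    using N open_contains_cball by blast
  have c: "compact (cball x0 \<rho>0 \<times> K)"
    by (intro compact_Times compact_cball K)
  have fc: "continuous_on (cball x0 \<rho>0 \<times> K) f"
    by (rule continuous_on_subset[OF f]) (use \<rho>0 in auto)
  have "continuous_on K (\<lambda>k. f (x0, k))"
    by (rule continuous_on_compose2[OF fc]) (use \<rho>0 in \<open>auto intro!: continuous_intros\<close>)
  then obtain k0 where k0: "k0 \<in> K" "\<And>k. k \<in> K \<Longrightarrow> f (x0, k0) \<le> f (x0, k)"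
    using continuous_attains_inf[OF K False, of "\<lambda>k. f (x0, k)"] by auto
  have m: "f (x0, k0) > 0"
    by (rule pos[OF k0(1)])
  have "uniformly_continuous_on (cball x0 \<rho>0 \<times> K) f"
    by (rule compact_uniformly_continuous[OF fc c])
  then obtain d where d: "d > 0" "\<forall>z\<in>cball x0 \<rho>0 \<times> K. \<forall>z'\<in>cball x0 \<rho>0 \<times> K. dist z' z < d \<longrightarrow> dist (f z') (f z) < f (x0, k0)"
    using m unfolding uniformly_continuous_on_def by blast
  show thesis
  proof (rule that[of "min d \<rho>0"])
    show "min d \<rho>0 > 0"
      using d \<rho>0 by simp
    show "ball x0 (min d \<rho>0) \<subseteq> N"
      using \<rho>0 by auto
    fix x k
    assume x: "x \<in> ball x0 (min d \<rho>0)" and k: "k \<in> K"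
    have mem: "(x0, k) \<in> cball x0 \<rho>0 \<times> K" "(x, k) \<in> cball x0 \<rho>0 \<times> K"
      using x k \<rho>0 by auto
    have "dist (x, k) (x0, k) < d"
      using x by (simp add: dist_Pair_Pair dist_commute)
    then have "dist (f (x, k)) (f (x0, k)) < f (x0, k0)"
      using d(2) mem by blast
    then show "f (x, k) > 0"
      using k0(2)[OF k] by (simp add: dist_real_def)
  qed
qed

section \<open>Splittings adapted to a transversal hypersurface\<close>

context C1_spacetime
begin

definition Theta :: "('a, real \<times> 'e) chart \<Rightarrow> real \<times> 'e \<Rightarrow> real \<times> 'e \<Rightarrow> real" where
  "Theta c x y = \<theta> (chart_inv c x) (tvec M (chart_inv c x) c y)"

lemma Theta_lincomb:
  assumes c: "c \<in> M" "x \<in> snd c ` fst c"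
  shows "Theta c x (a *\<^sub>R y + b *\<^sub>R y') = a * Theta c x y + b * Theta c x y'"
proof -
  obtain p where p: "p \<in> fst c" "x = snd c p" "chart_inv c x = p" "p \<in> mfd_space M"
    by (rule chart_point[OF c])
  show ?thesis
    unfolding Theta_def p(3) tvec_linear[OF atlas c(1) p(1)]
    by (rule theta_lincomb[OF p(4) tvec_in_tangent_space[OF atlas c(1) p(1)] tvec_in_tangent_space[OF atlas c(1) p(1)]])
qed

lemma linear_Theta: "c \<in> M \<Longrightarrow> x \<in> snd c ` fst c \<Longrightarrow> linear (Theta c x)"
  using Theta_lincomb[of c x 1 _ 1] Theta_lincomb[of c x _ _ 0] by (intro linearI) fastforce+

lemma Theta_K: "c \<in> M \<Longrightarrow> x \<in> snd c ` fst c \<Longrightarrow> Theta c x (Kc c x) = 2 * Lc c (x, Kc c x)"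
proof -
  assume c: "c \<in> M" "x \<in> snd c ` fst c"
  obtain p where p: "p \<in> fst c" "x = snd c p" "chart_inv c x = p" "p \<in> mfd_space M"
    by (rule chart_point[OF c])
  have "tvec M p c (K p c) = K p"
    by (rule tvec_eq[OF K_tangent[OF p(4)] c(1) p(1)])
  then show ?thesis
    unfolding Theta_def Lc_tvec[OF c] p(3) using theta_K[OF p(4)] p(2) by (simp add: Kc_eq[OF c(1) p(1)])
qed

lemma Lc_Kc_neg: "c \<in> M \<Longrightarrow> x \<in> snd c ` fst c \<Longrightarrow> Lc c (x, Kc c x) < 0"
proof -
  assume c: "c \<in> M" "x \<in> snd c ` fst c"
  obtain p where p: "p \<in> fst c" "x = snd c p" "chart_inv c x = p" "p \<in> mfd_space M"
    by (rule chart_point[OF c])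
  show ?thesis
    using timelike[OF p(4)] Lc_eq[OF c(1) p(1) K_tangent[OF p(4)]] by (simp add: p(2) Kc_eq[OF c(1) p(1)])
qed

lemma Ac_coord: "c \<in> M \<Longrightarrow> x \<in> snd c ` fst c \<Longrightarrow> (x, y) \<in> Ac c \<longleftrightarrow> \<not> (\<exists>r. y = r *\<^sub>R Kc c x)"
proof -
  assume c: "c \<in> M" "x \<in> snd c ` fst c"
  obtain p where p: "p \<in> fst c" "x = snd c p" "chart_inv c x = p" "p \<in> mfd_space M"
    by (rule chart_point[OF c])
  have t: "tvec M p c y \<in> tangent_space M p" "tvec M p c y c = y"
    using tvec_in_tangent_space[OF atlas c(1) p(1)] tvec_component[OF atlas c(1) p(1)] by auto
  have "tvec M p c y = r *\<^sub>R K p \<longleftrightarrow> y = r *\<^sub>R Kc c x" for r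
  proof
    show "y = r *\<^sub>R Kc c x" if "tvec M p c y = r *\<^sub>R K p"
      using arg_cong[OF that, of "\<lambda>v. v c"] t(2) by (simp add: p(2) Kc_eq[OF c(1) p(1)])
    show "tvec M p c y = r *\<^sub>R K p" if "y = r *\<^sub>R Kc c x"
      by (rule tangent_space_eqI[OF t(1) tangent_space_scaleR[OF atlas K_tangent[OF p(4)]] c(1) p(1)])
        (use that t(2) in \<open>simp add: p(2) Kc_eq[OF c(1) p(1)]\<close>)
  qed
  then show ?thesis
    using Ac_iff[OF c(1) p(1) t(1)] T_iff[OF K_mem_T[OF p(4)] p(4)] t(2) by (simp add: p(2))
qed

lemma hess_self: "c \<in> M \<Longrightarrow> (x, y) \<in> Ac c \<Longrightarrow> hess c (x, y) y y = Lc c (x, y)"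
proof -
  assume c: "c \<in> M" and xy: "(x, y) \<in> Ac c"
  have x: "x \<in> snd c ` fst c"
    using Ac_subset[OF c] xy by auto
  obtain p where p: "p \<in> fst c" "x = snd c p" "chart_inv c x = p" "p \<in> mfd_space M"
    by (rule chart_point[OF c x])
  have t: "tvec M p c y \<in> tangent_space M p" "tvec M p c y c = y"
    using tvec_in_tangent_space[OF atlas c p(1)] tvec_component[OF atlas c p(1)] by auto
  have "(p, tvec M p c y) \<notin> T"
    using Ac_iff[OF c p(1) t(1)] xy t(2) p(2) by simp
  then show ?thesis
    using fib_hess_eq[OF c p(1) t(1) _ t(1) t(1)] fib_hess_self[OF p(4) t(1)] Lc_eq[OF c p(1) t(1)] t(2) p(2) by simp
qed

end

lemma (in splitting_conditions) Lc_add_K: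
  assumes c: "c \<in> M" "x \<in> snd c ` fst c"
  shows "Lc c (x, \<tau> *\<^sub>R Kc c x + y) = Lc c (x, y) + \<tau> * Theta c x y + \<tau>\<^sup>2 * Lc c (x, Kc c x)"
proof -
  obtain p where p: "p \<in> fst c" "x = snd c p" "chart_inv c x = p" "p \<in> mfd_space M"
    by (rule chart_point[OF c])
  have K: "tvec M p c (Kc c x) = K p"
    using tvec_eq[OF K_tangent[OF p(4)] c(1) p(1)] by (simp add: p(2) Kc_eq[OF c(1) p(1)])
  have "tvec M p c (\<tau> *\<^sub>R Kc c x + y) = tvec M p c y + \<tau> *\<^sub>R K p"
    using tvec_linear[OF atlas c(1) p(1), of \<tau> "Kc c x" 1 y] K by (simp add: add.commute)
  then show ?thesis
    unfolding Lc_tvec[OF c] p(3) K Theta_def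
    by (simp add: L_add_K[OF p(4) tvec_in_tangent_space[OF atlas c(1) p(1)]])
qed

lemma tb_chart_image_nonzero:
  assumes "smooth_atlas M" "c \<in> M"
  shows "snd (tb_chart M c) ` ((tangent_bundle M - zero_section M) \<inter> fst (tb_chart M c)) = (snd c ` fst c) \<times> - {0}"
  unfolding tb_chart_image[OF assms]
proof (rule set_eqI)
  fix w :: "'b \<times> 'b"
  obtain x y where w: "w = (x, y)"
    by (cases w)
  have "(chart_inv c x, tvec M (chart_inv c x) c y) \<in> tangent_bundle M - zero_section M \<longleftrightarrow> y \<noteq> 0" if x: "x \<in> snd c ` fst c"
  proof -
    have p: "chart_inv c x \<in> fst c"
      by (rule chart_inv_mem[OF x])
    have "tvec M (chart_inv c x) c y = 0 \<longleftrightarrow> y = 0"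
      using tvec_0[OF assms p] tvec_component[OF assms p, of y] by (metis zero_fun_apply)
    then show ?thesis
      using tvec_in_tangent_space[OF assms p] mem_mfd_space[OF assms(2) p] by (simp add: tangent_bundle_def zero_section_def)
  qed
  then show "w \<in> {(x, y). x \<in> snd c ` fst c \<and> (chart_inv c x, tvec M (chart_inv c x) c y) \<in> tangent_bundle M - zero_section M} \<longleftrightarrow>
      w \<in> (snd c ` fst c) \<times> - {0}"
    unfolding w by simp blast
qed

lemma Ck_fun_tb_single:
  fixes c :: "('a, 'e::euclidean_space) chart"
  assumes a: "smooth_atlas {c}" and A: "open A" "A \<subseteq> (snd c ` fst c) \<times> UNIV" and h: "Ck_on k A h"
    and im: "snd (tb_chart {c} c) ` (W \<inter> fst (tb_chart {c} c)) = A"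
  shows "Ck_fun (tb_atlas {c}) k W (\<lambda>(p, w). h (snd c p, w c))"
proof -
  have "Ck_on k A ((\<lambda>(p, w). h (snd c p, w c)) \<circ> chart_inv (tb_chart {c} c))"
  proof (rule Ck_on_transfer[OF A(1) h])
    fix w
    assume w: "w \<in> A"
    obtain x y where xy: "w = (x, y)"
      by (cases w)
    have x: "x \<in> snd c ` fst c"
      using w A(2) xy by auto
    show "h w = ((\<lambda>(p, w). h (snd c p, w c)) \<circ> chart_inv (tb_chart {c} c)) w"
      using chart_inv_mem[OF x] by (simp add: xy chart_inv_tb_chart[OF a _ x] chart_inv_right[OF x] tvec_component[OF a])
  qed
  then show ?thesis
    using im by (simp add: Ck_fun_def tb_atlas_def)
qed

text \<open>In the chart \<open>c\<close>, the map \<open>j\<close> parametrizes a hypersurface,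
  \<open>\<psi>\<close> is the flow of \<open>K\<close> started on it, and \<open>g\<close> is the
  inverse of \<open>\<psi>\<close>. The last assumption is positivity of the Hessian on the tangent
  spaces of the hypersurface, from which the Finsler metric arises.\<close>

locale adapted_flow = splitting_conditions M L T K
  for M :: "('a, real \<times> 'e::euclidean_space) chart set"
    and L :: "'a \<times> ('a, real \<times> 'e) tvec \<Rightarrow> real"
    and T :: "('a \<times> ('a, real \<times> 'e) tvec) set"
    and K :: "'a \<Rightarrow> ('a, real \<times> 'e) tvec" +
  fixes c :: "('a, real \<times> 'e) chart" and j :: "'e \<Rightarrow> real \<times> 'e" and \<epsilon> \<rho> :: real
    and \<psi> :: "real \<times> 'e \<Rightarrow> real \<times> 'e" and g :: "real \<times> 'e \<Rightarrow> real \<times> 'e"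
  assumes c: "c \<in> M" and pos: "0 < \<epsilon>" "0 < \<rho>"
    and j_Ck: "\<And>k. Ck_on k (ball 0 \<rho>) j"
    and \<psi>_Ck: "\<And>k. Ck_on k ({-\<epsilon><..<\<epsilon>} \<times> ball 0 \<rho>) \<psi>"
    and \<psi>_range: "\<And>q. q \<in> {-\<epsilon><..<\<epsilon>} \<times> ball 0 \<rho> \<Longrightarrow> \<psi> q \<in> snd c ` fst c"
    and \<psi>_0: "\<And>x. x \<in> ball 0 \<rho> \<Longrightarrow> \<psi> (0, x) = j x"
    and \<psi>_flow: "\<And>q. q \<in> {-\<epsilon><..<\<epsilon>} \<times> ball 0 \<rho> \<Longrightarrow> frechet_derivative \<psi> (at q) (1, 0) = Kc c (\<psi> q)"
    and \<psi>_inj: "\<And>q. q \<in> {-\<epsilon><..<\<epsilon>} \<times> ball 0 \<rho> \<Longrightarrow> inj (frechet_derivative \<psi> (at q))"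
    and open_image: "open (\<psi> ` ({-\<epsilon><..<\<epsilon>} \<times> ball 0 \<rho>))"
    and g_Ck: "\<And>k. Ck_on k (\<psi> ` ({-\<epsilon><..<\<epsilon>} \<times> ball 0 \<rho>)) g"
    and g_\<psi>: "\<And>q. q \<in> {-\<epsilon><..<\<epsilon>} \<times> ball 0 \<rho> \<Longrightarrow> g (\<psi> q) = q"
    and hess_pos: "\<And>x v u. x \<in> ball 0 \<rho> \<Longrightarrow> v \<noteq> 0 \<Longrightarrow> u \<noteq> 0 \<Longrightarrow>
      hess c (j x, frechet_derivative j (at x) v) (frechet_derivative j (at x) u) (frechet_derivative j (at x) u) > 0"
begin

abbreviation "I \<equiv> {-\<epsilon><..<\<epsilon>}"
abbreviation "B \<equiv> ball (0 :: 'e) \<rho>"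
abbreviation "Q \<equiv> {-\<epsilon><..<\<epsilon>} \<times> ball (0 :: 'e) \<rho>"
abbreviation "dj x \<equiv> frechet_derivative j (at x)"
abbreviation "d\<psi> q \<equiv> frechet_derivative \<psi> (at q)"

lemma open_Q: "open Q"
  by (intro open_Times) auto

lemma zero_I: "x \<in> B \<Longrightarrow> (0, x) \<in> Q"
  using pos by auto

lemma j_range: "x \<in> B \<Longrightarrow> j x \<in> snd c ` fst c"
  using \<psi>_range[OF zero_I] \<psi>_0 by simp

lemma \<psi>_der: "q \<in> Q \<Longrightarrow> (\<psi> has_derivative d\<psi> q) (at q)"
  by (rule Ck_on_imp_has_derivative[OF \<psi>_Ck[of 1]]) simp_all

lemma j_der: "x \<in> B \<Longrightarrow> (j has_derivative dj x) (at x)"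
  by (rule Ck_on_imp_has_derivative[OF j_Ck[of 1]]) simp_all

lemma linear_d\<psi>: "q \<in> Q \<Longrightarrow> linear (d\<psi> q)"
  using \<psi>_der has_derivative_linear by blast

lemma linear_dj: "x \<in> B \<Longrightarrow> linear (dj x)"
  using j_der has_derivative_linear by blast

lemma d\<psi>_0: "x \<in> B \<Longrightarrow> d\<psi> (0, x) (\<tau>, v) = \<tau> *\<^sub>R Kc c (j x) + dj x v"
proof -
  assume x: "x \<in> B"
  note q = zero_I[OF x]
  have "((\<lambda>y. (0 :: real, y)) has_derivative (\<lambda>v. (0, v))) (at x)"
    by (auto intro!: derivative_eq_intros)
  from has_derivative_compose[OF this \<psi>_der[OF q]]
  have "((\<lambda>y. \<psi> (0, y)) has_derivative (\<lambda>v. d\<psi> (0, x) (0, v))) (at x)" .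
  then have "(j has_derivative (\<lambda>v. d\<psi> (0, x) (0, v))) (at x)"
    by (rule has_derivative_transform_within_open[OF _ open_ball x]) (rule \<psi>_0)
  then have "dj x = (\<lambda>v. d\<psi> (0, x) (0, v))"
    by (rule frechet_derivative_eqI)
  moreover have "d\<psi> (0, x) (\<tau>, v) = d\<psi> (0, x) (\<tau> *\<^sub>R (1, 0) + (0, v))"
    by simp
  ultimately show ?thesis
    unfolding linear_add[OF linear_d\<psi>[OF q]] linear_cmul[OF linear_d\<psi>[OF q]] \<psi>_flow[OF q] \<psi>_0[OF x] by simp
qed

text \<open>D\<psi> is injective and sends (1, 0) to \<open>K\<close>, so only vectors with v = 0
  are mapped to multiples of \<open>K\<close>.\<close>

lemma d\<psi>_in_Ac: "q \<in> Q \<Longrightarrow> v \<noteq> 0 \<Longrightarrow> (\<psi> q, d\<psi> q (\<tau>, v)) \<in> Ac c"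
proof -
  assume q: "q \<in> Q" and v: "v \<noteq> 0"
  have "d\<psi> q (\<tau>, v) \<noteq> r *\<^sub>R Kc c (\<psi> q)" for r
  proof
    assume "d\<psi> q (\<tau>, v) = r *\<^sub>R Kc c (\<psi> q)"
    also have "\<dots> = d\<psi> q (r *\<^sub>R (1, 0))"
      unfolding linear_cmul[OF linear_d\<psi>[OF q]] \<psi>_flow[OF q] ..
    finally have "(\<tau>, v) = r *\<^sub>R (1, 0)"
      by (rule injD[OF \<psi>_inj[OF q]])
    then show False
      using v by simp
  qed
  then show ?thesis
    using Ac_coord[OF c \<psi>_range[OF q]] by blast
qed

lemma dj_in_Ac: "x \<in> B \<Longrightarrow> v \<noteq> 0 \<Longrightarrow> (j x, \<tau> *\<^sub>R Kc c (j x) + dj x v) \<in> Ac c"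
  using d\<psi>_in_Ac[OF zero_I, of x v \<tau>] d\<psi>_0[of x \<tau> v] \<psi>_0[of x] by simp

text \<open>With \<open>v\<close> nonzero the whole curve of vectors stays off \<open>T\<close>,
  where the Killing equation is available; its value at \<open>t\<close> is compared with the one at
  0.\<close>

lemma Lc_invariant_nonzero:
  assumes t: "t \<in> I" and x: "x \<in> B" and v: "v \<noteq> 0"
  shows "Lc c (\<psi> (t, x), d\<psi> (t, x) (\<tau>, v)) = Lc c (j x, \<tau> *\<^sub>R Kc c (j x) + dj x v)"
proof -
  let ?f = "\<lambda>s. Lc c (\<psi> (s, x), d\<psi> (s, x) (\<tau>, v))"
  have "\<exists>k. \<forall>s\<in>I. ?f s = k"
  proof (rule has_field_derivative_zero_constant)
    fix s
    assume s: "s \<in> I"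
    have q: "(s, x) \<in> Q"
      using s x by auto
    note Ac = d\<psi>_in_Ac[OF q v, of \<tau>]
    have "(?f has_real_derivative 0) (at s)"
    proof (rule flow_invariance[OF open_Q \<psi>_Ck \<psi>_flow q])
      show "Kc c differentiable (at (\<psi> (s, x)))"
        by (rule Ck_on_imp_differentiable[OF Kc_smooth[OF c, of 1] _ \<psi>_range[OF q]]) simp
      show "Lc c differentiable (at (\<psi> (s, x), d\<psi> (s, x) (\<tau>, v)))"
        by (rule Ck_on_imp_differentiable[OF Lc_C3[OF c] _ Ac]) simp
      show "frechet_derivative (Lc c) (at (\<psi> (s, x), d\<psi> (s, x) (\<tau>, v)))
          (Kc c (\<psi> (s, x)), frechet_derivative (Kc c) (at (\<psi> (s, x))) (d\<psi> (s, x) (\<tau>, v))) = 0"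
        by (rule Lc_killing[OF c Ac])
    qed
    then show "(?f has_field_derivative 0) (at s within I)"
      by (rule has_field_derivative_at_within)
  qed simp
  then obtain k where k: "\<forall>s\<in>I. ?f s = k"
    by blast
  moreover have "0 \<in> I"
    using pos by simp
  ultimately have "?f t = ?f 0"
    using t by simp
  then show ?thesis
    by (simp only: d\<psi>_0[OF x] \<psi>_0[OF x])
qed

text \<open>For v = 0 the vector is a multiple of \<open>K\<close> and lies in \<open>T\<close>.
  Polarization with an auxiliary vector expresses L(K) by values of \<open>L\<close> off
  \<open>T\<close>, whose invariance is already known.\<close>

lemma Lc_invariant:
  assumes t: "t \<in> I" and x: "x \<in> B"
  shows "Lc c (\<psi> (t, x), d\<psi> (t, x) (\<tau>, v)) = Lc c (j x, \<tau> *\<^sub>R Kc c (j x) + dj x v)"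
proof (cases "v = 0")
  case False
  then show ?thesis
    by (rule Lc_invariant_nonzero[OF t x])
next
  case True
  have q: "(t, x) \<in> Q"
    using t x by auto
  have Lc0: "Lc c (y, \<tau> *\<^sub>R Kc c y) = \<tau>\<^sup>2 * Lc c (y, Kc c y)" if y: "y \<in> snd c ` fst c" for y \<tau>
  proof -
    have "Lc c (y, 0) = 0"
      by (rule homogeneous_zero) (rule Lc_homogeneous[OF c y])
    moreover have "Theta c y 0 = 0"
      using linear_0[OF linear_Theta[OF c y]] .
    ultimately show ?thesis
      using Lc_add_K[OF c y, of \<tau> 0] by simp
  qed
  \<comment> \<open>Any nonzero direction of the hypersurface serves; one exists because the model
    space is not trivial.\<close>
  obtain b :: 'e where b: "b \<noteq> 0"
    using nonempty_Basis nonzero_Basis by blast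
  \<comment> \<open>By \<open>Lc_add_K\<close> the terms linear in \<open>K\<close> cancel in L(w +
    K) + L(w - K) - 2 L(w), which leaves 2 L(K).\<close>
  have KK: "2 * Lc c (y, Kc c y) = Lc c (y, 1 *\<^sub>R Kc c y + w) + Lc c (y, (-1) *\<^sub>R Kc c y + w) - 2 * Lc c (y, 0 *\<^sub>R Kc c y + w)"
    if y: "y \<in> snd c ` fst c" for y w
    unfolding Lc_add_K[OF c y] by simp
  have dp: "d\<psi> (t, x) (\<sigma>, w) = \<sigma> *\<^sub>R Kc c (\<psi> (t, x)) + d\<psi> (t, x) (0, w)" for \<sigma> w
  proof -
    have "d\<psi> (t, x) (\<sigma>, w) = d\<psi> (t, x) (\<sigma> *\<^sub>R (1, 0) + (0, w))"
      by simp
    then show ?thesis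
      unfolding linear_add[OF linear_d\<psi>[OF q]] linear_cmul[OF linear_d\<psi>[OF q]] \<psi>_flow[OF q] .
  qed
  have inv: "Lc c (\<psi> (t, x), \<sigma> *\<^sub>R Kc c (\<psi> (t, x)) + d\<psi> (t, x) (0, b)) = Lc c (j x, \<sigma> *\<^sub>R Kc c (j x) + dj x b)" for \<sigma>
    using Lc_invariant_nonzero[OF t x b, of \<sigma>] unfolding dp[of \<sigma> b] .
  have "2 * Lc c (\<psi> (t, x), Kc c (\<psi> (t, x))) = 2 * Lc c (j x, Kc c (j x))"
    unfolding KK[OF \<psi>_range[OF q], of "d\<psi> (t, x) (0, b)"] KK[OF j_range[OF x], of "dj x b"] inv ..
  then have "Lc c (\<psi> (t, x), \<tau> *\<^sub>R Kc c (\<psi> (t, x))) = Lc c (j x, \<tau> *\<^sub>R Kc c (j x))"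
    unfolding Lc0[OF \<psi>_range[OF q]] Lc0[OF j_range[OF x]] by simp
  moreover have "d\<psi> (t, x) (0, 0) = 0" "dj x 0 = 0"
    using linear_0[OF linear_d\<psi>[OF q]] linear_0[OF linear_dj[OF x]] by (simp_all add: zero_prod_def)
  ultimately show ?thesis
    unfolding True dp[of \<tau> 0] by simp
qed

lemma Lc_dj_Ck:
  "Ck_on 3 (B \<times> - {0}) (\<lambda>w. Lc c (j (fst w), \<tau> *\<^sub>R Kc c (j (fst w)) + dj (fst w) (snd w)))"
proof -
  let ?A = "B \<times> - {0 :: 'e}"
  have A: "open ?A"
    by (intro open_Times) auto
  have j: "Ck_on k ?A (\<lambda>w. j (fst w))" for k
    by (rule Ck_on_compose[OF A j_Ck Ck_on_fst]) auto
  have "Ck_on 3 ?A (\<lambda>w. (j (fst w), \<tau> *\<^sub>R Kc c (j (fst w)) + dj (fst w) (snd w)))"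
    by (intro Ck_on_Pair[OF A j] Ck_on_add[OF A] Ck_on_scaleR[OF A Ck_on_const] Ck_on_compose[OF A Kc_smooth[OF c] j]
        Ck_on_frechet_derivative[OF A j_Ck Ck_on_fst Ck_on_snd]) (use j_range in auto)
  from Ck_on_compose[OF A Lc_C3[OF c] this] show ?thesis
    using dj_in_Ac by auto
qed

lemma Lc_dj_pos: "x \<in> B \<Longrightarrow> v \<noteq> 0 \<Longrightarrow> Lc c (j x, dj x v) > 0"
  using hess_pos[of x v v] hess_self[OF c, of "j x" "dj x v"] dj_in_Ac[of x v 0] by simp

lemma Lc_dj_nonneg: "x \<in> B \<Longrightarrow> Lc c (j x, dj x v) \<ge> 0"
proof (cases "v = 0")
  case True
  assume x: "x \<in> B"
  have "Lc c (j x, 0) = 0"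
    by (rule homogeneous_zero) (rule Lc_homogeneous[OF c j_range[OF x]])
  then show ?thesis
    using linear_0[OF linear_dj[OF x]] True by simp
qed (use Lc_dj_pos less_imp_le in blast)

definition J :: "'e \<Rightarrow> 'a" where "J x = chart_inv c (j x)"

text \<open>The hypersurface is realized as a subset of \<open>M\<close>, since
  \<open>locally_standard_stationary\<close> takes the points of \<open>S\<close> from there. Its
  coordinates are the spatial components of the inverse flow map.\<close>

definition cS :: "('a, 'e) chart" where "cS = (J ` B, \<lambda>p. snd (g (snd c p)))"

definition Fh :: "'e \<times> 'e \<Rightarrow> real" where "Fh w = sqrt (Lc c (j (fst w), dj (fst w) (snd w)))"

definition \<omega>h :: "'e \<times> 'e \<Rightarrow> real" where "\<omega>h w = Theta c (j (fst w)) (dj (fst w) (snd w))"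

definition \<Lambda>h :: "'e \<Rightarrow> real" where "\<Lambda>h x = - Lc c (j x, Kc c (j x))"

text \<open>Off the zero section \<open>L\<close> is positive and C^3 on the hypersurface, so the
  root is C^3; at the zero section continuity of \<open>L\<close> is enough.\<close>

lemma Fh_Ck: "Ck_on 3 (B \<times> - {0}) Fh" "Ck_on 0 (B \<times> UNIV) Fh"
proof -
  have "Ck_on 3 (B \<times> - {0}) (\<lambda>w. sqrt (Lc c (j (fst w), 0 *\<^sub>R Kc c (j (fst w)) + dj (fst w) (snd w))))"
  proof (rule Ck_on_sqrt[OF _ Lc_dj_Ck])
    show "open (B \<times> - {0 :: 'e})"
      by (intro open_Times) auto
    show "0 < Lc c (j (fst w), 0 *\<^sub>R Kc c (j (fst w)) + dj (fst w) (snd w))" if "w \<in> B \<times> - {0}" for w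
      using Lc_dj_pos[of "fst w" "snd w"] that by (simp add: mem_Times_iff)
  qed
  then show "Ck_on 3 (B \<times> - {0}) Fh"
    by (simp add: Fh_def[abs_def])
  have A: "open (B \<times> (UNIV :: 'e set))"
    by (intro open_Times) auto
  have j: "Ck_on 0 (B \<times> (UNIV :: 'e set)) (\<lambda>w. j (fst w))"
    by (rule Ck_on_compose[OF A j_Ck Ck_on_fst]) auto
  have dj: "Ck_on 0 (B \<times> (UNIV :: 'e set)) (\<lambda>w. dj (fst w) (snd w))"
    by (rule Ck_on_frechet_derivative[OF A j_Ck Ck_on_fst Ck_on_snd]) auto
  have "continuous_on (B \<times> UNIV) (\<lambda>w. Lc c (j (fst w), dj (fst w) (snd w)))"
    by (rule continuous_on_compose2[OF Lc_continuous[OF c]])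
      (use j dj j_range in \<open>auto intro!: continuous_on_Pair\<close>)
  then show "Ck_on 0 (B \<times> UNIV) Fh"
    by (simp add: Fh_def[abs_def] continuous_on_real_sqrt)
qed

text \<open>\<theta> is defined by differentiating \<open>L\<close> at \<open>K\<close>, inside
  \<open>T\<close>, where \<open>L\<close> is merely C^1. Half the difference of \<open>L\<close> at
  w + K and w - K has the same value, and for w the image of a basis vector both arguments are off
  \<open>T\<close>; this is what makes \<omega> of class C^3.\<close>

lemma \<omega>h_eq:
  assumes x: "x \<in> B"
  shows "\<omega>h (x, v) = (\<Sum>b\<in>Basis. (v \<bullet> b) * ((Lc c (j x, 1 *\<^sub>R Kc c (j x) + dj x b) - Lc c (j x, (-1) *\<^sub>R Kc c (j x) + dj x b)) / 2))"
proof -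
  have "linear (\<lambda>v. Theta c (j x) (dj x v))"
    using linear_compose[OF linear_dj[OF x] linear_Theta[OF c j_range[OF x]]] by (simp add: o_def)
  from linear_basis_sum[OF this, of v]
  have "\<omega>h (x, v) = (\<Sum>b\<in>Basis. (v \<bullet> b) * Theta c (j x) (dj x b))"
    by (simp add: \<omega>h_def)
  then show ?thesis
    unfolding Lc_add_K[OF c j_range[OF x]] by simp
qed

lemma \<omega>h_Ck: "Ck_on 3 (B \<times> UNIV) \<omega>h"
proof -
  let ?A = "B \<times> (UNIV :: 'e set)"
  have A: "open ?A"
    by (intro open_Times) auto
  have Lb: "Ck_on 3 ?A (\<lambda>w. Lc c (j (fst w), \<sigma> *\<^sub>R Kc c (j (fst w)) + dj (fst w) b))" if "b \<in> Basis" for b \<sigma>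
  proof -
    have "Ck_on 3 ?A (\<lambda>w. (fst w, b))"
      by (intro Ck_on_Pair[OF A] Ck_on_fst Ck_on_const)
    moreover have "(fst w, b) \<in> B \<times> - {0}" if "w \<in> ?A" for w
      using that nonzero_Basis[OF \<open>b \<in> Basis\<close>] by (simp add: mem_Times_iff)
    ultimately have "Ck_on 3 ?A (\<lambda>w. Lc c (j (fst (fst w, b)), \<sigma> *\<^sub>R Kc c (j (fst (fst w, b))) + dj (fst (fst w, b)) (snd (fst w, b))))"
      by (rule Ck_on_compose[OF A Lc_dj_Ck])
    then show ?thesis
      by simp
  qed
  have v: "Ck_on 3 ?A (\<lambda>w. snd w \<bullet> b)" for b
    by (intro Ck_on_inner[OF A] Ck_on_snd Ck_on_const)
  have "Ck_on 3 ?A (\<lambda>w. \<Sum>b\<in>Basis. (snd w \<bullet> b) * ((Lc c (j (fst w), 1 *\<^sub>R Kc c (j (fst w)) + dj (fst w) b) -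
      Lc c (j (fst w), (-1) *\<^sub>R Kc c (j (fst w)) + dj (fst w) b)) * (1 / 2)))"
    by (intro Ck_on_sum[OF A] Ck_on_mult[OF A v] Ck_on_mult[OF A _ Ck_on_const] Ck_on_diff[OF A] Lb)
  then show ?thesis
    by (rule Ck_on_transfer[OF A]) (auto simp: \<omega>h_eq)
qed

text \<open>The same device for L(K), as a second difference of values of \<open>L\<close> off
  \<open>T\<close>.\<close>

lemma \<Lambda>h_Ck: "Ck_on 3 B \<Lambda>h"
proof -
  obtain b :: 'e where b: "b \<noteq> 0"
    using nonempty_Basis nonzero_Basis by blast
  have Lb: "Ck_on 3 B (\<lambda>x. Lc c (j x, \<sigma> *\<^sub>R Kc c (j x) + dj x b))" for \<sigma>
  proof -
    have "Ck_on 3 B (\<lambda>x. (x, b))"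
      by (intro Ck_on_Pair open_ball Ck_on_ident Ck_on_const)
    from Ck_on_compose[OF open_ball Lc_dj_Ck this, of \<sigma>] show ?thesis
      using b by auto
  qed
  have "Ck_on 3 B (\<lambda>x. Lc c (j x, 0 *\<^sub>R Kc c (j x) + dj x b) - (1 / 2) * (Lc c (j x, 1 *\<^sub>R Kc c (j x) + dj x b) +
      Lc c (j x, (-1) *\<^sub>R Kc c (j x) + dj x b)))"
    by (intro Ck_on_diff[OF open_ball] Ck_on_mult[OF open_ball Ck_on_const] Ck_on_add[OF open_ball] Lb)
  then show ?thesis
    by (rule Ck_on_transfer[OF open_ball])
      (simp only: Lc_add_K[OF c j_range] \<Lambda>h_def, simp add: field_simps)
qed

end

section \<open>The splitting obtained from an adapted flow\<close>

context adapted_flow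
begin

lemma snd_cS_J: "x \<in> B \<Longrightarrow> snd cS (J x) = x"
  using chart_inv_right[OF j_range, of x] g_\<psi>[OF zero_I, of x] \<psi>_0[of x] by (simp add: cS_def J_def)

lemma inj_cS: "inj_on (snd cS) (fst cS)"
proof (rule inj_onI)
  fix p q
  assume "p \<in> fst cS" "q \<in> fst cS" and eq: "snd cS p = snd cS q"
  then obtain x y where xy: "x \<in> B" "y \<in> B" "p = J x" "q = J y"
    by (auto simp: cS_def)
  have "x = y"
    using eq unfolding xy(3,4) snd_cS_J[OF xy(1)] snd_cS_J[OF xy(2)] .
  then show "p = q"
    using xy by simp
qed

lemma range_cS: "snd cS ` fst cS = B"
proof -
  have "fst cS = J ` B"
    by (simp add: cS_def)
  then show ?thesis
    using snd_cS_J by (simp add: image_image)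
qed

lemma atlas_cS: "smooth_atlas {cS}"
  by (rule smooth_atlas_single[OF inj_cS]) (simp only: range_cS open_ball)

lemma manifold_cS: "smooth_manifold {cS}"
  by (rule smooth_manifold_single[OF inj_cS]) (simp only: range_cS open_ball)

lemma chart_inv_cS: "x \<in> B \<Longrightarrow> chart_inv cS x = J x"
  using chart_inv_left[OF atlas_cS, of cS "J x"] snd_cS_J[of x] by (simp add: cS_def)

abbreviation "P \<equiv> prod_atlas {-\<epsilon><..<\<epsilon>} {cS}"
abbreviation "cP \<equiv> prod_chart {-\<epsilon><..<\<epsilon>} cS"

lemma P_single: "P = {cP}"
  by (simp add: prod_atlas_def)

lemma cP_mem: "cP \<in> P"
  unfolding P_single by (rule singletonI)

lemma atlas_P: "smooth_atlas P"
  by (rule smooth_atlas_prod_atlas[OF atlas_cS open_greaterThanLessThan])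

lemma range_cP: "snd cP ` fst cP = Q"
  unfolding prod_chart_range range_cS ..

lemma open_dom: "openin (mfd_top P) (fst cP)"
  by (rule openin_chart_domain[OF atlas_P cP_mem])

lemma snd_cP_mem: "q \<in> fst cP \<Longrightarrow> snd cP q \<in> Q"
  unfolding range_cP[symmetric] by (rule imageI)

definition \<phi> :: "real \<times> 'a \<Rightarrow> 'a" where "\<phi> q = chart_inv c (\<psi> (snd cP q))"

definition U :: "'a set" where "U = chart_inv c ` \<psi> ` Q"

lemma openin_U: "openin (mfd_top M) U"
  unfolding U_def by (rule openin_chart_preimage[OF atlas c open_image]) (use \<psi>_range in blast)

lemma snd_c_\<phi>: "q \<in> fst cP \<Longrightarrow> snd c (\<phi> q) = \<psi> (snd cP q)"
  unfolding \<phi>_def by (rule chart_inv_right[OF \<psi>_range[OF snd_cP_mem]])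

lemma \<phi>_mem: "q \<in> fst cP \<Longrightarrow> \<phi> q \<in> fst c"
  unfolding \<phi>_def by (rule chart_inv_mem[OF \<psi>_range[OF snd_cP_mem]])

lemma \<phi>_image: "\<phi> ` fst cP = U"
proof -
  have "\<phi> ` fst cP = chart_inv c ` \<psi> ` snd cP ` fst cP"
    unfolding image_image using \<phi>_def by (intro image_cong refl)
  then show ?thesis
    unfolding range_cP U_def .
qed

lemma \<phi>_bij: "bij_betw \<phi> (fst cP) U"
proof (rule bij_betw_imageI[OF _ \<phi>_image], rule inj_onI)
  fix q q'
  assume q: "q \<in> fst cP" "q' \<in> fst cP" and "\<phi> q = \<phi> q'"
  then have "\<psi> (snd cP q) = \<psi> (snd cP q')"
    using snd_c_\<phi>[OF q(1)] snd_c_\<phi>[OF q(2)] by simp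
  then have "snd cP q = snd cP q'"
    using g_\<psi>[OF snd_cP_mem[OF q(1)]] g_\<psi>[OF snd_cP_mem[OF q(2)]] by simp
  then show "q = q'"
    by (rule inj_onD[OF chart_inj[OF atlas_P cP_mem] _ q])
qed

lemma \<phi>_smooth: "smooth_map_on P M (fst cP) \<phi>"
  by (rule smooth_map_on_single_chart[OF atlas_P atlas open_dom cP_mem subset_refl c, of \<psi>])
    (unfold range_cP, auto intro: \<psi>_Ck \<psi>_range simp: \<phi>_def)

lemma U_subset: "U \<subseteq> fst c"
  unfolding \<phi>_image[symmetric] by (rule image_subsetI) (rule \<phi>_mem)

lemma snd_c_U: "snd c ` U = \<psi> ` Q"
  unfolding \<phi>_image[symmetric] range_cP[symmetric] image_image using snd_c_\<phi> by (intro image_cong refl)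

lemma \<phi>_inv_smooth: "smooth_map_on M P U (inv_into (fst cP) \<phi>)"
proof (rule smooth_map_on_single_chart[OF atlas atlas_P openin_U c U_subset cP_mem, of g])
  show "Ck_on k (snd c ` U) g" for k
    unfolding snd_c_U by (rule g_Ck)
  show "g x \<in> snd cP ` fst cP" if "x \<in> snd c ` U" for x
    using that unfolding snd_c_U range_cP using g_\<psi> by auto
  show "inv_into (fst cP) \<phi> p = chart_inv cP (g (snd c p))" if "p \<in> U" for p
  proof -
    have "p \<in> \<phi> ` fst cP"
      using that unfolding \<phi>_image .
    then obtain q where q: "p = \<phi> q" "q \<in> fst cP"
      by (rule imageE)
    have "inv_into (fst cP) \<phi> p = q"
      unfolding q(1) by (rule inv_into_f_f[OF bij_betw_imp_inj_on[OF \<phi>_bij] q(2)])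
    moreover have "g (snd c p) = snd cP q"
      unfolding q(1) snd_c_\<phi>[OF q(2)] by (rule g_\<psi>[OF snd_cP_mem[OF q(2)]])
    ultimately show ?thesis
      using chart_inv_left[OF atlas_P cP_mem q(2)] by simp
  qed
qed

lemma tangent_map_\<phi>:
  assumes q: "q \<in> fst cP" and u: "u \<in> tangent_space P q"
  shows "tangent_map P M \<phi> q u = tvec M (\<phi> q) c (d\<psi> (snd cP q) (u cP))"
proof -
  have "frechet_derivative (snd c \<circ> \<phi> \<circ> chart_inv cP) (at (snd cP q)) = d\<psi> (snd cP q)"
  proof (rule frechet_derivative_cong_open[OF open_Q snd_cP_mem[OF q]])
    fix w
    assume "w \<in> Q"
    then have w: "w \<in> snd cP ` fst cP"
      unfolding range_cP .
    show "(snd c \<circ> \<phi> \<circ> chart_inv cP) w = \<psi> w"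
      using snd_c_\<phi>[OF chart_inv_mem[OF w]] unfolding chart_inv_right[OF w] by simp
  qed
  then show ?thesis
    using tangent_map_eqI[OF atlas_P atlas open_dom q \<phi>_smooth cP_mem q c \<phi>_mem[OF q] u] by simp
qed

lemma time_field_eq: "q \<in> fst cP \<Longrightarrow> time_field {-\<epsilon><..<\<epsilon>} {cS} q = tvec P q cP (1, 0)"
proof
  fix d
  assume q: "q \<in> fst cP"
  show "time_field {-\<epsilon><..<\<epsilon>} {cS} q d = tvec P q cP (1, 0) d"
  proof (cases "d = cP")
    case True
    then show ?thesis
      using q cP_mem tvec_component[OF atlas_P cP_mem q] by (simp only: time_field_def) simp
  next
    case False
    then have "d \<notin> P"
      unfolding P_single by simp
    then show ?thesis
      by (simp only: time_field_def tvec_def) simp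
  qed
qed

lemma snd_mem: "q \<in> fst cP \<Longrightarrow> fst q \<in> I \<and> snd q \<in> fst cS"
  by auto

lemma dfun_fst: "q \<in> fst cP \<Longrightarrow> u \<in> tangent_space P q \<Longrightarrow> dfun P fst q u = fst (u cP)"
  using dfun_prod_fst[OF atlas_cS open_greaterThanLessThan singletonI, of "fst q" _ _ "snd q" u] snd_mem[of q] by (simp only: prod.collapse)

lemma tangent_map_snd: "q \<in> fst cP \<Longrightarrow> u \<in> tangent_space P q \<Longrightarrow> tangent_map P {cS} snd q u = tvec {cS} (snd q) cS (snd (u cP))"
  using tangent_map_prod_snd[OF atlas_cS open_greaterThanLessThan singletonI, of "fst q" _ _ "snd q" u] snd_mem[of q] by (simp only: prod.collapse)

definition F :: "'a \<times> ('a, 'e) tvec \<Rightarrow> real" where "F = (\<lambda>(p, w). Fh (snd cS p, w cS))"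
definition \<omega> :: "'a \<times> ('a, 'e) tvec \<Rightarrow> real" where "\<omega> = (\<lambda>(p, w). \<omega>h (snd cS p, w cS))"
definition \<Lambda> :: "'a \<Rightarrow> real" where "\<Lambda> p = \<Lambda>h (snd cS p)"

lemma space_cS: "mfd_space {cS} = fst cS"
  by (simp add: mfd_space_def)

lemma snd_cS_mem: "p \<in> fst cS \<Longrightarrow> snd cS p \<in> B"
  using range_cS by blast

text \<open>F^2 is \<open>L\<close> composed with the linear map \<iota> from the tangent space of
  the hypersurface into that of \<open>M\<close>. Its fibre Hessian is therefore the pullback of the
  Hessian of \<open>L\<close>, positive by \<open>hess_pos\<close>.\<close>

lemma finsler_F: "finsler_metric {cS} F"
  unfolding finsler_metric_def
proof (intro conjI)
  have im: "snd (tb_chart {cS} cS) ` (tangent_bundle {cS} \<inter> fst (tb_chart {cS} cS)) = B \<times> UNIV"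
    using tb_chart_image_bundle[OF atlas_cS, of cS] range_cS by simp
  have im0: "snd (tb_chart {cS} cS) ` ((tangent_bundle {cS} - zero_section {cS}) \<inter> fst (tb_chart {cS} cS)) = B \<times> - {0}"
    using tb_chart_image_nonzero[OF atlas_cS, of cS] range_cS by simp
  show "\<forall>x\<in>tangent_bundle {cS}. 0 \<le> F x"
  proof
    fix x
    assume "x \<in> tangent_bundle {cS}"
    then obtain p w where "x = (p, w)" "p \<in> fst cS"
      by (auto simp: tangent_bundle_def space_cS)
    then show "0 \<le> F x"
      using Lc_dj_nonneg[OF snd_cS_mem] by (simp add: F_def Fh_def)
  qed
  show "Ck_fun (tb_atlas {cS}) 0 (tangent_bundle {cS}) F"
    unfolding F_def
    by (rule Ck_fun_tb_single[OF atlas_cS _ _ Fh_Ck(2) im]) (auto intro!: open_Times simp: range_cS)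
  show "Ck_fun (tb_atlas {cS}) 3 (tangent_bundle {cS} - zero_section {cS}) F"
    unfolding F_def
    by (rule Ck_fun_tb_single[OF atlas_cS _ _ Fh_Ck(1) im0]) (auto intro!: open_Times simp: range_cS)
  show "\<forall>(p, v)\<in>tangent_bundle {cS}. \<forall>r>0. F (p, r *\<^sub>R v) = r * F (p, v)"
  proof safe
    fix p v and r :: real
    assume "(p, v) \<in> tangent_bundle {cS}" and r: "r > 0"
    then have "p \<in> fst cS"
      by (auto simp: tangent_bundle_def space_cS)
    then have x: "snd cS p \<in> B"
      by (rule snd_cS_mem)
    show "F (p, r *\<^sub>R v) = r * F (p, v)"
      using Lc_homogeneous[OF c j_range[OF x] r] r
      by (simp add: F_def Fh_def linear_cmul[OF linear_dj[OF x]] real_sqrt_mult)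
  qed
  show "\<forall>(p, v)\<in>tangent_bundle {cS} - zero_section {cS}.
      \<forall>u\<in>tangent_space {cS} p. u \<noteq> 0 \<longrightarrow> fib_hess (\<lambda>x. (F x)\<^sup>2) p v u u > 0"
  proof safe
    fix p v u
    assume pv: "(p, v) \<in> tangent_bundle {cS}" "(p, v) \<notin> zero_section {cS}"
      and u: "u \<in> tangent_space {cS} p" "u \<noteq> 0"
    have p: "p \<in> fst cS" and v: "v \<in> tangent_space {cS} p" "v \<noteq> 0"
      using pv by (auto simp: tangent_bundle_def zero_section_def space_cS)
    let ?x = "snd cS p"
    have x: "?x \<in> B"
      by (rule snd_cS_mem[OF p])
    have nz: "w cS \<noteq> 0" if "w \<in> tangent_space {cS} p" "w \<noteq> 0" for w
      using tangent_space_eqI[OF that(1) tangent_space_0[OF atlas_cS] _ p] that(2) by auto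
    let ?y = "J ?x"
    have y: "?y \<in> fst c" "snd c ?y = j ?x"
      using chart_inv_mem[OF j_range[OF x]] chart_inv_right[OF j_range[OF x]] by (simp_all add: J_def)
    define \<iota> where "\<iota> = (\<lambda>w :: ('a, 'e) tvec. tvec M ?y c (dj ?x (w cS)))"
    have \<iota>t: "\<iota> w \<in> tangent_space M ?y" "\<iota> w c = dj ?x (w cS)" for w
      using tvec_in_tangent_space[OF atlas c y(1)] tvec_component[OF atlas c y(1)] by (simp_all add: \<iota>_def)
    have \<iota>_lin: "\<iota> (v + s *\<^sub>R u + t *\<^sub>R u) = \<iota> v + s *\<^sub>R \<iota> u + t *\<^sub>R \<iota> u" for s t
      by (rule tangent_space_eqI[OF \<iota>t(1) _ c y(1)])
        (simp_all add: \<iota>t tangent_space_add tangent_space_scaleR atlas linear_add[OF linear_dj[OF x]] linear_cmul[OF linear_dj[OF x]])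
    have F2: "(F (p, w))\<^sup>2 = L (?y, \<iota> w)" for w
    proof -
      have "(F (p, w))\<^sup>2 = Lc c (j ?x, dj ?x (w cS))"
        using Lc_dj_nonneg[OF x] by (simp add: F_def Fh_def)
      then show ?thesis
        using Lc_eq[OF c y(1) \<iota>t(1)] \<iota>t(2) y(2) by simp
    qed
    have "fib_hess (\<lambda>x. (F x)\<^sup>2) p v u u = fib_hess L ?y (\<iota> v) (\<iota> u) (\<iota> u)"
      unfolding fib_hess_def F2 \<iota>_lin ..
    also have "\<dots> = hess c (j ?x, dj ?x (v cS)) (dj ?x (u cS)) (dj ?x (u cS))"
    proof -
      have "(?y, \<iota> v) \<notin> T"
        using Ac_iff[OF c y(1) \<iota>t(1)] dj_in_Ac[OF x nz[OF v], of 0] by (simp add: \<iota>t y(2))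
      from fib_hess_eq[OF c y(1) \<iota>t(1) this \<iota>t(1) \<iota>t(1)] show ?thesis
        by (simp add: \<iota>t y(2))
    qed
    finally show "fib_hess (\<lambda>x. (F x)\<^sup>2) p v u u > 0"
      using hess_pos[OF x nz[OF v] nz[OF u]] by simp
  qed
qed

lemma one_form_\<omega>: "one_form {cS} \<omega>"
  unfolding one_form_def
proof (intro conjI ballI allI)
  have im: "snd (tb_chart {cS} cS) ` (tangent_bundle {cS} \<inter> fst (tb_chart {cS} cS)) = B \<times> UNIV"
    using tb_chart_image_bundle[OF atlas_cS, of cS] range_cS by simp
  show "Ck_fun (tb_atlas {cS}) 3 (tangent_bundle {cS}) \<omega>"
    unfolding \<omega>_def
    by (rule Ck_fun_tb_single[OF atlas_cS _ _ \<omega>h_Ck im]) (auto intro!: open_Times simp: range_cS)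
  fix p u v and a b :: real
  assume "p \<in> mfd_space {cS}"
  then have x: "snd cS p \<in> B"
    unfolding space_cS by (rule snd_cS_mem)
  show "\<omega> (p, a *\<^sub>R u + b *\<^sub>R v) = a * \<omega> (p, u) + b * \<omega> (p, v)"
    by (simp add: \<omega>_def \<omega>h_def linear_add[OF linear_dj[OF x]] linear_cmul[OF linear_dj[OF x]]
        Theta_lincomb[OF c j_range[OF x]])
qed

lemma Lambda_Ck: "Ck_fun {cS} 3 (mfd_space {cS}) \<Lambda>"
proof -
  have "Ck_on 3 B (\<Lambda> \<circ> chart_inv cS)"
    by (rule Ck_on_transfer[OF open_ball \<Lambda>h_Ck]) (simp add: \<Lambda>_def chart_inv_cS snd_cS_J)
  then show ?thesis
    by (simp add: Ck_fun_def space_cS range_cS)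
qed

text \<open>In the formula for \<open>L\<close>, flow invariance removes the dependence on t, and
  \<open>Lc_add_K\<close> on the hypersurface expands in \<tau>.\<close>

lemma splitting: "standard_splitting M L K U \<epsilon> {cS} \<phi> \<Lambda> \<omega> F"
proof -
  have D: "I \<times> mfd_space {cS} = fst cP"
    by (simp add: space_cS)
  have time: "tangent_map P M \<phi> q (time_field I {cS} q) = K (\<phi> q)" if q: "q \<in> fst cP" for q
  proof -
    have "tangent_map P M \<phi> q (time_field I {cS} q) = tvec M (\<phi> q) c (d\<psi> (snd cP q) (1, 0))"
      unfolding time_field_eq[OF q]
      using tangent_map_\<phi>[OF q tvec_in_tangent_space[OF atlas_P cP_mem q]] tvec_component[OF atlas_P cP_mem q] by (simp only:)
    also have "d\<psi> (snd cP q) (1, 0) = K (\<phi> q) c"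
      unfolding \<psi>_flow[OF snd_cP_mem[OF q]] snd_c_\<phi>[OF q, symmetric] by (rule Kc_eq[OF c \<phi>_mem[OF q]])
    finally show ?thesis
      using tvec_eq[OF K_tangent[OF mem_mfd_space[OF c \<phi>_mem[OF q]]] c \<phi>_mem[OF q]] by simp
  qed
  have formula: "L (\<phi> q, tangent_map P M \<phi> q u) =
      - \<Lambda> (snd q) * (dfun P fst q u)\<^sup>2 + \<omega> (snd q, tangent_map P {cS} snd q u) * dfun P fst q u +
      (F (snd q, tangent_map P {cS} snd q u))\<^sup>2" if q: "q \<in> fst cP" and u: "u \<in> tangent_space P q" for q u
  proof -
    let ?x = "snd cS (snd q)"
    obtain \<tau> v where uv: "u cP = (\<tau>, v)"
      by (cases "u cP")
    have x: "?x \<in> B" and t: "fst q \<in> I"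
      using q snd_cS_mem by auto
    have scP: "snd cP q = (fst q, ?x)"
      by (simp add: case_prod_unfold)
    have "L (\<phi> q, tangent_map P M \<phi> q u) = Lc c (\<psi> (fst q, ?x), d\<psi> (fst q, ?x) (\<tau>, v))"
      unfolding tangent_map_\<phi>[OF q u] uv scP
      using Lc_eq[OF c \<phi>_mem[OF q] tvec_in_tangent_space[OF atlas c \<phi>_mem[OF q]]] tvec_component[OF atlas c \<phi>_mem[OF q]]
        snd_c_\<phi>[OF q] scP by metis
    also have "\<dots> = Lc c (j ?x, \<tau> *\<^sub>R Kc c (j ?x) + dj ?x v)"
      by (rule Lc_invariant[OF t x])
    also have "\<dots> = Lc c (j ?x, dj ?x v) + \<tau> * Theta c (j ?x) (dj ?x v) + \<tau>\<^sup>2 * Lc c (j ?x, Kc c (j ?x))"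
      by (rule Lc_add_K[OF c j_range[OF x]])
    also have "\<dots> = - \<Lambda> (snd q) * \<tau>\<^sup>2 + \<omega> (snd q, tvec {cS} (snd q) cS v) * \<tau> + (F (snd q, tvec {cS} (snd q) cS v))\<^sup>2"
      using Lc_dj_nonneg[OF x] tvec_component[OF atlas_cS _ conjunct2[OF snd_mem[OF q]]]
      by (simp add: \<Lambda>_def \<Lambda>h_def \<omega>_def \<omega>h_def F_def Fh_def)
    finally show ?thesis
      unfolding dfun_fst[OF q u] tangent_map_snd[OF q u] uv by simp
  qed
  have Lpos: "0 < \<Lambda> s" if "s \<in> mfd_space {cS}" for s
    using Lc_Kc_neg[OF c j_range[OF snd_cS_mem]] that by (simp add: \<Lambda>_def \<Lambda>h_def space_cS)
  have tb: "tangent_bundle P = Sigma (fst cP) (tangent_space P)"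
    unfolding tangent_bundle_def mfd_space_prod_atlas D ..
  show ?thesis
    unfolding standard_splitting_def Let_def D
  proof (intro conjI)
    show "\<forall>(q, u)\<in>tangent_bundle P. L (\<phi> q, tangent_map P M \<phi> q u) =
        - \<Lambda> (snd q) * (dfun P fst q u)\<^sup>2 + \<omega> (snd q, tangent_map P {cS} snd q u) * dfun P fst q u +
        (F (snd q, tangent_map P {cS} snd q u))\<^sup>2"
      unfolding tb using formula by (auto simp del: prod.sel split_paired_All)
  qed (use openin_U pos manifold_cS \<phi>_bij \<phi>_smooth \<phi>_inv_smooth time Lambda_Ck Lpos one_form_\<omega> finsler_F in \<open>simp_all only: ball_simps\<close>, blast+)
qed

lemma \<omega>_eq_0:
  assumes "\<And>x v. x \<in> B \<Longrightarrow> Theta c (j x) (dj x v) = 0" and "y \<in> tangent_bundle {cS}"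
  shows "\<omega> y = 0"
  using assms snd_cS_mem by (auto simp: \<omega>_def \<omega>h_def tangent_bundle_def space_cS)

lemma base_in_U: "chart_inv c (j 0) \<in> U"
proof -
  have "0 \<in> B"
    using pos by simp
  then have "j 0 = \<psi> (0, 0)" "(0, 0) \<in> Q"
    by (auto intro!: \<psi>_0[symmetric] simp: pos)
  then show ?thesis
    unfolding U_def by (simp only: imageI)
qed

end

section \<open>Existence of adapted flows\<close>

lemma flow_initial_derivative:
  fixes \<psi> :: "real \<times> 'p::euclidean_space \<Rightarrow> 'b::euclidean_space"
  assumes \<psi>: "(\<psi> has_derivative D) (at (0, x))" and "open S" "x \<in> S" and j: "\<And>y. y \<in> S \<Longrightarrow> \<psi> (0, y) = j y"
  shows "D (\<tau>, v) = \<tau> *\<^sub>R D (1, 0) + frechet_derivative j (at x) v"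
proof -
  have "((\<lambda>y. (0 :: real, y)) has_derivative (\<lambda>v. (0, v))) (at x)"
    by (auto intro!: derivative_eq_intros)
  from has_derivative_compose[OF this \<psi>]
  have "((\<lambda>y. \<psi> (0, y)) has_derivative (\<lambda>v. D (0, v))) (at x)" .
  then have "(j has_derivative (\<lambda>v. D (0, v))) (at x)"
    by (rule has_derivative_transform_within_open[OF _ assms(2,3)]) (rule j)
  then have "frechet_derivative j (at x) = (\<lambda>v. D (0, v))"
    by (rule frechet_derivative_eqI)
  moreover have "D (\<tau>, v) = D (\<tau> *\<^sub>R (1, 0) + (0, v))"
    by simp
  moreover have "linear D"
    using \<psi> by (rule has_derivative_linear)
  ultimately show ?thesis
    using linear_add[of D "\<tau> *\<^sub>R (1, 0)" "(0, v)"] linear_cmul[of D \<tau> "(1, 0)"] by simp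
qed

context splitting_conditions
begin

text \<open>\<open>hess\<close> is known to be continuous in the point only for fixed vectors, while
  below the vectors vary with the point; the expansion in components separates the two
  dependences.\<close>

lemma hess_double_sum:
  assumes c: "c \<in> M" and z: "z \<in> Ac c"
  shows "hess c z u u = (\<Sum>l\<in>Basis. \<Sum>i\<in>Basis. (u \<bullet> l) * (u \<bullet> i) * hess c z i l)"
proof -
  have "hess c z u u = (\<Sum>l\<in>Basis. (u \<bullet> l) *\<^sub>R hess c z l u)"
    by (rule linear_basis_sum[OF hess_linear[OF c z]])
  also have "\<dots> = (\<Sum>l\<in>Basis. (u \<bullet> l) *\<^sub>R (\<Sum>i\<in>Basis. (u \<bullet> i) *\<^sub>R hess c z i l))"
    unfolding hess_sym[OF c z, of _ u] linear_basis_sum[OF hess_linear[OF c z], of u] ..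
  finally show ?thesis
    by (simp add: sum_distrib_left mult.assoc)
qed

text \<open>Horizontality is required at 0 only. There it gives transversality to \<open>K\<close>,
  hence a local inverse of the flow map, and positivity of the Hessian; both persist nearby. All
  domains are then shrunk to a common box.\<close>

lemma adapted_flow_exists:
  fixes j :: "'e \<Rightarrow> real \<times> 'e"
  assumes c: "c \<in> M" and P: "open P" "0 \<in> P" and j: "\<And>k. Ck_on k P j" "j 0 \<in> snd c ` fst c"
    and inj: "inj (frechet_derivative j (at 0))" and hor: "\<And>v. Theta c (j 0) (frechet_derivative j (at 0) v) = 0"
  obtains \<epsilon> \<rho> \<psi> g where "adapted_flow M L T K c j \<epsilon> \<rho> \<psi> g" "ball 0 \<rho> \<subseteq> P"
proof -
  let ?R = "snd c ` fst c"
  let ?dj = "\<lambda>x. frechet_derivative j (at x)"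
  have R: "open ?R"
    by (rule open_chart_range[OF atlas c])
  obtain a r :: real and \<psi> :: "real \<times> 'e \<Rightarrow> real \<times> 'e" where ar: "0 < a" "0 < r" "ball 0 r \<subseteq> P"
    and \<psi>: "\<And>k. Ck_on k ({-a<..<a} \<times> ball 0 r) \<psi>"
      "\<And>t x. \<bar>t\<bar> < a \<Longrightarrow> x \<in> ball 0 r \<Longrightarrow> \<psi> (t, x) \<in> ?R"
      "\<And>x. x \<in> ball 0 r \<Longrightarrow> \<psi> (0, x) = j x"
      "\<And>t x. \<bar>t\<bar> < a \<Longrightarrow> x \<in> ball 0 r \<Longrightarrow> frechet_derivative \<psi> (at (t, x)) (1, 0) = Kc c (\<psi> (t, x))"
    by (rule smooth_flow[OF R Kc_smooth[OF c] P(1) j(1) P(2) j(2)]) (rule that)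
  let ?Q = "{-a<..<a} \<times> ball (0 :: 'e) r"
  have Q: "open ?Q"
    by (intro open_Times) auto
  have Q0: "(0, x) \<in> ?Q" if "x \<in> ball 0 r" for x
    using ar that by auto
  have \<psi>_der: "(\<psi> has_derivative frechet_derivative \<psi> (at q)) (at q)" if "q \<in> ?Q" for q
    by (rule Ck_on_imp_has_derivative[OF \<psi>(1)[of 1] _ that]) simp
  have D0: "frechet_derivative \<psi> (at (0, x)) (\<tau>, v) = \<tau> *\<^sub>R Kc c (j x) + ?dj x v" if x: "x \<in> ball 0 r" for x \<tau> v
    using flow_initial_derivative[OF \<psi>_der[OF Q0[OF x]] open_ball x \<psi>(3), of \<tau> v] \<psi>(4)[of 0 x] \<psi>(3)[OF x] ar(1) x by simp
  have z: "(0 :: 'e) \<in> ball 0 r"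
    using ar by simp
  have j_der: "(j has_derivative ?dj x) (at x)" if "x \<in> ball 0 r" for x
    by (rule Ck_on_imp_has_derivative[OF j(1)[of 1]]) (use ar(3) that in auto)
  have dj_lin: "linear (?dj x)" if "x \<in> ball 0 r" for x
    using j_der[OF that] by (rule has_derivative_linear)
  have jR: "j x \<in> ?R" if "x \<in> ball 0 r" for x
    using \<psi>(2)[of 0 x] \<psi>(3)[OF that] ar(1) that by simp
  have inj0: "inj (frechet_derivative \<psi> (at (0, 0)))"
    unfolding linear_injective_0[OF has_derivative_linear[OF \<psi>_der[OF Q0[OF z]]]]
  proof (intro allI impI)
    fix w :: "real \<times> 'e"
    assume w: "frechet_derivative \<psi> (at (0, 0)) w = 0"
    obtain \<tau> v where tv: "w = (\<tau>, v)"
      by (cases w)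
    have e: "\<tau> *\<^sub>R Kc c (j 0) + 1 *\<^sub>R ?dj 0 v = 0"
      using w D0[OF z, of \<tau> v] tv by simp
    \<comment> \<open>\<theta> annihilates the tangential part and has the nonzero value 2 L(K) at
      \<open>K\<close>, so the component along \<open>K\<close> vanishes.\<close>
    have "Theta c (j 0) (\<tau> *\<^sub>R Kc c (j 0) + 1 *\<^sub>R ?dj 0 v) = \<tau> * (2 * Lc c (j 0, Kc c (j 0)))"
      unfolding Theta_lincomb[OF c j(2)] Theta_K[OF c j(2)] hor by simp
    moreover have "Theta c (j 0) 0 = 0"
      by (rule linear_0[OF linear_Theta[OF c j(2)]])
    ultimately have \<tau>: "\<tau> = 0"
      using e Lc_Kc_neg[OF c j(2)] by simp
    then have "?dj 0 v = ?dj 0 0"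
      using e linear_0[OF dj_lin[OF z]] by simp
    then have "v = 0"
      by (rule injD[OF inj])
    then show "w = 0"
      using \<tau> tv by (simp add: zero_prod_def)
  qed
  obtain U' V g where U': "open U'" "U' \<subseteq> ?Q" "(0, 0) \<in> U'" "open V" "homeomorphism U' V \<psi> g"
    "\<And>k. Ck_on k V g" "\<And>x. x \<in> U' \<Longrightarrow> bij (frechet_derivative \<psi> (at x))"
    by (rule smooth_inverse_function[OF Q \<psi>(1) Q0[OF z] inj0]) (rule that)
  define N where "N = ball 0 r \<inter> (\<lambda>x. (0 :: real, x)) -` U'"
  have N: "open N" "0 \<in> N"
    unfolding N_def using U' z by (auto intro!: open_Int open_vimage continuous_intros)
  have Nr: "x \<in> ball 0 r" "(0, x) \<in> U'" if "x \<in> N" for x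
    using that by (auto simp: N_def)
  have dj_Ac: "(j x, ?dj x v) \<in> Ac c" "?dj x v \<noteq> 0" if x: "x \<in> N" and v: "v \<noteq> 0" for x v
  proof -
    have inj: "inj (frechet_derivative \<psi> (at (0, x)))"
      by (rule bij_is_inj[OF U'(7)[OF Nr(2)[OF x]]])
    have ne: "?dj x v \<noteq> s *\<^sub>R Kc c (j x)" for s
    proof
      assume "?dj x v = s *\<^sub>R Kc c (j x)"
      then have "frechet_derivative \<psi> (at (0, x)) (0, v) = frechet_derivative \<psi> (at (0, x)) (s, 0)"
        unfolding D0[OF Nr(1)[OF x]] using linear_0[OF dj_lin[OF Nr(1)[OF x]]] by simp
      then have "(0, v) = (s, 0 :: 'e)"
        by (rule injD[OF inj])
      then show False
        using v by simp
    qed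
    show "(j x, ?dj x v) \<in> Ac c"
      using Ac_coord[OF c jR[OF Nr(1)[OF x]]] ne by blast
    show "?dj x v \<noteq> 0"
      using ne[of 0] by simp
  qed
  \<comment> \<open>The Hessian at Dj(x) v evaluated on Dj(x) u, in components, so that it is
    jointly continuous in (x, v, u) for nonzero v.\<close>
  define H where "H = (\<lambda>w :: 'e \<times> ('e \<times> 'e). \<Sum>l\<in>Basis. \<Sum>i\<in>Basis. (?dj (fst w) (snd (snd w)) \<bullet> l) *
      (?dj (fst w) (snd (snd w)) \<bullet> i) * hess c (j (fst w), ?dj (fst w) (fst (snd w))) i l)"
  have H_eq: "H (x, v, u) = hess c (j x, ?dj x v) (?dj x u) (?dj x u)" if "x \<in> N" "v \<noteq> 0" for x v u
    unfolding H_def hess_double_sum[OF c dj_Ac(1)[OF that]] by simp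
  let ?W = "N \<times> ((- {0 :: 'e}) \<times> (UNIV :: 'e set))"
  have W: "open ?W"
    using N by (intro open_Times) auto
  have jN: "Ck_on k N j" for k
    by (rule Ck_on_subset[OF j(1)]) (use Nr ar(3) in blast)
  have f1: "Ck_on 0 ?W (\<lambda>w. snd (snd w))" "Ck_on 0 ?W (\<lambda>w. fst (snd w))"
    by (auto intro!: continuous_intros)
  have cj: "continuous_on ?W (\<lambda>w. j (fst w))"
    using Ck_on_compose[OF W jN[of 0] Ck_on_fst] by auto
  have cu: "continuous_on ?W (\<lambda>w. ?dj (fst w) (snd (snd w)))" "continuous_on ?W (\<lambda>w. ?dj (fst w) (fst (snd w)))"
    using Ck_on_frechet_derivative[OF W jN[of "Suc 0"] Ck_on_fst f1(1)]
      Ck_on_frechet_derivative[OF W jN[of "Suc 0"] Ck_on_fst f1(2)] by auto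
  have ch: "continuous_on ?W (\<lambda>w. hess c (j (fst w), ?dj (fst w) (fst (snd w))) i l)" for i l
  proof (rule continuous_on_compose2[OF Ck_on_imp_continuous_on[OF second_derivative_Ck[OF c]] continuous_on_Pair[OF cj cu(2)]])
    show "(\<lambda>w. (j (fst w), ?dj (fst w) (fst (snd w)))) ` ?W \<subseteq> Ac c"
    proof (rule image_subsetI)
      fix w
      assume "w \<in> ?W"
      then have "fst w \<in> N" "fst (snd w) \<noteq> 0"
        by (simp_all add: mem_Times_iff)
      then show "(j (fst w), ?dj (fst w) (fst (snd w))) \<in> Ac c"
        by (rule dj_Ac(1))
    qed
  qed
  have "continuous_on ?W H"
    unfolding H_def by (intro continuous_on_sum continuous_on_mult continuous_on_inner cu ch continuous_on_const)
  then have cH: "continuous_on (N \<times> (sphere 0 1 \<times> sphere 0 1)) H"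
    by (rule continuous_on_subset) auto
  obtain p where p: "p \<in> fst c" "j 0 = snd c p" "chart_inv c (j 0) = p" "p \<in> mfd_space M"
    by (rule chart_point[OF c j(2)])
  have pos0: "H (0, v, u) > 0" if "v \<noteq> 0" "u \<noteq> 0" for v u
  proof -
    have t: "tvec M p c y \<in> tangent_space M p" "tvec M p c y c = y" for y
      using tvec_in_tangent_space[OF atlas c p(1)] tvec_component[OF atlas c p(1)] by auto
    have nT: "(p, tvec M p c (?dj 0 v)) \<notin> T"
      using Ac_iff[OF c p(1) t(1)] dj_Ac(1)[OF N(2) that(1)] by (simp add: t p(2))
    have "tvec M p c (?dj 0 u) \<noteq> 0"
      using t(2)[of "?dj 0 u"] dj_Ac(2)[OF N(2) that(2)] by (metis zero_fun_apply)
    moreover have "\<theta> p (tvec M p c (?dj 0 u)) = 0"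
      using hor[of u] by (simp add: Theta_def p(3))
    ultimately have "fib_hess L p (tvec M p c (?dj 0 v)) (tvec M p c (?dj 0 u)) (tvec M p c (?dj 0 u)) > 0"
      by (intro hess_positive[OF c p(1) t(1) nT t(1)])
    then show ?thesis
      unfolding H_eq[OF N(2) that(1)] fib_hess_eq[OF c p(1) t(1) nT t(1) t(1)] t(2) p(2) .
  qed
  \<comment> \<open>Pairs of unit vectors form a compact set, so positivity over 0 extends to a
    ball.\<close>
  obtain \<rho>1 where \<rho>1: "\<rho>1 > 0" "ball 0 \<rho>1 \<subseteq> N"
    "\<And>x k. x \<in> ball 0 \<rho>1 \<Longrightarrow> k \<in> sphere 0 1 \<times> sphere 0 1 \<Longrightarrow> H (x, k) > 0"
  proof (rule compact_positive_neighbourhood[OF N _ cH])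
    show "compact (sphere (0 :: 'e) 1 \<times> sphere (0 :: 'e) 1)"
      by (intro compact_Times compact_sphere)
    show "H (0, k) > 0" if "k \<in> sphere 0 1 \<times> sphere 0 1" for k
    proof -
      have "fst k \<noteq> 0" "snd k \<noteq> 0"
        using that by auto
      then show ?thesis
        using pos0[of "fst k" "snd k"] by simp
    qed
  qed (rule that)
  \<comment> \<open>Degree 0 in \<open>v\<close> and degree 2 in \<open>u\<close> reduce arbitrary
    nonzero vectors to unit vectors.\<close>
  have hp: "hess c (j x, ?dj x v) (?dj x u) (?dj x u) > 0" if x: "x \<in> ball 0 \<rho>1" and v: "v \<noteq> 0" and u: "u \<noteq> 0" for x v u
  proof -
    have xN: "x \<in> N"
      using x \<rho>1(2) by auto
    note lin = dj_lin[OF Nr(1)[OF xN]]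
    let ?v = "v /\<^sub>R norm v" and ?u = "u /\<^sub>R norm u"
    have nv: "?v \<noteq> 0" "norm v > 0" "norm u > 0"
      using v u by auto
    have vv: "?dj x v = norm v *\<^sub>R ?dj x ?v" "?dj x u = norm u *\<^sub>R ?dj x ?u"
      using v u by (simp_all add: linear_cmul[OF lin])
    have Ac: "(j x, ?dj x ?v) \<in> Ac c" "(j x, norm v *\<^sub>R ?dj x ?v) \<in> Ac c"
      using dj_Ac(1)[OF xN nv(1)] dj_Ac(1)[OF xN v] unfolding vv(1) by auto
    have "H (x, ?v, ?u) > 0"
      by (rule \<rho>1(3)[OF x]) (use u v in auto)
    then have pos: "hess c (j x, ?dj x ?v) (?dj x ?u) (?dj x ?u) > 0"
      unfolding H_eq[OF xN nv(1)] .
    have "hess c (j x, ?dj x v) (?dj x u) (?dj x u) = hess c (j x, ?dj x ?v) (norm u *\<^sub>R ?dj x ?u) (norm u *\<^sub>R ?dj x ?u)"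
      unfolding vv hess_scale[OF c Ac nv(2)] ..
    also have "\<dots> = norm u * hess c (j x, ?dj x ?v) (?dj x ?u) (norm u *\<^sub>R ?dj x ?u)"
      using linear_cmul[OF hess_linear[OF c Ac(1)]] by simp
    also have "\<dots> = norm u * (norm u * hess c (j x, ?dj x ?v) (?dj x ?u) (?dj x ?u))"
      unfolding hess_sym[OF c Ac(1), of "?dj x ?u" "norm u *\<^sub>R ?dj x ?u"] using linear_cmul[OF hess_linear[OF c Ac(1)]] by simp
    finally show ?thesis
      using pos nv(3) by simp
  qed
  obtain e where e: "e > 0" "ball (0, 0) e \<subseteq> U'"
    using U'(1,3) openE by blast
  \<comment> \<open>The norm of a pair is at most the sum of the norms, so a box with half-widths
    e/2 fits into the ball of radius e.\<close>
  define \<epsilon> where "\<epsilon> = e / 2"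
  define \<rho> where "\<rho> = min (e / 2) \<rho>1"
  let ?q = "{-\<epsilon><..<\<epsilon>} \<times> ball (0 :: 'e) \<rho>"
  have q: "open ?q"
    by (intro open_Times) auto
  have qU: "?q \<subseteq> U'"
  proof
    fix w
    assume w: "w \<in> ?q"
    have "norm w \<le> norm (fst w) + norm (snd w)"
      using norm_Pair_le[of "fst w" "snd w"] by simp
    also have "\<dots> < e"
      using w by (auto simp: \<epsilon>_def \<rho>_def abs_less_iff)
    finally have "dist (0, 0) w < e"
      by (simp add: dist_norm zero_prod_def[symmetric])
    then show "w \<in> U'"
      using e(2) by auto
  qed
  have sub: "x \<in> ball 0 r" "x \<in> ball 0 \<rho>1" if "x \<in> ball 0 \<rho>" for x :: 'e
  proof -
    show "x \<in> ball 0 \<rho>1"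
      using that by (simp add: \<rho>_def)
    then show "x \<in> ball 0 r"
      using \<rho>1(2) Nr(1) by blast
  qed
  have qQ: "\<bar>fst w\<bar> < a" "snd w \<in> ball 0 r" if "w \<in> ?q" for w
    using subsetD[OF U'(2) subsetD[OF qU that]] by (auto simp: mem_Times_iff abs_less_iff)
  have gpsi: "g (\<psi> w) = w" "\<psi> w \<in> V" if "w \<in> ?q" for w
    using U'(5) qU that by (auto simp: homeomorphism_def)
  \<comment> \<open>The image of the box is the preimage of the box under \<open>g\<close> within
    \<open>V\<close>; in this form it is seen to be open.\<close>
  have im: "\<psi> ` ?q = V \<inter> g -` ?q"
  proof
    show "\<psi> ` ?q \<subseteq> V \<inter> g -` ?q"
      using gpsi by auto
    show "V \<inter> g -` ?q \<subseteq> \<psi> ` ?q"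
    proof
      fix y
      assume y: "y \<in> V \<inter> g -` ?q"
      then have "\<psi> (g y) = y"
        using U'(5) by (simp add: homeomorphism_def)
      then show "y \<in> \<psi> ` ?q"
        using y by (metis IntD2 image_eqI vimageD)
    qed
  qed
  have adapted: "adapted_flow M L T K c j \<epsilon> \<rho> \<psi> g"
  proof (unfold_locales)
    show "c \<in> M"
      by (rule c)
    show "0 < \<epsilon>" "0 < \<rho>"
      using e(1) \<rho>1(1) by (auto simp: \<epsilon>_def \<rho>_def)
    show "Ck_on k (ball 0 \<rho>) j" for k
      by (rule Ck_on_subset[OF j(1)]) (use sub ar(3) in blast)
    show "Ck_on k ?q \<psi>" for k
      by (rule Ck_on_subset[OF \<psi>(1)]) (use qU U'(2) in blast)
    show "\<psi> w \<in> ?R" if "w \<in> ?q" for w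
      using \<psi>(2)[OF qQ[OF that]] by simp
    show "\<psi> (0, x) = j x" if "x \<in> ball 0 \<rho>" for x
      by (rule \<psi>(3)[OF sub(1)[OF that]])
    show "frechet_derivative \<psi> (at w) (1, 0) = Kc c (\<psi> w)" if "w \<in> ?q" for w
      using \<psi>(4)[OF qQ[OF that]] by simp
    show "inj (frechet_derivative \<psi> (at w))" if "w \<in> ?q" for w
      by (rule bij_is_inj[OF U'(7)]) (use qU that in blast)
    show "open (\<psi> ` ?q)"
      unfolding im using U'(4) U'(6)[of 0] q by (intro continuous_open_preimage) auto
    show "Ck_on k (\<psi> ` ?q) g" for k
      by (rule Ck_on_subset[OF U'(6)]) (auto simp: im)
    show "g (\<psi> w) = w" if "w \<in> ?q" for w
      by (rule gpsi(1)[OF that])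
    show "hess c (j x, ?dj x v) (?dj x u) (?dj x u) > 0" if "x \<in> ball 0 \<rho>" "v \<noteq> 0" "u \<noteq> 0" for x v u
      by (rule hp[OF sub(2)[OF that(1)] that(2,3)])
  qed
  show thesis
    by (rule that[OF adapted]) (use sub(1) ar(3) in blast)
qed

text \<open>The final implication is what the static case adds: if the hypersurface is horizontal on
  all of \<open>P\<close> and not just at 0, the same splitting has \<omega> = 0. So one
  construction serves both equivalences.\<close>

lemma splitting_exists:
  fixes j :: "'e \<Rightarrow> real \<times> 'e"
  assumes c: "c \<in> M" "z \<in> fst c" and P: "open P" "0 \<in> P" and j: "\<And>k. Ck_on k P j" "j 0 = snd c z"
    and inj: "inj (frechet_derivative j (at 0))" and hor: "\<And>v. Theta c (j 0) (frechet_derivative j (at 0) v) = 0"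
  shows "\<exists>U \<epsilon> (S :: ('a, 'e) chart set) \<phi> \<Lambda> \<omega> F. z \<in> U \<and> standard_splitting M L K U \<epsilon> S \<phi> \<Lambda> \<omega> F \<and>
    ((\<forall>x\<in>P. \<forall>v. Theta c (j x) (frechet_derivative j (at x) v) = 0) \<longrightarrow> (\<forall>y\<in>tangent_bundle S. \<omega> y = 0))"
proof -
  have j0: "j 0 \<in> snd c ` fst c"
    using j(2) c(2) by simp
  obtain \<epsilon> \<rho> \<psi> g where A: "adapted_flow M L T K c j \<epsilon> \<rho> \<psi> g" and B: "ball 0 \<rho> \<subseteq> P"
    by (rule adapted_flow_exists[OF c(1) P j(1) j0 inj hor])
  interpret A: adapted_flow M L T K c j \<epsilon> \<rho> \<psi> g
    by (rule A)
  have "z \<in> A.U"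
    using A.base_in_U j(2) chart_inv_left[OF atlas c] by simp
  moreover have "A.\<omega> y = 0" if "\<forall>x\<in>P. \<forall>v. Theta c (j x) (frechet_derivative j (at x) v) = 0" "y \<in> tangent_bundle {A.cS}" for y
    by (rule A.\<omega>_eq_0[OF _ that(2)]) (use that(1) B in blast)
  ultimately have "z \<in> A.U \<and> standard_splitting M L K A.U \<epsilon> {A.cS} A.\<phi> A.\<Lambda> A.\<omega> A.F \<and>
    ((\<forall>x\<in>P. \<forall>v. Theta c (j x) (frechet_derivative j (at x) v) = 0) \<longrightarrow> (\<forall>y\<in>tangent_bundle {A.cS}. A.\<omega> y = 0))"
    using A.splitting by (intro conjI impI ballI) simp_all
  then show ?thesis
    by - (intro exI, assumption)
qed

text \<open>\<theta>(K) is nonzero, so ker \<theta> is a hyperplane and has the dimension of the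
  space factor \<open>'e\<close> of the model space.\<close>

lemma horizontal_injection:
  assumes c: "c \<in> M" "x \<in> snd c ` fst c"
  obtains f :: "'e \<Rightarrow> real \<times> 'e" where "linear f" "inj f" "\<And>v. Theta c x (f v) = 0"
proof -
  define a where "a = (\<Sum>b\<in>Basis. Theta c x b *\<^sub>R b)"
  have a: "Theta c x y = a \<bullet> y" for y
  proof -
    have "Theta c x y = (\<Sum>b\<in>Basis. (y \<bullet> b) * Theta c x b)"
      using linear_basis_sum[OF linear_Theta[OF c], of y] by simp
    also have "\<dots> = (\<Sum>b\<in>Basis. Theta c x b * (b \<bullet> y))"
      by (rule sum.cong[OF refl]) (simp only: inner_commute mult.commute)
    finally show ?thesis
      by (simp add: a_def inner_sum_left)
  qed
  have "a \<noteq> 0"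
    using a[of "Kc c x"] Theta_K[OF c] Lc_Kc_neg[OF c] by auto
  then have "dim {y. a \<bullet> y = 0} = dim (UNIV :: 'e set)"
    by (simp add: dim_hyperplane)
  then obtain f :: "'e \<Rightarrow> real \<times> 'e" where f: "linear f" "f ` UNIV = {y. a \<bullet> y = 0}" "inj_on f UNIV"
    using subspace_isomorphism[OF subspace_UNIV subspace_hyperplane[of a]] by metis
  show thesis
  proof (rule that[OF f(1,3)])
    show "Theta c x (f v) = 0" for v
      using rangeI[of f v] unfolding f(2) a by simp
  qed
qed

text \<open>In coordinates the hypersurface is the affine hyperplane through \<open>z\<close>
  directed by ker \<theta>; tangency at the single point \<open>z\<close> is enough.\<close>

lemma standard_splitting_at:
  assumes z: "z \<in> mfd_space M"
  shows "\<exists>U \<epsilon> (S :: ('a, 'e) chart set) \<phi> \<Lambda> \<omega> F. z \<in> U \<and> standard_splitting M L K U \<epsilon> S \<phi> \<Lambda> \<omega> F"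
proof -
  obtain c where c: "c \<in> M" "z \<in> fst c"
    using z by (auto simp: mfd_space_def)
  have x: "snd c z \<in> snd c ` fst c"
    using c by simp
  obtain f :: "'e \<Rightarrow> real \<times> 'e" where f: "linear f" "inj f" "\<And>v. Theta c (snd c z) (f v) = 0"
    by (rule horizontal_injection[OF c(1) x]) (rule that)
  define j where "j = (\<lambda>v. snd c z + f v)"
  have bl: "bounded_linear f"
    using f(1) by (simp add: linear_conv_bounded_linear)
  have "Ck_on k UNIV j" for k
    unfolding j_def by (intro Ck_on_add Ck_on_const Ck_on_bounded_linear bl open_UNIV)
  moreover have "(j has_derivative (\<lambda>v. 0 + f v)) (at 0)"
    unfolding j_def by (intro has_derivative_add has_derivative_const bounded_linear_imp_has_derivative bl)
  then have "frechet_derivative j (at 0) = f"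
    by (simp add: frechet_derivative_eqI)
  moreover have "j 0 = snd c z"
    using linear_0[OF f(1)] by (simp add: j_def)
  ultimately show ?thesis
    using splitting_exists[OF c open_UNIV UNIV_I, of j] f(2,3) by (metis (no_types, lifting))
qed

text \<open>The hypersurface is now an integral manifold in coordinates: its tangent space is ker
  \<theta> at every point, so \<theta> vanishes along it.\<close>

lemma static_splitting_at:
  assumes z: "z \<in> mfd_space M" and int: "integrable_distribution M (kernel_distribution M L K)"
  shows "\<exists>U \<epsilon> (S :: ('a, 'e) chart set) \<phi> \<Lambda> \<omega> F. z \<in> U \<and> standard_splitting M L K U \<epsilon> S \<phi> \<Lambda> \<omega> F \<and>
    (\<forall>y\<in>tangent_bundle S. \<omega> y = 0)"
proof -
  obtain S :: "('a, 'e) chart set" and \<iota> where S: "smooth_manifold S" "smooth_map_on S M (mfd_space S) \<iota>"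
      "z \<in> \<iota> ` mfd_space S"
      "\<forall>s\<in>mfd_space S. inj_on (tangent_map S M \<iota> s) (tangent_space S s) \<and>
         tangent_map S M \<iota> s ` tangent_space S s = kernel_distribution M L K (\<iota> s)"
    using bspec[OF int[unfolded integrable_distribution_def] z] by (elim exE conjE)
  have Sa: "smooth_atlas S"
    using S(1) by (simp add: smooth_manifold_def)
  obtain s where s: "s \<in> mfd_space S" "\<iota> s = z"
    using S(3) by blast
  obtain d where d: "d \<in> S" "s \<in> fst d"
    using s(1) by (auto simp: mfd_space_def)
  obtain c where c: "c \<in> M" "z \<in> fst c"
    using z by (auto simp: mfd_space_def)
  have oS: "openin (mfd_top S) (mfd_space S)"
    using topspace_mfd_top[OF Sa] openin_topspace[of "mfd_top S"] by simp
  define h where "h = snd c \<circ> \<iota> \<circ> chart_inv d"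
  define W where "W = snd d ` (mfd_space S \<inter> fst d \<inter> \<iota> -` fst c)"
  have W: "open W" "Ck_on k W h" for k
    using smooth_map_on_chart[OF Sa atlas oS S(2) d(1) c(1)] by (simp_all add: W_def h_def)
  define a where "a = snd d s"
  have aW: "a \<in> W"
    using s d c by (auto simp: W_def a_def)
  \<comment> \<open>A translation moves the base point to 0, where \<open>splitting_exists\<close>
    expects it.\<close>
  define P where "P = (\<lambda>v. a + v) -` W"
  define j where "j = (\<lambda>v. h (a + v))"
  have P: "open P" "0 \<in> P"
    unfolding P_def using W(1) aW by (auto intro!: open_vimage continuous_intros)
  have j_Ck: "Ck_on k P j" for k
    unfolding j_def
    by (rule Ck_on_compose[OF P(1) W(2) Ck_on_add[OF P(1) Ck_on_const Ck_on_ident]]) (simp add: P_def)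
  have dj: "frechet_derivative j (at x) = frechet_derivative h (at (a + x))" if x: "x \<in> P" for x
  proof -
    have h: "(h has_derivative frechet_derivative h (at (a + x))) (at (a + x))"
      by (rule Ck_on_imp_has_derivative[OF W(2)[of 1]]) (use x in \<open>simp_all add: P_def\<close>)
    have "((\<lambda>v. a + v) has_derivative (\<lambda>v. v)) (at x)"
      by (auto intro!: derivative_eq_intros)
    from has_derivative_compose[OF this h] show ?thesis
      unfolding j_def by (simp add: frechet_derivative_eqI)
  qed
  have point: "\<exists>q. q \<in> mfd_space S \<and> q \<in> fst d \<and> \<iota> q \<in> fst c \<and> a + x = snd d q \<and> j x = snd c (\<iota> q)" if x: "x \<in> P" for x
  proof -
    obtain q where "q \<in> mfd_space S" "q \<in> fst d" "\<iota> q \<in> fst c" "a + x = snd d q"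
      using x by (auto simp: P_def W_def)
    then show ?thesis
      using chart_inv_left[OF Sa d(1)] by (auto simp: j_def h_def)
  qed
  have tm: "tangent_map S M \<iota> q (tvec S q d v) = tvec M (\<iota> q) c (frechet_derivative j (at x) v)"
    if x: "x \<in> P" and q: "q \<in> mfd_space S" "q \<in> fst d" "\<iota> q \<in> fst c" "a + x = snd d q" for x q v
    using tangent_map_eqI[OF Sa atlas oS q(1) S(2) d(1) q(2) c(1) q(3) tvec_in_tangent_space[OF Sa d(1) q(2)]]
      tvec_component[OF Sa d(1) q(2)] dj[OF x] q(4) by (simp add: h_def)
  have hor: "Theta c (j x) (frechet_derivative j (at x) v) = 0" if x: "x \<in> P" for x v
  proof -
    obtain q where q: "q \<in> mfd_space S" "q \<in> fst d" "\<iota> q \<in> fst c" "a + x = snd d q" "j x = snd c (\<iota> q)"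
      using point[OF x] by blast
    have "tangent_map S M \<iota> q (tvec S q d v) \<in> kernel_distribution M L K (\<iota> q)"
      using S(4) q(1) tvec_in_tangent_space[OF Sa d(1) q(2)] by blast
    then show ?thesis
      unfolding tm[OF x q(1-4)] by (simp add: kernel_distribution_def Theta_def q(5) chart_inv_left[OF atlas c(1) q(3)])
  qed
  have j0: "j 0 = snd c z"
    using chart_inv_left[OF Sa d] s(2) by (simp add: j_def h_def a_def)
  have inj: "inj (frechet_derivative j (at 0))"
  proof (rule injI)
    fix v w
    assume eq: "frechet_derivative j (at 0) v = frechet_derivative j (at 0) w"
    have q: "s \<in> mfd_space S" "s \<in> fst d" "\<iota> s \<in> fst c" "a + 0 = snd d s"
      using s d c by (auto simp: a_def)
    have "tangent_map S M \<iota> s (tvec S s d v) = tangent_map S M \<iota> s (tvec S s d w)"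
      unfolding tm[OF P(2) q] eq ..
    then have "tvec S s d v = tvec S s d w"
      using S(4) s(1) tvec_in_tangent_space[OF Sa d] by (meson inj_onD)
    then show "v = w"
      using tvec_component[OF Sa d] by metis
  qed
  show ?thesis
    using splitting_exists[OF c P j_Ck j0 inj hor[OF P(2)]] hor by blast
qed

end

section \<open>Regularity of a splitting and its slices\<close>

locale split_spacetime = killing_spacetime M L T K
  for M :: "('a, real \<times> 'e::euclidean_space) chart set"
    and L :: "'a \<times> ('a, real \<times> 'e) tvec \<Rightarrow> real"
    and T :: "('a \<times> ('a, real \<times> 'e) tvec) set"
    and K :: "'a \<Rightarrow> ('a, real \<times> 'e) tvec" +
  fixes U :: "'a set" and \<epsilon> :: real and S :: "('s, 'e) chart set" and \<phi> :: "real \<times> 's \<Rightarrow> 'a"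
    and \<Lambda> :: "'s \<Rightarrow> real" and \<omega> F :: "'s \<times> ('s, 'e) tvec \<Rightarrow> real"
  assumes split: "standard_splitting M L K U \<epsilon> S \<phi> \<Lambda> \<omega> F"
begin

abbreviation "I \<equiv> {-\<epsilon><..<\<epsilon>}"
abbreviation "P \<equiv> prod_atlas I S"
abbreviation "D \<equiv> I \<times> mfd_space S"
abbreviation "cP d \<equiv> prod_chart I d"
abbreviation "\<kappa> \<equiv> inv_into D \<phi>"

lemma
  shows openin_U: "openin (mfd_top M) U" and S_manifold: "smooth_manifold S" and bij: "bij_betw \<phi> D U"
    and \<phi>_smooth: "smooth_map_on P M D \<phi>" and \<kappa>_smooth: "smooth_map_on M P U \<kappa>"
    and time: "\<forall>q\<in>D. tangent_map P M \<phi> q (time_field I S q) = K (\<phi> q)"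
    and \<Lambda>_C3: "Ck_fun S 3 (mfd_space S) \<Lambda>" and \<Lambda>_pos: "\<forall>s\<in>mfd_space S. 0 < \<Lambda> s"
    and one_form: "one_form S \<omega>" and finsler_F: "finsler_metric S F"
    and formula: "\<forall>(q, u)\<in>tangent_bundle P. L (\<phi> q, tangent_map P M \<phi> q u) =
      - \<Lambda> (snd q) * (dfun P fst q u)\<^sup>2 + \<omega> (snd q, tangent_map P S snd q u) * dfun P fst q u +
      (F (snd q, tangent_map P S snd q u))\<^sup>2"
  using split[unfolded standard_splitting_def Let_def] by - (elim conjE, assumption)+

lemma S_atlas: "smooth_atlas S"
  using S_manifold by (simp only: smooth_manifold_def)

lemma P_atlas: "smooth_atlas P"
  by (rule smooth_atlas_prod_atlas[OF S_atlas open_greaterThanLessThan])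

lemma openin_D: "openin (mfd_top P) D"
  using openin_topspace[of "mfd_top P"] unfolding topspace_mfd_top[OF P_atlas] mfd_space_prod_atlas .

lemma \<kappa>_\<phi>: "q \<in> D \<Longrightarrow> \<kappa> (\<phi> q) = q"
  by (rule inv_into_f_f[OF bij_betw_imp_inj_on[OF bij]])

lemma \<phi>_\<kappa>: "p \<in> U \<Longrightarrow> \<phi> (\<kappa> p) = p"
  by (rule bij_betw_inv_into_right[OF bij])

lemma \<kappa>_mem: "p \<in> U \<Longrightarrow> \<kappa> p \<in> D"
  by (rule bij_betw_apply[OF bij_betw_inv_into[OF bij]])

lemma \<phi>_mem: "q \<in> D \<Longrightarrow> \<phi> q \<in> U"
  by (rule bij_betw_apply[OF bij])

lemmas cP_mem = prod_chart_mem[of _ S I]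

lemma mem_D: "d \<in> S \<Longrightarrow> t \<in> I \<Longrightarrow> s \<in> fst d \<Longrightarrow> (t, s) \<in> D"
  using mem_mfd_space[of d S s] by simp

text \<open>\<open>G\<close> and \<open>H\<close> are the coordinate expressions of the inverse of
  \<phi> and of \<phi> in a chart of \<open>M\<close> and a product chart; \<open>domG\<close> and
  \<open>domH\<close> are their natural domains.\<close>

definition G :: "('a, real \<times> 'e) chart \<Rightarrow> ('s, 'e) chart \<Rightarrow> real \<times> 'e \<Rightarrow> real \<times> 'e" where
  "G c d = snd (cP d) \<circ> \<kappa> \<circ> chart_inv c"

definition H :: "('a, real \<times> 'e) chart \<Rightarrow> ('s, 'e) chart \<Rightarrow> real \<times> 'e \<Rightarrow> real \<times> 'e" where
  "H c d = snd c \<circ> \<phi> \<circ> chart_inv (cP d)"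

definition domG :: "('a, real \<times> 'e) chart \<Rightarrow> ('s, 'e) chart \<Rightarrow> (real \<times> 'e) set" where
  "domG c d = snd c ` (U \<inter> fst c \<inter> \<kappa> -` fst (cP d))"

definition domH :: "('a, real \<times> 'e) chart \<Rightarrow> ('s, 'e) chart \<Rightarrow> (real \<times> 'e) set" where
  "domH c d = snd (cP d) ` (D \<inter> fst (cP d) \<inter> \<phi> -` fst c)"

lemma G_smooth:
  assumes "c \<in> M" "d \<in> S"
  shows "open (domG c d)" "Ck_on k (domG c d) (G c d)"
  unfolding domG_def G_def
  using smooth_map_on_chart[OF atlas P_atlas openin_U \<kappa>_smooth assms(1) cP_mem[OF assms(2)]] by - assumption+

lemma H_smooth:
  assumes "c \<in> M" "d \<in> S"
  shows "open (domH c d)" "Ck_on k (domH c d) (H c d)"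
  unfolding domH_def H_def
  using smooth_map_on_chart[OF P_atlas atlas openin_D \<phi>_smooth cP_mem[OF assms(2)] assms(1)] by - assumption+

context
  fixes c d t s
  assumes c: "c \<in> M" and d: "d \<in> S" and t: "t \<in> I" and s: "s \<in> fst d" and p: "\<phi> (t, s) \<in> fst c"
begin

lemma point_domG: "snd c (\<phi> (t, s)) \<in> domG c d"
  unfolding domG_def using \<phi>_mem[OF mem_D[OF d t s]] \<kappa>_\<phi>[OF mem_D[OF d t s]] p t s by (intro imageI) simp

lemma G_point: "G c d (snd c (\<phi> (t, s))) = (t, snd d s)"
  unfolding G_def using \<kappa>_\<phi>[OF mem_D[OF d t s]] by (simp add: chart_inv_left[OF atlas c p])

lemma point_domH: "(t, snd d s) \<in> domH c d"
proof -
  have "snd (cP d) (t, s) \<in> domH c d"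
    unfolding domH_def using mem_D[OF d t s] p t s by (intro imageI) simp
  then show ?thesis
    by simp
qed

lemma H_point: "H c d (t, snd d s) = snd c (\<phi> (t, s))"
  unfolding H_def using chart_inv_prod_chart[OF S_atlas d t imageI[OF s]] by (simp add: chart_inv_left[OF S_atlas d s])

end

lemma domG_point:
  assumes c: "c \<in> M" "d \<in> S" and x: "x \<in> domG c d"
  obtains t s where "t \<in> I" "s \<in> fst d" "\<phi> (t, s) \<in> fst c" "x = snd c (\<phi> (t, s))" "chart_inv c x = \<phi> (t, s)"
proof -
  obtain p where "x = snd c p" "p \<in> U \<inter> fst c \<inter> \<kappa> -` fst (cP d)"
    using x unfolding domG_def by (rule imageE)
  then have p: "p \<in> U" "p \<in> fst c" "\<kappa> p \<in> fst (cP d)" "x = snd c p"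
    by (simp_all only: Int_iff vimage_eq)
  obtain t s where ts: "\<kappa> p = (t, s)"
    by (cases "\<kappa> p")
  have \<phi>: "\<phi> (t, s) = p"
    using \<phi>_\<kappa>[OF p(1)] unfolding ts .
  show thesis
  proof (rule that)
    show "t \<in> I" "s \<in> fst d"
      using p(3) unfolding ts by simp_all
    show "\<phi> (t, s) \<in> fst c" "x = snd c (\<phi> (t, s))"
      unfolding \<phi> by (rule p(2), rule p(4))
    show "chart_inv c x = \<phi> (t, s)"
      unfolding \<phi> p(4) by (rule chart_inv_left[OF atlas c(1) p(2)])
  qed
qed

lemma H_G:
  assumes c: "c \<in> M" "d \<in> S" and x: "x \<in> domG c d"
  shows "H c d (G c d x) = x" "G c d x \<in> domH c d"
proof -
  obtain t s where ts: "t \<in> I" "s \<in> fst d" "\<phi> (t, s) \<in> fst c" "x = snd c (\<phi> (t, s))" "chart_inv c x = \<phi> (t, s)"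
    by (rule domG_point[OF c x])
  show "H c d (G c d x) = x" "G c d x \<in> domH c d"
    unfolding ts(4) G_point[OF c ts(1-3)] by (rule H_point[OF c ts(1-3)], rule point_domH[OF c ts(1-3)])
qed

text \<open>Differentiating one composition gives one identity; the other follows because a
  one-sided inverse of a linear map of a finite-dimensional space to itself is two-sided.\<close>

lemma derivative_inverse:
  assumes c: "c \<in> M" "d \<in> S" and x: "x \<in> domG c d"
  defines "DG \<equiv> frechet_derivative (G c d) (at x)" and "DH \<equiv> frechet_derivative (H c d) (at (G c d x))"
  shows "linear DG" "linear DH" "DH (DG y) = y" "DG (DH a) = a"
proof -
  have dG: "(G c d has_derivative DG) (at x)"
    unfolding DG_def by (rule Ck_on_imp_has_derivative[OF G_smooth(2)[OF c, of 1] _ x]) simp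
  have dH: "(H c d has_derivative DH) (at (G c d x))"
    unfolding DH_def by (rule Ck_on_imp_has_derivative[OF H_smooth(2)[OF c, of 1] _ H_G(2)[OF c x]]) simp
  show lin: "linear DG" "linear DH"
    using has_derivative_linear[OF dG] has_derivative_linear[OF dH] by - assumption+
  have "((\<lambda>x. x) has_derivative (\<lambda>y. DH (DG y))) (at x)"
    by (rule has_derivative_transform_within_open[OF has_derivative_compose[OF dG dH] G_smooth(1)[OF c] x])
      (rule H_G(1)[OF c])
  then have id: "(\<lambda>y. DH (DG y)) = (\<lambda>y. y)"
    by (rule has_derivative_unique[OF _ has_derivative_ident])
  then show "DH (DG y) = y"
    by (rule fun_cong)
  have "DH \<circ> DG = id"
    using id by (simp add: fun_eq_iff)
  then have "DG \<circ> DH = id"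
    by (simp only: linear_inverse_left[OF lin])
  then have "(DG \<circ> DH) a = id a"
    by (rule fun_cong)
  then show "DG (DH a) = a"
    by (simp only: o_apply id_apply)
qed

lemmas dfun_fst = dfun_prod_fst[OF S_atlas open_greaterThanLessThan]
lemmas tangent_map_snd = tangent_map_prod_snd[OF S_atlas open_greaterThanLessThan]

lemma tangent_map_\<phi>:
  assumes c: "c \<in> M" "d \<in> S" and ts: "t \<in> I" "s \<in> fst d" "\<phi> (t, s) \<in> fst c" and u: "u \<in> tangent_space P (t, s)"
  shows "tangent_map P M \<phi> (t, s) u = tvec M (\<phi> (t, s)) c (frechet_derivative (H c d) (at (t, snd d s)) (u (cP d)))"
proof -
  have q: "(t, s) \<in> fst (cP d)"
    using ts by simp
  show ?thesis
    using tangent_map_eqI[OF P_atlas atlas openin_D mem_D[OF c(2) ts(1,2)] \<phi>_smooth cP_mem[OF c(2)] q c(1) ts(3) u]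
    by (simp add: H_def)
qed

text \<open>The splitting describes \<open>L\<close> on images of tangent vectors of the product.
  The differential of \<phi> is invertible, so every \<open>w\<close> is such an image, with
  components given by the derivative of \<open>G\<close>.\<close>

lemma L_formula:
  assumes c: "c \<in> M" "d \<in> S" and ts: "t \<in> I" "s \<in> fst d" "\<phi> (t, s) \<in> fst c"
    and w: "w \<in> tangent_space M (\<phi> (t, s))"
    and \<tau>v: "frechet_derivative (G c d) (at (snd c (\<phi> (t, s)))) (w c) = (\<tau>, v)"
  shows "L (\<phi> (t, s), w) = - \<Lambda> s * \<tau>\<^sup>2 + \<omega> (s, tvec S s d v) * \<tau> + (F (s, tvec S s d v))\<^sup>2"
proof -
  have q: "(t, s) \<in> fst (cP d)"
    using ts by simp
  define u where "u = tvec P (t, s) (cP d) (\<tau>, v)"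
  have u: "u \<in> tangent_space P (t, s)" "u (cP d) = (\<tau>, v)"
    unfolding u_def by (rule tvec_in_tangent_space[OF P_atlas cP_mem[OF c(2)] q], rule tvec_component[OF P_atlas cP_mem[OF c(2)] q])
  have "frechet_derivative (H c d) (at (t, snd d s)) (\<tau>, v) = w c"
    using derivative_inverse(3)[OF c point_domG[OF c ts], of "w c"] unfolding \<tau>v G_point[OF c ts] .
  then have tm: "tangent_map P M \<phi> (t, s) u = w"
    using tangent_map_\<phi>[OF c ts u(1)] tvec_eq[OF w c(1) ts(3)] by (simp add: u(2))
  have "((t, s), u) \<in> tangent_bundle P"
    using u(1) mem_D[OF c(2) ts(1,2)] unfolding tangent_bundle_def mfd_space_prod_atlas by (rule SigmaI[rotated])
  from bspec[OF formula this] show ?thesis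
    by (simp only: prod.case tm dfun_fst[OF c(2) ts(1,2) u(1)] tangent_map_snd[OF c(2) ts(1,2) u(1)] u(2) fst_conv snd_conv)
qed

lemma Lc_formula:
  assumes c: "c \<in> M" "d \<in> S" and x: "x \<in> domG c d" and \<xi>: "\<xi> = snd (G c d x)"
    and \<tau>v: "frechet_derivative (G c d) (at x) y = (\<tau>, v)"
  shows "Lc c (x, y) = (\<omega> \<circ> chart_inv (tb_chart S d)) (\<xi>, v) * \<tau> + ((F \<circ> chart_inv (tb_chart S d)) (\<xi>, v))\<^sup>2
    - (\<Lambda> \<circ> chart_inv d) \<xi> * \<tau>\<^sup>2" and "\<xi> \<in> snd d ` fst d"
proof -
  obtain t s where ts: "t \<in> I" "s \<in> fst d" "\<phi> (t, s) \<in> fst c" "x = snd c (\<phi> (t, s))" "chart_inv c x = \<phi> (t, s)"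
    by (rule domG_point[OF c x])
  have \<xi>s: "\<xi> = snd d s"
    unfolding \<xi> ts(4) G_point[OF c ts(1-3)] by simp
  show mem: "\<xi> \<in> snd d ` fst d"
    unfolding \<xi>s using ts(2) by (rule imageI)
  have inv: "chart_inv d \<xi> = s" "chart_inv (tb_chart S d) (\<xi>, v) = (s, tvec S s d v)"
    using chart_inv_tb_chart[OF S_atlas c(2) mem] chart_inv_left[OF S_atlas c(2) ts(2)] by (simp_all add: \<xi>s)
  let ?w = "tvec M (\<phi> (t, s)) c y"
  have w: "?w \<in> tangent_space M (\<phi> (t, s))" "?w c = y"
    using tvec_in_tangent_space[OF atlas c(1) ts(3)] tvec_component[OF atlas c(1) ts(3)] by simp_all
  have "Lc c (x, y) = L (\<phi> (t, s), ?w)"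
    using Lc_eq[OF c(1) ts(3) w(1)] unfolding w(2) ts(4) .
  also have "\<dots> = - \<Lambda> s * \<tau>\<^sup>2 + \<omega> (s, tvec S s d v) * \<tau> + (F (s, tvec S s d v))\<^sup>2"
    by (rule L_formula[OF c ts(1-3) w(1)]) (use \<tau>v in \<open>simp only: w(2) ts(4)\<close>)
  finally show "Lc c (x, y) = (\<omega> \<circ> chart_inv (tb_chart S d)) (\<xi>, v) * \<tau> + ((F \<circ> chart_inv (tb_chart S d)) (\<xi>, v))\<^sup>2
    - (\<Lambda> \<circ> chart_inv d) \<xi> * \<tau>\<^sup>2"
    by (simp add: inv)
qed

lemma F_scale: "s \<in> mfd_space S \<Longrightarrow> v \<in> tangent_space S s \<Longrightarrow> r > 0 \<Longrightarrow> F (s, r *\<^sub>R v) = r * F (s, v)"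
  using finsler_F by (auto simp: finsler_metric_def tangent_bundle_def)

lemma F_zero:
  assumes "s \<in> mfd_space S"
  shows "F (s, 0) = 0"
  using F_scale[OF assms tangent_space_0[OF S_atlas], of 2] by simp

text \<open>The regularity of \<open>F\<close> stops at the zero section, but F^2 is homogeneous of
  degree 2, so \<open>homogeneous_C1\<close> extends it across.\<close>

lemma F_square_C1:
  assumes d: "d \<in> S"
  shows "Ck_on 1 (snd d ` fst d \<times> UNIV) (\<lambda>z. ((F \<circ> chart_inv (tb_chart S d)) z)\<^sup>2)"
proof (rule homogeneous_C1[OF open_chart_range[OF S_atlas d]])
  have "Ck_fun (tb_atlas S) 3 (tangent_bundle S - zero_section S) F"
    using finsler_F unfolding finsler_metric_def by (elim conjE)
  then have "Ck_on 3 (snd d ` fst d \<times> - {0}) (F \<circ> chart_inv (tb_chart S d))"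
    unfolding Ck_fun_def tb_atlas_def tb_chart_image_nonzero[OF S_atlas d, symmetric] using imageI[OF d] by (rule bspec)
  then have "Ck_on 1 (snd d ` fst d \<times> - {0}) (F \<circ> chart_inv (tb_chart S d))"
    by (rule Ck_on_le) simp
  then show "Ck_on 1 (snd d ` fst d \<times> - {0}) (\<lambda>z. ((F \<circ> chart_inv (tb_chart S d)) z)\<^sup>2)"
    by (rule Ck_on_power2[rotated]) (intro open_Times open_chart_range[OF S_atlas d] open_Compl closed_singleton)
  fix x y and r :: real
  assume x: "x \<in> snd d ` fst d" and r: "r > 0"
  let ?s = "chart_inv d x"
  have s: "?s \<in> fst d"
    by (rule chart_inv_mem[OF x])
  have "tvec S ?s d (r *\<^sub>R y) = r *\<^sub>R tvec S ?s d y"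
    using tvec_linear[OF S_atlas d s, of r y 0 0] by simp
  then show "((F \<circ> chart_inv (tb_chart S d)) (x, r *\<^sub>R y))\<^sup>2 = r\<^sup>2 * ((F \<circ> chart_inv (tb_chart S d)) (x, y))\<^sup>2"
    using F_scale[OF mem_mfd_space[OF d s] tvec_in_tangent_space[OF S_atlas d s] r]
    by (simp add: chart_inv_tb_chart[OF S_atlas d x] power_mult_distrib)
qed

text \<open>The splitting formula is composed of C^1 functions; the critical term is F^2, at vectors
  without spatial part.\<close>

lemma Lc_C1_local:
  assumes c: "c \<in> M" "d \<in> S"
  shows "Ck_on 1 (domG c d \<times> UNIV) (Lc c)"
proof -
  let ?W = "domG c d \<times> (UNIV :: (real \<times> 'e) set)"
  let ?R = "snd d ` fst d"
  have W: "open ?W"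
    by (intro open_Times G_smooth(1)[OF c] open_UNIV)
  define \<xi> where "\<xi> = (\<lambda>z :: (real \<times> 'e) \<times> (real \<times> 'e). snd (G c d (fst z)))"
  define dG where "dG = (\<lambda>z :: (real \<times> 'e) \<times> (real \<times> 'e). frechet_derivative (G c d) (at (fst z)) (snd z))"
  have "Ck_on 1 ?W (\<lambda>z. G c d (fst z))"
    by (rule Ck_on_compose[OF W G_smooth(2)[OF c] Ck_on_fst]) auto
  then have \<xi>: "Ck_on 1 ?W \<xi>"
    unfolding \<xi>_def by (rule Ck_on_snd_compose[OF W])
  have dG: "Ck_on 1 ?W dG"
    unfolding dG_def by (rule Ck_on_frechet_derivative[OF W G_smooth(2)[OF c] Ck_on_fst Ck_on_snd]) auto
  have \<tau>: "Ck_on 1 ?W (\<lambda>z. fst (dG z))" and v: "Ck_on 1 ?W (\<lambda>z. snd (dG z))"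
    using Ck_on_fst_compose[OF W dG] Ck_on_snd_compose[OF W dG] by - assumption+
  have pair: "Ck_on 1 ?W (\<lambda>z. (\<xi> z, snd (dG z)))"
    by (rule Ck_on_Pair[OF W \<xi> v])
  have \<xi>_mem: "\<xi> z \<in> ?R" if "z \<in> ?W" for z
  proof -
    have "fst z \<in> domG c d"
      using that by auto
    then show ?thesis
      unfolding \<xi>_def by (rule Lc_formula(2)[OF c _ refl prod.collapse[symmetric]])
  qed
  have "mfd_space S \<inter> fst d = fst d"
    using c(2) by (auto simp: mfd_space_def)
  then have "Ck_on 3 ?R (\<Lambda> \<circ> chart_inv d)"
    using \<Lambda>_C3 c(2) by (auto simp: Ck_fun_def dest!: bspec)
  then have "Ck_on 1 ?R (\<Lambda> \<circ> chart_inv d)"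
    by (rule Ck_on_le) simp
  then have Lam: "Ck_on 1 ?W (\<lambda>z. (\<Lambda> \<circ> chart_inv d) (\<xi> z))"
    by (rule Ck_on_compose[OF W _ \<xi> \<xi>_mem])
  have "Ck_fun (tb_atlas S) 3 (tangent_bundle S) \<omega>"
    using one_form unfolding one_form_def by (elim conjE)
  then have "Ck_on 3 (?R \<times> UNIV) (\<omega> \<circ> chart_inv (tb_chart S d))"
    unfolding Ck_fun_def tb_atlas_def tb_chart_image_bundle[OF S_atlas c(2), symmetric] using imageI[OF c(2)] by (rule bspec)
  then have "Ck_on 1 (?R \<times> UNIV) (\<omega> \<circ> chart_inv (tb_chart S d))"
    by (rule Ck_on_le) simp
  then have om: "Ck_on 1 ?W (\<lambda>z. (\<omega> \<circ> chart_inv (tb_chart S d)) (\<xi> z, snd (dG z)))"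
    by (rule Ck_on_compose[OF W _ pair]) (use \<xi>_mem in blast)
  have F2: "Ck_on 1 ?W (\<lambda>z. ((F \<circ> chart_inv (tb_chart S d)) (\<xi> z, snd (dG z)))\<^sup>2)"
    by (rule Ck_on_compose[OF W F_square_C1[OF c(2)] pair]) (use \<xi>_mem in blast)
  have "Ck_on 1 ?W (\<lambda>z. (\<omega> \<circ> chart_inv (tb_chart S d)) (\<xi> z, snd (dG z)) * fst (dG z) +
      ((F \<circ> chart_inv (tb_chart S d)) (\<xi> z, snd (dG z)))\<^sup>2 - (\<Lambda> \<circ> chart_inv d) (\<xi> z) * (fst (dG z))\<^sup>2)"
    by (intro Ck_on_diff Ck_on_add Ck_on_mult Ck_on_power2 W om F2 Lam \<tau>)
  then show ?thesis
  proof (rule Ck_on_transfer[OF W])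
    fix z
    assume "z \<in> ?W"
    then obtain x y where z: "z = (x, y)" "x \<in> domG c d"
      by (rule SigmaE)
    show "(\<omega> \<circ> chart_inv (tb_chart S d)) (\<xi> z, snd (dG z)) * fst (dG z) +
      ((F \<circ> chart_inv (tb_chart S d)) (\<xi> z, snd (dG z)))\<^sup>2 - (\<Lambda> \<circ> chart_inv d) (\<xi> z) * (fst (dG z))\<^sup>2 = Lc c z"
      using Lc_formula(1)[OF c z(2), of "\<xi> z" y "fst (dG z)" "snd (dG z)"] by (simp add: \<xi>_def dG_def z(1))
  qed
qed

text \<open>The chart \<open>d\<close> is the one that \<open>chart_at\<close> selects and
  \<open>tangent_map\<close> uses, so the equation for the time field can be read off by unfolding
  definitions.\<close>

lemma adapted_chart:
  assumes p: "p \<in> U"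
  obtains c d t s where "c \<in> M" "d \<in> S" "t \<in> I" "s \<in> fst d" "p = \<phi> (t, s)" "\<phi> (t, s) \<in> fst c"
    "K p c = frechet_derivative (H c d) (at (t, snd d s)) (1, 0)"
proof -
  have "p \<in> mfd_space M"
    using openin_subset[OF openin_U] p unfolding topspace_mfd_top[OF atlas] by (rule subsetD)
  then obtain c where c: "c \<in> M" "p \<in> fst c"
    by (auto simp: mfd_space_def)
  obtain t s where ts: "\<kappa> p = (t, s)"
    by (cases "\<kappa> p")
  have \<phi>: "p = \<phi> (t, s)" and D: "(t, s) \<in> D"
    using \<phi>_\<kappa>[OF p] \<kappa>_mem[OF p] unfolding ts by simp_all
  have "(t, s) \<in> mfd_space P"
    unfolding mfd_space_prod_atlas by (rule D)
  note ca = chart_at_props[OF this]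
  obtain d where d: "d \<in> S" "chart_at P (t, s) = cP d"
    using ca(1) unfolding prod_atlas_def by (elim imageE)
  have mem: "t \<in> I" "s \<in> fst d"
    using ca(2) unfolding d(2) by simp_all
  have "K p c = tangent_map P M \<phi> (t, s) (time_field I S (t, s)) c"
    unfolding \<phi> by (rule fun_cong[OF bspec[OF time D, symmetric]])
  also have "\<dots> = frechet_derivative (H c d) (at (t, snd d s)) (1, 0)"
    using c mem cP_mem[OF d(1)] unfolding tangent_map_def Let_def d(2) \<phi> H_def time_field_def by simp
  finally show thesis
    using that[OF c(1) d(1) mem \<phi>] c(2) unfolding \<phi> by simp
qed

end

section \<open>The one-form \<theta> and the slices of a splitting\<close>

lemma has_derivative_quadratic_bound:
  fixes f :: "real \<Rightarrow> real"
  assumes f: "\<And>s. \<bar>f s\<bar> \<le> C * s\<^sup>2"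
  shows "(f has_real_derivative 0) (at 0)"
proof -
  have f0: "f 0 = 0"
    using f[of 0] by simp
  have "((\<lambda>h. (f (0 + h) - f 0) / h) \<longlongrightarrow> 0) (at 0)"
  proof (rule Lim_null_comparison)
    show "\<forall>\<^sub>F h in at 0. norm ((f (0 + h) - f 0) / h) \<le> C * \<bar>h\<bar>"
    proof (rule eventuallyI)
      fix h :: real
      have "\<bar>f h\<bar> \<le> (C * \<bar>h\<bar>) * \<bar>h\<bar>"
        using f[of h] by (simp add: power2_eq_square)
      then show "norm ((f (0 + h) - f 0) / h) \<le> C * \<bar>h\<bar>"
        by (cases "h = 0") (simp_all add: f0 abs_divide pos_divide_le_eq)
    qed
    show "((\<lambda>h. C * \<bar>h\<bar>) \<longlongrightarrow> 0) (at 0)"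
      by (auto intro!: tendsto_eq_intros)
  qed
  then show ?thesis
    by (simp add: DERIV_def)
qed

locale C1_splitting = C1_spacetime M L T K + split_spacetime M L T K U \<epsilon> S \<phi> \<Lambda> \<omega> F
  for M :: "('a, real \<times> 'e::euclidean_space) chart set"
    and L :: "'a \<times> ('a, real \<times> 'e) tvec \<Rightarrow> real"
    and T :: "('a \<times> ('a, real \<times> 'e) tvec) set"
    and K :: "'a \<Rightarrow> ('a, real \<times> 'e) tvec"
    and U :: "'a set" and \<epsilon> :: real and S :: "('s, 'e) chart set" and \<phi> :: "real \<times> 's \<Rightarrow> 'a"
    and \<Lambda> :: "'s \<Rightarrow> real" and \<omega> F :: "'s \<times> ('s, 'e) tvec \<Rightarrow> real"
begin

lemma \<omega>_scale:
  assumes "s \<in> mfd_space S" "v \<in> tangent_space S s"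
  shows "\<omega> (s, r *\<^sub>R v) = r * \<omega> (s, v)"
proof -
  have "\<omega> (s, r *\<^sub>R v + 0 *\<^sub>R v) = r * \<omega> (s, v) + 0 * \<omega> (s, v)"
    using one_form assms unfolding one_form_def by blast
  then show ?thesis
    by simp
qed

text \<open>Differentiate the splitting formula along K + r w at r = 0: the term F^2 is O(r^2) and
  contributes nothing. The second part compares the formula at \<open>w\<close> and at w + \<sigma>
  K, since adding \<sigma> K only shifts \<tau>.\<close>

lemma theta_formula:
  assumes c: "c \<in> M" "d \<in> S" and ts: "t \<in> I" "s \<in> fst d" "\<phi> (t, s) \<in> fst c"
    and K: "K (\<phi> (t, s)) c = frechet_derivative (H c d) (at (t, snd d s)) (1, 0)"
    and w: "w \<in> tangent_space M (\<phi> (t, s))"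
    and \<tau>v: "frechet_derivative (G c d) (at (snd c (\<phi> (t, s)))) (w c) = (\<tau>, v)"
  shows "\<theta> (\<phi> (t, s)) w = \<omega> (s, tvec S s d v) - 2 * \<Lambda> s * \<tau>" (is ?theta)
    and "L (\<phi> (t, s), w + \<sigma> *\<^sub>R K (\<phi> (t, s))) =
      L (\<phi> (t, s), w) + \<sigma> * \<theta> (\<phi> (t, s)) w + \<sigma>\<^sup>2 * L (\<phi> (t, s), K (\<phi> (t, s)))" (is ?add)
proof -
  let ?p = "\<phi> (t, s)" and ?V = "tvec S s d v"
  let ?DG = "frechet_derivative (G c d) (at (snd c ?p))"
  note inv = derivative_inverse[OF c point_domG[OF c ts]]
  have p: "?p \<in> mfd_space M" and s: "s \<in> mfd_space S"
    using mem_mfd_space[OF c(1) ts(3)] mem_mfd_space[OF c(2) ts(2)] by simp_all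
  have V: "?V \<in> tangent_space S s" "- ?V \<in> tangent_space S s"
    using tvec_in_tangent_space[OF S_atlas c(2) ts(2)] tangent_space_minus[OF S_atlas] by blast+
  have DK: "?DG (K ?p c) = (1, 0)"
    unfolding K using inv(4)[of "(1, 0)"] unfolding G_point[OF c ts] .
  have general: "L (?p, r *\<^sub>R w + \<sigma> *\<^sub>R K ?p) = - \<Lambda> s * (r * \<tau> + \<sigma>)\<^sup>2 + r * \<omega> (s, ?V) * (r * \<tau> + \<sigma>) + (F (s, r *\<^sub>R ?V))\<^sup>2"
    for r \<sigma>
  proof -
    have "?DG ((r *\<^sub>R w + \<sigma> *\<^sub>R K ?p) c) = (r * \<tau> + \<sigma>, r *\<^sub>R v)"
      using DK \<tau>v by (simp add: linear_add[OF inv(1)] linear_cmul[OF inv(1)])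
    moreover have "r *\<^sub>R w + \<sigma> *\<^sub>R K ?p \<in> tangent_space M ?p"
      by (rule tangent_space_lincomb[OF atlas w K_tangent[OF p]])
    moreover have "tvec S s d (r *\<^sub>R v) = r *\<^sub>R ?V"
      using tvec_linear[OF S_atlas c(2) ts(2), of r v 0 0] by simp
    ultimately show ?thesis
      using L_formula[OF c ts, of "r *\<^sub>R w + \<sigma> *\<^sub>R K ?p"] \<omega>_scale[OF s V(1)] by presburger
  qed
  \<comment> \<open>\<open>F\<close> is only positively homogeneous, so the bound has to involve its
    values at v and at -v.\<close>
  define C where "C = (F (s, ?V))\<^sup>2 + (F (s, - ?V))\<^sup>2"
  have "\<bar>(F (s, r *\<^sub>R ?V))\<^sup>2\<bar> \<le> C * r\<^sup>2" for r
  proof (cases r "0 :: real" rule: linorder_cases)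
    case less
    then have "F (s, r *\<^sub>R ?V) = - r * F (s, - ?V)"
      using F_scale[OF s V(2), of "- r"] by simp
    then show ?thesis
      by (simp add: C_def power_mult_distrib algebra_simps)
  next
    case equal
    then show ?thesis
      by (simp add: F_zero[OF s])
  next
    case greater
    then show ?thesis
      using F_scale[OF s V(1), of r] by (simp add: C_def power_mult_distrib algebra_simps)
  qed
  then have "((\<lambda>r. (F (s, r *\<^sub>R ?V))\<^sup>2) has_real_derivative 0) (at 0)"
    by (rule has_derivative_quadratic_bound)
  then have "((\<lambda>r. - \<Lambda> s * (r * \<tau> + 1)\<^sup>2 + r * \<omega> (s, ?V) * (r * \<tau> + 1) + (F (s, r *\<^sub>R ?V))\<^sup>2)
      has_real_derivative (- \<Lambda> s * (2 * \<tau>) + \<omega> (s, ?V) + 0)) (at 0)"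
    by (rule DERIV_add[rotated]) (auto intro!: derivative_eq_intros)
  moreover have "K ?p + r *\<^sub>R w = r *\<^sub>R w + 1 *\<^sub>R K ?p" for r
    by simp
  ultimately have "((\<lambda>r. L (?p, K ?p + r *\<^sub>R w)) has_real_derivative (- \<Lambda> s * (2 * \<tau>) + \<omega> (s, ?V) + 0)) (at 0)"
    by (simp only: general)
  then have "- \<Lambda> s * (2 * \<tau>) + \<omega> (s, ?V) + 0 = \<theta> ?p w"
    by (rule DERIV_unique[OF _ theta_line[OF p w]])
  then show th: ?theta
    by simp
  have LK: "L (?p, K ?p) = - \<Lambda> s"
    using general[of 0 1] by (simp add: F_zero[OF s])
  have Lw: "L (?p, w) = - \<Lambda> s * \<tau>\<^sup>2 + \<omega> (s, ?V) * \<tau> + (F (s, ?V))\<^sup>2"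
    using general[of 1 0] by simp
  show ?add
    using general[of 1 \<sigma>] by (simp add: LK Lw th power2_eq_square algebra_simps)
qed

lemma L_add_K:
  assumes p: "p \<in> U" and w: "w \<in> tangent_space M p"
  shows "L (p, w + \<sigma> *\<^sub>R K p) = L (p, w) + \<sigma> * \<theta> p w + \<sigma>\<^sup>2 * L (p, K p)"
proof -
  obtain c d t s where cd: "c \<in> M" "d \<in> S" and ts: "t \<in> I" "s \<in> fst d" and \<phi>: "p = \<phi> (t, s)" and pc: "\<phi> (t, s) \<in> fst c"
    and K: "K p c = frechet_derivative (H c d) (at (t, snd d s)) (1, 0)"
    by (rule adapted_chart[OF p])
  show ?thesis
    using theta_formula(2)[OF cd ts pc K[unfolded \<phi>] w[unfolded \<phi>] prod.collapse[symmetric]] unfolding \<phi> .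
qed

text \<open>In product coordinates a slice is a preimage under \<xi> -> (t, \<xi>). This yields
  continuity of the inclusion of slices.\<close>

lemma slice_open:
  assumes d: "d \<in> S" and B: "openin (mfd_top P) B"
  shows "open (snd d ` ({s. (t, s) \<in> B} \<inter> fst d))"
proof -
  have "snd d ` ({s. (t, s) \<in> B} \<inter> fst d) = (\<lambda>\<xi>. (t, \<xi>)) -` (snd (cP d) ` (B \<inter> fst (cP d)))"
  proof (intro set_eqI iffI)
    fix \<xi>
    assume "\<xi> \<in> snd d ` ({s. (t, s) \<in> B} \<inter> fst d)"
    then obtain s where s: "(t, s) \<in> B" "s \<in> fst d" "\<xi> = snd d s"
      by blast
    have "(t, s) \<in> D"
      using openin_subset[OF B] s(1) unfolding topspace_mfd_top[OF P_atlas] mfd_space_prod_atlas by (rule subsetD)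
    then have "(t, s) \<in> B \<inter> fst (cP d)"
      using s by simp
    then have "snd (cP d) (t, s) \<in> snd (cP d) ` (B \<inter> fst (cP d))"
      by (rule imageI)
    then show "\<xi> \<in> (\<lambda>\<xi>. (t, \<xi>)) -` (snd (cP d) ` (B \<inter> fst (cP d)))"
      using s(3) by simp
  next
    fix \<xi>
    assume "\<xi> \<in> (\<lambda>\<xi>. (t, \<xi>)) -` (snd (cP d) ` (B \<inter> fst (cP d)))"
    then show "\<xi> \<in> snd d ` ({s. (t, s) \<in> B} \<inter> fst d)"
      by auto
  qed
  moreover have "open ((\<lambda>\<xi>. (t, \<xi>)) -` (snd (cP d) ` (B \<inter> fst (cP d))))"
    by (intro open_vimage[OF open_chart_image[OF P_atlas cP_mem[OF d] B]] continuous_intros)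
  ultimately show ?thesis
    by simp
qed

lemma slice_smooth:
  assumes t: "t \<in> I"
  shows "smooth_map_on S M (mfd_space S) (\<lambda>s. \<phi> (t, s))"
  unfolding smooth_map_on_def
proof (intro conjI ballI allI)
  let ?\<iota> = "\<lambda>s. \<phi> (t, s)"
  have pre: "openin (mfd_top P) {q \<in> D. \<phi> q \<in> V}" if "openin (mfd_top M) V" for V
  proof -
    have "openin (subtopology (mfd_top P) D) {q \<in> topspace (subtopology (mfd_top P) D). \<phi> q \<in> V}"
      using \<phi>_smooth that unfolding smooth_map_on_def continuous_map_def by blast
    moreover have "topspace (subtopology (mfd_top P) D) = D"
      unfolding topspace_subtopology topspace_mfd_top[OF P_atlas] mfd_space_prod_atlas by simp
    ultimately show ?thesis
      by (simp only: openin_open_subtopology[OF openin_D])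
  qed
  have opn: "openin (mfd_top S) {s \<in> mfd_space S. \<phi> (t, s) \<in> V}" if "openin (mfd_top M) V" for V
  proof (unfold openin_mfd_top[OF S_atlas], intro conjI ballI)
    fix d
    assume d: "d \<in> S"
    have "{s. (t, s) \<in> {q \<in> D. \<phi> q \<in> V}} = {s \<in> mfd_space S. \<phi> (t, s) \<in> V}"
      using t by auto
    then show "open (snd d ` ({s \<in> mfd_space S. \<phi> (t, s) \<in> V} \<inter> fst d))"
      using slice_open[OF d pre[OF that], of t] by simp
  qed auto
  have top: "topspace (mfd_top S) = mfd_space S"
    by (rule topspace_mfd_top[OF S_atlas])
  have sub: "subtopology (mfd_top S) (mfd_space S) = mfd_top S"
    unfolding top[symmetric] by (rule subtopology_topspace)
  have "?\<iota> s \<in> mfd_space M" if "s \<in> mfd_space S" for s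
    using smooth_map_on_mem[OF \<phi>_smooth P_atlas atlas, of "(t, s)"] that t by (simp add: mfd_space_prod_atlas)
  then show "continuous_map (subtopology (mfd_top S) (mfd_space S)) (mfd_top M) ?\<iota>"
    unfolding sub continuous_map_def top topspace_mfd_top[OF atlas] using opn by auto
  fix d c k
  assume d: "d \<in> S" and c: "c \<in> M"
  let ?E = "snd d ` (mfd_space S \<inter> fst d \<inter> ?\<iota> -` fst c)"
  have "mfd_space S \<inter> fst d \<inter> ?\<iota> -` fst c = {s \<in> mfd_space S. \<phi> (t, s) \<in> fst c} \<inter> fst d"
    by auto
  then have E: "open ?E"
    using open_chart_image[OF S_atlas d opn[OF openin_chart_domain[OF atlas c]]] by simp
  have mem: "(t, \<xi>) \<in> domH c d \<and> H c d (t, \<xi>) = (snd c \<circ> ?\<iota> \<circ> chart_inv d) \<xi>" if xi: "\<xi> \<in> ?E" for \<xi>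
  proof -
    obtain s where s: "s \<in> fst d" "\<phi> (t, s) \<in> fst c" "\<xi> = snd d s"
      using xi by blast
    show ?thesis
      using point_domH[OF c d t s(1,2)] H_point[OF c d t s(1,2)] chart_inv_left[OF S_atlas d s(1)] by (simp add: s(3))
  qed
  have "Ck_on k ?E (\<lambda>\<xi>. H c d (t, \<xi>))"
    by (rule Ck_on_compose[OF E H_smooth(2)[OF c d] Ck_on_Pair[OF E Ck_on_const Ck_on_ident]]) (use mem in blast)
  then show "Ck_on k ?E (snd c \<circ> ?\<iota> \<circ> chart_inv d)"
    by (rule Ck_on_transfer[OF E]) (use mem in blast)
qed

lemma slice_tangent_map:
  assumes c: "c \<in> M" "d \<in> S" and ts: "t \<in> I" "s \<in> fst d" "\<phi> (t, s) \<in> fst c" and v: "v \<in> tangent_space S s"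
  shows "tangent_map S M (\<lambda>s. \<phi> (t, s)) s v =
    tvec M (\<phi> (t, s)) c (frechet_derivative (H c d) (at (t, snd d s)) (0, v d))"
proof -
  let ?h = "snd c \<circ> (\<lambda>s. \<phi> (t, s)) \<circ> chart_inv d"
  have oS: "openin (mfd_top S) (mfd_space S)"
    using openin_topspace[of "mfd_top S"] unfolding topspace_mfd_top[OF S_atlas] .
  let ?E = "snd d ` (mfd_space S \<inter> fst d \<inter> (\<lambda>s. \<phi> (t, s)) -` fst c)"
  have E: "open ?E"
    by (rule smooth_map_on_chart(1)[OF S_atlas atlas oS slice_smooth[OF ts(1)] c(2,1)])
  have s: "s \<in> mfd_space S"
    by (rule mem_mfd_space[OF c(2) ts(2)])
  have "((\<lambda>\<xi>. (t, \<xi>)) has_derivative (\<lambda>y. (0, y))) (at (snd d s))"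
    by (auto intro!: derivative_eq_intros)
  moreover have "(H c d has_derivative frechet_derivative (H c d) (at (t, snd d s))) (at (t, snd d s))"
    by (rule Ck_on_imp_has_derivative[OF H_smooth(2)[OF c, of 1] _ point_domH[OF c ts]]) simp
  ultimately have "((\<lambda>\<xi>. H c d (t, \<xi>)) has_derivative (\<lambda>y. frechet_derivative (H c d) (at (t, snd d s)) (0, y))) (at (snd d s))"
    by (rule has_derivative_compose)
  then have "(?h has_derivative (\<lambda>y. frechet_derivative (H c d) (at (t, snd d s)) (0, y))) (at (snd d s))"
  proof (rule has_derivative_transform_within_open[OF _ E])
    show "snd d s \<in> ?E"
      using s ts by (intro imageI) simp
    fix \<xi>
    assume "\<xi> \<in> ?E"
    then obtain s' where s': "s' \<in> fst d" "\<phi> (t, s') \<in> fst c" "\<xi> = snd d s'"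
      by blast
    show "H c d (t, \<xi>) = ?h \<xi>"
      using H_point[OF c ts(1) s'(1,2)] chart_inv_left[OF S_atlas c(2) s'(1)] by (simp add: s'(3))
  qed
  from frechet_derivative_eqI[OF this] show ?thesis
    using tangent_map_eqI[OF S_atlas atlas oS s slice_smooth[OF ts(1)] c(2) ts(2) c(1) ts(3) v] by simp
qed

text \<open>For \<omega> = 0 the formula for \<theta> becomes -2 \<Lambda> dt with \<Lambda> > 0, so
  ker \<theta> = ker dt, which is the tangent space of the slice. The slice taken is the one through
  \<open>z\<close>.\<close>

lemma integral_manifold:
  assumes \<omega>0: "\<forall>x\<in>tangent_bundle S. \<omega> x = 0" and z: "z \<in> U"
  shows "\<exists>\<iota>. smooth_map_on S M (mfd_space S) \<iota> \<and> inj_on \<iota> (mfd_space S) \<and> z \<in> \<iota> ` mfd_space S \<and>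
    (\<forall>s\<in>mfd_space S. inj_on (tangent_map S M \<iota> s) (tangent_space S s) \<and>
       tangent_map S M \<iota> s ` tangent_space S s = kernel_distribution M L K (\<iota> s))"
proof -
  obtain t s0 where ts0: "\<kappa> z = (t, s0)"
    by (cases "\<kappa> z")
  have z\<phi>: "\<phi> (t, s0) = z" and D0: "(t, s0) \<in> D"
    using \<phi>_\<kappa>[OF z] \<kappa>_mem[OF z] unfolding ts0 by simp_all
  have t: "t \<in> I" and s0: "s0 \<in> mfd_space S"
    using D0 by simp_all
  let ?\<iota> = "\<lambda>s. \<phi> (t, s)"
  have D: "(t, s) \<in> D" if "s \<in> mfd_space S" for s
    using t that by simp
  have "inj_on ?\<iota> (mfd_space S)"
  proof (rule inj_onI)
    fix s s'
    assume s: "s \<in> mfd_space S" "s' \<in> mfd_space S" "\<phi> (t, s) = \<phi> (t, s')"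
    have "(t, s) = (t, s')"
      by (rule inj_onD[OF bij_betw_imp_inj_on[OF bij] s(3) D[OF s(1)] D[OF s(2)]])
    then show "s = s'"
      by simp
  qed
  moreover have "z \<in> ?\<iota> ` mfd_space S"
    by (rule image_eqI[of _ _ s0]) (simp_all add: z\<phi> s0)
  moreover have "inj_on (tangent_map S M ?\<iota> s) (tangent_space S s) \<and>
      tangent_map S M ?\<iota> s ` tangent_space S s = kernel_distribution M L K (?\<iota> s)" if s: "s \<in> mfd_space S" for s
  proof -
    obtain c d t' s' where cd: "c \<in> M" "d \<in> S" and ts': "t' \<in> I" "s' \<in> fst d" and \<phi>': "\<phi> (t, s) = \<phi> (t', s')"
      and pc': "\<phi> (t', s') \<in> fst c" and K': "K (\<phi> (t, s)) c = frechet_derivative (H c d) (at (t', snd d s')) (1, 0)"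
      by (rule adapted_chart[OF \<phi>_mem[OF D[OF s]]])
    \<comment> \<open>\<open>adapted_chart\<close> returns its own coordinates of the point;
      injectivity of \<phi> identifies them with the given ones.\<close>
    have "(t, s) = (t', s')"
      by (rule inj_onD[OF bij_betw_imp_inj_on[OF bij] \<phi>' D[OF s] mem_D[OF cd(2) ts']])
    then have eq: "t' = t" "s' = s"
      by simp_all
    note sd = ts'(2)[unfolded eq] and pc = pc'[unfolded eq] and K = K'[unfolded eq]
    let ?p = "\<phi> (t, s)"
    let ?DG = "frechet_derivative (G c d) (at (snd c ?p))" and ?DH = "frechet_derivative (H c d) (at (t, snd d s))"
    note inv = derivative_inverse[OF cd point_domG[OF cd t sd pc], unfolded G_point[OF cd t sd pc]]
    note tm = slice_tangent_map[OF cd t sd pc]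
    note tv = tvec_in_tangent_space[OF atlas cd(1) pc] tvec_component[OF atlas cd(1) pc]
    have kern: "w \<in> kernel_distribution M L K ?p \<longleftrightarrow> w \<in> tangent_space M ?p \<and> fst (?DG (w c)) = 0" for w
    proof (cases "w \<in> tangent_space M ?p")
      case True
      have "(s, tvec S s d v) \<in> tangent_bundle S" for v
        unfolding tangent_bundle_def using s tvec_in_tangent_space[OF S_atlas cd(2) sd] by (rule SigmaI)
      then have "\<theta> ?p w = - 2 * \<Lambda> s * fst (?DG (w c))"
        using theta_formula(1)[OF cd t sd pc K True prod.collapse[symmetric]] \<omega>0 by simp
      then show ?thesis
        using bspec[OF \<Lambda>_pos s] True by (simp add: kernel_distribution_def)
    next
      case False
      then show ?thesis
        by (simp add: kernel_distribution_def)
    qed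
    show ?thesis
    proof (intro conjI inj_onI set_eqI iffI)
      fix v v'
      assume v: "v \<in> tangent_space S s" "v' \<in> tangent_space S s"
        and "tangent_map S M ?\<iota> s v = tangent_map S M ?\<iota> s v'"
      then have "?DH (0, v d) = ?DH (0, v' d)"
        using tv(2) unfolding tm[OF v(1)] tm[OF v(2)] by metis
      then have "(0 :: real, v d) = (0, v' d)"
        using inv(4) by metis
      then show "v = v'"
        using tangent_space_eqI[OF v cd(2) sd] by simp
    next
      fix w
      assume "w \<in> tangent_map S M ?\<iota> s ` tangent_space S s"
      then obtain v where v: "w = tangent_map S M ?\<iota> s v" "v \<in> tangent_space S s"
        by (rule imageE)
      show "w \<in> kernel_distribution M L K ?p"
        unfolding kern v(1) tm[OF v(2)] tv(2) inv(4) using tv(1) by simp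
    next
      fix w
      assume "w \<in> kernel_distribution M L K ?p"
      then have w: "w \<in> tangent_space M ?p" "fst (?DG (w c)) = 0"
        unfolding kern by simp_all
      let ?v = "tvec S s d (snd (?DG (w c)))"
      have v: "?v \<in> tangent_space S s" "?v d = snd (?DG (w c))"
        by (rule tvec_in_tangent_space[OF S_atlas cd(2) sd], rule tvec_component[OF S_atlas cd(2) sd])
      have "(0, ?v d) = ?DG (w c)"
        using w(2) v(2) by (metis prod.collapse)
      then have "tangent_map S M ?\<iota> s ?v = tvec M ?p c (w c)"
        using tm[OF v(1)] inv(3)[of "w c"] by simp
      then have "w = tangent_map S M ?\<iota> s ?v"
        using tvec_eq[OF w(1) cd(1) pc] by simp
      then show "w \<in> tangent_map S M ?\<iota> s ` tangent_space S s"
        using v(1) by (rule image_eqI)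
    qed
  qed
  ultimately show ?thesis
    using slice_smooth[OF t] by blast
qed

end

section \<open>From splittings to the conditions and back\<close>

context killing_spacetime
begin

text \<open>Being C^1 is local and holds near each point by the formula of a splitting there. It has
  to precede everything about \<theta>, which is meaningful only for \<open>L\<close> of class
  C^1.\<close>

lemma L_C1_of_splittings:
  assumes "\<And>z. z \<in> mfd_space M \<Longrightarrow> \<exists>U \<epsilon> (S :: ('s, 'e) chart set) \<phi> \<Lambda> \<omega> F. z \<in> U \<and> standard_splitting M L K U \<epsilon> S \<phi> \<Lambda> \<omega> F"
  shows "Ck_fun (tb_atlas M) 1 (tangent_bundle M) L"
proof -
  have C1: "Ck_on 1 (snd c ` fst c \<times> UNIV) (Lc c)" if c: "c \<in> M" for c
  proof (rule Ck_on_local)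
    show "open (snd c ` fst c \<times> (UNIV :: (real \<times> 'e) set))"
      by (intro open_Times open_chart_range[OF atlas c] open_UNIV)
    fix w :: "(real \<times> 'e) \<times> (real \<times> 'e)"
    assume "w \<in> snd c ` fst c \<times> UNIV"
    then obtain z where z: "z \<in> fst c" "fst w = snd c z"
      by auto
    obtain U \<epsilon> \<phi> \<Lambda> \<omega> F and S :: "('s, 'e) chart set" where U: "z \<in> U" "standard_splitting M L K U \<epsilon> S \<phi> \<Lambda> \<omega> F"
      using assms[OF mem_mfd_space[OF c z(1)]] by (elim exE conjE)
    interpret split_spacetime M L T K U \<epsilon> S \<phi> \<Lambda> \<omega> F
      by unfold_locales (rule U(2))
    obtain t s where ts: "\<kappa> z = (t, s)"
      by (cases "\<kappa> z")
    have \<phi>: "\<phi> (t, s) = z" and D: "t \<in> I" "s \<in> mfd_space S"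
      using \<phi>_\<kappa>[OF U(1)] \<kappa>_mem[OF U(1)] unfolding ts by simp_all
    obtain d where d: "d \<in> S" "s \<in> fst d"
      using D(2) by (auto simp: mfd_space_def)
    have mem: "w \<in> domG c d \<times> UNIV"
      using point_domG[OF c d(1) D(1) d(2)] z unfolding \<phi> by (auto simp: mem_Times_iff)
    show "\<exists>N. open N \<and> w \<in> N \<and> Ck_on 1 (N \<inter> snd c ` fst c \<times> UNIV) (Lc c)"
    proof (intro exI conjI)
      show "open (domG c d \<times> (UNIV :: (real \<times> 'e) set))"
        by (intro open_Times G_smooth(1)[OF c d(1)] open_UNIV)
      show "Ck_on 1 (domG c d \<times> UNIV \<inter> snd c ` fst c \<times> UNIV) (Lc c)"
        by (rule Ck_on_subset[OF Lc_C1_local[OF c d(1)]]) (rule Int_lower1)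
    qed (rule mem)
  qed
  show ?thesis
    unfolding Ck_fun_def tb_atlas_def
  proof (rule ballI)
    fix C
    assume "C \<in> tb_chart M ` M"
    then obtain c where c: "C = tb_chart M c" "c \<in> M"
      by (rule imageE)
    show "Ck_on 1 (snd C ` (tangent_bundle M \<inter> fst C)) (L \<circ> chart_inv C)"
      unfolding c(1) tb_chart_image_bundle[OF atlas c(2)] Lc_def[symmetric] by (rule C1[OF c(2)])
  qed
qed

text \<open>C^2 regularity off \<open>T\<close> is contained in the C^3 regularity of the spacetime,
  and the fibrewise clause of (a) holds because \<open>K\<close> is in \<open>T\<close> everywhere.
  (b) and (c) are special cases of the expansion in \<sigma>: w = 0 with \<sigma> = -1, and
  \<theta>(w) = 0 with \<sigma> = 1 and \<sigma> = -1.\<close>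

lemma conditions_of_splittings:
  assumes KT: "\<And>z. z \<in> mfd_space M \<Longrightarrow> (z, K z) \<in> T"
    and split: "\<And>z. z \<in> mfd_space M \<Longrightarrow> \<exists>U \<epsilon> (S :: ('s, 'e) chart set) \<phi> \<Lambda> \<omega> F. z \<in> U \<and> standard_splitting M L K U \<epsilon> S \<phi> \<Lambda> \<omega> F"
  shows "C1_spacetime M L T K" "condition_a M L T K" "condition_b M L K" "condition_c M L K"
proof -
  have C1: "Ck_fun (tb_atlas M) 1 (tangent_bundle M) L"
    by (rule L_C1_of_splittings[OF split])
  show loc: "C1_spacetime M L T K"
    by unfold_locales (rule KT, assumption, rule C1)
  interpret C1_spacetime M L T K
    by (rule loc)
  have "Ck_fun (tb_atlas M) 2 (tangent_bundle M - T) L"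
    unfolding Ck_fun_def
  proof
    fix c
    assume c: "c \<in> tb_atlas M"
    show "Ck_on 2 (snd c ` ((tangent_bundle M - T) \<inter> fst c)) (L \<circ> chart_inv c)"
      by (rule Ck_on_le[OF bspec[OF L_C3[unfolded Ck_fun_def] c]]) simp
  qed
  then show "condition_a M L T K"
    unfolding condition_a_def using C1 KT by blast
  have add: "L (z, w + \<sigma> *\<^sub>R K z) = L (z, w) + \<sigma> * \<theta> z w + \<sigma>\<^sup>2 * L (z, K z)"
    if z: "z \<in> mfd_space M" and w: "w \<in> tangent_space M z" for z w \<sigma>
  proof -
    obtain U \<epsilon> \<phi> \<Lambda> \<omega> F and S :: "('s, 'e) chart set" where U: "z \<in> U" "standard_splitting M L K U \<epsilon> S \<phi> \<Lambda> \<omega> F"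
      using split[OF z] by (elim exE conjE)
    interpret C1_splitting M L T K U \<epsilon> S \<phi> \<Lambda> \<omega> F
      by unfold_locales (rule U(2))
    show ?thesis
      by (rule L_add_K[OF U(1) w])
  qed
  show "condition_b M L K"
    unfolding condition_b_def
  proof
    fix z
    assume z: "z \<in> mfd_space M"
    show "L (z, K z) = L (z, - K z)"
      using add[OF z tangent_space_0[OF atlas], of "- 1"] by (simp add: theta_0[OF z] L_zero[OF z])
  qed
  show "condition_c M L K"
    unfolding condition_c_def
  proof (intro ballI)
    fix z w
    assume z: "z \<in> mfd_space M" and "w \<in> kernel_distribution M L K z"
    then have w: "w \<in> tangent_space M z" "\<theta> z w = 0"
      by (simp_all add: kernel_distribution_def)
    show "L (z, w + K z) = L (z, w) + L (z, K z) \<and> L (z, w - K z) = L (z, w) + L (z, K z)"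
      using add[OF z w(1), of 1] add[OF z w(1), of "- 1"] by (simp add: w(2))
  qed
qed

lemma integrable_of_splittings:
  assumes KT: "\<And>z. z \<in> mfd_space M \<Longrightarrow> (z, K z) \<in> T"
    and split: "\<And>z. z \<in> mfd_space M \<Longrightarrow> \<exists>U \<epsilon> (S :: ('a, 'e) chart set) \<phi> \<Lambda> \<omega> F.
      z \<in> U \<and> standard_splitting M L K U \<epsilon> S \<phi> \<Lambda> \<omega> F \<and> (\<forall>x\<in>tangent_bundle S. \<omega> x = 0)"
  shows "integrable_distribution M (kernel_distribution M L K)"
  unfolding integrable_distribution_def
proof
  fix z
  assume z: "z \<in> mfd_space M"
  have "\<And>z. z \<in> mfd_space M \<Longrightarrow> \<exists>U \<epsilon> (S :: ('a, 'e) chart set) \<phi> \<Lambda> \<omega> F. z \<in> U \<and> standard_splitting M L K U \<epsilon> S \<phi> \<Lambda> \<omega> F"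
    by (drule split) (elim exE conjE, intro exI conjI)
  note loc = conditions_of_splittings(1)[OF KT this]
  obtain U \<epsilon> \<phi> \<Lambda> \<omega> F and S :: "('a, 'e) chart set" where U: "z \<in> U" "standard_splitting M L K U \<epsilon> S \<phi> \<Lambda> \<omega> F"
      and \<omega>: "\<forall>x\<in>tangent_bundle S. \<omega> x = 0"
    using split[OF z] by (elim exE conjE)
  interpret C1_spacetime M L T K
    by (rule loc)
  interpret C1_splitting M L T K U \<epsilon> S \<phi> \<Lambda> \<omega> F
    by unfold_locales (rule U(2))
  obtain \<iota> where "smooth_map_on S M (mfd_space S) \<iota> \<and> inj_on \<iota> (mfd_space S) \<and> z \<in> \<iota> ` mfd_space S \<and>
    (\<forall>s\<in>mfd_space S. inj_on (tangent_map S M \<iota> s) (tangent_space S s) \<and>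
       tangent_map S M \<iota> s ` tangent_space S s = kernel_distribution M L K (\<iota> s))"
    using integral_manifold[OF \<omega> U(1)] by (elim exE)
  then show "\<exists>(S :: ('a, 'e) chart set) \<iota>. smooth_manifold S \<and> smooth_map_on S M (mfd_space S) \<iota> \<and>
      inj_on \<iota> (mfd_space S) \<and> z \<in> \<iota> ` mfd_space S \<and>
      (\<forall>s\<in>mfd_space S. inj_on (tangent_map S M \<iota> s) (tangent_space S s) \<and>
         tangent_map S M \<iota> s ` tangent_space S s = kernel_distribution M L K (\<iota> s))"
    using S_manifold by (intro exI conjI) (elim conjE, assumption)+
qed

text \<open>(a) enters twice: through C^1 regularity, and through \<open>K_in_T\<close>, which turns
  its clause on single fibres into membership of \<open>K\<close> in \<open>T\<close> at every
  point.\<close>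

lemma splitting_conditionsI:
  assumes a: "condition_a M L T K" and c: "condition_c M L K"
  shows "splitting_conditions M L T K"
proof unfold_locales
  show "(p, K p) \<in> T" if "p \<in> mfd_space M" for p
    by (rule K_in_T[OF _ that]) (use a in \<open>simp add: condition_a_def\<close>)
  show "Ck_fun (tb_atlas M) 1 (tangent_bundle M) L"
    using a by (simp add: condition_a_def)
qed (rule c)

end

theorem theorem4p8:
  fixes M :: "('a, real \<times> (real ^ 'n)) chart set"
    and L :: "'a \<times> ('a, real \<times> (real ^ 'n)) tvec \<Rightarrow> real"
    and T :: "('a \<times> ('a, real \<times> (real ^ 'n)) tvec) set"
    and K :: "'a \<Rightarrow> ('a, real \<times> (real ^ 'n)) tvec"
  assumes "smooth_manifold M"
    and "connected_space (mfd_top M)"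
    and "line_subbundle M T"
    and "stationary_spacetime M L (tangent_bundle M - T) K"
  shows "(locally_standard_stationary M L T K \<longleftrightarrow>
            condition_a M L T K \<and> condition_b M L K \<and> condition_c M L K) \<and>
         (locally_standard_static M L T K \<longleftrightarrow>
            condition_a M L T K \<and> condition_b M L K \<and> condition_c M L K \<and>
            integrable_distribution M (kernel_distribution M L K))"
proof -
  interpret killing_spacetime M L T K
    using assms by unfold_locales (simp_all add: smooth_manifold_def)
  have stationary_imp: "condition_a M L T K \<and> condition_b M L K \<and> condition_c M L K"
    if l: "locally_standard_stationary M L T K"
  proof -
    have KT: "(z, K z) \<in> T" if "z \<in> mfd_space M" for z
      using l that by (simp add: locally_standard_stationary_def)
    have sp: "\<exists>U \<epsilon> (S :: ('a, real ^ 'n) chart set) \<phi> \<Lambda> \<omega> F. z \<in> U \<and> standard_splitting M L K U \<epsilon> S \<phi> \<Lambda> \<omega> F"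
      if "z \<in> mfd_space M" for z
      using l[unfolded locally_standard_stationary_def] that by (elim conjE) (rule bspec)
    show ?thesis
      using conditions_of_splittings(2-4)[OF KT sp] by (intro conjI)
  qed
  \<comment> \<open>Forgetting \<omega> = 0, so that (a), (b) and (c) in the static case are
    inherited from the stationary one.\<close>
  have static_stationary: "locally_standard_stationary M L T K" if l: "locally_standard_static M L T K"
    unfolding locally_standard_stationary_def
  proof (intro conjI ballI)
    fix z
    assume z: "z \<in> mfd_space M"
    have "\<exists>U \<epsilon> (S :: ('a, real ^ 'n) chart set) \<phi> \<Lambda> \<omega> F. z \<in> U \<and> standard_splitting M L K U \<epsilon> S \<phi> \<Lambda> \<omega> F \<and>
        (\<forall>x\<in>tangent_bundle S. \<omega> x = 0)"
      using l[unfolded locally_standard_static_def] z by (elim conjE) (rule bspec)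
    then show "\<exists>U \<epsilon> (S :: ('a, real ^ 'n) chart set) \<phi> \<Lambda> \<omega> F. z \<in> U \<and> standard_splitting M L K U \<epsilon> S \<phi> \<Lambda> \<omega> F"
      by (elim exE conjE) (intro exI conjI)
  qed (use l in \<open>simp_all add: locally_standard_static_def\<close>)
  have static_integrable: "integrable_distribution M (kernel_distribution M L K)"
    if l: "locally_standard_static M L T K"
  proof (rule integrable_of_splittings)
    show "(z, K z) \<in> T" if "z \<in> mfd_space M" for z
      using l that by (simp add: locally_standard_static_def)
    show "\<exists>U \<epsilon> (S :: ('a, real ^ 'n) chart set) \<phi> \<Lambda> \<omega> F. z \<in> U \<and> standard_splitting M L K U \<epsilon> S \<phi> \<Lambda> \<omega> F \<and>
        (\<forall>x\<in>tangent_bundle S. \<omega> x = 0)" if "z \<in> mfd_space M" for z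
      using l[unfolded locally_standard_static_def] that by (elim conjE) (rule bspec)
  qed
  have stationaryI: "locally_standard_stationary M L T K" if ac: "condition_a M L T K" "condition_c M L K"
  proof -
    interpret splitting_conditions M L T K
      by (rule splitting_conditionsI[OF ac])
    show ?thesis
      unfolding locally_standard_stationary_def
      by (intro conjI ballI stationary K_mem_T standard_splitting_at)
  qed
  have staticI: "locally_standard_static M L T K"
    if ac: "condition_a M L T K" "condition_c M L K" and int: "integrable_distribution M (kernel_distribution M L K)"
  proof -
    interpret splitting_conditions M L T K
      by (rule splitting_conditionsI[OF ac])
    show ?thesis
      unfolding locally_standard_static_def
      by (intro conjI ballI stationary K_mem_T static_splitting_at int)
  qed
  show ?thesis
    using stationary_imp static_stationary static_integrable stationaryI staticI by (iprover)
qed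

end
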